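(* Assume that the stabilisation parameter satisfies $\varepsilon>0$, and let $(\underline\ell_{\mathcal D}^n)_{n\ge1}$ be a solution to the nonlinear scheme (defined in the context). Then the discrete solution converges in time towards the discrete equilibrium logarithm potential: $$\underline\ell_{\mathcal D}^n\xrightarrow[n\to\infty]{}\underline\ell_{\mathcal D}^\infty\quad\text{in }\underline V_{\mathcal D}^k,\qquad\text{where }\ \underline\ell^\infty_{\mathcal D}=\log(c_{nl}^M)\,\underline 1_{\mathcal D}-\underline\phi_{\mathcal D},\quad c^M_{nl}=\frac{M}{\int_\Omega e^{-\phi_{\mathcal M}}}.$$ Consequently, the corresponding reconstructed discrete density $(\mathfrak u_{\mathcal M}^n)_{n\ge1}$, $\mathfrak u^n_{\mathcal M}=e^{\ell^n_{\mathcal M}}$, converges to $\mathfrak u_{\mathcal M}^\infty=c_{nl}^Me^{-\phi_{\mathcal M}}$ in $L^\infty(\Omega)$ as $n\to\infty$.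
   Context: **Data.** $\Omega\subset\mathbb R^d$, $d\in\{2,3\}$, is an open, bounded, connected polytopal set with Lipschitz boundary. $\Lambda\in L^\infty(\Omega)^{d\times d}$ is uniformly elliptic: there is $\lambda_\flat>0$ with $\Lambda(x)\xi\cdot\xi\ge\lambda_\flat|\xi|^2$ for a.e. $x\in\Omega$ and all $\xi\in\mathbb R^d$. $\phi\in W^{1,\infty}(\Omega)$. $u^0\in L^1(\Omega)$ is non-negative with $\int_\Omega u^0\log(u^0)<\infty$ and $M=\int_\Omega u^0>0$. $\Delta t>0$ is the time step, $k\ge 0$ is an integer. **Mesh.** A discretisation is a couple $\mathcal D=(\mathcal M,\mathcal E)$. $\mathcal M$ is a finite collection of disjoint, open, Lipschitz polytopes $K\subset\Omega$ (cells) of positive measure with $\overline\Omega=\bigcup_{K\in\mathcal M}\overline K$. $\mathcal E$ is a finite collection of disjoint, connected, relatively open subsets $\sigma$ of $\overline\Omega$ (faces), with positive $(d-1)$-dimensional measure, each a Lipschitz polytopal subset of an affine hyperplane, with $\partial\mathcal M:=\bigcup_{K\in\mathcal M}\partial K=\bigcup_{\sigma\in\mathcal E}\overline\sigma$; for each $K$ there is $\mathcal E_K\subset\mathcal E$ with $\partial K=\bigcup_{\sigma\in\mathcal E_K}\overline\sigma$. $n_{K,\sigma}$ is the unit normal to $\sigma\in\mathcal E_K$ pointing out of $K$; $h_X$ is the diameter of $X$. It is assumed that $\Lambda_{|K}\in W^{1,\infty}(K)^{d\times d}$ for all $K\in\mathcal M$. **Discrete space and operators.** $\mathbb P^q(X)$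 denotes polynomial functions on $X$ of total degree at most $q$, and $\Pi_X^q$ the $L^2(X)$-orthogonal projector onto it. $\underline V_{\mathcal D}^k$ is the (finite-dimensional) space of $\underline v_{\mathcal D}=((v_K)_{K\in\mathcal M},(v_\sigma)_{\sigma\in\mathcal E})$ with $v_K\in\mathbb P^{k+1}(K)$ and $v_\sigma\in\mathbb P^k(\sigma)$; convergence in it is with respect to any norm. The restriction of $\underline v_{\mathcal D}$ to $K$ is $\underline v_K=(v_K,(v_\sigma)_{\sigma\in\mathcal E_K})$; $v_{\mathcal M}:\Omega\to\mathbb R$ is the piecewise polynomial function with $(v_{\mathcal M})_{|K}=v_K$; $\underline 1_{\mathcal D}$ is the element with all components equal to $1$. The discrete potential is $\underline\phi_{\mathcal D}=\big((\Pi_K^{k+1}(\phi_{|K}))_{K\in\mathcal M},(\Pi_\sigma^k(\phi_{|\sigma}))_{\sigma\in\mathcal E}\big)\in\underline V^k_{\mathcal D}$, so $(\phi_{\mathcal M})_{|K}=\Pi_K^{k+1}(\phi_{|K})$. The discrete gradient $G_K(\underline v_K)\in\mathbb P^k(K)^d$ is defined by $$\int_K G_K(\underline v_K)\cdot\tau=-\int_K v_K\,\nabla\cdot\tau+\sum_{\sigma\in\mathcal E_K}\int_\sigma v_\sigma\,\tau\cdot n_{K,\sigma}\qquad\forall\tau\in\mathbb P^k(K)^d,$$ and the jump by $J_{K,\sigma}(\underline v_K)=\Pi_\sigma^k(v_{K|\sigma})-v_\sigma$. Let $\Lambda_{K,\sigma}=\|\Lambda_{|K}n_{K,\sigma}\cdot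 n_{K,\sigma}\|_{L^\infty(\sigma)}$ and $$a_K(\underline z_K,\underline v_K)=\int_K\Lambda G_K(\underline z_K)\cdot G_K(\underline v_K)+\sum_{\sigma\in\mathcal E_K}\frac{\Lambda_{K,\sigma}}{h_\sigma}\int_\sigma J_{K,\sigma}(\underline z_K)J_{K,\sigma}(\underline v_K).$$ **The map $\mathcal T_{\mathcal D}$.** For a parameter $\varepsilon\ge0$ and $\underline\ell_{\mathcal D},\underline w_{\mathcal D},\underline v_{\mathcal D}\in\underline V_{\mathcal D}^k$, $\mathcal T_{\mathcal D}(\underline\ell_{\mathcal D};\underline w_{\mathcal D},\underline v_{\mathcal D})$ is the sum over $K\in\mathcal M$ of $$\int_K e^{\ell_K}\Lambda G_K(\underline w_K)\cdot G_K(\underline v_K)+\sum_{\sigma\in\mathcal E_K}\frac{\Lambda_{K,\sigma}}{h_\sigma}\int_\sigma\frac{e^{\Pi_\sigma^k(\ell_{K|\sigma})}+e^{\ell_\sigma}}{2}J_{K,\sigma}(\underline w_K)J_{K,\sigma}(\underline v_K)+\varepsilon\,h_K^{k+2}a_K(\underline w_K,\underline v_K).$$ **Nonlinear scheme.** A solution is a sequence $(\underline\ell_{\mathcal D}^n)_{n\ge1}$ in $\underline V_{\mathcal D}^k$ such that, for all $n\in\mathbb N$ (including $n=0$) and all $\underline v_{\mathcal D}\in\underline V_{\mathcal D}^k$, $$\sum_{K\in\mathcal M}\int_K\frac{\mathfrak u_K^{n+1}-\mathfrak u_K^n}{\Delta t}\,v_K+\mathcal T_{\mathcal D}(\underline\ell_{\mathcal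 D}^{n+1};\underline\ell_{\mathcal D}^{n+1}+\underline\phi_{\mathcal D},\underline v_{\mathcal D})=0,$$ where $\mathfrak u_K^{n+1}=e^{\ell_K^{n+1}}$ and $\mathfrak u_K^0=u^0_{|K}$ for all $K\in\mathcal M$. *)

theory Defs
  imports
    "HOL-Analysis.Analysis"
    "HOL-Probability.Essential_Supremum"
    "HOL-Library.Function_Algebras"
begin

section \<open>Polytopal sets with Lipschitz boundary\<close>

text \<open>
  The ambient affine space \<open>H\<close> is the whole space for domains and cells, and a hyperplane for
  faces. In the second definition, \<open>x + e \<in> H\<close> says that the direction \<open>e\<close> is parallel to \<open>H\<close>;
  near \<open>x\<close> the set is the strict hypograph, in the direction \<open>e\<close>, of a Lipschitz function of the
  component orthogonal to \<open>e\<close>.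
\<close>

definition polytopal_in :: "'a::euclidean_space set \<Rightarrow> 'a set \<Rightarrow> bool" where
  "polytopal_in H S \<longleftrightarrow>
     (\<exists>F. finite F \<and> (\<forall>P\<in>F. polytope P \<and> P \<subseteq> H) \<and> S = top_of_set H interior_of (\<Union>F))"

definition lipschitz_boundary_in :: "'a::euclidean_space set \<Rightarrow> 'a set \<Rightarrow> bool" where
  "lipschitz_boundary_in H S \<longleftrightarrow>
     (\<forall>x \<in> top_of_set H frontier_of S. \<exists>U e L \<gamma>.
        open U \<and> x \<in> U \<and> norm e = 1 \<and> x + e \<in> H \<and> L-lipschitz_on UNIV \<gamma> \<and>
        S \<inter> U = {y \<in> H \<inter> U. y \<bullet> e < \<gamma> (y - (y \<bullet> e) *\<^sub>R e)})"

definition lipschitz_polytope_in :: "'a::euclidean_space set \<Rightarrow> 'a set \<Rightarrow> bool" where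
  "lipschitz_polytope_in H S \<longleftrightarrow> S \<subseteq> H \<and> polytopal_in H S \<and> lipschitz_boundary_in H S"

definition polytopal_domain :: "'a::euclidean_space set \<Rightarrow> bool" where
  "polytopal_domain \<Omega> \<longleftrightarrow>
     open \<Omega> \<and> bounded \<Omega> \<and> connected \<Omega> \<and> lipschitz_polytope_in UNIV \<Omega>"


section \<open>Measure on faces\<close>

text \<open>
  The \<open>(d-1)\<close>-dimensional Lebesgue measure on a hyperplane \<open>H\<close> of a \<open>d\<close>-dimensional space: by
  Fubini's theorem the \<open>(d-1)\<close>-dimensional measure of \<open>A \<subseteq> H\<close> is the \<open>d\<close>-dimensional measure of the
  right cylinder of height one, centred at \<open>H\<close>, with basis \<open>A\<close>. Here \<open>closest_point H\<close> is the
  orthogonal projection onto \<open>H\<close>.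
\<close>

definition hyperplane_measure :: "'a::euclidean_space set \<Rightarrow> 'a measure" where
  "hyperplane_measure H =
     distr (restrict_space lborel {y. infdist y H < 1/2}) borel (closest_point H)"

text \<open>Faces are nonempty and relatively open in a hyperplane, which is thus their affine hull.\<close>

definition face_measure :: "'a::euclidean_space set \<Rightarrow> 'a measure" where
  "face_measure \<sigma> = restrict_space (hyperplane_measure (affine hull \<sigma>)) \<sigma>"


section \<open>Meshes\<close>

text \<open>\<open>\<F> K\<close> is the set of the faces of the cell \<open>K\<close>.\<close>

definition mesh ::
  "'a::euclidean_space set \<Rightarrow> 'a set set \<Rightarrow> 'a set set \<Rightarrow> ('a set \<Rightarrow> 'a set set) \<Rightarrow> bool" where
  "mesh \<Omega> \<M> \<E> \<F> \<longleftrightarrow>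
     finite \<M> \<and> pairwise disjnt \<M> \<and>
     (\<forall>K\<in>\<M>. open K \<and> K \<subseteq> \<Omega> \<and> lipschitz_polytope_in UNIV K \<and> emeasure lebesgue K > 0) \<and>
     closure \<Omega> = (\<Union>K\<in>\<M>. closure K) \<and>
     finite \<E> \<and> pairwise disjnt \<E> \<and>
     (\<forall>\<sigma>\<in>\<E>. connected \<sigma> \<and> \<sigma> \<subseteq> closure \<Omega> \<and>
        (\<exists>a b. a \<noteq> 0 \<and> openin (top_of_set {x. a \<bullet> x = b}) \<sigma> \<and>
               lipschitz_polytope_in {x. a \<bullet> x = b} \<sigma> \<and>
               emeasure (hyperplane_measure {x. a \<bullet> x = b}) \<sigma> > 0)) \<and>
     (\<Union>K\<in>\<M>. frontier K) = (\<Union>\<sigma>\<in>\<E>. closure \<sigma>) \<and>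
     (\<forall>K\<in>\<M>. \<F> K \<subseteq> \<E> \<and> frontier K = (\<Union>\<sigma>\<in>\<F> K. closure \<sigma>))"

definition outward_normal :: "'a::euclidean_space set \<Rightarrow> 'a set \<Rightarrow> 'a" where
  "outward_normal K \<sigma> =
     (THE n. norm n = 1 \<and> (\<exists>c. \<forall>x\<in>\<sigma>. n \<bullet> x = c) \<and>
        (\<forall>x\<in>\<sigma>. \<exists>\<delta>>0. \<forall>t\<in>{0<..<\<delta>}. x - t *\<^sub>R n \<in> K \<and> x + t *\<^sub>R n \<notin> K))"


section \<open>Function spaces on open sets\<close>

definition Linf :: "'a::euclidean_space set \<Rightarrow> ('a \<Rightarrow> real) \<Rightarrow> bool" where
  "Linf S f \<longleftrightarrow>
     f \<in> borel_measurable (lebesgue_on S) \<and> esssup (lebesgue_on S) (\<lambda>x. ereal \<bar>f x\<bar>) < \<infinity>"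

definition tendsto_Linf ::
  "'a::euclidean_space set \<Rightarrow> (nat \<Rightarrow> 'a \<Rightarrow> real) \<Rightarrow> ('a \<Rightarrow> real) \<Rightarrow> bool" where
  "tendsto_Linf S f g \<longleftrightarrow>
     (\<forall>\<^sub>F n in sequentially. Linf S (f n)) \<and> Linf S g \<and>
     (\<lambda>n. esssup (lebesgue_on S) (\<lambda>x. ereal \<bar>f n x - g x\<bar>)) \<longlonglongrightarrow> 0"

definition partial :: "'n::finite \<Rightarrow> (real^'n \<Rightarrow> real) \<Rightarrow> real^'n \<Rightarrow> real" where
  "partial i f x = frechet_derivative f (at x) (axis i 1)"

definition smooth :: "(real^'n::finite \<Rightarrow> real) \<Rightarrow> bool" where
  "smooth f \<longleftrightarrow> (\<forall>is. foldr partial is f differentiable_on UNIV)"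

definition test_function :: "(real^'n::finite) set \<Rightarrow> (real^'n \<Rightarrow> real) \<Rightarrow> bool" where
  "test_function S \<psi> \<longleftrightarrow>
     smooth \<psi> \<and> compact (closure {x. \<psi> x \<noteq> 0}) \<and> closure {x. \<psi> x \<noteq> 0} \<subseteq> S"

definition W1inf :: "(real^'n::finite) set \<Rightarrow> (real^'n \<Rightarrow> real) \<Rightarrow> bool" where
  "W1inf S f \<longleftrightarrow> Linf S f \<and>
     (\<forall>i. \<exists>g. Linf S g \<and>
        (\<forall>\<psi>. test_function S \<psi> \<longrightarrow>
           (LINT x|lebesgue_on S. f x * partial i \<psi> x) = - (LINT x|lebesgue_on S. g x * \<psi> x)))"

text \<open>
  A \<open>W\<^sup>1\<^sup>,\<^sup>\<infinity>\<close> function on a bounded Lipschitz set \<open>S\<close> is almost everywhere equal to a (unique)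
  continuous function on the closure of \<open>S\<close>. That function gives its trace on parts of the boundary
  and its values on null sets; it is only ever evaluated on the closure of \<open>S\<close>.
\<close>

definition continuous_trace :: "'a::euclidean_space set \<Rightarrow> ('a \<Rightarrow> 'b::topological_space) \<Rightarrow> 'a \<Rightarrow> 'b" where
  "continuous_trace S f = (SOME g. continuous_on (closure S) g \<and> (AE x in lebesgue_on S. g x = f x))"


section \<open>Polynomials and projectors\<close>

definition polys :: "nat \<Rightarrow> (real^'n::finite \<Rightarrow> real) set" where
  "polys q =
     {p. \<exists>c. p = (\<lambda>x. \<Sum>\<alpha> | (\<Sum>i\<in>UNIV. \<alpha> i) \<le> q. c \<alpha> * (\<Prod>i\<in>UNIV. x $ i ^ \<alpha> i))}"

definition vpolys :: "nat \<Rightarrow> (real^'n::finite \<Rightarrow> real^'n) set" where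
  "vpolys q = {\<tau>. \<forall>i. (\<lambda>x. \<tau> x $ i) \<in> polys q}"

text \<open>
  A polynomial function on a cell (a nonempty open set) determines the polynomial function on the
  whole space, and is identified with it: \<open>polys q\<close> serves as the space of polynomials on a cell.
  This fails on a face, where the restriction to the face is used, extended by zero.
\<close>

definition face_polys :: "nat \<Rightarrow> (real^'n::finite) set \<Rightarrow> (real^'n \<Rightarrow> real) set" where
  "face_polys q \<sigma> = {\<lambda>x. indicat_real \<sigma> x * p x |p. p \<in> polys q}"

definition L2_proj ::
  "('a \<Rightarrow> real) set \<Rightarrow> 'a measure \<Rightarrow> ('a \<Rightarrow> real) \<Rightarrow> 'a \<Rightarrow> real" where
  "L2_proj P \<mu> f = (THE p. p \<in> P \<and> (\<forall>r\<in>P. (LINT x|\<mu>. p x * r x) = (LINT x|\<mu>. f x * r x)))"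

definition cell_proj ::
  "nat \<Rightarrow> (real^'n::finite) set \<Rightarrow> (real^'n \<Rightarrow> real) \<Rightarrow> real^'n \<Rightarrow> real" where
  "cell_proj q K f = L2_proj (polys q) (lebesgue_on K) f"

definition face_proj ::
  "nat \<Rightarrow> (real^'n::finite) set \<Rightarrow> (real^'n \<Rightarrow> real) \<Rightarrow> real^'n \<Rightarrow> real" where
  "face_proj q \<sigma> f = L2_proj (face_polys q \<sigma>) (face_measure \<sigma>) f"


section \<open>Discrete space\<close>

text \<open>
  First component: cell unknowns, second component: face unknowns. Both vanish off the mesh, so that
  the space of these pairs is a genuine finite-dimensional vector space for the pointwise operations.
\<close>

type_synonym 'n hybrid =
  "((real^'n) set \<Rightarrow> real^'n \<Rightarrow> real) \<times> ((real^'n) set \<Rightarrow> real^'n \<Rightarrow> real)"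

definition hybrid_space ::
  "(real^'n::finite) set set \<Rightarrow> (real^'n) set set \<Rightarrow> nat \<Rightarrow> 'n hybrid set" where
  "hybrid_space \<M> \<E> k =
     {v. (\<forall>K\<in>\<M>. fst v K \<in> polys (k + 1)) \<and> (\<forall>K. K \<notin> \<M> \<longrightarrow> fst v K = 0) \<and>
         (\<forall>\<sigma>\<in>\<E>. snd v \<sigma> \<in> face_polys k \<sigma>) \<and> (\<forall>\<sigma>. \<sigma> \<notin> \<E> \<longrightarrow> snd v \<sigma> = 0)}"

definition hybrid_scale :: "real \<Rightarrow> ('n::finite) hybrid \<Rightarrow> 'n hybrid" where
  "hybrid_scale c v = (\<lambda>K x. c * fst v K x, \<lambda>\<sigma> x. c * snd v \<sigma> x)"

definition hybrid_one ::
  "(real^'n::finite) set set \<Rightarrow> (real^'n) set set \<Rightarrow> 'n hybrid" where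
  "hybrid_one \<M> \<E> =
     (\<lambda>K. if K \<in> \<M> then (\<lambda>x. 1) else 0, \<lambda>\<sigma>. if \<sigma> \<in> \<E> then indicat_real \<sigma> else 0)"

definition norm_on :: "('n::finite) hybrid set \<Rightarrow> ('n hybrid \<Rightarrow> real) \<Rightarrow> bool" where
  "norm_on V N \<longleftrightarrow>
     (\<forall>v\<in>V. N v \<ge> 0 \<and> (N v = 0 \<longrightarrow> v = 0)) \<and>
     (\<forall>v\<in>V. \<forall>w\<in>V. N (v + w) \<le> N v + N w) \<and>
     (\<forall>c. \<forall>v\<in>V. N (hybrid_scale c v) = \<bar>c\<bar> * N v)"

definition tendsto_hybrid ::
  "('n::finite) hybrid set \<Rightarrow> (nat \<Rightarrow> 'n hybrid) \<Rightarrow> 'n hybrid \<Rightarrow> bool" where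
  "tendsto_hybrid V v w \<longleftrightarrow>
     (\<forall>\<^sub>F n in sequentially. v n \<in> V) \<and> w \<in> V \<and>
     (\<forall>N. norm_on V N \<longrightarrow> (\<lambda>n. N (v n - w)) \<longlonglongrightarrow> 0)"

text \<open>The cells being disjoint, at most one term is nonzero; the value on the (null) skeleton is 0.\<close>

definition reconstruct ::
  "(real^'n::finite) set set \<Rightarrow> 'n hybrid \<Rightarrow> real^'n \<Rightarrow> real" where
  "reconstruct \<M> v x = (\<Sum>K\<in>\<M>. indicat_real K x * fst v K x)"

definition hybrid_potential ::
  "(real^'n::finite) set \<Rightarrow> (real^'n) set set \<Rightarrow> (real^'n) set set \<Rightarrow> nat \<Rightarrow>
   (real^'n \<Rightarrow> real) \<Rightarrow> 'n hybrid" where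
  "hybrid_potential \<Omega> \<M> \<E> k \<phi> =
     (\<lambda>K. if K \<in> \<M> then cell_proj (k + 1) K \<phi> else 0,
      \<lambda>\<sigma>. if \<sigma> \<in> \<E> then face_proj k \<sigma> (continuous_trace \<Omega> \<phi>) else 0)"


section \<open>Discrete operators\<close>

definition divergence :: "(real^'n::finite \<Rightarrow> real^'n) \<Rightarrow> real^'n \<Rightarrow> real" where
  "divergence \<tau> x = (\<Sum>i\<in>UNIV. partial i (\<lambda>y. \<tau> y $ i) x)"

definition discrete_grad ::
  "((real^'n::finite) set \<Rightarrow> (real^'n) set set) \<Rightarrow> nat \<Rightarrow> (real^'n) set \<Rightarrow> 'n hybrid \<Rightarrow>
   real^'n \<Rightarrow> real^'n" where
  "discrete_grad \<F> k K v =
     (THE G. G \<in> vpolys k \<and> (\<forall>\<tau>\<in>vpolys k.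
        (LINT x|lebesgue_on K. G x \<bullet> \<tau> x) =
          - (LINT x|lebesgue_on K. fst v K x * divergence \<tau> x) +
          (\<Sum>\<sigma>\<in>\<F> K. LINT x|face_measure \<sigma>. snd v \<sigma> x * (\<tau> x \<bullet> outward_normal K \<sigma>))))"

definition jump ::
  "nat \<Rightarrow> (real^'n::finite) set \<Rightarrow> (real^'n) set \<Rightarrow> 'n hybrid \<Rightarrow> real^'n \<Rightarrow> real" where
  "jump k K \<sigma> v x = face_proj k \<sigma> (fst v K) x - snd v \<sigma> x"

definition face_diffusion ::
  "(real^'n::finite \<Rightarrow> real^'n^'n) \<Rightarrow> (real^'n) set \<Rightarrow> (real^'n) set \<Rightarrow> real" where
  "face_diffusion \<Lambda> K \<sigma> =
     real_of_ereal (esssup (face_measure \<sigma>)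
       (\<lambda>x. ereal \<bar>(continuous_trace K \<Lambda> x *v outward_normal K \<sigma>) \<bullet> outward_normal K \<sigma>\<bar>))"

definition form_a ::
  "((real^'n::finite) set \<Rightarrow> (real^'n) set set) \<Rightarrow> nat \<Rightarrow> (real^'n \<Rightarrow> real^'n^'n) \<Rightarrow>
   (real^'n) set \<Rightarrow> 'n hybrid \<Rightarrow> 'n hybrid \<Rightarrow> real" where
  "form_a \<F> k \<Lambda> K z v =
     (LINT x|lebesgue_on K. (\<Lambda> x *v discrete_grad \<F> k K z x) \<bullet> discrete_grad \<F> k K v x) +
     (\<Sum>\<sigma>\<in>\<F> K. face_diffusion \<Lambda> K \<sigma> / diameter \<sigma> *
        (LINT x|face_measure \<sigma>. jump k K \<sigma> z x * jump k K \<sigma> v x))"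

definition form_T ::
  "(real^'n::finite) set set \<Rightarrow> ((real^'n) set \<Rightarrow> (real^'n) set set) \<Rightarrow> nat \<Rightarrow>
   (real^'n \<Rightarrow> real^'n^'n) \<Rightarrow> real \<Rightarrow> 'n hybrid \<Rightarrow> 'n hybrid \<Rightarrow> 'n hybrid \<Rightarrow> real" where
  "form_T \<M> \<F> k \<Lambda> \<epsilon> l w v =
     (\<Sum>K\<in>\<M>.
        (LINT x|lebesgue_on K. exp (fst l K x) *
           ((\<Lambda> x *v discrete_grad \<F> k K w x) \<bullet> discrete_grad \<F> k K v x)) +
        (\<Sum>\<sigma>\<in>\<F> K. face_diffusion \<Lambda> K \<sigma> / diameter \<sigma> *
           (LINT x|face_measure \<sigma>.
              (exp (face_proj k \<sigma> (fst l K) x) + exp (snd l \<sigma> x)) / 2 *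
              jump k K \<sigma> w x * jump k K \<sigma> v x)) +
        \<epsilon> * diameter K ^ (k + 2) * form_a \<F> k \<Lambda> K w v)"


section \<open>Nonlinear scheme\<close>

text \<open>Only the terms \<open>l n\<close> with \<open>n \<ge> 1\<close> matter; the initial density is \<open>u0\<close>.\<close>

definition density_at ::
  "(real^'n::finite \<Rightarrow> real) \<Rightarrow> (nat \<Rightarrow> 'n hybrid) \<Rightarrow> nat \<Rightarrow> (real^'n) set \<Rightarrow> real^'n \<Rightarrow> real" where
  "density_at u0 l n K x = (if n = 0 then u0 x else exp (fst (l n) K x))"

definition nonlinear_scheme_solution ::
  "(real^'n::finite) set \<Rightarrow> (real^'n) set set \<Rightarrow> (real^'n) set set \<Rightarrow>
   ((real^'n) set \<Rightarrow> (real^'n) set set) \<Rightarrow> nat \<Rightarrow> (real^'n \<Rightarrow> real^'n^'n) \<Rightarrow>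
   (real^'n \<Rightarrow> real) \<Rightarrow> (real^'n \<Rightarrow> real) \<Rightarrow> real \<Rightarrow> real \<Rightarrow> (nat \<Rightarrow> 'n hybrid) \<Rightarrow> bool" where
  "nonlinear_scheme_solution \<Omega> \<M> \<E> \<F> k \<Lambda> \<phi> u0 dt \<epsilon> l \<longleftrightarrow>
     (\<forall>n\<ge>1. l n \<in> hybrid_space \<M> \<E> k) \<and>
     (\<forall>n. \<forall>v\<in>hybrid_space \<M> \<E> k.
        (\<Sum>K\<in>\<M>. LINT x|lebesgue_on K.
           (density_at u0 l (n + 1) K x - density_at u0 l n K x) / dt * fst v K x) +
        form_T \<M> \<F> k \<Lambda> \<epsilon> (l (n + 1)) (l (n + 1) + hybrid_potential \<Omega> \<M> \<E> k \<phi>) v = 0)"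

definition equilibrium_constant ::
  "(real^'n::finite) set \<Rightarrow> (real^'n) set set \<Rightarrow> (real^'n) set set \<Rightarrow> nat \<Rightarrow>
   (real^'n \<Rightarrow> real) \<Rightarrow> real \<Rightarrow> real" where
  "equilibrium_constant \<Omega> \<M> \<E> k \<phi> mass =
     mass / (LINT x|lebesgue_on \<Omega>. exp (- reconstruct \<M> (hybrid_potential \<Omega> \<M> \<E> k \<phi>) x))"

definition equilibrium_log_potential ::
  "(real^'n::finite) set \<Rightarrow> (real^'n) set set \<Rightarrow> (real^'n) set set \<Rightarrow> nat \<Rightarrow>
   (real^'n \<Rightarrow> real) \<Rightarrow> real \<Rightarrow> 'n hybrid" where
  "equilibrium_log_potential \<Omega> \<M> \<E> k \<phi> mass =
     hybrid_scale (ln (equilibrium_constant \<Omega> \<M> \<E> k \<phi> mass)) (hybrid_one \<M> \<E>) -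
     hybrid_potential \<Omega> \<M> \<E> k \<phi>"

end

theory Submission
  imports Defs "HOL-Computational_Algebra.Polynomial"
begin

text \<open>
  Testing the scheme with \<open>w\<^sup>n = \<ell>\<^sup>n + \<phi>\<close> shows that the entropy \<open>\<integral> u\<^sup>n (log u\<^sup>n - 1 + \<phi>)\<close> decreases by at
  least the time step times the dissipation \<open>T(\<ell>\<^sup>n; w\<^sup>n, w\<^sup>n)\<close>; it is bounded from below, so the dissipation
  tends to zero. Since \<open>\<epsilon> > 0\<close>, the dissipation bounds, uniformly in \<open>\<ell>\<^sup>n\<close>, the squared norms of the discrete
  gradients and jumps of \<open>w\<^sup>n\<close>. If these vanish, the divergence theorem identifies the discrete
  gradient with the broken gradient, so that \<open>w\<^sup>n\<close> is constant on each cell and across faces, hence constant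
  since the cells are connected through faces. In finite dimension \<open>w\<^sup>n\<close> minus its mean therefore tends
  to zero, and conservation of mass, obtained by testing with constants, fixes the limit of the means.
\<close>

section \<open>Integration along lines\<close>

text \<open>No bound on \<open>l n\<close> is at hand before convergence is known, so the
  exponential weights in the form could degenerate along the sequence; they contribute only a sign,
  and the stabilisation has to carry the whole estimate. That it sees every nonconstant element
  rests on facts that the definitions leave implicit. Faces are given by relative openness and
  unions of closures, so the side on which a cell lies, the outward normal, the membership of a face
  in a cell and the divergence theorem are all extracted from hypographs and polytopes. The
  divergence theorem is proved by integrating along lines in a fixed direction: this needs neither
  rotations nor surface parametrisations and fits a face measure defined by cylinders. The face
  coefficients and the face part of the potential evaluate a chosen continuous representative, whose
  existence is shown by mollification and a path argument at the boundary. Projectors, discrete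
  gradients and normals are definite descriptions, and each is shown to denote before it is
  used.\<close>

lemma nn_integral_lborel_translate:
  fixes F :: "'a::euclidean_space \<Rightarrow> ennreal"
  assumes [measurable]: "F \<in> borel_measurable borel"
  shows "(\<integral>\<^sup>+y. F (y + v) \<partial>lborel) = (\<integral>\<^sup>+y. F y \<partial>lborel)"
proof -
  have "(\<integral>\<^sup>+y. F y \<partial>lborel) = (\<integral>\<^sup>+y. F y \<partial>distr lborel borel ((+) v))"
    by (simp add: lborel_distr_plus)
  also have "\<dots> = (\<integral>\<^sup>+y. F (v + y) \<partial>lborel)"
    by (subst nn_integral_distr) auto
  finally show ?thesis by (simp add: add.commute)
qed

lemma integral_lborel_translate:
  fixes F :: "'a::euclidean_space \<Rightarrow> real"
  assumes [measurable]: "F \<in> borel_measurable borel"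
  shows "(LINT y|lborel. F (y + v)) = (LINT y|lborel. F y)"
proof -
  have "(LINT y|lborel. F y) = (LINT y|distr lborel borel ((+) v). F y)"
    by (simp add: lborel_distr_plus)
  also have "\<dots> = (LINT y|lborel. F (v + y))"
    by (subst integral_distr) auto
  finally show ?thesis by (simp add: add.commute)
qed

lemma nn_integral_neg_line:
  fixes \<theta> :: "'a::euclidean_space \<Rightarrow> ennreal"
  assumes [measurable]: "\<theta> \<in> borel_measurable borel"
    and \<theta>: "\<And>y. (\<integral>\<^sup>+t. \<theta> (y + t *\<^sub>R e) \<partial>lborel) = 1"
  shows "(\<integral>\<^sup>+t. \<theta> (y + (- t) *\<^sub>R e) \<partial>lborel) = 1"
proof -
  have "(\<integral>\<^sup>+t. \<theta> (y + (- t) *\<^sub>R e) \<partial>lborel) = (\<integral>\<^sup>+t. \<theta> (y + t *\<^sub>R e) \<partial>distr lborel borel uminus)"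
    by (subst nn_integral_distr) auto
  also have "\<dots> = 1"
    using \<theta> by (simp add: lborel_distr_uminus)
  finally show ?thesis .
qed

text \<open>Since \<theta> has mass one on every line parallel to \<open>e\<close>, Fubini in
  \<open>(y, t)\<close>, a translation by \<open>t\<close> times \<open>e\<close> and Fubini again
  move \<theta> from the base point onto the line, where it integrates to one. This is integration
  over parallel lines without coordinates adapted to \<open>e\<close>.\<close>

lemma nn_integral_along_lines:
  fixes F \<theta> :: "'a::euclidean_space \<Rightarrow> ennreal"
  assumes [measurable]: "F \<in> borel_measurable borel" "\<theta> \<in> borel_measurable borel"
    and \<theta>: "\<And>y. (\<integral>\<^sup>+t. \<theta> (y + t *\<^sub>R e) \<partial>lborel) = 1"
  shows "(\<integral>\<^sup>+y. F y \<partial>lborel) = (\<integral>\<^sup>+y. \<theta> y * (\<integral>\<^sup>+t. F (y + t *\<^sub>R e) \<partial>lborel) \<partial>lborel)"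
proof -
  have "(\<integral>\<^sup>+y. \<theta> y * (\<integral>\<^sup>+t. F (y + t *\<^sub>R e) \<partial>lborel) \<partial>lborel)
      = (\<integral>\<^sup>+y. (\<integral>\<^sup>+t. \<theta> y * F (y + t *\<^sub>R e) \<partial>lborel) \<partial>lborel)"
    by (intro nn_integral_cong) (simp add: nn_integral_cmult)
  also have "\<dots> = (\<integral>\<^sup>+t. (\<integral>\<^sup>+y. \<theta> y * F (y + t *\<^sub>R e) \<partial>lborel) \<partial>lborel)"
    by (rule lborel_pair.Fubini') measurable
  also have "\<dots> = (\<integral>\<^sup>+t. (\<integral>\<^sup>+y. \<theta> (y + (- t) *\<^sub>R e) * F y \<partial>lborel) \<partial>lborel)"
  proof (rule nn_integral_cong)
    fix t :: real
    show "(\<integral>\<^sup>+y. \<theta> y * F (y + t *\<^sub>R e) \<partial>lborel) = (\<integral>\<^sup>+y. \<theta> (y + (- t) *\<^sub>R e) * F y \<partial>lborel)"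
      using nn_integral_lborel_translate[of "\<lambda>y. \<theta> (y + (- t) *\<^sub>R e) * F y" "t *\<^sub>R e"]
      by simp
  qed
  also have "\<dots> = (\<integral>\<^sup>+y. (\<integral>\<^sup>+t. \<theta> (y + (- t) *\<^sub>R e) * F y \<partial>lborel) \<partial>lborel)"
    by (rule lborel_pair.Fubini') measurable
  also have "\<dots> = (\<integral>\<^sup>+y. F y \<partial>lborel)"
  proof (rule nn_integral_cong)
    fix y :: 'a
    show "(\<integral>\<^sup>+t. \<theta> (y + (- t) *\<^sub>R e) * F y \<partial>lborel) = F y"
      using nn_integral_neg_line[OF assms(2) \<theta>, of y] by (simp add: nn_integral_multc)
  qed
  finally show ?thesis by simp
qed

text \<open>Both exchanges of integrals need integrability on the product: the first is the
  nonnegative version for the absolute value of \<open>F\<close>, the second follows from the unit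
  mass on lines.\<close>

lemma integral_along_lines:
  fixes F \<theta> :: "'a::euclidean_space \<Rightarrow> real"
  assumes [measurable]: "\<theta> \<in> borel_measurable borel" and F: "integrable lborel F"
    and nonneg: "\<And>y. \<theta> y \<ge> 0"
    and \<theta>: "\<And>y. (\<integral>\<^sup>+t. ennreal (\<theta> (y + t *\<^sub>R e)) \<partial>lborel) = 1"
  shows "(LINT y|lborel. F y) = (LINT y|lborel. \<theta> y * (LINT t|lborel. F (y + t *\<^sub>R e)))"
proof -
  have [measurable]: "F \<in> borel_measurable borel"
    using borel_measurable_integrable[OF F] by simp
  have neg_line: "(\<integral>\<^sup>+t. ennreal (\<theta> (y + (- t) *\<^sub>R e)) \<partial>lborel) = 1" for y
    by (rule nn_integral_neg_line) (use \<theta> in auto)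
  have int1: "integrable (lborel \<Otimes>\<^sub>M lborel) (\<lambda>(y, t). \<theta> y * F (y + t *\<^sub>R e))"
  proof (rule integrableI_bounded)
    show "(\<lambda>(y, t). \<theta> y * F (y + t *\<^sub>R e)) \<in> borel_measurable (lborel \<Otimes>\<^sub>M lborel)" by measurable
    have "(\<integral>\<^sup>+ p. ennreal (norm (case p of (y, t) \<Rightarrow> \<theta> y * F (y + t *\<^sub>R e))) \<partial>(lborel \<Otimes>\<^sub>M lborel))
        = (\<integral>\<^sup>+y. (\<integral>\<^sup>+t. ennreal (norm (\<theta> y * F (y + t *\<^sub>R e))) \<partial>lborel) \<partial>lborel)"
      by (subst lborel.nn_integral_fst[symmetric]) auto
    also have "\<dots> = (\<integral>\<^sup>+y. ennreal (\<theta> y) * (\<integral>\<^sup>+t. ennreal (norm (F (y + t *\<^sub>R e))) \<partial>lborel) \<partial>lborel)"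
      using nonneg by (intro nn_integral_cong)
        (simp add: nn_integral_cmult[symmetric] ennreal_mult abs_mult)
    also have "\<dots> = (\<integral>\<^sup>+y. ennreal (norm (F y)) \<partial>lborel)"
      by (rule nn_integral_along_lines[symmetric]) (use \<theta> in auto)
    also have "\<dots> < \<infinity>"
      using F by (auto simp: integrable_iff_bounded)
    finally show "(\<integral>\<^sup>+ p. ennreal (norm (case p of (y, t) \<Rightarrow> \<theta> y * F (y + t *\<^sub>R e))) \<partial>(lborel \<Otimes>\<^sub>M lborel)) < \<infinity>" .
  qed
  have int2: "integrable (lborel \<Otimes>\<^sub>M lborel) (\<lambda>(y, t). \<theta> (y + (- t) *\<^sub>R e) * F y)"
  proof (rule integrableI_bounded)
    show "(\<lambda>(y, t). \<theta> (y + (- t) *\<^sub>R e) * F y) \<in> borel_measurable (lborel \<Otimes>\<^sub>M lborel)" by measurable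
    have "(\<integral>\<^sup>+ p. ennreal (norm (case p of (y, t) \<Rightarrow> \<theta> (y + (- t) *\<^sub>R e) * F y)) \<partial>(lborel \<Otimes>\<^sub>M lborel))
        = (\<integral>\<^sup>+y. (\<integral>\<^sup>+t. ennreal (\<theta> (y + (- t) *\<^sub>R e)) * ennreal (norm (F y)) \<partial>lborel) \<partial>lborel)"
      using nonneg by (subst lborel.nn_integral_fst[symmetric]) (auto simp: abs_mult ennreal_mult)
    also have "\<dots> = (\<integral>\<^sup>+y. ennreal (norm (F y)) \<partial>lborel)"
      by (intro nn_integral_cong) (subst nn_integral_multc, measurable, simp only: neg_line, simp)
    also have "\<dots> < \<infinity>"
      using F by (auto simp: integrable_iff_bounded)
    finally show "(\<integral>\<^sup>+ p. ennreal (norm (case p of (y, t) \<Rightarrow> \<theta> (y + (- t) *\<^sub>R e) * F y)) \<partial>(lborel \<Otimes>\<^sub>M lborel)) < \<infinity>" .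
  qed
  have "(LINT y|lborel. \<theta> y * (LINT t|lborel. F (y + t *\<^sub>R e)))
      = (LINT y|lborel. (LINT t|lborel. \<theta> y * F (y + t *\<^sub>R e)))" by simp
  also have "\<dots> = (LINT t|lborel. (LINT y|lborel. \<theta> y * F (y + t *\<^sub>R e)))"
    by (rule lborel_pair.Fubini_integral[symmetric]) (rule int1)
  also have "\<dots> = (LINT t|lborel. (LINT y|lborel. \<theta> (y + (- t) *\<^sub>R e) * F y))"
  proof (rule Bochner_Integration.integral_cong[OF refl])
    fix t :: real
    show "(LINT y|lborel. \<theta> y * F (y + t *\<^sub>R e)) = (LINT y|lborel. \<theta> (y + (- t) *\<^sub>R e) * F y)"
      using integral_lborel_translate[of "\<lambda>y. \<theta> (y + (- t) *\<^sub>R e) * F y" "t *\<^sub>R e"]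
      by simp
  qed
  also have "\<dots> = (LINT y|lborel. (LINT t|lborel. \<theta> (y + (- t) *\<^sub>R e) * F y))"
    by (rule lborel_pair.Fubini_integral) (rule int2)
  also have "\<dots> = (LINT y|lborel. F y)"
    using nonneg by (simp add: integral_eq_nn_integral neg_line[simplified])
  finally show ?thesis by simp
qed

text \<open>The length of the piece of a line inside a slab; a negative \<open>r\<close> is harmless
  because \<open>ennreal\<close> sends negative reals to 0.\<close>

lemma nn_integral_abs_less_affine:
  assumes "a \<noteq> 0"
  shows "(\<integral>\<^sup>+t. indicator {t. \<bar>b + a * t\<bar> < r} t \<partial>lborel) = ennreal (2 * r / \<bar>a\<bar>)"
proof -
  have "{t. \<bar>b + a * t\<bar> < r} = {- b / a - r / \<bar>a\<bar> <..< - b / a + r / \<bar>a\<bar>}"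
  proof (intro set_eqI)
    fix t
    have "\<bar>b + a * t\<bar> = \<bar>a\<bar> * \<bar>t + b / a\<bar>"
      using assms by (simp add: abs_mult[symmetric] algebra_simps)
    then have "\<bar>b + a * t\<bar> < r \<longleftrightarrow> \<bar>t + b / a\<bar> < r / \<bar>a\<bar>"
      using assms by (simp add: pos_less_divide_eq mult.commute)
    then show "t \<in> {t. \<bar>b + a * t\<bar> < r} \<longleftrightarrow> t \<in> {- b / a - r / \<bar>a\<bar> <..< - b / a + r / \<bar>a\<bar>}"
      by auto
  qed
  then have eq: "(\<integral>\<^sup>+t. indicator {t. \<bar>b + a * t\<bar> < r} t \<partial>lborel)
     = emeasure lborel {- b / a - r / \<bar>a\<bar> <..< - b / a + r / \<bar>a\<bar>}"
    by (simp add: nn_integral_indicator)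
  show ?thesis
  proof (cases "r \<ge> 0")
    case True
    then show ?thesis unfolding eq by (subst emeasure_lborel_Ioo) (auto simp: field_simps)
  next
    case False
    then have "2 * r / \<bar>a\<bar> \<le> 0" by (intro divide_nonpos_nonneg) auto
    moreover have "{- b / a - r / \<bar>a\<bar> <..< - b / a + r / \<bar>a\<bar>} = {}"
    proof -
      have "r / \<bar>a\<bar> < 0" using False assms by (intro divide_neg_pos) auto
      then show ?thesis by (intro greaterThanLessThan_empty) linarith
    qed
    ultimately show ?thesis unfolding eq by (simp add: ennreal_neg)
  qed
qed

text \<open>
  An oblique cylinder over a piece of a hyperplane is compared with the right cylinder of the
  definition of \<open>hyperplane_measure\<close>, using invariance under translations only.
\<close>

lemma nn_integral_oblique:
  fixes g :: "'a::euclidean_space \<Rightarrow> ennreal" and e n :: 'a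
  assumes [measurable]: "g \<in> borel_measurable borel" "\<theta> \<in> borel_measurable borel"
    and n: "norm n = 1" and ne: "n \<bullet> e \<noteq> 0"
    and \<theta>: "\<And>y. (\<integral>\<^sup>+t. \<theta> (y + t *\<^sub>R e) \<partial>lborel) = 1"
  shows "(\<integral>\<^sup>+y. \<theta> y * g (y - ((n \<bullet> y - c) / (n \<bullet> e)) *\<^sub>R e) \<partial>lborel) =
     ennreal \<bar>n \<bullet> e\<bar> * (\<integral>\<^sup>+y. indicator {y. \<bar>n \<bullet> y - c\<bar> < 1/2} y * g (y - (n \<bullet> y - c) *\<^sub>R n) \<partial>lborel)"
proof -
  define pe where "pe y = y - ((n \<bullet> y - c) / (n \<bullet> e)) *\<^sub>R e" for y
  define pn where "pn y = y - (n \<bullet> y - c) *\<^sub>R n" for y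
  define S :: "'a \<Rightarrow> ennreal" where "S = indicator {y. \<bar>n \<bullet> y - c\<bar> < 1/2}"
  have [measurable]: "pe \<in> borel_measurable borel" "pn \<in> borel_measurable borel"
    unfolding pe_def pn_def by measurable
  have [measurable]: "S \<in> borel_measurable borel"
    unfolding S_def by measurable
  have nn: "n \<bullet> n = 1" using n by (simp add: norm_eq_1)
  \<comment> \<open>The slab meets a line in the direction \<open>e\<close> in length
    \<open>1 / \<bar>n \<bullet> e\<bar>\<close>, so this factor turns it into another weight of
    unit mass along \<open>e\<close>. This is where the cosine in the statement comes from.\<close>
  have Se: "(\<integral>\<^sup>+t. ennreal \<bar>n \<bullet> e\<bar> * S (y + t *\<^sub>R e) \<partial>lborel) = 1" for y
  proof -
    have "(\<integral>\<^sup>+t. S (y + t *\<^sub>R e) \<partial>lborel) = ennreal (1 / \<bar>n \<bullet> e\<bar>)"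
      using nn_integral_abs_less_affine[OF ne, of "n \<bullet> y - c" "1/2"]
      by (simp add: S_def indicator_def inner_add_right algebra_simps)
    then show ?thesis
      using ne by (simp add: nn_integral_cmult ennreal_mult[symmetric])
  qed
  have Sn: "(\<integral>\<^sup>+t. S (y + t *\<^sub>R n) \<partial>lborel) = 1" for y
    using nn_integral_abs_less_affine[of 1 "n \<bullet> y - c" "1/2"]
    by (simp add: S_def indicator_def inner_add_right nn algebra_simps)
  have inv: "pe (y + t *\<^sub>R e) = pe y" for y t
    using ne by (simp add: pe_def inner_add_right field_simps scaleR_add_left[symmetric])
  \<comment> \<open>As \<open>pe\<close> is constant along \<open>e\<close>, the weight \<theta> can
    be exchanged for the normalised slab.\<close>
  have "(\<integral>\<^sup>+y. \<theta> y * g (pe y) \<partial>lborel)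
      = (\<integral>\<^sup>+y. \<theta> y * (\<integral>\<^sup>+t. (ennreal \<bar>n \<bullet> e\<bar> * S (y + t *\<^sub>R e)) * g (pe (y + t *\<^sub>R e)) \<partial>lborel) \<partial>lborel)"
    unfolding inv by (intro nn_integral_cong, subst nn_integral_multc) (measurable, simp only: Se, simp)
  also have "\<dots> = (\<integral>\<^sup>+y. (ennreal \<bar>n \<bullet> e\<bar> * S y) * g (pe y) \<partial>lborel)"
    by (rule nn_integral_along_lines[symmetric]) (use \<theta> in auto)
  also have "\<dots> = ennreal \<bar>n \<bullet> e\<bar> * (\<integral>\<^sup>+y. S y * g (pe y) \<partial>lborel)"
    by (simp add: nn_integral_cmult mult.assoc)
  also have "(\<integral>\<^sup>+y. S y * g (pe y) \<partial>lborel)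
      = (\<integral>\<^sup>+y. S y * (\<integral>\<^sup>+t. S (y + t *\<^sub>R n) * g (pe (y + t *\<^sub>R n)) \<partial>lborel) \<partial>lborel)"
    by (rule nn_integral_along_lines) (use Sn in auto)
  also have "\<dots> = (\<integral>\<^sup>+y. S y * (\<integral>\<^sup>+t. indicator {t. \<bar>t\<bar> < 1/2} t * g (pn (y + t *\<^sub>R (n - e /\<^sub>R (n \<bullet> e)))) \<partial>lborel) \<partial>lborel)"
  proof (rule nn_integral_cong, rule arg_cong2[where f = "(*)"], rule refl)
    fix y
    \<comment> \<open>The height above the hyperplane becomes the variable: after the shift by
      \<open>n \<bullet> y - c\<close>, projecting along \<open>e\<close> differs from projecting
      along \<open>n\<close> by a translation parallel to the hyperplane and proportional to the
      height.\<close>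
    define h where "h t = indicator {t. \<bar>t\<bar> < 1/2} t * g (pn (y + t *\<^sub>R (n - e /\<^sub>R (n \<bullet> e))))" for t :: real
    have [measurable]: "h \<in> borel_measurable borel"
      unfolding h_def by measurable
    have "S (y + t *\<^sub>R n) * g (pe (y + t *\<^sub>R n)) = h (t + (n \<bullet> y - c))" for t
    proof -
      have "pe (y + t *\<^sub>R n) = pn (y + (t + (n \<bullet> y - c)) *\<^sub>R (n - e /\<^sub>R (n \<bullet> e)))"
      proof -
        have [simp]: "(n \<bullet> e) * (x * inverse (n \<bullet> e)) = x" "(n \<bullet> e) * inverse (n \<bullet> e) = 1" for x
          using ne by simp_all
        have [simp]: "(x * 2) *\<^sub>R n = x *\<^sub>R n + x *\<^sub>R n" for x
          by (simp flip: scaleR_add_left)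
        show ?thesis
          by (simp add: pe_def pn_def inner_add_right inner_diff_right nn algebra_simps divide_inverse)
      qed
      then show ?thesis
        unfolding h_def S_def by (simp add: indicator_def inner_add_right nn algebra_simps)
    qed
    then show "(\<integral>\<^sup>+t. S (y + t *\<^sub>R n) * g (pe (y + t *\<^sub>R n)) \<partial>lborel) =
        (\<integral>\<^sup>+t. indicator {t. \<bar>t\<bar> < 1/2} t * g (pn (y + t *\<^sub>R (n - e /\<^sub>R (n \<bullet> e)))) \<partial>lborel)"
      using nn_integral_lborel_translate[of h "n \<bullet> y - c"] unfolding h_def[symmetric] by simp
  qed
  also have "\<dots> = (\<integral>\<^sup>+y. (\<integral>\<^sup>+t. S y * (indicator {t. \<bar>t\<bar> < 1/2} t * g (pn (y + t *\<^sub>R (n - e /\<^sub>R (n \<bullet> e))))) \<partial>lborel) \<partial>lborel)"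
    by (intro nn_integral_cong nn_integral_cmult[symmetric]) measurable
  also have "\<dots> = (\<integral>\<^sup>+t. (\<integral>\<^sup>+y. S y * (indicator {t. \<bar>t\<bar> < 1/2} t * g (pn (y + t *\<^sub>R (n - e /\<^sub>R (n \<bullet> e))))) \<partial>lborel) \<partial>lborel)"
    by (rule lborel_pair.Fubini') measurable
  also have "\<dots> = (\<integral>\<^sup>+t. indicator {t::real. \<bar>t\<bar> < 1/2} t * (\<integral>\<^sup>+y. S y * g (pn y) \<partial>lborel) \<partial>lborel)"
  proof (rule nn_integral_cong)
    fix t :: real
    \<comment> \<open>The shear is orthogonal to \<open>n\<close>, so translating by it preserves
      the slab and commutes with \<open>pn\<close>; the inner integral no longer depends on the
      height.\<close>
    define v where "v = t *\<^sub>R (n - e /\<^sub>R (n \<bullet> e))"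
    have v: "n \<bullet> v = 0" using ne by (simp add: v_def inner_diff_right nn)
    have "(\<integral>\<^sup>+y. S y * (indicator {t. \<bar>t\<bar> < 1/2} t * g (pn (y + v))) \<partial>lborel)
        = indicator {t. \<bar>t\<bar> < 1/2} t * (\<integral>\<^sup>+y. S (y + v) * g (pn (y + v)) \<partial>lborel)"
      by (subst nn_integral_cmult[symmetric])
        (auto simp: S_def inner_add_right v indicator_def mult_ac intro!: nn_integral_cong)
    also have "(\<integral>\<^sup>+y. S (y + v) * g (pn (y + v)) \<partial>lborel) = (\<integral>\<^sup>+y. S y * g (pn y) \<partial>lborel)"
      by (rule nn_integral_lborel_translate[where F = "\<lambda>y. S y * g (pn y)"]) measurable
    finally show "(\<integral>\<^sup>+y. S y * (indicator {t. \<bar>t\<bar> < 1/2} t * g (pn (y + t *\<^sub>R (n - e /\<^sub>R (n \<bullet> e))))) \<partial>lborel)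
        = indicator {t. \<bar>t\<bar> < 1/2} t * (\<integral>\<^sup>+y. S y * g (pn y) \<partial>lborel)"
      by (simp add: v_def)
  qed
  also have "\<dots> = (\<integral>\<^sup>+y. S y * g (pn y) \<partial>lborel)"
    using nn_integral_abs_less_affine[of 1 0 "1/2"] by (simp add: nn_integral_multc)
  finally show ?thesis unfolding pe_def pn_def S_def .
qed


text \<open>Tested on indicators, the nonnegative version says that the weighted oblique cylinder
  and the right cylinder with density \<open>\<bar>n \<bullet> e\<bar>\<close> have the same image
  measure on the hyperplane. Integrability then passes from the right cylinder to the oblique
  one.\<close>

lemma integral_oblique:
  fixes g \<theta> :: "'a::euclidean_space \<Rightarrow> real" and e n :: 'a and c :: real
  defines "pn \<equiv> \<lambda>y. y - (n \<bullet> y - c) *\<^sub>R n"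
    and "pe \<equiv> \<lambda>y. y - ((n \<bullet> y - c) / (n \<bullet> e)) *\<^sub>R e"
    and "S \<equiv> {y. \<bar>n \<bullet> y - c\<bar> < 1/2}"
  assumes [measurable]: "g \<in> borel_measurable borel" "\<theta> \<in> borel_measurable borel"
    and n: "norm n = 1" and ne: "n \<bullet> e \<noteq> 0" and nonneg: "\<And>y. \<theta> y \<ge> 0"
    and \<theta>: "\<And>y. (\<integral>\<^sup>+t. ennreal (\<theta> (y + t *\<^sub>R e)) \<partial>lborel) = 1"
    and int: "integrable lborel (\<lambda>y. indicator S y * g (pn y))"
  shows "integrable lborel (\<lambda>y. \<theta> y * g (pe y))"
    and "(LINT y|lborel. \<theta> y * g (pe y)) = \<bar>n \<bullet> e\<bar> * (LINT y|lborel. indicator S y * g (pn y))"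
proof -
  have [measurable]: "pe \<in> borel_measurable borel" "pn \<in> borel_measurable borel"
    unfolding pe_def pn_def by measurable
  have [measurable]: "S \<in> sets borel"
    unfolding S_def by measurable
  define M1 where "M1 = distr (density lborel (\<lambda>y. ennreal (\<theta> y))) borel pe"
  define M2 where "M2 = distr (density lborel (\<lambda>y. ennreal (\<bar>n \<bullet> e\<bar> * indicator S y))) borel pn"
  have M: "M1 = M2"
  proof (rule measure_eqI)
    fix A assume "A \<in> sets M1"
    then have [measurable]: "A \<in> sets borel" by (simp add: M1_def)
    have "emeasure M1 A = (\<integral>\<^sup>+y. indicator A y \<partial>M1)"
      using \<open>A \<in> sets M1\<close> by simp
    also have "\<dots> = (\<integral>\<^sup>+y. ennreal (\<theta> y) * indicator A (pe y) \<partial>lborel)"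
      unfolding M1_def by (subst nn_integral_distr) (auto simp: nn_integral_density)
    also have "\<dots> = ennreal \<bar>n \<bullet> e\<bar> * (\<integral>\<^sup>+y. indicator S y * indicator A (pn y) \<partial>lborel)"
      unfolding pe_def pn_def S_def by (rule nn_integral_oblique) (use n ne \<theta> in auto)
    also have "\<dots> = (\<integral>\<^sup>+y. ennreal (\<bar>n \<bullet> e\<bar> * indicator S y) * indicator A (pn y) \<partial>lborel)"
      by (subst nn_integral_cmult[symmetric])
        (auto simp: indicator_def intro!: nn_integral_cong)
    also have "\<dots> = (\<integral>\<^sup>+y. indicator A y \<partial>M2)"
      unfolding M2_def by (subst nn_integral_distr) (auto simp: nn_integral_density)
    also have "\<dots> = emeasure M2 A"
      by (simp add: M2_def)
    finally show "emeasure M1 A = emeasure M2 A" .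
  qed (simp add: M1_def M2_def)
  have nonneg2: "\<bar>n \<bullet> e\<bar> * indicator S y \<ge> 0" for y by simp
  have "integrable M2 g"
    unfolding M2_def using int
    by (subst integrable_distr_eq) (auto simp: integrable_density nonneg2 mult.assoc)
  then have "integrable M1 g" by (simp add: M)
  then show "integrable lborel (\<lambda>y. \<theta> y * g (pe y))"
    unfolding M1_def
    by (subst (asm) integrable_distr_eq) (auto simp: integrable_density nonneg)
  have "(LINT y|lborel. \<theta> y * g (pe y)) = (LINT y|M1. g y)"
    unfolding M1_def by (subst integral_distr) (auto simp: integral_density nonneg)
  also have "\<dots> = (LINT y|M2. g y)" by (simp add: M)
  also have "\<dots> = \<bar>n \<bullet> e\<bar> * (LINT y|lborel. indicator S y * g (pn y))"
    unfolding M2_def by (subst integral_distr) (auto simp: integral_density nonneg2 mult.assoc)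
  finally show "(LINT y|lborel. \<theta> y * g (pe y)) = \<bar>n \<bullet> e\<bar> * (LINT y|lborel. indicator S y * g (pn y))" .
qed

section \<open>The divergence theorem on a polytope\<close>

text \<open>The local limits \<open>g t\<close> form a locally constant function on the connected
  line. Punctured neighbourhoods are used because the values of \<open>f\<close> at exceptional
  points are arbitrary.\<close>

lemma punctured_locally_constant:
  fixes f :: "real \<Rightarrow> 'b"
  assumes "\<And>t. \<exists>c. \<forall>\<^sub>F s in at t. f s = c"
  shows "\<exists>c. \<forall>t. \<forall>\<^sub>F s in at t. f s = c"
proof -
  obtain g where g: "\<And>t. \<forall>\<^sub>F s in at t. f s = g t"
    using assms by metis
  have "\<forall>\<^sub>F s in at t. g t = g s" for t
  proof -
    obtain T where T: "open T" "t \<in> T" "\<And>s. s \<in> T \<Longrightarrow> s \<noteq> t \<Longrightarrow> f s = g t"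
      using g[of t] unfolding eventually_at_topological by blast
    have "g t = g s" if "s \<in> T" "s \<noteq> t" for s
    proof -
      have "\<forall>\<^sub>F x in at s. x \<in> T - {t}"
        using that T(1) by (intro eventually_at_in_open') auto
      with g[of s] have "\<forall>\<^sub>F x in at s. g t = g s"
        by eventually_elim (use T(3) in auto)
      then show ?thesis by (auto simp: eventually_const)
    qed
    then show ?thesis
      unfolding eventually_at_topological using T by blast
  qed
  then have "g t = g 0" for t
    by (intro connected_local_const[of UNIV t 0 g]) auto
  then show ?thesis using g by metis
qed

text \<open>The fundamental theorem of calculus on an open set that is not split into intervals.
  Here \<open>s j = 1\<close> marks a right end of \<open>U\<close> and \<open>s j = -1\<close> a
  left end, so adding to the indicator of \<open>U\<close> a step of height \<open>s j\<close> at
  each \<open>\<tau> j\<close> cancels every jump: \<open>D\<close> is constant off the end points.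
  It is 0 far to the left, hence also far to the right, where it equals the sum of the
  \<open>s j\<close>.\<close>

lemma integral_deriv_open_set:
  fixes U :: "real set" and \<tau> s :: "'j \<Rightarrow> real" and h h' :: "real \<Rightarrow> real"
  assumes U: "open U" "bounded U" and J: "finite J" "inj_on \<tau> J"
    and s: "\<And>j. j \<in> J \<Longrightarrow> s j = 1 \<or> s j = -1"
    and cross: "\<And>j. j \<in> J \<Longrightarrow> \<forall>\<^sub>F t in at (\<tau> j). t \<in> U \<longleftrightarrow> s j * (t - \<tau> j) < 0"
    and front: "frontier U \<subseteq> \<tau> ` J"
    and h: "\<And>t. (h has_real_derivative h' t) (at t)" and h': "continuous_on UNIV h'"
  shows "(LINT t|lborel. indicator U t * h' t) = (\<Sum>j\<in>J. s j * h (\<tau> j))"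
proof -
  define R where "R j t = (if \<tau> j < t then s j else 0)" for j t
  define D where "D t = indicator U t + (\<Sum>j\<in>J. R j t)" for t
  have Rc: "\<forall>\<^sub>F t in nhds t0. R j t = R j t0" if "\<tau> j \<noteq> t0" for j t0
  proof (cases "\<tau> j < t0")
    case True
    then have "\<forall>\<^sub>F t in nhds t0. t \<in> {\<tau> j<..}" by (intro eventually_nhds_in_open) auto
    then show ?thesis by eventually_elim (use True in \<open>auto simp: R_def\<close>)
  next
    case False
    then have "\<forall>\<^sub>F t in nhds t0. t \<in> {..<\<tau> j}" using that by (intro eventually_nhds_in_open) auto
    then show ?thesis by eventually_elim (use False in \<open>auto simp: R_def\<close>)
  qed
  have Uc: "\<forall>\<^sub>F t in nhds t0. (indicator U t :: real) = indicator U t0" if "t0 \<notin> \<tau> ` J" for t0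
  proof (cases "t0 \<in> U")
    case True
    then have "\<forall>\<^sub>F t in nhds t0. t \<in> U" using U by (intro eventually_nhds_in_open) auto
    then show ?thesis by eventually_elim (use True in auto)
  next
    case False
    then have "t0 \<in> - closure U" using that front U by (auto simp: frontier_def interior_open)
    then have "\<forall>\<^sub>F t in nhds t0. t \<in> - closure U" by (intro eventually_nhds_in_open) auto
    then show ?thesis by eventually_elim (use False closure_subset[of U] in \<open>auto simp: indicator_def\<close>)
  qed
  have nonhit: "\<forall>\<^sub>F t in nhds t0. D t = D t0" if "t0 \<notin> \<tau> ` J" for t0
  proof -
    have "\<forall>\<^sub>F t in nhds t0. \<forall>j\<in>J. R j t = R j t0"
      using J Rc that by (intro eventually_ball_finite) (metis image_eqI)+
    with Uc[OF that] show ?thesis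
      by eventually_elim (simp add: D_def)
  qed
  have "\<exists>c. \<forall>\<^sub>F t in at t0. D t = c" for t0
  proof (cases "t0 \<in> \<tau> ` J")
    case False
    then show ?thesis using nonhit[of t0] by (auto simp add: eventually_nhds_conv_at)
  next
    case True
    then obtain j where j: "j \<in> J" "t0 = \<tau> j" by auto
    have "\<forall>\<^sub>F t in nhds t0. \<forall>i\<in>J-{j}. R i t = R i t0"
      using J Rc j by (intro eventually_ball_finite) (auto dest: inj_onD)
    then have ev: "\<forall>\<^sub>F t in at t0. \<forall>i\<in>J-{j}. R i t = R i t0"
      by (simp add: eventually_nhds_conv_at)
    have "\<forall>\<^sub>F t in at t0. t \<noteq> t0" by (simp add: eventually_at_filter)
    with ev cross[OF j(1), folded j(2)]
    have "\<forall>\<^sub>F t in at t0. D t = (if s j = 1 then 1 else 0) + (\<Sum>i\<in>J-{j}. R i t0)"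
    proof eventually_elim
      case (elim t)
      have "D t = indicator U t + R j t + (\<Sum>i\<in>J-{j}. R i t)"
        using J j by (simp add: D_def sum.remove)
      then show ?case using elim s[OF j(1)] j by (auto simp: R_def indicator_def)
    qed
    then show ?thesis by blast
  qed
  then obtain c where c: "\<And>t. \<forall>\<^sub>F s in at t. D s = c"
    using punctured_locally_constant[of D] by blast
  have Dc: "D t = c" if "t \<notin> \<tau> ` J" for t
  proof -
    have "\<forall>\<^sub>F s in at t. D s = D t" using nonhit[OF that] by (simp add: eventually_nhds_conv_at)
    with c[of t] have "\<forall>\<^sub>F s in at t. D t = c" by eventually_elim auto
    then show ?thesis by (auto simp: eventually_const)
  qed
  have "bounded (U \<union> \<tau> ` J)" using U J by (simp add: finite_imp_bounded)
  then obtain B where B: "\<And>x. x \<in> U \<union> \<tau> ` J \<Longrightarrow> \<bar>x\<bar> < B"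
    by (metis bounded_pos_less real_norm_def)
  have "- B \<notin> U \<union> \<tau> ` J" "B \<notin> U \<union> \<tau> ` J" using B[of B] B[of "-B"] by auto
  moreover have "R j (-B) = 0" "R j B = s j" if "j \<in> J" for j
    using B[of "\<tau> j"] that by (auto simp: R_def)
  ultimately have c0: "c = 0" and sums: "(\<Sum>j\<in>J. s j) = 0"
    using Dc[of "-B"] Dc[of B] by (auto simp: D_def indicator_def)
  \<comment> \<open>Cutting the steps off at \<open>B\<close> writes the indicator of
    \<open>U\<close> with the intervals from \<open>\<tau> j\<close> to \<open>B\<close>; the terms
    \<open>h B\<close> that they produce cancel because the \<open>s j\<close> sum to zero.\<close>
  have eq: "indicator U t * h' t = (\<Sum>j\<in>J. - s j * (h' t * indicator {\<tau> j..B} t))"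
    if t: "t \<notin> \<tau> ` J" for t
  proof (cases "t \<le> B")
    case True
    have "indicator U t = - (\<Sum>j\<in>J. R j t)" using Dc[OF t] c0 by (simp add: D_def)
    also have "\<dots> = (\<Sum>j\<in>J. - s j * indicator {\<tau> j..B} t)"
      unfolding sum_negf[symmetric]
      using t True by (intro sum.cong) (auto simp: R_def indicator_def less_le)
    finally show ?thesis by (simp add: sum_distrib_left sum_distrib_right sum_negf mult_ac)
  next
    case False
    then have "t \<notin> U" using B[of t] by auto
    then show ?thesis using False by simp
  qed
  have ae: "AE t in lborel. t \<notin> \<tau> ` J"
    using J by (intro AE_not_in finite_imp_null_set_lborel) auto
  have cont: "isCont h' t" for t using h' by (simp add: continuous_on_eq_continuous_at)
  have int: "integrable lborel (\<lambda>t. h' t * indicator {\<tau> j..B} t)" for j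
    using borel_integrable_atLeastAtMost[of "\<tau> j" B h'] cont by simp
  have [measurable]: "h' \<in> borel_measurable borel" "U \<in> sets borel"
    using h' U by (auto intro: borel_measurable_continuous_onI)
  have "(LINT t|lborel. indicator U t * h' t)
      = (LINT t|lborel. (\<Sum>j\<in>J. - s j * (h' t * indicator {\<tau> j..B} t)))"
    by (rule integral_cong_AE) (use ae eq in auto)
  also have "\<dots> = (\<Sum>j\<in>J. - s j * (LINT t|lborel. h' t * indicator {\<tau> j..B} t))"
    by (subst Bochner_Integration.integral_sum) (use int in auto)
  also have "\<dots> = (\<Sum>j\<in>J. - s j * (h B - h (\<tau> j)))"
  proof (intro sum.cong refl arg_cong2[where f = "(*)"])
    fix j assume "j \<in> J"
    then have "\<tau> j \<le> B" using B[of "\<tau> j"] by auto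
    then show "(LINT t|lborel. h' t * indicator {\<tau> j..B} t) = h B - h (\<tau> j)"
      by (intro integral_FTC_Icc_real) (use h cont in auto)
  qed
  also have "\<dots> = (\<Sum>j\<in>J. s j * h (\<tau> j)) - (\<Sum>j\<in>J. s j) * h B"
    by (simp add: sum_subtractf sum_distrib_left algebra_simps)
  finally show ?thesis using sums by simp
qed

lemma integrable_bounded_support:
  fixes f :: "'a::euclidean_space \<Rightarrow> real"
  assumes f: "f \<in> borel_measurable lborel" and A: "A \<in> sets borel" "bounded A"
    and B: "\<And>x. x \<in> A \<Longrightarrow> \<bar>f x\<bar> \<le> B" and out: "\<And>x. x \<notin> A \<Longrightarrow> f x = 0"
  shows "integrable lborel f"
proof (rule Bochner_Integration.integrable_bound)
  have "emeasure lborel A < \<infinity>" using A(2) by (rule emeasure_bounded_finite)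
  then show "integrable lborel (\<lambda>x. B * indicator A x)" using A(1) by simp
  show "AE x in lborel. norm (f x) \<le> norm (B * indicator A x)"
  proof (rule AE_I2)
    fix x show "norm (f x) \<le> norm (B * indicator A x)"
      using B[of x] out[of x] by (cases "x \<in> A") auto
  qed
qed (rule f)

lemma negligible_affine:
  fixes L :: "'a::euclidean_space set"
  assumes "affine L" "aff_dim L < DIM('a)"
  shows "negligible L"
proof -
  have "interior L = {}"
    using assms(2) aff_dim_nonempty_interior[of L] by auto
  then show ?thesis
    using assms by (simp add: negligible_convex_interior affine_imp_convex)
qed

text \<open>Sweeping an affine set along \<open>e\<close> raises its dimension by at most one, so a
  set of codimension two stays inside a proper affine subspace. Hence almost every line in the
  direction \<open>e\<close> misses it.\<close>

lemma negligible_line_cylinder: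
  fixes L :: "'a::euclidean_space set"
  assumes L: "affine L" "aff_dim L + 2 \<le> DIM('a)"
  shows "negligible {y. \<exists>t. y + t *\<^sub>R e \<in> L}"
proof (cases "L = {}")
  case False
  then obtain p where p: "p \<in> L" by auto
  define A where "A = affine hull (insert (p + e) L)"
  have "aff_dim A \<le> aff_dim L + 1"
    unfolding A_def aff_dim_affine_hull by (simp add: aff_dim_insert)
  then have "negligible A"
    using L by (intro negligible_affine) (auto simp: A_def)
  moreover have "{y. \<exists>t. y + t *\<^sub>R e \<in> L} \<subseteq> A"
  proof clarify
    fix y t assume l: "y + t *\<^sub>R e \<in> L"
    have "y + t *\<^sub>R e \<in> A" "p \<in> A" "p + e \<in> A"
      using l p by (auto simp: A_def intro: hull_inc)
    moreover have "affine A" by (simp add: A_def)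
    ultimately have "(y + t *\<^sub>R e) + (- t) *\<^sub>R ((p + e) - p) \<in> A"
      by (intro mem_affine_3_minus)
    then show "y \<in> A" by simp
  qed
  ultimately show ?thesis by (rule negligible_subset)
qed simp

lemma AE_lborel_negligible:
  assumes "negligible N"
  shows "AE x in lborel. x \<notin> N"
proof -
  have "AE x in lebesgue. x \<notin> N"
    using assms by (simp add: AE_not_in negligible_iff_null_sets)
  then show ?thesis by (simp add: AE_completion_iff)
qed

lemma AE_lborel_hyperplane:
  fixes n :: "'a::euclidean_space"
  assumes "n \<noteq> 0"
  shows "AE x in lborel. n \<bullet> x \<noteq> c"
proof -
  have "negligible {x. n \<bullet> x = c}"
    using assms by (intro negligible_hyperplane) auto
  from AE_lborel_negligible[OF this] show ?thesis by simp
qed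

text \<open>
  The open set \<open>K\<close> lies locally on one side of each of its faces \<open>\<sigma>\<close>; what is left of its frontier
  is contained in finitely many affine sets of codimension two, which almost every line avoids.
\<close>

locale faceted_set =
  fixes K :: "'a::euclidean_space set" and J :: "'a set set" and n :: "'a set \<Rightarrow> 'a"
    and c :: "'a set \<Rightarrow> real" and \<L> :: "'a set set"
  assumes K: "open K" "bounded K"
    and J: "finite J" "pairwise disjnt J" "\<And>\<sigma>. \<sigma> \<in> J \<Longrightarrow> \<sigma> \<in> sets borel"
    and n: "\<And>\<sigma>. \<sigma> \<in> J \<Longrightarrow> norm (n \<sigma>) = 1"
    and plane: "\<And>\<sigma> x. \<sigma> \<in> J \<Longrightarrow> x \<in> \<sigma> \<Longrightarrow> n \<sigma> \<bullet> x = c \<sigma>"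
    and side: "\<And>\<sigma> x. \<sigma> \<in> J \<Longrightarrow> x \<in> \<sigma> \<Longrightarrow> \<exists>r>0. \<forall>y\<in>ball x r. y \<in> K \<longleftrightarrow> n \<sigma> \<bullet> y < c \<sigma>"
    and bounded_face: "\<And>\<sigma>. \<sigma> \<in> J \<Longrightarrow> bounded \<sigma>"
    and \<L>: "finite \<L>" "\<And>L. L \<in> \<L> \<Longrightarrow> affine L" "\<And>L. L \<in> \<L> \<Longrightarrow> aff_dim L + 2 \<le> DIM('a)"
    and front: "frontier K \<subseteq> \<Union>J \<union> \<Union>\<L>"
begin

text \<open>On a line that misses the sets in \<open>\<L>\<close> and does not lie in the hyperplane
  of a face parallel to \<open>e\<close>, every boundary point of the trace of \<open>K\<close> is a
  transversal crossing of exactly one face, and the sign of \<open>n \<sigma> \<bullet> e\<close>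
  tells whether the line leaves or enters \<open>K\<close> there.\<close>

lemma integral_deriv_line:
  fixes f f' :: "'a \<Rightarrow> real"
  assumes f: "\<And>x t. ((\<lambda>t. f (x + t *\<^sub>R e)) has_real_derivative f' (x + t *\<^sub>R e)) (at t)"
    and f': "continuous_on UNIV f'" and e: "e \<noteq> 0"
    and y1: "\<And>L t. L \<in> \<L> \<Longrightarrow> y + t *\<^sub>R e \<notin> L"
    and y2: "\<And>\<sigma>. \<sigma> \<in> J \<Longrightarrow> n \<sigma> \<bullet> e = 0 \<Longrightarrow> n \<sigma> \<bullet> y \<noteq> c \<sigma>"
  shows "(LINT t|lborel. indicator K (y + t *\<^sub>R e) * f' (y + t *\<^sub>R e)) =
    (\<Sum>\<sigma>\<in>{\<sigma>\<in>J. n \<sigma> \<bullet> e \<noteq> 0}. sgn (n \<sigma> \<bullet> e) *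
        (indicator \<sigma> (y - ((n \<sigma> \<bullet> y - c \<sigma>) / (n \<sigma> \<bullet> e)) *\<^sub>R e) *
         f (y - ((n \<sigma> \<bullet> y - c \<sigma>) / (n \<sigma> \<bullet> e)) *\<^sub>R e)))"
proof -
  define p where "p t = y + t *\<^sub>R e" for t
  define \<tau> where "\<tau> \<sigma> = - ((n \<sigma> \<bullet> y - c \<sigma>) / (n \<sigma> \<bullet> e))" for \<sigma>
  define J1 where "J1 = {\<sigma>\<in>J. n \<sigma> \<bullet> e \<noteq> 0}"
  define J2 where "J2 = {\<sigma>\<in>J1. p (\<tau> \<sigma>) \<in> \<sigma>}"
  define U where "U = {t. p t \<in> K}"
  have contp: "continuous_on S p" for S
    unfolding p_def by (intro continuous_intros)
  have J2sub: "\<sigma> \<in> J" "n \<sigma> \<bullet> e \<noteq> 0" "p (\<tau> \<sigma>) \<in> \<sigma>" if "\<sigma> \<in> J2" for \<sigma>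
    using that by (auto simp: J2_def J1_def)
  have "(LINT t|lborel. indicator U t * f' (p t)) = (\<Sum>\<sigma>\<in>J2. sgn (n \<sigma> \<bullet> e) * f (p (\<tau> \<sigma>)))"
  proof (rule integral_deriv_open_set[where \<tau> = \<tau> and h = "\<lambda>t. f (p t)" and s = "\<lambda>\<sigma>. sgn (n \<sigma> \<bullet> e)"])
    show "open U"
      unfolding U_def using open_vimage[OF K(1) contp[of UNIV]] by (simp add: vimage_def)
    obtain B where B: "\<And>x. x \<in> K \<Longrightarrow> norm x \<le> B"
      using K(2) by (auto simp: bounded_iff)
    show "bounded U"
      unfolding bounded_iff
    proof (intro exI ballI)
      fix t assume "t \<in> U"
      then have "norm (t *\<^sub>R e) \<le> B + norm y"
        using B[of "p t"] norm_triangle_ineq4[of "p t" y] by (simp add: U_def p_def)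
      then show "norm t \<le> (B + norm y) / norm e"
        using e by (simp add: field_simps)
    qed
    show "finite J2" using J by (simp add: J2_def J1_def)
    show "inj_on \<tau> J2"
    proof (rule inj_onI)
      fix \<sigma> \<sigma>' assume *: "\<sigma> \<in> J2" "\<sigma>' \<in> J2" "\<tau> \<sigma> = \<tau> \<sigma>'"
      then have "p (\<tau> \<sigma>) \<in> \<sigma> \<inter> \<sigma>'" using J2sub(3) by force
      with J(2) J2sub(1) * show "\<sigma> = \<sigma>'"
        unfolding pairwise_def disjnt_def by blast
    qed
    show "sgn (n \<sigma> \<bullet> e) = 1 \<or> sgn (n \<sigma> \<bullet> e) = - 1" if "\<sigma> \<in> J2" for \<sigma>
      using J2sub[OF that] by (auto simp: sgn_if)
    show "\<forall>\<^sub>F t in at (\<tau> \<sigma>). t \<in> U \<longleftrightarrow> sgn (n \<sigma> \<bullet> e) * (t - \<tau> \<sigma>) < 0" if \<sigma>2: "\<sigma> \<in> J2" for \<sigma>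
    proof -
      obtain r where r: "r > 0" "\<And>z. z \<in> ball (p (\<tau> \<sigma>)) r \<Longrightarrow> z \<in> K \<longleftrightarrow> n \<sigma> \<bullet> z < c \<sigma>"
        using side[OF J2sub(1,3)[OF \<sigma>2]] by blast
      have "(p \<longlongrightarrow> p (\<tau> \<sigma>)) (at (\<tau> \<sigma>))"
        using contp[of UNIV] by (simp add: continuous_on_def)
      then have "\<forall>\<^sub>F t in at (\<tau> \<sigma>). p t \<in> ball (p (\<tau> \<sigma>)) r"
        using r(1) by (intro topological_tendstoD) auto
      then show ?thesis
      proof eventually_elim
        case (elim t)
        have "n \<sigma> \<bullet> p (\<tau> \<sigma>) = c \<sigma>" using plane J2sub[OF \<sigma>2] by auto
        then have "n \<sigma> \<bullet> p t = c \<sigma> + (n \<sigma> \<bullet> e) * (t - \<tau> \<sigma>)"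
          by (simp add: p_def inner_add_right algebra_simps)
        then have "t \<in> U \<longleftrightarrow> (n \<sigma> \<bullet> e) * (t - \<tau> \<sigma>) < 0"
          using r(2)[OF elim] by (simp add: U_def)
        then show ?case
          using J2sub(2)[OF \<sigma>2] by (auto simp: sgn_if mult_less_0_iff zero_less_mult_iff)
      qed
    qed
    show "frontier U \<subseteq> \<tau> ` J2"
    proof
      fix t assume t: "t \<in> frontier U"
      have "closure U \<subseteq> {t. p t \<in> closure K}"
        using continuous_closed_vimage[OF closed_closure[of K], of p] contp[of UNIV] closure_subset[of K]
        by (intro closure_minimal) (auto simp: U_def vimage_def continuous_on_eq_continuous_at)
      moreover have "t \<notin> U" using t \<open>open U\<close> by (simp add: frontier_def interior_open)
      ultimately have "p t \<in> frontier K"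
        using t K by (auto simp: frontier_def interior_open U_def)
      then obtain \<sigma> where \<sigma>: "\<sigma> \<in> J" "p t \<in> \<sigma>"
        using front y1 by (auto simp: p_def)
      have pl: "n \<sigma> \<bullet> y + t * (n \<sigma> \<bullet> e) = c \<sigma>"
        using plane[OF \<sigma>] by (simp add: p_def inner_add_right)
      then have ne: "n \<sigma> \<bullet> e \<noteq> 0" using y2[OF \<sigma>(1)] by auto
      then have "t = \<tau> \<sigma>" using pl by (simp add: \<tau>_def field_simps)
      then show "t \<in> \<tau> ` J2" using \<sigma> ne by (auto simp: J2_def J1_def)
    qed
    show "((\<lambda>t. f (p t)) has_real_derivative f' (p t)) (at t)" for t
      unfolding p_def by (rule f)
    show "continuous_on UNIV (\<lambda>t. f' (p t))"
      by (rule continuous_on_compose2[OF f' contp]) auto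
  qed
  also have "\<dots> = (\<Sum>\<sigma>\<in>J1. sgn (n \<sigma> \<bullet> e) * (indicator \<sigma> (p (\<tau> \<sigma>)) * f (p (\<tau> \<sigma>))))"
    using J by (intro sum.mono_neutral_cong_left) (auto simp: J2_def J1_def indicator_def)
  finally show ?thesis
    by (simp add: p_def \<tau>_def J1_def U_def indicator_def of_bool_def)
qed

text \<open>The divergence theorem for the field \<open>f\<close> times \<open>e\<close>, with face
  integrals written over right cylinders of height one. Integrating the formula on lines against
  \<theta> produces oblique cylinders over the faces; straightening them costs
  \<open>\<bar>n \<sigma> \<bullet> e\<bar>\<close>, and the sign of the crossing restores
  \<open>n \<sigma> \<bullet> e\<close>. Faces parallel to \<open>e\<close> carry the factor
  0.\<close>

theorem integral_directional_derivative:
  fixes f f' :: "'a \<Rightarrow> real"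
  assumes f: "\<And>x t. ((\<lambda>t. f (x + t *\<^sub>R e)) has_real_derivative f' (x + t *\<^sub>R e)) (at t)"
    and contf: "continuous_on UNIV f" and f': "continuous_on UNIV f'" and e: "norm e = 1"
  shows "(LINT x|lborel. indicator K x * f' x) =
    (\<Sum>\<sigma>\<in>J. (n \<sigma> \<bullet> e) * (LINT y|lborel. indicator {y. \<bar>n \<sigma> \<bullet> y - c \<sigma>\<bar> < 1/2} y *
       (indicator \<sigma> (y - (n \<sigma> \<bullet> y - c \<sigma>) *\<^sub>R n \<sigma>) * f (y - (n \<sigma> \<bullet> y - c \<sigma>) *\<^sub>R n \<sigma>))))"
proof -
  define J1 where "J1 = {\<sigma>\<in>J. n \<sigma> \<bullet> e \<noteq> 0}"
  \<comment> \<open>A slab of width one orthogonal to the unit vector \<open>e\<close> has unit mass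
    on every line in that direction.\<close>
  define \<theta> :: "'a \<Rightarrow> real" where "\<theta> = indicator {y. \<bar>e \<bullet> y\<bar> < 1/2}"
  define S where "S \<sigma> = {y. \<bar>n \<sigma> \<bullet> y - c \<sigma>\<bar> < 1/2}" for \<sigma>
  define pe where "pe \<sigma> y = y - ((n \<sigma> \<bullet> y - c \<sigma>) / (n \<sigma> \<bullet> e)) *\<^sub>R e" for \<sigma> y
  define pn where "pn \<sigma> y = y - (n \<sigma> \<bullet> y - c \<sigma>) *\<^sub>R n \<sigma>" for \<sigma> y
  have ee: "e \<bullet> e = 1" and e0: "e \<noteq> 0" using e by (auto simp: norm_eq_1)
  have [measurable]: "f \<in> borel_measurable borel" "f' \<in> borel_measurable borel" "K \<in> sets borel"
    using contf f' K by (auto intro: borel_measurable_continuous_onI)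
  have [measurable]: "\<theta> \<in> borel_measurable borel" "S \<sigma> \<in> sets borel"
     "pn \<sigma> \<in> borel_measurable borel" "pe \<sigma> \<in> borel_measurable borel" for \<sigma>
    unfolding \<theta>_def S_def pn_def pe_def by measurable
  have \<theta>1: "(\<integral>\<^sup>+t. ennreal (\<theta> (y + t *\<^sub>R e)) \<partial>lborel) = 1" for y
  proof -
    have "ennreal (\<theta> (y + t *\<^sub>R e)) = indicator {t. \<bar>e \<bullet> y + 1 * t\<bar> < 1/2} t" for t
      by (simp add: \<theta>_def indicator_def inner_add_right ee)
    then show ?thesis
      using nn_integral_abs_less_affine[of 1 "e \<bullet> y" "1/2"] by simp
  qed
  have intK: "integrable lborel (\<lambda>x. indicator K x * f' x)"
  proof -
    have "bounded (f' ` closure K)"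
      using K f' by (intro compact_imp_bounded compact_continuous_image)
        (auto intro: continuous_on_subset simp: compact_eq_bounded_closed bounded_closure)
    then obtain B where B: "\<And>x. x \<in> closure K \<Longrightarrow> norm (f' x) \<le> B"
      by (auto simp: bounded_iff)
    show ?thesis
      by (rule integrable_bounded_support[where A = K and B = B])
        (use K B closure_subset[of K] in \<open>auto simp: subset_iff\<close>)
  qed
  have intS: "integrable lborel (\<lambda>y. indicator (S \<sigma>) y * (indicator \<sigma> (pn \<sigma> y) * f (pn \<sigma> y)))"
    if \<sigma>: "\<sigma> \<in> J" for \<sigma>
  proof -
    have [measurable]: "\<sigma> \<in> sets borel" using J \<sigma> by auto
    have "bounded (f ` closure \<sigma>)"
      using bounded_face[OF \<sigma>] contf by (intro compact_imp_bounded compact_continuous_image)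
        (auto intro: continuous_on_subset simp: compact_eq_bounded_closed bounded_closure)
    then obtain B where B: "\<And>x. x \<in> closure \<sigma> \<Longrightarrow> norm (f x) \<le> B"
      by (auto simp: bounded_iff)
    obtain R where R: "\<And>x. x \<in> \<sigma> \<Longrightarrow> norm x \<le> R"
      using bounded_face[OF \<sigma>] by (auto simp: bounded_iff)
    define C where "C = S \<sigma> \<inter> {y. pn \<sigma> y \<in> \<sigma>}"
    have [measurable]: "C \<in> sets borel" unfolding C_def by measurable
    have "bounded C"
      unfolding bounded_iff
    proof (intro exI ballI)
      fix y assume "y \<in> C"
      then have "norm (pn \<sigma> y) \<le> R" "norm ((n \<sigma> \<bullet> y - c \<sigma>) *\<^sub>R n \<sigma>) \<le> 1/2"
        using R n[OF \<sigma>] by (auto simp: C_def S_def)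
      moreover have "norm y \<le> norm (pn \<sigma> y) + norm ((n \<sigma> \<bullet> y - c \<sigma>) *\<^sub>R n \<sigma>)"
        using norm_triangle_ineq[of "pn \<sigma> y" "(n \<sigma> \<bullet> y - c \<sigma>) *\<^sub>R n \<sigma>"] by (simp add: pn_def)
      ultimately show "norm y \<le> R + 1/2" by linarith
    qed
    then show ?thesis
      by (rule integrable_bounded_support[where B = B, rotated 2])
        (use B closure_subset[of \<sigma>] in \<open>auto simp: C_def subset_iff indicator_def\<close>)
  qed
  have obl: "integrable lborel (\<lambda>y. \<theta> y * (indicator \<sigma> (pe \<sigma> y) * f (pe \<sigma> y)))"
    "(LINT y|lborel. \<theta> y * (indicator \<sigma> (pe \<sigma> y) * f (pe \<sigma> y))) =
      \<bar>n \<sigma> \<bullet> e\<bar> * (LINT y|lborel. indicator (S \<sigma>) y * (indicator \<sigma> (pn \<sigma> y) * f (pn \<sigma> y)))"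
    if "\<sigma> \<in> J1" for \<sigma>
  proof -
    have \<sigma>: "\<sigma> \<in> J" "n \<sigma> \<bullet> e \<noteq> 0" using that by (auto simp: J1_def)
    then have [measurable]: "\<sigma> \<in> sets borel" using J by auto
    have m: "(\<lambda>x. indicator \<sigma> x * f x) \<in> borel_measurable borel" by measurable
    have \<theta>0: "\<theta> y \<ge> 0" for y by (simp add: \<theta>_def)
    note * = integral_oblique[OF m, of \<theta> "n \<sigma>" e "c \<sigma>", OF _ n[OF \<sigma>(1)] \<sigma>(2) \<theta>0 \<theta>1,
        folded S_def, folded pn_def, OF _ intS[OF \<sigma>(1)]]
    show "integrable lborel (\<lambda>y. \<theta> y * (indicator \<sigma> (pe \<sigma> y) * f (pe \<sigma> y)))"
      "(LINT y|lborel. \<theta> y * (indicator \<sigma> (pe \<sigma> y) * f (pe \<sigma> y))) =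
      \<bar>n \<sigma> \<bullet> e\<bar> * (LINT y|lborel. indicator (S \<sigma>) y * (indicator \<sigma> (pn \<sigma> y) * f (pn \<sigma> y)))"
      unfolding pe_def by (rule *; measurable)+
  qed
  have aeL: "AE y in lborel. \<forall>L\<in>\<L>. y \<notin> {y. \<exists>t. y + t *\<^sub>R e \<in> L}"
    using \<L> by (intro AE_finite_allI AE_lborel_negligible negligible_line_cylinder) auto
  have n0: "n \<sigma> \<noteq> 0" if "\<sigma> \<in> J" for \<sigma> using n[OF that] by auto
  have aeJ: "AE y in lborel. \<forall>\<sigma>\<in>J. n \<sigma> \<bullet> y \<noteq> c \<sigma>"
    using J by (intro AE_finite_allI AE_lborel_hyperplane n0) auto
  have "(LINT x|lborel. indicator K x * f' x)
      = (LINT y|lborel. \<theta> y * (LINT t|lborel. indicator K (y + t *\<^sub>R e) * f' (y + t *\<^sub>R e)))"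
    by (rule integral_along_lines[OF _ intK _ \<theta>1]) (auto simp: \<theta>_def)
  also have "\<dots> = (LINT y|lborel. (\<Sum>\<sigma>\<in>J1. sgn (n \<sigma> \<bullet> e) * (\<theta> y * (indicator \<sigma> (pe \<sigma> y) * f (pe \<sigma> y)))))"
  proof (rule integral_cong_AE)
    show "AE y in lborel. \<theta> y * (LINT t|lborel. indicator K (y + t *\<^sub>R e) * f' (y + t *\<^sub>R e)) =
        (\<Sum>\<sigma>\<in>J1. sgn (n \<sigma> \<bullet> e) * (\<theta> y * (indicator \<sigma> (pe \<sigma> y) * f (pe \<sigma> y))))"
      using aeL aeJ
    proof eventually_elim
      case (elim y)
      have "(LINT t|lborel. indicator K (y + t *\<^sub>R e) * f' (y + t *\<^sub>R e)) =
          (\<Sum>\<sigma>\<in>J1. sgn (n \<sigma> \<bullet> e) * (indicator \<sigma> (pe \<sigma> y) * f (pe \<sigma> y)))"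
        unfolding J1_def pe_def by (rule integral_deriv_line[OF f f' e0]) (use elim in auto)
      then show ?case by (simp add: sum_distrib_left mult_ac)
    qed
    show "(\<lambda>y. \<Sum>\<sigma>\<in>J1. sgn (n \<sigma> \<bullet> e) * (\<theta> y * (indicator \<sigma> (pe \<sigma> y) * f (pe \<sigma> y)))) \<in> borel_measurable lborel"
      using obl(1) by (intro borel_measurable_sum borel_measurable_times borel_measurable_const borel_measurable_integrable)
  qed measurable
  also have "\<dots> = (\<Sum>\<sigma>\<in>J1. sgn (n \<sigma> \<bullet> e) * (LINT y|lborel. \<theta> y * (indicator \<sigma> (pe \<sigma> y) * f (pe \<sigma> y))))"
    using obl(1) by (subst Bochner_Integration.integral_sum) auto
  also have "\<dots> = (\<Sum>\<sigma>\<in>J1. (n \<sigma> \<bullet> e) *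
      (LINT y|lborel. indicator (S \<sigma>) y * (indicator \<sigma> (pn \<sigma> y) * f (pn \<sigma> y))))"
    using obl(2) by (intro sum.cong) (auto simp: sgn_mult_abs mult.assoc[symmetric])
  also have "\<dots> = (\<Sum>\<sigma>\<in>J. (n \<sigma> \<bullet> e) *
      (LINT y|lborel. indicator (S \<sigma>) y * (indicator \<sigma> (pn \<sigma> y) * f (pn \<sigma> y))))"
    using J by (intro sum.mono_neutral_left) (auto simp: J1_def)
  finally show ?thesis by (simp add: S_def pn_def)
qed

end

section \<open>Face measures\<close>

lemma dist_hyperplane:
  fixes n :: "'a::euclidean_space"
  assumes n: "norm n = 1" and x: "n \<bullet> x = c"
  shows "\<bar>n \<bullet> y - c\<bar> \<le> dist y x"
proof -
  have "n \<bullet> y - c = n \<bullet> (y - x)" using x by (simp add: inner_diff_right)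
  then show ?thesis
    using Cauchy_Schwarz_ineq2[of n "y - x"] n by (simp add: dist_norm)
qed

lemma closest_point_hyperplane:
  fixes n :: "'a::euclidean_space"
  assumes n: "norm n = 1"
  shows "closest_point {x. n \<bullet> x = c} y = y - (n \<bullet> y - c) *\<^sub>R n"
proof (rule sym, rule closest_point_unique)
  have nn: "n \<bullet> n = 1" using n by (simp add: norm_eq_1)
  show "convex {x. n \<bullet> x = c}" by (rule convex_hyperplane)
  show "closed {x. n \<bullet> x = c}" by (rule closed_hyperplane)
  show "y - (n \<bullet> y - c) *\<^sub>R n \<in> {x. n \<bullet> x = c}"
    by (simp add: inner_diff_right nn)
  show "\<forall>z\<in>{x. n \<bullet> x = c}. dist y (y - (n \<bullet> y - c) *\<^sub>R n) \<le> dist y z"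
    using dist_hyperplane[OF n] n by (auto simp: dist_norm)
qed

lemma infdist_hyperplane:
  fixes n :: "'a::euclidean_space"
  assumes n: "norm n = 1"
  shows "infdist y {x. n \<bullet> x = c} = \<bar>n \<bullet> y - c\<bar>"
proof (rule antisym)
  have nn: "n \<bullet> n = 1" using n by (simp add: norm_eq_1)
  have mem: "y - (n \<bullet> y - c) *\<^sub>R n \<in> {x. n \<bullet> x = c}"
    by (simp add: inner_diff_right nn)
  show "infdist y {x. n \<bullet> x = c} \<le> \<bar>n \<bullet> y - c\<bar>"
    using infdist_le[OF mem, of y] n by (simp add: dist_norm)
  show "\<bar>n \<bullet> y - c\<bar> \<le> infdist y {x. n \<bullet> x = c}"
    using mem dist_hyperplane[OF n]
    by (subst infdist_notempty) (auto intro!: cINF_greatest)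
qed

text \<open>The unit normal is a parameter and not a function of the face: a face between two cells
  is used with either of two opposite normals, and also with an arbitrary one.\<close>

locale flat_face =
  fixes \<sigma> :: "'a::euclidean_space set" and n :: 'a and c :: real
  assumes openin_face: "openin (top_of_set {x. n \<bullet> x = c}) \<sigma>" and normal: "norm n = 1"
    and nonempty_face: "\<sigma> \<noteq> {}" and bounded_face: "bounded \<sigma>"
begin

abbreviation "slab \<equiv> {y. \<bar>n \<bullet> y - c\<bar> < 1/2}"
abbreviation "proj y \<equiv> y - (n \<bullet> y - c) *\<^sub>R n"

lemma normal_inner: "n \<bullet> n = 1"
  using normal by (simp add: norm_eq_1)

lemma face_plane: "x \<in> \<sigma> \<Longrightarrow> n \<bullet> x = c"
  using openin_imp_subset[OF openin_face] by auto

lemma affine_hull_face: "affine hull \<sigma> = {x. n \<bullet> x = c}"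
proof -
  have H: "affine hull {x. n \<bullet> x = c} = {x. n \<bullet> x = c}"
    by (simp add: affine_hyperplane affine_hull_eq)
  show ?thesis
    using affine_hull_openin[of "{x. n \<bullet> x = c}" \<sigma>] openin_face nonempty_face H by simp
qed

lemma borel_face [measurable]: "\<sigma> \<in> sets borel"
proof -
  obtain T where "open T" "\<sigma> = {x. n \<bullet> x = c} \<inter> T"
    using openin_face by (auto simp: openin_open)
  moreover have "{x. n \<bullet> x = c} \<in> sets borel"
    by (intro borel_closed closed_hyperplane)
  ultimately show ?thesis by auto
qed

lemma hyperplane_measure_face:
  "hyperplane_measure (affine hull \<sigma>) = distr (restrict_space lborel slab) borel (\<lambda>y. proj y)"
proof -
  have "closest_point {x. n \<bullet> x = c} = (\<lambda>y. proj y)"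
    by (rule ext) (rule closest_point_hyperplane[OF normal])
  moreover have "{y. infdist y {x. n \<bullet> x = c} < 1/2} = slab"
    by (simp only: infdist_hyperplane[OF normal])
  ultimately show ?thesis
    unfolding hyperplane_measure_def affine_hull_face by (simp only:)
qed

lemma proj_measurable [measurable]: "(\<lambda>y. proj y) \<in> measurable (restrict_space lborel A) borel"
  by (intro measurable_restrict_space1) measurable

lemma space_face_measure [simp]: "space (face_measure \<sigma>) = \<sigma>"
  by (simp add: face_measure_def hyperplane_measure_def space_restrict_space)

lemma sets_face_measure: "sets (face_measure \<sigma>) = sets (restrict_space borel \<sigma>)"
  unfolding face_measure_def by (intro sets_restrict_space_cong) (simp add: hyperplane_measure_def)

lemma measurable_face_measure_iff:
  fixes f :: "'a \<Rightarrow> 'b::topological_space"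
  shows "f \<in> borel_measurable (face_measure \<sigma>) \<longleftrightarrow> f \<in> borel_measurable (restrict_space borel \<sigma>)"
proof -
  have "measurable (face_measure \<sigma>) (borel :: 'b measure) = measurable (restrict_space borel \<sigma>) borel"
    by (rule measurable_cong_sets) (simp_all add: sets_face_measure)
  then show ?thesis by simp
qed

lemma measurable_face_measure:
  fixes f :: "'a \<Rightarrow> 'b::topological_space"
  shows "f \<in> borel_measurable borel \<Longrightarrow> f \<in> borel_measurable (face_measure \<sigma>)"
  unfolding measurable_face_measure_iff by (rule measurable_restrict_space1)

lemma measurable_face_measure_continuous:
  fixes f :: "'a \<Rightarrow> 'b::topological_space"
  assumes "continuous_on \<sigma> f"
  shows "f \<in> borel_measurable (face_measure \<sigma>)"
  unfolding measurable_face_measure_iff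
  using assms by (rule borel_measurable_continuous_on_restrict)

text \<open>Brings face integrals to the form in which the divergence theorem delivers them.
  Measurability of \<open>f\<close> on the face suffices, as the indicator makes the product
  Borel.\<close>

lemma integral_face_measure:
  fixes f :: "'a \<Rightarrow> real"
  assumes f: "f \<in> borel_measurable (face_measure \<sigma>)"
  shows "(LINT x|face_measure \<sigma>. f x) =
    (LINT y|lborel. indicator slab y * (indicator \<sigma> (proj y) * f (proj y)))"
proof -
  have m: "(\<lambda>x. indicator \<sigma> x * f x) \<in> borel_measurable borel"
    using f unfolding measurable_face_measure_iff
    by (subst (asm) borel_measurable_restrict_space_iff) auto
  have [measurable]: "slab \<in> sets lborel" by measurable
  have "(LINT x|face_measure \<sigma>. f x) = (LINT x|hyperplane_measure (affine hull \<sigma>). indicator \<sigma> x * f x)"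
    unfolding face_measure_def
    by (subst integral_restrict_space) (auto simp: hyperplane_measure_def)
  also have "\<dots> = (LINT y|restrict_space lborel slab. indicator \<sigma> (proj y) * f (proj y))"
    unfolding hyperplane_measure_face by (rule integral_distr) (use m in measurable)
  also have "\<dots> = (LINT y|lborel. indicator slab y * (indicator \<sigma> (proj y) * f (proj y)))"
    by (subst integral_restrict_space) auto
  finally show ?thesis .
qed

lemma emeasure_face_measure:
  assumes "A \<in> sets borel" "A \<subseteq> \<sigma>"
  shows "emeasure (face_measure \<sigma>) A = emeasure lborel {y \<in> slab. proj y \<in> A}"
proof -
  have [measurable]: "slab \<in> sets lborel" by measurable
  have "emeasure (face_measure \<sigma>) A = emeasure (hyperplane_measure (affine hull \<sigma>)) A"
    unfolding face_measure_def using assms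
    by (intro emeasure_restrict_space) (auto simp: hyperplane_measure_def)
  also have "\<dots> = emeasure (restrict_space lborel slab) ((\<lambda>y. proj y) -` A \<inter> slab)"
    unfolding hyperplane_measure_face using assms
    by (subst emeasure_distr) (auto simp: space_restrict_space)
  also have "\<dots> = emeasure lborel ((\<lambda>y. proj y) -` A \<inter> slab)"
    by (intro emeasure_restrict_space) auto
  also have "(\<lambda>y. proj y) -` A \<inter> slab = {y \<in> slab. proj y \<in> A}" by auto
  finally show ?thesis .
qed

lemma finite_face_measure: "finite_measure (face_measure \<sigma>)"
proof
  obtain R where R: "\<And>x. x \<in> \<sigma> \<Longrightarrow> norm x \<le> R"
    using bounded_face by (auto simp: bounded_iff)
  have "bounded {y \<in> slab. proj y \<in> \<sigma>}"
    unfolding bounded_iff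
  proof (intro exI ballI)
    fix y assume "y \<in> {y \<in> slab. proj y \<in> \<sigma>}"
    then have "norm (proj y) \<le> R" "norm ((n \<bullet> y - c) *\<^sub>R n) \<le> 1/2"
      using R normal by auto
    moreover have "norm y \<le> norm (proj y) + norm ((n \<bullet> y - c) *\<^sub>R n)"
      using norm_triangle_ineq[of "proj y" "(n \<bullet> y - c) *\<^sub>R n"] by simp
    ultimately show "norm y \<le> R + 1/2" by linarith
  qed
  then show "emeasure (face_measure \<sigma>) (space (face_measure \<sigma>)) \<noteq> \<infinity>"
    using emeasure_face_measure[of \<sigma>] emeasure_bounded_finite by fastforce
qed

lemma integrable_face_measure:
  fixes f :: "'a \<Rightarrow> real"
  assumes "f \<in> borel_measurable (face_measure \<sigma>)" and "\<And>x. x \<in> \<sigma> \<Longrightarrow> \<bar>f x\<bar> \<le> B"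
  shows "integrable (face_measure \<sigma>) f"
proof (rule finite_measure.integrable_const_bound[OF finite_face_measure])
  show "AE x in face_measure \<sigma>. norm (f x) \<le> B"
    by (rule AE_I2) (use assms(2) in simp)
qed (rule assms(1))

text \<open>The part of the slab that projects into a relatively open piece of the hyperplane
  contains a nonempty open set of the whole space.\<close>

lemma emeasure_face_measure_ball:
  assumes "x \<in> \<sigma>" "r > 0"
  shows "emeasure (face_measure \<sigma>) (\<sigma> \<inter> ball x r) > 0"
proof -
  obtain T where T: "open T" "\<sigma> = {x. n \<bullet> x = c} \<inter> T"
    using openin_face by (auto simp: openin_open)
  define V where "V = slab \<inter> ((\<lambda>y. proj y) -` (T \<inter> ball x r))"
  have "open V"
    unfolding V_def using T
    by (intro open_Int open_Collect_less open_vimage continuous_intros) auto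
  moreover have "x \<in> V"
    using assms face_plane[OF assms(1)] T by (auto simp: V_def)
  ultimately have "\<not> negligible V" by (metis empty_iff open_not_negligible)
  then have "emeasure lborel V > 0"
    using \<open>open V\<close> by (auto simp: negligible_iff_null_sets null_sets_completion_iff null_sets_def zero_less_iff_neq_zero)
  moreover have "V \<subseteq> {y \<in> slab. proj y \<in> \<sigma> \<inter> ball x r}"
    using T normal_inner by (auto simp: V_def inner_diff_right)
  then have "emeasure lborel V \<le> emeasure lborel {y \<in> slab. proj y \<in> \<sigma> \<inter> ball x r}"
    by (intro emeasure_mono) auto
  moreover have "emeasure (face_measure \<sigma>) (\<sigma> \<inter> ball x r) = emeasure lborel {y \<in> slab. proj y \<in> \<sigma> \<inter> ball x r}"
    by (intro emeasure_face_measure) auto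
  ultimately show ?thesis by simp
qed

text \<open>The face measure charges every relatively open piece of the face. This is what makes the
  inner product of face polynomials definite.\<close>

lemma AE_face_measure_continuous:
  fixes f :: "'a \<Rightarrow> real"
  assumes f: "continuous_on \<sigma> f" and ae: "AE x in face_measure \<sigma>. f x = 0" and x: "x \<in> \<sigma>"
  shows "f x = 0"
proof (rule ccontr)
  assume "f x \<noteq> 0"
  have "(f \<longlongrightarrow> f x) (at x within \<sigma>)" using f x by (simp add: continuous_on_def)
  then have "\<forall>\<^sub>F y in at x within \<sigma>. f y \<noteq> 0"
    using \<open>f x \<noteq> 0\<close> by (rule tendsto_imp_eventually_ne)
  then obtain r where r: "r > 0" "\<And>y. y \<in> \<sigma> \<Longrightarrow> dist y x < r \<Longrightarrow> f y \<noteq> 0"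
    unfolding eventually_at using \<open>f x \<noteq> 0\<close> by (metis zero_less_dist_iff)
  have "AE y in face_measure \<sigma>. y \<notin> \<sigma> \<inter> ball x r"
    using ae by eventually_elim (use r in \<open>auto simp: dist_commute\<close>)
  moreover have "\<sigma> \<inter> ball x r \<in> sets (face_measure \<sigma>)"
    unfolding sets_face_measure by (auto simp: sets_restrict_space)
  ultimately have "emeasure (face_measure \<sigma>) (\<sigma> \<inter> ball x r) = 0"
    by (metis AE_iff_null_sets null_setsD1)
  then show False using emeasure_face_measure_ball[OF x r(1)] by simp
qed

end

section \<open>Geometry of the mesh\<close>

text \<open>A polytope of the union that spans the hyperplane contributes its relative interior to
  \<sigma> and leaves only its facets; one of smaller dimension lies in an affine set of codimension
  two as a whole. The affine hulls of these finitely many pieces cover what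
  \<open>closure \<sigma>\<close> has outside \<sigma>.\<close>

lemma frontier_face_codim2:
  fixes a :: "'a::euclidean_space"
  assumes a: "a \<noteq> 0" and \<sigma>: "polytopal_in {x. a \<bullet> x = b} \<sigma>"
  shows "\<exists>\<L>. finite \<L> \<and> (\<forall>L\<in>\<L>. affine L \<and> aff_dim L + 2 \<le> DIM('a)) \<and> closure \<sigma> \<subseteq> \<sigma> \<union> \<Union>\<L>"
proof -
  define H where "H = {x. a \<bullet> x = b}"
  obtain F where F: "finite F" "\<And>P. P \<in> F \<Longrightarrow> polytope P \<and> P \<subseteq> H"
    and \<sigma>F: "\<sigma> = top_of_set H interior_of (\<Union>F)"
    using \<sigma> by (auto simp: polytopal_in_def H_def)
  have H: "affine H" "aff_dim H = DIM('a) - 1"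
    using a by (auto simp: H_def affine_hyperplane aff_dim_hyperplane)
  define \<L> where "\<L> = (\<lambda>P. affine hull P) ` {P\<in>F. aff_dim P < DIM('a) - 1} \<union>
     (\<Union>P\<in>F. (\<lambda>Q. affine hull Q) ` {Q. Q facet_of P})"
  have "finite \<L>"
    using F by (auto simp: \<L>_def intro!: finite_imageI finite_polytope_facets)
  moreover have "affine L \<and> aff_dim L + 2 \<le> DIM('a)" if "L \<in> \<L>" for L
  proof -
    have "aff_dim P \<le> DIM('a) - 1" if "P \<in> F" for P
      using aff_dim_subset[of P H] F(2)[OF that] H by auto
    with that show ?thesis
      by (fastforce simp: \<L>_def facet_of_def)
  qed
  moreover have "closure \<sigma> \<subseteq> \<sigma> \<union> \<Union>\<L>"
  proof
    fix x assume "x \<in> closure \<sigma>"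
    moreover have "closed (\<Union>F)" using F by (intro closed_Union) (auto intro: polytope_imp_closed)
    moreover have "\<sigma> \<subseteq> \<Union>F" unfolding \<sigma>F by (rule interior_of_subset)
    ultimately have "x \<in> \<Union>F" using closure_minimal by blast
    then obtain P where P: "P \<in> F" "x \<in> P" by auto
    show "x \<in> \<sigma> \<union> \<Union>\<L>"
    proof (cases "aff_dim P < DIM('a) - 1")
      case True
      then show ?thesis using P by (auto simp: \<L>_def intro: hull_inc)
    next
      case False
      have PH: "affine hull P \<subseteq> H" using F(2)[OF P(1)] H by (intro hull_minimal) auto
      have "aff_dim P \<le> aff_dim H" using F(2)[OF P(1)] by (intro aff_dim_subset) auto
      then have "affine hull P = H"
        using H False P PH by (intro affine_dim_equal) (auto simp: hull_inc)
      then have "openin (top_of_set H) (rel_interior P)"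
        using openin_rel_interior[of P] by simp
      moreover have "rel_interior P \<subseteq> \<Union>F" using rel_interior_subset P by blast
      ultimately have "rel_interior P \<subseteq> \<sigma>" unfolding \<sigma>F by (intro interior_of_maximal)
      moreover have "polyhedron P" using F P by (simp add: polytope_imp_polyhedron)
      then have "rel_frontier P \<subseteq> \<Union>\<L>"
        using P by (auto simp: rel_frontier_of_polyhedron \<L>_def intro: hull_inc)
      moreover have "x \<in> rel_interior P \<union> rel_frontier P"
        using P closure_subset[of P] by (auto simp: rel_frontier_def)
      ultimately show ?thesis by auto
    qed
  qed
  ultimately show ?thesis by blast
qed

text \<open>
  A graph over the orthogonal complement of \<open>e\<close> that contains a relatively open piece of a
  hyperplane coincides with it locally, so that the hypograph is locally a half-space.
\<close>

lemma hypograph_half_space: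
  fixes a :: "'a::euclidean_space"
  assumes K: "open K" "lipschitz_boundary_in UNIV K" and a: "a \<noteq> 0"
    and \<sigma>: "openin (top_of_set {x. a \<bullet> x = b}) \<sigma>" "\<sigma> \<subseteq> frontier K" and x: "x \<in> \<sigma>"
  shows "\<exists>s\<in>{1, -1}. \<exists>r>0. \<forall>y\<in>ball x r. y \<in> K \<longleftrightarrow> s * (a \<bullet> y - b) < 0"
proof -
  have xf: "x \<in> top_of_set UNIV frontier_of K" using \<sigma> x by auto
  obtain U e L \<gamma> where U: "open U" "x \<in> U" and e: "norm e = 1"
    and \<gamma>: "L-lipschitz_on UNIV \<gamma>"
    and graph: "K \<inter> U = {y \<in> UNIV \<inter> U. y \<bullet> e < \<gamma> (y - (y \<bullet> e) *\<^sub>R e)}"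
    using K(2)[unfolded lipschitz_boundary_in_def, rule_format, OF xf] by blast
  have ee: "e \<bullet> e = 1" using e by (simp add: norm_eq_1)
  define h where "h y = y \<bullet> e - \<gamma> (y - (y \<bullet> e) *\<^sub>R e)" for y
  have memK: "y \<in> K \<longleftrightarrow> h y < 0" if "y \<in> U" for y
    using graph that by (auto simp: h_def)
  have contg: "continuous_on UNIV \<gamma>" using \<gamma> by (rule lipschitz_on_continuous_on)
  have conth: "continuous_on UNIV h"
    unfolding h_def by (intro continuous_intros continuous_on_compose2[OF contg]) auto
  have front: "h y = 0" if y: "y \<in> frontier K" "y \<in> U" for y
  proof (rule ccontr)
    assume "h y \<noteq> 0"
    moreover have "y \<notin> K" using y K by (simp add: frontier_def interior_open)
    ultimately have "h y > 0" using memK[OF y(2)] by linarith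
    moreover have "open (U \<inter> {z. h z > 0})"
      using U conth by (intro open_Int open_Collect_less continuous_intros) auto
    moreover have "(U \<inter> {z. h z > 0}) \<inter> K = {}" using memK by force
    ultimately have "y \<notin> closure K"
      using y(2) open_Int_closure_eq_empty[of "U \<inter> {z. h z > 0}" K] by blast
    then show False using y by (simp add: frontier_def)
  qed
  obtain T where T: "open T" "\<sigma> = {x. a \<bullet> x = b} \<inter> T"
    using \<sigma>(1) by (auto simp: openin_open)
  have "open (U \<inter> T)" "x \<in> U \<inter> T" using U T x by auto
  then obtain r0 where r0: "r0 > 0" "ball x r0 \<subseteq> U \<inter> T" by (meson open_contains_ball)
  have ax: "a \<bullet> x = b" using T x by auto
  have zero: "h y = 0" if "y \<in> ball x r0" "a \<bullet> y = b" for y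
    using that r0 T \<sigma>(2) by (intro front) auto
  have shift: "h (y + t *\<^sub>R e) = h y + t" for y t
    by (simp add: h_def inner_add_left ee algebra_simps)
  \<comment> \<open>Were \<open>e\<close> parallel to the hyperplane, \<open>h\<close> would vanish
    at two points of one line in the direction \<open>e\<close>, along which it grows with slope
    one.\<close>
  have ae: "a \<bullet> e \<noteq> 0"
  proof
    assume "a \<bullet> e = 0"
    then have "h (x + (r0 / 2) *\<^sub>R e) = 0"
      using r0 e ax by (intro zero) (auto simp: dist_norm inner_add_right)
    then show False using shift[of x "r0 / 2"] zero[of x] r0 ax by simp
  qed
  \<comment> \<open>\<open>\<tau> y\<close> is the travel along \<open>e\<close> from
    \<open>y\<close> to the hyperplane. As \<open>h\<close> vanishes there,
    \<open>h y = - \<tau> y\<close>, an affine function whose sign is that of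
    \<open>a \<bullet> y - b\<close> up to the sign of \<open>a \<bullet> e\<close>.\<close>
  define \<tau> where "\<tau> y = (b - a \<bullet> y) / (a \<bullet> e)" for y
  have "continuous_on UNIV (\<lambda>y. y + \<tau> y *\<^sub>R e)"
    unfolding \<tau>_def by (intro continuous_intros) (simp add: ae)
  then have "open ((\<lambda>y. y + \<tau> y *\<^sub>R e) -` ball x r0 \<inter> ball x r0)"
    by (intro open_Int open_vimage) auto
  moreover have "x \<in> (\<lambda>y. y + \<tau> y *\<^sub>R e) -` ball x r0 \<inter> ball x r0"
    using r0 ax by (simp add: \<tau>_def)
  ultimately obtain r where r: "r > 0" "ball x r \<subseteq> (\<lambda>y. y + \<tau> y *\<^sub>R e) -` ball x r0 \<inter> ball x r0"
    by (meson open_contains_ball)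
  have "y \<in> K \<longleftrightarrow> sgn (a \<bullet> e) * (a \<bullet> y - b) < 0" if y: "y \<in> ball x r" for y
  proof -
    have "y + \<tau> y *\<^sub>R e \<in> ball x r0" "y \<in> U" using r r0 y by auto
    moreover have "a \<bullet> (y + \<tau> y *\<^sub>R e) = b" using ae by (simp add: \<tau>_def inner_add_right)
    ultimately have "h y = - \<tau> y" using zero shift[of y "\<tau> y"] by auto
    then have "y \<in> K \<longleftrightarrow> (a \<bullet> y - b) / (a \<bullet> e) < 0"
      using memK[OF \<open>y \<in> U\<close>] by (simp add: \<tau>_def minus_divide_left)
    then show ?thesis
      using ae by (auto simp: sgn_if divide_less_0_iff)
  qed
  moreover have "sgn (a \<bullet> e) \<in> {1, -1}" using ae by (auto simp: sgn_if)
  ultimately show ?thesis using r(1) by blast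
qed

lemma half_space_side_unique:
  fixes a :: "'a::euclidean_space"
  assumes a: "a \<noteq> 0" and s: "s \<in> {1, -1::real}" "s' \<in> {1, -1}" and y: "a \<bullet> y = b"
    and r: "r > 0" "\<forall>z\<in>ball y r. z \<in> K \<longleftrightarrow> s * (a \<bullet> z - b) < 0"
    and r': "r' > 0" "\<forall>z\<in>ball y r'. z \<in> K \<longleftrightarrow> s' * (a \<bullet> z - b) < 0"
  shows "s = s'"
proof -
  define t where "t = min r r' / (2 * norm a)"
  have t: "t > 0" "t * norm a < r" "t * norm a < r'"
    using a r(1) r'(1) by (auto simp: t_def)
  have "y - t *\<^sub>R a \<in> ball y r" "y - t *\<^sub>R a \<in> ball y r'"
    using t by (auto simp: dist_norm)
  then have "s * (a \<bullet> (y - t *\<^sub>R a) - b) < 0 \<longleftrightarrow> s' * (a \<bullet> (y - t *\<^sub>R a) - b) < 0"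
    using r r' by blast
  moreover have "a \<bullet> (y - t *\<^sub>R a) - b = - t * (a \<bullet> a)" using y by (simp add: inner_diff_right)
  moreover have "a \<bullet> a > 0" using a by simp
  ultimately show ?thesis
    using s t(1) by (auto simp: mult_less_0_iff zero_less_mult_iff)
qed

text \<open>The side of \<sigma> on which \<open>K\<close> lies could change from point to point. It
  is locally constant, because both descriptions hold near any common point and determine the sign,
  and \<sigma> is connected.\<close>

lemma outer_normal_exists:
  fixes a :: "'a::euclidean_space"
  assumes K: "open K" "lipschitz_boundary_in UNIV K" and a: "a \<noteq> 0"
    and \<sigma>: "openin (top_of_set {x. a \<bullet> x = b}) \<sigma>" "\<sigma> \<subseteq> frontier K" "connected \<sigma>" "\<sigma> \<noteq> {}"
  shows "\<exists>n c. norm n = 1 \<and> {x. a \<bullet> x = b} = {x. n \<bullet> x = c} \<and>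
    (\<forall>x\<in>\<sigma>. \<exists>r>0. \<forall>y\<in>ball x r. y \<in> K \<longleftrightarrow> n \<bullet> y < c)"
proof -
  have "\<forall>x\<in>\<sigma>. \<exists>s. s \<in> {1, -1} \<and> (\<exists>r>0. \<forall>y\<in>ball x r. y \<in> K \<longleftrightarrow> s * (a \<bullet> y - b) < 0)"
    using hypograph_half_space[OF K a \<sigma>(1,2)] by blast
  from bchoice[OF this] obtain s where
    s: "\<And>x. x \<in> \<sigma> \<Longrightarrow> s x \<in> {1, -1}"
      "\<And>x. x \<in> \<sigma> \<Longrightarrow> \<exists>r>0. \<forall>y\<in>ball x r. y \<in> K \<longleftrightarrow> s x * (a \<bullet> y - b) < 0"
    by blast
  have plane: "a \<bullet> x = b" if "x \<in> \<sigma>" for x using openin_imp_subset[OF \<sigma>(1)] that by auto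
  have loc: "\<forall>\<^sub>F y in at x within \<sigma>. s x = s y" if x: "x \<in> \<sigma>" for x
  proof -
    obtain r where r: "r > 0" "\<forall>y\<in>ball x r. y \<in> K \<longleftrightarrow> s x * (a \<bullet> y - b) < 0" using s(2)[OF x] by blast
    have "s x = s y" if y: "y \<in> \<sigma>" "dist y x < r" for y
    proof -
      obtain r' where r': "r' > 0" "\<forall>z\<in>ball y r'. z \<in> K \<longleftrightarrow> s y * (a \<bullet> z - b) < 0" using s(2)[OF y(1)] by blast
      have sub: "ball y (r - dist y x) \<subseteq> ball x r"
      proof
        fix z assume "z \<in> ball y (r - dist y x)"
        then show "z \<in> ball x r"
          using dist_triangle[of x z y] by (simp add: dist_commute)
      qed
      have "\<forall>z\<in>ball y (r - dist y x). z \<in> K \<longleftrightarrow> s x * (a \<bullet> z - b) < 0" using sub r(2) by blast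
      from half_space_side_unique[OF a s(1)[OF x] s(1)[OF y(1)] plane[OF y(1)] _ this r'] y(2)
      show ?thesis by simp
    qed
    then show ?thesis unfolding eventually_at using r(1) by blast
  qed
  obtain x0 where x0: "x0 \<in> \<sigma>" using \<sigma>(4) by auto
  have const: "s x = s x0" if "x \<in> \<sigma>" for x
    by (rule connected_local_const[OF \<sigma>(3) that x0]) (use loc in auto)
  define n where "n = (s x0 / norm a) *\<^sub>R a"
  define c where "c = s x0 / norm a * b"
  have s0: "s x0 = 1 \<or> s x0 = -1" using s(1)[OF x0] by simp
  have "norm n = 1" using a s0 by (auto simp: n_def)
  moreover have diff: "n \<bullet> y - c = s x0 * (a \<bullet> y - b) / norm a" for y
    using a by (simp add: n_def c_def field_simps)
  have "{x. a \<bullet> x = b} = {x. n \<bullet> x = c}"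
  proof -
    have "a \<bullet> x = b \<longleftrightarrow> n \<bullet> x = c" for x
    proof -
      have "n \<bullet> x = c \<longleftrightarrow> n \<bullet> x - c = 0" by simp
      also have "\<dots> \<longleftrightarrow> a \<bullet> x = b" using a s0 by (auto simp: diff)
      finally show ?thesis ..
    qed
    then show ?thesis by auto
  qed
  moreover have "n \<bullet> y < c \<longleftrightarrow> s x0 * (a \<bullet> y - b) < 0" for y
  proof -
    have "n \<bullet> y < c \<longleftrightarrow> n \<bullet> y - c < 0" by auto
    then show ?thesis using a by (simp add: diff divide_less_0_iff)
  qed
  then have "\<forall>x\<in>\<sigma>. \<exists>r>0. \<forall>y\<in>ball x r. y \<in> K \<longleftrightarrow> n \<bullet> y < c"
    using s(2) const by (metis (no_types, lifting))
  ultimately show ?thesis by blast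
qed

text \<open>Shows that the definite description of the outward normal denotes. A competitor has no
  tangential component, since its inner product is constant on a relatively open piece of the
  hyperplane, and the opposite unit vector points into \<open>K\<close>.\<close>

lemma outward_normal_eqI:
  fixes n :: "'a::euclidean_space"
  assumes n: "norm n = 1" and \<sigma>: "openin (top_of_set {x. n \<bullet> x = c}) \<sigma>" "\<sigma> \<noteq> {}"
    and side: "\<And>x. x \<in> \<sigma> \<Longrightarrow> \<exists>r>0. \<forall>y\<in>ball x r. y \<in> K \<longleftrightarrow> n \<bullet> y < c"
  shows "outward_normal K \<sigma> = n"
  unfolding outward_normal_def
proof (rule the_equality)
  have nn: "n \<bullet> n = 1" using n by (simp add: norm_eq_1)
  have plane: "n \<bullet> x = c" if "x \<in> \<sigma>" for x using openin_imp_subset[OF \<sigma>(1)] that by auto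
  have along: "\<exists>\<delta>>0. \<forall>t\<in>{0<..<\<delta>}. x - t *\<^sub>R n \<in> K \<and> x + t *\<^sub>R n \<notin> K" if x: "x \<in> \<sigma>" for x
  proof -
    obtain r where r: "r > 0" "\<forall>y\<in>ball x r. y \<in> K \<longleftrightarrow> n \<bullet> y < c" using side[OF x] by blast
    have "x - t *\<^sub>R n \<in> K \<and> x + t *\<^sub>R n \<notin> K" if "t \<in> {0<..<r}" for t
      using that r(2)[rule_format, of "x - t *\<^sub>R n"] r(2)[rule_format, of "x + t *\<^sub>R n"] n plane[OF x]
      by (auto simp: dist_norm inner_diff_right inner_add_right nn)
    then show ?thesis using r(1) by blast
  qed
  show "norm n = 1 \<and> (\<exists>c. \<forall>x\<in>\<sigma>. n \<bullet> x = c) \<and>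
     (\<forall>x\<in>\<sigma>. \<exists>\<delta>>0. \<forall>t\<in>{0<..<\<delta>}. x - t *\<^sub>R n \<in> K \<and> x + t *\<^sub>R n \<notin> K)"
    by (intro conjI exI[of _ c] ballI n plane along)
  fix m assume m: "norm m = 1 \<and> (\<exists>c. \<forall>x\<in>\<sigma>. m \<bullet> x = c) \<and>
     (\<forall>x\<in>\<sigma>. \<exists>\<delta>>0. \<forall>t\<in>{0<..<\<delta>}. x - t *\<^sub>R m \<in> K \<and> x + t *\<^sub>R m \<notin> K)"
  obtain x where x: "x \<in> \<sigma>" using \<sigma>(2) by auto
  obtain T where T: "open T" "\<sigma> = {x. n \<bullet> x = c} \<inter> T"
    using \<sigma>(1) by (auto simp: openin_open)
  then obtain r where r: "r > 0" "ball x r \<subseteq> T" using x by (meson IntD2 open_contains_ball)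
  define v where "v = m - (m \<bullet> n) *\<^sub>R n"
  have nv: "n \<bullet> v = 0" by (simp add: v_def inner_diff_right nn inner_commute)
  have "v = 0"
  proof (rule ccontr)
    assume v: "v \<noteq> 0"
    define t where "t = r / (2 * norm v)"
    have t: "t > 0" "t * norm v < r" using v r(1) by (auto simp: t_def)
    have "x + t *\<^sub>R v \<in> \<sigma>"
      using T r(2) t plane[OF x] nv by (auto simp: dist_norm inner_add_right subset_iff)
    then have "m \<bullet> (x + t *\<^sub>R v) = m \<bullet> x" using m x by metis
    then have "m \<bullet> v = 0" using t by (simp add: inner_add_right)
    then have "(m - (m \<bullet> n) *\<^sub>R n) \<bullet> v = 0"
      unfolding inner_diff_left inner_scaleR_left nv by simp
    then have "v \<bullet> v = 0" unfolding v_def[symmetric] .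
    then show False using v by simp
  qed
  then have mn: "m = (m \<bullet> n) *\<^sub>R n" by (simp add: v_def)
  then have "\<bar>m \<bullet> n\<bar> = 1" using m n by (metis mult.right_neutral norm_scaleR)
  moreover have "m \<bullet> n \<noteq> -1"
  proof
    assume "m \<bullet> n = -1"
    then have m': "m = - n" using mn by simp
    obtain \<delta> \<delta>' where d: "\<delta> > 0" "\<forall>t\<in>{0<..<\<delta>}. x - t *\<^sub>R m \<in> K \<and> x + t *\<^sub>R m \<notin> K"
        "\<delta>' > 0" "\<forall>t\<in>{0<..<\<delta>'}. x - t *\<^sub>R n \<in> K \<and> x + t *\<^sub>R n \<notin> K"
      using m along x by blast
    have "min \<delta> \<delta>' / 2 \<in> {0<..<\<delta>}" "min \<delta> \<delta>' / 2 \<in> {0<..<\<delta>'}" using d(1,3) by auto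
    then show False using d(2,4) m' by fastforce
  qed
  ultimately show "m = n" using mn by (metis abs_eq_iff' scaleR_one)
qed

section \<open>Faces, ridges and connectivity of the mesh\<close>

locale discretisation =
  fixes \<Omega> :: "'a::euclidean_space set" and \<M> \<E> :: "'a set set" and \<F> :: "'a set \<Rightarrow> 'a set set"
  assumes domain: "polytopal_domain \<Omega>" and mesh: "mesh \<Omega> \<M> \<E> \<F>"
begin

lemma open_domain: "open \<Omega>" and bounded_domain: "bounded \<Omega>" and connected_domain: "connected \<Omega>"
  and lipschitz_domain: "lipschitz_boundary_in UNIV \<Omega>"
  using domain by (auto simp: polytopal_domain_def lipschitz_polytope_in_def)

lemma finite_cells: "finite \<M>"
  and disjoint_cells: "pairwise disjnt \<M>"
  and finite_faces: "finite \<E>"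
  and disjoint_faces: "pairwise disjnt \<E>"
  and closure_domain: "closure \<Omega> = (\<Union>K\<in>\<M>. closure K)"
  and skeleton: "(\<Union>K\<in>\<M>. frontier K) = (\<Union>\<sigma>\<in>\<E>. closure \<sigma>)"
  and mesh_cells: "\<forall>K\<in>\<M>. open K \<and> K \<subseteq> \<Omega> \<and> lipschitz_polytope_in UNIV K \<and> emeasure lebesgue K > 0"
  and mesh_faces: "\<forall>\<sigma>\<in>\<E>. connected \<sigma> \<and> \<sigma> \<subseteq> closure \<Omega> \<and>
        (\<exists>a b. a \<noteq> 0 \<and> openin (top_of_set {x. a \<bullet> x = b}) \<sigma> \<and>
               lipschitz_polytope_in {x. a \<bullet> x = b} \<sigma> \<and>
               emeasure (hyperplane_measure {x. a \<bullet> x = b}) \<sigma> > 0)"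
  and mesh_cell_faces: "\<forall>K\<in>\<M>. \<F> K \<subseteq> \<E> \<and> frontier K = (\<Union>\<sigma>\<in>\<F> K. closure \<sigma>)"
  using mesh unfolding mesh_def by - (elim conjE, assumption)+

lemma cell:
  assumes "K \<in> \<M>"
  shows "open K" "K \<subseteq> \<Omega>" "bounded K" "K \<noteq> {}" "lipschitz_boundary_in UNIV K"
    "\<F> K \<subseteq> \<E>" "frontier K = (\<Union>\<sigma>\<in>\<F> K. closure \<sigma>)" "finite (\<F> K)"
proof -
  note 1 = bspec[OF mesh_cells assms] and 2 = bspec[OF mesh_cell_faces assms]
  show K: "open K" "K \<subseteq> \<Omega>" "lipschitz_boundary_in UNIV K"
    using 1 by (simp_all add: lipschitz_polytope_in_def)
  show K': "\<F> K \<subseteq> \<E>" "frontier K = (\<Union>\<sigma>\<in>\<F> K. closure \<sigma>)"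
    using 2 by simp_all
  show "bounded K" using bounded_domain K(2) by (rule bounded_subset)
  show "K \<noteq> {}" using 1 by auto
  show "finite (\<F> K)" using K'(1) finite_faces by (rule finite_subset)
qed

lemma face_hyperplane:
  assumes "\<sigma> \<in> \<E>"
  obtains a b where "a \<noteq> 0" "openin (top_of_set {x. a \<bullet> x = b}) \<sigma>"
    "polytopal_in {x. a \<bullet> x = b} \<sigma>" "emeasure (hyperplane_measure {x. a \<bullet> x = b}) \<sigma> > 0"
  using bspec[OF mesh_faces assms] unfolding lipschitz_polytope_in_def by (elim conjE exE)

lemma face:
  assumes "\<sigma> \<in> \<E>"
  shows "connected \<sigma>" "\<sigma> \<subseteq> closure \<Omega>" "bounded \<sigma>" "\<sigma> \<noteq> {}"
proof -
  show s: "connected \<sigma>" "\<sigma> \<subseteq> closure \<Omega>"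
    using bspec[OF mesh_faces assms] by simp_all
  show "bounded \<sigma>"
    using bounded_closure[OF bounded_domain] s(2) by (rule bounded_subset)
  show "\<sigma> \<noteq> {}" using face_hyperplane[OF assms] by (metis emeasure_empty less_irrefl)
qed

lemma face_flat:
  assumes "\<sigma> \<in> \<E>"
  obtains n c where "flat_face \<sigma> n c"
proof -
  obtain a b where ab: "a \<noteq> 0" "openin (top_of_set {x. a \<bullet> x = b}) \<sigma>"
    using face_hyperplane[OF assms] .
  have "{x. a \<bullet> x = b} = {x. (a /\<^sub>R norm a) \<bullet> x = b / norm a}"
    using ab(1) by (auto simp: field_simps)
  then have "flat_face \<sigma> (a /\<^sub>R norm a) (b / norm a)"
    using ab face[OF assms] by unfold_locales auto
  then show ?thesis by (rule that)
qed

lemma face_subset_frontier: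
  assumes "K \<in> \<M>" "\<sigma> \<in> \<F> K"
  shows "\<sigma> \<subseteq> frontier K"
proof -
  have "\<sigma> \<subseteq> closure \<sigma>" by (rule closure_subset)
  also have "\<dots> \<subseteq> frontier K" using cell(7)[OF assms(1)] assms(2) by blast
  finally show ?thesis .
qed

lemma face_normal:
  assumes K: "K \<in> \<M>" and \<sigma>: "\<sigma> \<in> \<F> K"
  shows "\<exists>c. flat_face \<sigma> (outward_normal K \<sigma>) c \<and>
    (\<forall>x\<in>\<sigma>. \<exists>r>0. \<forall>y\<in>ball x r. y \<in> K \<longleftrightarrow> outward_normal K \<sigma> \<bullet> y < c)"
proof -
  have \<sigma>E: "\<sigma> \<in> \<E>" using cell(6)[OF K] \<sigma> by auto
  obtain a b where ab: "a \<noteq> 0" "openin (top_of_set {x. a \<bullet> x = b}) \<sigma>"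
    using face_hyperplane[OF \<sigma>E] .
  obtain n c where n: "norm n = 1" "{x. a \<bullet> x = b} = {x. n \<bullet> x = c}"
    "\<forall>x\<in>\<sigma>. \<exists>r>0. \<forall>y\<in>ball x r. y \<in> K \<longleftrightarrow> n \<bullet> y < c"
    using outer_normal_exists[OF cell(1,5)[OF K] ab face_subset_frontier[OF K \<sigma>] face(1,4)[OF \<sigma>E]] by blast
  have "outward_normal K \<sigma> = n"
    by (rule outward_normal_eqI[OF n(1)]) (use ab n face(4)[OF \<sigma>E] in auto)
  moreover have "flat_face \<sigma> n c"
    using ab n face[OF \<sigma>E] by unfold_locales auto
  ultimately show ?thesis using n(3) by blast
qed

lemma norm_outward_normal: "K \<in> \<M> \<Longrightarrow> \<sigma> \<in> \<F> K \<Longrightarrow> norm (outward_normal K \<sigma>) = 1"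
  using face_normal flat_face.normal by blast

text \<open>One finite family of affine sets of codimension two for all faces at once, so that a
  single genericity condition on a line or a segment serves the whole skeleton.\<close>

lemma ridges_exist:
  "\<exists>\<L>. finite \<L> \<and> (\<forall>L\<in>\<L>. affine L \<and> aff_dim L + 2 \<le> DIM('a)) \<and>
    (\<forall>\<sigma>\<in>\<E>. closure \<sigma> \<subseteq> \<sigma> \<union> \<Union>\<L>)"
proof -
  have "\<forall>\<sigma>\<in>\<E>. \<exists>\<L>. finite \<L> \<and> (\<forall>L\<in>\<L>. affine L \<and> aff_dim L + 2 \<le> DIM('a)) \<and> closure \<sigma> \<subseteq> \<sigma> \<union> \<Union>\<L>"
    using face_hyperplane frontier_face_codim2 by metis
  from bchoice[OF this] obtain \<L> where \<L>: "\<forall>\<sigma>\<in>\<E>. finite (\<L> \<sigma>) \<and>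
    (\<forall>L\<in>\<L> \<sigma>. affine L \<and> aff_dim L + 2 \<le> DIM('a)) \<and> closure \<sigma> \<subseteq> \<sigma> \<union> \<Union>(\<L> \<sigma>)" ..
  show ?thesis
  proof (rule exI[of _ "\<Union>\<sigma>\<in>\<E>. \<L> \<sigma>"], intro conjI ballI)
    show "finite (\<Union>\<sigma>\<in>\<E>. \<L> \<sigma>)" using \<L> finite_faces by simp
    show "affine L" "aff_dim L + 2 \<le> DIM('a)" if L: "L \<in> (\<Union>\<sigma>\<in>\<E>. \<L> \<sigma>)" for L
    proof -
      obtain \<sigma> where "\<sigma> \<in> \<E>" "L \<in> \<L> \<sigma>" using L by auto
      then show "affine L" "aff_dim L + 2 \<le> DIM('a)" using \<L> by simp_all
    qed
    show "closure \<sigma> \<subseteq> \<sigma> \<union> \<Union>(\<Union>\<sigma>\<in>\<E>. \<L> \<sigma>)" if "\<sigma> \<in> \<E>" for \<sigma>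
    proof -
      have "closure \<sigma> \<subseteq> \<sigma> \<union> \<Union>(\<L> \<sigma>)" using \<L> that by simp
      also have "\<dots> \<subseteq> \<sigma> \<union> \<Union>(\<Union>\<sigma>\<in>\<E>. \<L> \<sigma>)" using that by (intro Un_mono Union_mono) auto
      finally show ?thesis .
    qed
  qed
qed

lemma ridges:
  obtains \<L> where "finite \<L>" "\<And>L. L \<in> \<L> \<Longrightarrow> affine L \<and> aff_dim L + 2 \<le> DIM('a)"
    "\<And>\<sigma>. \<sigma> \<in> \<E> \<Longrightarrow> closure \<sigma> \<subseteq> \<sigma> \<union> \<Union>\<L>"
  using ridges_exist by (elim exE conjE) (simp only: Ball_def)

theorem divergence_theorem_cell:
  fixes f f' :: "'a \<Rightarrow> real"
  assumes KM: "K \<in> \<M>"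
    and f: "\<And>x t. ((\<lambda>t. f (x + t *\<^sub>R e)) has_real_derivative f' (x + t *\<^sub>R e)) (at t)"
    and contf: "continuous_on UNIV f" and f': "continuous_on UNIV f'" and e: "norm e = 1"
  shows "(LINT x|lebesgue_on K. f' x) =
    (\<Sum>\<sigma>\<in>\<F> K. (outward_normal K \<sigma> \<bullet> e) * (LINT x|face_measure \<sigma>. f x))"
proof -
  obtain c where c: "\<And>\<sigma>. \<sigma> \<in> \<F> K \<Longrightarrow> flat_face \<sigma> (outward_normal K \<sigma>) (c \<sigma>)"
    "\<And>\<sigma> x. \<sigma> \<in> \<F> K \<Longrightarrow> x \<in> \<sigma> \<Longrightarrow> \<exists>r>0. \<forall>y\<in>ball x r. y \<in> K \<longleftrightarrow> outward_normal K \<sigma> \<bullet> y < c \<sigma>"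
    using face_normal[OF KM] by metis
  obtain \<L> where \<L>: "finite \<L>" "\<And>L. L \<in> \<L> \<Longrightarrow> affine L \<and> aff_dim L + 2 \<le> DIM('a)"
    "\<And>\<sigma>. \<sigma> \<in> \<E> \<Longrightarrow> closure \<sigma> \<subseteq> \<sigma> \<union> \<Union>\<L>"
    by (rule ridges) blast
  have disj: "pairwise disjnt (\<F> K)"
    using disjoint_faces cell(6)[OF KM] by (rule pairwise_subset)
  \<comment> \<open>The frontier is the union of the closed faces, hence covered by the faces and
    the ridges.\<close>
  interpret faceted_set K "\<F> K" "outward_normal K" c \<L>
  proof
    show "frontier K \<subseteq> \<Union>(\<F> K) \<union> \<Union>\<L>"
    proof
      fix x assume "x \<in> frontier K"
      then obtain \<sigma> where "\<sigma> \<in> \<F> K" "x \<in> closure \<sigma>" using cell(7)[OF KM] by auto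
      then show "x \<in> \<Union>(\<F> K) \<union> \<Union>\<L>" using \<L>(3)[of \<sigma>] cell(6)[OF KM] by blast
    qed
    show "bounded \<sigma>" if "\<sigma> \<in> \<F> K" for \<sigma> using that cell(6)[OF KM] face(3) by blast
    show "\<exists>r>0. \<forall>y\<in>ball x r. y \<in> K \<longleftrightarrow> outward_normal K \<sigma> \<bullet> y < c \<sigma>" if "\<sigma> \<in> \<F> K" "x \<in> \<sigma>" for \<sigma> x
      using c(2) that by blast
  qed (use disj cell[OF KM] \<L> flat_face.borel_face[OF c(1)] flat_face.face_plane[OF c(1)]
      norm_outward_normal[OF KM] in auto)
  have "(LINT x|lebesgue_on K. f' x) = (LINT x|lborel. indicator K x * f' x)"
  proof -
    have [measurable]: "K \<in> sets borel" "f' \<in> borel_measurable borel"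
      using cell[OF KM] f' by (auto intro: borel_measurable_continuous_onI)
    have "(LINT x|lebesgue_on K. f' x) = (LINT x|lebesgue. indicator K x * f' x)"
      by (subst integral_restrict_space) auto
    also have "\<dots> = (LINT x|lborel. indicator K x * f' x)"
      by (rule integral_completion) measurable
    finally show ?thesis .
  qed
  also have "\<dots> = (\<Sum>\<sigma>\<in>\<F> K. (outward_normal K \<sigma> \<bullet> e) * (LINT x|face_measure \<sigma>. f x))"
    unfolding integral_directional_derivative[OF f contf f' e]
  proof (intro sum.cong refl arg_cong2[where f = "(*)"])
    fix \<sigma> assume \<sigma>: "\<sigma> \<in> \<F> K"
    interpret flat_face \<sigma> "outward_normal K \<sigma>" "c \<sigma>" by (rule c(1)[OF \<sigma>])
    show "(LINT y|lborel. indicator slab y * (indicator \<sigma> (proj y) * f (proj y)))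
        = (LINT x|face_measure \<sigma>. f x)"
      using contf by (intro integral_face_measure[symmetric] measurable_face_measure)
        (rule borel_measurable_continuous_onI)
  qed
  finally show ?thesis .
qed

text \<open>A point of the domain in no cell still lies in the closure of one, hence on a frontier,
  hence in one of finitely many hyperplanes.\<close>

lemma negligible_skeleton: "negligible (\<Omega> - \<Union>\<M>)"
proof (rule negligible_subset)
  have "negligible (closure \<sigma>)" if \<sigma>: "\<sigma> \<in> \<E>" for \<sigma>
  proof -
    obtain n c where "flat_face \<sigma> n c" using face_flat[OF \<sigma>] .
    then interpret flat_face \<sigma> n c .
    have "closure \<sigma> \<subseteq> {x. n \<bullet> x = c}"
      using face_plane by (intro closure_minimal closed_hyperplane) auto
    moreover have "negligible {x. n \<bullet> x = c}"
      using normal by (intro negligible_hyperplane) auto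
    ultimately show ?thesis using negligible_subset by blast
  qed
  then show "negligible (\<Union>\<sigma>\<in>\<E>. closure \<sigma>)"
    using finite_faces by (intro negligible_Union) auto
  show "\<Omega> - \<Union>\<M> \<subseteq> (\<Union>\<sigma>\<in>\<E>. closure \<sigma>)"
  proof
    fix x assume x: "x \<in> \<Omega> - \<Union>\<M>"
    then have "x \<in> closure \<Omega>" using closure_subset by blast
    then obtain K where K: "K \<in> \<M>" "x \<in> closure K" using closure_domain by auto
    then have "x \<in> frontier K" using x cell(1)[OF K(1)] by (auto simp: frontier_def interior_open)
    then show "x \<in> (\<Union>\<sigma>\<in>\<E>. closure \<sigma>)" using K skeleton by blast
  qed
qed

text \<open>The cylinder in normal direction has positive volume over a face, whereas over sets of
  codimension two it is negligible.\<close>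

lemma face_not_in_ridges:
  assumes \<sigma>: "\<sigma> \<in> \<E>" and \<L>: "finite \<L>" "\<And>L. L \<in> \<L> \<Longrightarrow> affine L \<and> aff_dim L + 2 \<le> DIM('a)"
  shows "\<not> \<sigma> \<subseteq> \<Union>\<L>"
proof
  assume sub: "\<sigma> \<subseteq> \<Union>\<L>"
  obtain n c where "flat_face \<sigma> n c" using face_flat[OF \<sigma>] .
  then interpret flat_face \<sigma> n c .
  obtain x where x: "x \<in> \<sigma>" using nonempty_face by auto
  define N where "N = (\<Union>L\<in>\<L>. {y. \<exists>t. y + t *\<^sub>R n \<in> L})"
  have "negligible N"
    unfolding N_def using \<L> by (intro negligible_Union) (auto intro: negligible_line_cylinder)
  moreover have "{y \<in> slab. proj y \<in> \<sigma> \<inter> ball x 1} \<subseteq> N"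
  proof clarify
    fix y assume "proj y \<in> \<sigma>"
    then obtain L where L: "L \<in> \<L>" "proj y \<in> L" using sub by blast
    then have "y + (- (n \<bullet> y - c)) *\<^sub>R n \<in> L"
      unfolding scaleR_minus_left add_uminus_conv_diff by simp
    then show "y \<in> N" unfolding N_def using L(1) by blast
  qed
  ultimately have neg: "negligible {y \<in> slab. proj y \<in> \<sigma> \<inter> ball x 1}" by (rule negligible_subset)
  have [measurable]: "\<sigma> \<inter> ball x 1 \<in> sets borel" by auto
  have "{y \<in> slab. proj y \<in> \<sigma> \<inter> ball x 1} \<in> sets borel" by measurable
  then have "emeasure lborel {y \<in> slab. proj y \<in> \<sigma> \<inter> ball x 1} = 0"
    using neg by (auto simp: negligible_iff_null_sets null_sets_completion_iff null_setsD1)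
  then show False
    using emeasure_face_measure_ball[OF x, of 1] emeasure_face_measure[of "\<sigma> \<inter> ball x 1"] by simp
qed

text \<open>The mesh axioms equate unions only. A face of no cell would be covered by closures of
  other faces and, faces being disjoint, by their ridges. The lemma ensures that every face unknown
  occurs in some jump.\<close>

lemma face_has_cell:
  assumes \<sigma>: "\<sigma> \<in> \<E>"
  obtains K where "K \<in> \<M>" "\<sigma> \<in> \<F> K"
proof (rule ccontr)
  assume "\<not> thesis"
  with that have no: "\<And>K. K \<in> \<M> \<Longrightarrow> \<sigma> \<notin> \<F> K" by blast
  obtain \<L> where \<L>: "finite \<L>" "\<And>L. L \<in> \<L> \<Longrightarrow> affine L \<and> aff_dim L + 2 \<le> DIM('a)"
    "\<And>\<sigma>. \<sigma> \<in> \<E> \<Longrightarrow> closure \<sigma> \<subseteq> \<sigma> \<union> \<Union>\<L>"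
    by (rule ridges) blast
  have "\<sigma> \<subseteq> \<Union>\<L>"
  proof
    fix x assume x: "x \<in> \<sigma>"
    then have "x \<in> (\<Union>\<sigma>\<in>\<E>. closure \<sigma>)" using \<sigma> closure_subset by blast
    then obtain K where K: "K \<in> \<M>" "x \<in> frontier K" using skeleton by blast
    then obtain \<sigma>' where \<sigma>': "\<sigma>' \<in> \<F> K" "x \<in> closure \<sigma>'" using cell(7) by blast
    then have "\<sigma>' \<in> \<E>" "\<sigma>' \<noteq> \<sigma>" using cell(6)[OF K(1)] no[OF K(1)] by auto
    then have "x \<notin> \<sigma>'" using disjoint_faces \<sigma> x by (auto simp: pairwise_def disjnt_def)
    then show "x \<in> \<Union>\<L>" using \<L>(3)[OF \<open>\<sigma>' \<in> \<E>\<close>] \<sigma>'(2) by blast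
  qed
  then show False using face_not_in_ridges[OF \<sigma> \<L>(1,2)] by blast
qed

text \<open>A generic segment between two cells inside the domain meets the skeleton only in faces.\<close>

lemma cells_connected_through_faces:
  assumes S: "S \<subseteq> \<M>" "S \<noteq> {}" "S \<noteq> \<M>"
  obtains K K' \<sigma> where "K \<in> S" "K' \<in> \<M> - S" "\<sigma> \<in> \<F> K" "\<sigma> \<in> \<F> K'"
proof -
  obtain \<L> where \<L>: "finite \<L>" "\<And>L. L \<in> \<L> \<Longrightarrow> affine L \<and> aff_dim L + 2 \<le> DIM('a)"
    "\<And>\<sigma>. \<sigma> \<in> \<E> \<Longrightarrow> closure \<sigma> \<subseteq> \<sigma> \<union> \<Union>\<L>"
    by (rule ridges) blast
  define A where "A = (\<Union>K\<in>S. closure K)"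
  define B where "B = (\<Union>K\<in>\<M> - S. closure K)"
  have fin: "finite S" "finite (\<M> - S)" using S finite_cells by (auto intro: finite_subset)
  have AB: "closed A" "closed B" using fin by (auto simp: A_def B_def)
  have cov: "\<Omega> \<subseteq> A \<union> B"
  proof
    fix x assume "x \<in> \<Omega>"
    then have "x \<in> closure \<Omega>" using closure_subset by blast
    then obtain K where "K \<in> \<M>" "x \<in> closure K" using closure_domain by auto
    then show "x \<in> A \<union> B" by (cases "K \<in> S") (auto simp: A_def B_def)
  qed
  have nonempty: "\<exists>x\<in>\<Omega>. x \<in> closure K" if "K \<in> \<M>" for K
    using cell(2,4)[OF that] closure_subset[of K] by blast
  obtain K01 K02 where K0: "K01 \<in> S" "K02 \<in> \<M> - S" using S by blast
  then have "A \<inter> \<Omega> \<noteq> {}" "B \<inter> \<Omega> \<noteq> {}"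
    using nonempty[of K01] nonempty[of K02] S(1) by (auto simp: A_def B_def)
  \<comment> \<open>Two closed sets that cover the connected domain and both meet it must touch
    inside it; a whole ball around the contact point lies in the domain.\<close>
  then have "A \<inter> B \<inter> \<Omega> \<noteq> {}"
    using connected_closedD[OF connected_domain _ cov AB] by blast
  then obtain p where p: "p \<in> \<Omega>" "p \<in> A" "p \<in> B" by auto
  obtain r where r: "r > 0" "ball p r \<subseteq> \<Omega>" using open_domain p by (meson open_contains_ball)
  obtain K1 where K1: "K1 \<in> S" "p \<in> closure K1" using p by (auto simp: A_def)
  obtain K2 where K2: "K2 \<in> \<M> - S" "p \<in> closure K2" using p by (auto simp: B_def)
  have ex: "\<exists>z\<in>K \<inter> ball p r. z \<notin> N" if KN: "K \<in> \<M>" "p \<in> closure K" "negligible N" for K N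
  proof (rule ccontr)
    assume "\<not> ?thesis"
    then have "negligible (K \<inter> ball p r)" using KN(3) negligible_subset by blast
    moreover have "open (K \<inter> ball p r)" using cell(1)[OF KN(1)] by auto
    moreover have "K \<inter> ball p r \<noteq> {}"
    proof -
      obtain y where "y \<in> K" "dist y p < r" using KN(2) r(1) unfolding closure_approachable by blast
      then show ?thesis by (auto simp: dist_commute)
    qed
    ultimately show False using open_not_negligible by blast
  qed
  have "negligible (\<Union>\<L>)"
  proof (intro negligible_Union \<L>(1))
    show "negligible L" if "L \<in> \<L>" for L
      using \<L>(2)[OF that] by (intro negligible_affine) auto
  qed
  then obtain y where y: "y \<in> K1" "y \<in> ball p r" "y \<notin> \<Union>\<L>" using ex[of K1] K1 S by blast
  \<comment> \<open>Joining \<open>y\<close> to a set of codimension two gives at most a hyperplane,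
    so \<open>z\<close> can be chosen off all of these hulls. If the segment from \<open>y\<close>
    to \<open>z\<close> hit some \<open>L\<close>, the line through \<open>y\<close> and the hit
    would carry \<open>z\<close> into the hull of \<open>y\<close> and \<open>L\<close>.\<close>
  have "negligible (\<Union>L\<in>\<L>. affine hull (insert y L))"
  proof (intro negligible_Union finite_imageI \<L>(1); clarify)
    fix L assume "L \<in> \<L>"
    then have "aff_dim (insert y L) < DIM('a)" using \<L>(2)[of L] by (simp add: aff_dim_insert)
    then show "negligible (affine hull (insert y L))"
      by (intro negligible_affine) auto
  qed
  then obtain z where z: "z \<in> K2" "z \<in> ball p r" "z \<notin> (\<Union>L\<in>\<L>. affine hull (insert y L))"
    using ex[of K2] K2 by blast
  define s where "s = closed_segment y z"
  have "s \<subseteq> ball p r" unfolding s_def using y z by (intro closed_segment_subset) auto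
  then have s\<Omega>: "s \<subseteq> \<Omega>" using r by auto
  have sL: "q \<notin> \<Union>\<L>" if qs: "q \<in> s" for q
  proof
    assume "q \<in> \<Union>\<L>"
    then obtain L where L: "L \<in> \<L>" "q \<in> L" by auto
    obtain t where t: "q = (1 - t) *\<^sub>R y + t *\<^sub>R z" using qs by (auto simp: s_def in_segment)
    have "t \<noteq> 0" using t L y(3) by auto
    have "y \<in> affine hull (insert y L)" "q \<in> affine hull (insert y L)"
      using L by (auto intro: hull_inc)
    then have "(1 - 1 / t) *\<^sub>R y + (1 / t) *\<^sub>R q \<in> affine hull (insert y L)"
      by (intro mem_affine) auto
    moreover have "(1 - 1 / t) *\<^sub>R y + (1 / t) *\<^sub>R q = z"
    proof -
      have "(1 / t) *\<^sub>R q = (1 / t - 1) *\<^sub>R y + z"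
        using \<open>t \<noteq> 0\<close> by (simp add: t scaleR_add_right diff_divide_distrib)
      then show ?thesis by (simp add: algebra_simps)
    qed
    ultimately show False using z(3) L by auto
  qed
  have "connected s" by (simp add: s_def)
  moreover have "y \<in> A \<inter> s" "z \<in> B \<inter> s"
  proof -
    have "y \<in> closure K1" "z \<in> closure K2" using y(1) z(1) closure_subset by blast+
    then show "y \<in> A \<inter> s" "z \<in> B \<inter> s" using K1(1) K2(1) by (auto simp: A_def B_def s_def)
  qed
  \<comment> \<open>A point of the segment common to both groups lies on the frontiers of two
    disjoint open cells. Off the ridges it belongs to a face of each, and disjointness of faces
    makes the two equal.\<close>
  ultimately have "A \<inter> B \<inter> s \<noteq> {}"
    using connected_closedD[of s A B] AB cov s\<Omega> by blast
  then obtain q where q: "q \<in> A" "q \<in> B" "q \<in> s" by auto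
  obtain K where K: "K \<in> S" "q \<in> closure K" using q by (auto simp: A_def)
  obtain K' where K': "K' \<in> \<M> - S" "q \<in> closure K'" using q by (auto simp: B_def)
  have KM: "K \<in> \<M>" "K' \<in> \<M>" using K K' S by auto
  have "K \<noteq> K'" using K K' by auto
  then have disj: "K \<inter> K' = {}" using disjoint_cells KM by (auto simp: pairwise_def disjnt_def)
  have hit: "\<exists>\<sigma>\<in>\<F> K0. q \<in> \<sigma>" if K0: "K0 \<in> \<M>" "q \<in> frontier K0" for K0
  proof -
    obtain \<sigma> where \<sigma>: "\<sigma> \<in> \<F> K0" "q \<in> closure \<sigma>" using K0 cell(7)[OF K0(1)] by auto
    then have "\<sigma> \<in> \<E>" using cell(6)[OF K0(1)] by auto
    then have "q \<in> \<sigma>" using \<L>(3) sL[OF q(3)] \<sigma>(2) by blast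
    then show ?thesis using \<sigma> by auto
  qed
  have "q \<in> frontier K" "q \<in> frontier K'"
    using K K' disj cell(1)[OF KM(1)] cell(1)[OF KM(2)]
      open_Int_closure_eq_empty[of K K'] open_Int_closure_eq_empty[of K' K]
    by (auto simp: frontier_def interior_open)
  then obtain \<sigma> \<sigma>' where \<sigma>: "\<sigma> \<in> \<F> K" "q \<in> \<sigma>" "\<sigma>' \<in> \<F> K'" "q \<in> \<sigma>'"
    using hit KM by metis
  then have "\<sigma> \<in> \<E>" "\<sigma>' \<in> \<E>" using cell(6) KM by auto
  then have "\<sigma> = \<sigma>'" using disjoint_faces \<sigma> by (auto simp: pairwise_def disjnt_def)
  then show ?thesis using that \<sigma> K K' by blast
qed

end

section \<open>A smooth mollifier\<close>

text \<open>A whole sequence of derivatives is postulated, so that shifts and affine substitutions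
  act on it term by term.\<close>

definition smooth_real :: "(real \<Rightarrow> real) \<Rightarrow> bool" where
  "smooth_real f \<longleftrightarrow> (\<exists>D. D 0 = f \<and> (\<forall>n t. (D n has_real_derivative D (Suc n) t) (at t)))"

lemma smooth_realI:
  assumes "f \<in> X" and X: "\<And>g. g \<in> X \<Longrightarrow> \<exists>g'\<in>X. \<forall>t. (g has_real_derivative g' t) (at t)"
  shows "smooth_real f"
proof -
  define d where "d g = (SOME g'. g' \<in> X \<and> (\<forall>t. (g has_real_derivative g' t) (at t)))" for g
  have d: "d g \<in> X \<and> (\<forall>t. (g has_real_derivative d g t) (at t))" if "g \<in> X" for g
  proof -
    have "\<exists>g'. g' \<in> X \<and> (\<forall>t. (g has_real_derivative g' t) (at t))" using X[OF that] by blast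
    from someI_ex[OF this] show ?thesis unfolding d_def .
  qed
  define D where "D n = (d ^^ n) f" for n
  have "D n \<in> X" for n by (induction n) (use assms(1) d in \<open>auto simp: D_def\<close>)
  then show ?thesis
    unfolding smooth_real_def using d by (intro exI[of _ D]) (auto simp: D_def)
qed

lemma smooth_real_deriv:
  assumes "smooth_real f"
  obtains f' where "smooth_real f'" "\<And>t. (f has_real_derivative f' t) (at t)"
proof -
  obtain D where D: "D 0 = f" "\<And>n t. (D n has_real_derivative D (Suc n) t) (at t)"
    using assms by (auto simp: smooth_real_def)
  have "smooth_real (D 1)"
    unfolding smooth_real_def by (intro exI[of _ "\<lambda>n. D (Suc n)"]) (use D(2) in simp)
  moreover have "(f has_real_derivative D 1 t) (at t)" for t using D(2)[of 0 t] D(1) by simp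
  ultimately show ?thesis by (rule that)
qed

lemma smooth_real_continuous: "smooth_real f \<Longrightarrow> continuous_on UNIV f"
  by (metis DERIV_continuous_on has_field_derivative_at_within smooth_real_deriv)

lemma smooth_real_affine:
  assumes "smooth_real f"
  shows "smooth_real (\<lambda>t. f (a * t + b))"
proof -
  obtain D where D: "D 0 = f" "\<And>n t. (D n has_real_derivative D (Suc n) t) (at t)"
    using assms by (auto simp: smooth_real_def)
  have "((\<lambda>t. a ^ n * D n (a * t + b)) has_real_derivative a ^ Suc n * D (Suc n) (a * t + b)) (at t)" for n t
  proof -
    have "((\<lambda>t. D n (a * t + b)) has_real_derivative D (Suc n) (a * t + b) * a) (at t)"
      by (rule DERIV_chain2[OF D(2)]) (auto intro!: derivative_eq_intros)
    from DERIV_cmult[OF this, of "a ^ n"] show ?thesis by (simp add: mult_ac)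
  qed
  then show ?thesis
    unfolding smooth_real_def using D(1)
    by (intro exI[of _ "\<lambda>n t. a ^ n * D n (a * t + b)"]) auto
qed

text \<open>One term of the exponential series at \<open>1 / s\<close>: the exponential beats a pole
  of any order.\<close>

lemma exp_minus_inverse_le:
  fixes s :: real
  assumes "s > 0"
  shows "exp (- 1 / s) \<le> fact k * s ^ k"
proof -
  have "(1 / s) ^ k / fact k \<le> exp (1 / s)"
  proof -
    have "(\<lambda>n. (1 / s) ^ n /\<^sub>R fact n) sums exp (1 / s)" by (rule exp_converges)
    then have s: "(\<lambda>n. (1 / s) ^ n / fact n) sums exp (1 / s)" by (simp add: divide_inverse mult.commute)
    have "sum (\<lambda>n. (1 / s) ^ n / fact n) {k} \<le> suminf (\<lambda>n. (1 / s) ^ n / fact n)"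
      using assms by (intro sum_le_suminf sums_summable[OF s]) auto
    then show ?thesis using sums_unique[OF s] by simp
  qed
  then have "exp (- 1 / s) \<le> 1 / ((1 / s) ^ k / fact k)"
    using assms by (simp add: exp_minus inverse_eq_divide divide_simps mult_ac)
  then show ?thesis by (simp add: power_divide mult.commute)
qed

text \<open>The polynomial factor and the power of \<open>1 - t\<^sup>2\<close> in the denominator
  make the family closed under differentiation; \<open>bump 1 0\<close> is the standard profile of a
  mollifier.\<close>

definition bump :: "real poly \<Rightarrow> nat \<Rightarrow> real \<Rightarrow> real" where
  "bump p m t = (if \<bar>t\<bar> < 1 then poly p t / (1 - t\<^sup>2) ^ m * exp (- 1 / (1 - t\<^sup>2)) else 0)"

text \<open>The three terms come from the polynomial, the power in the denominator and the
  exponential, brought to the denominator of order \<open>m + 2\<close>; \<open>[:1, 0, -1:]\<close>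
  is \<open>1 - t\<^sup>2\<close>, and \<open>[:0, 1, 0, -1:]\<close> is \<open>t\<close> times
  it.\<close>

lemma bump_deriv_inside:
  assumes "\<bar>t\<bar> < 1"
  shows "(bump p m has_real_derivative
    bump (pderiv p * [:1, 0, -1:]\<^sup>2 + smult (2 * real m) ([:0, 1, 0, -1:] * p) - smult 2 ([:0, 1:] * p)) (m + 2) t) (at t)"
proof -
  define s where "s = 1 - t\<^sup>2"
  have s: "s > 0" using assms by (simp add: s_def abs_square_less_1)
  have ds: "((\<lambda>t::real. 1 - t\<^sup>2) has_real_derivative - (2 * t)) (at t)"
    by (auto intro!: derivative_eq_intros)
  have d1: "((\<lambda>t::real. inverse ((1 - t\<^sup>2) ^ m)) has_real_derivative
      real m * (2 * t) * inverse (s ^ (m + 1))) (at t)"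
  proof -
    have "((\<lambda>t::real. (1 - t\<^sup>2) ^ m) has_real_derivative real m * ((- (2 * t)) * s ^ (m - 1))) (at t)"
      using DERIV_power[OF ds, of m] by (simp add: s_def)
    from DERIV_inverse'[OF this] s
    have d: "((\<lambda>t::real. inverse ((1 - t\<^sup>2) ^ m)) has_real_derivative
      - (inverse (s ^ m) * (real m * ((- (2 * t)) * s ^ (m - 1))) * inverse (s ^ m))) (at t)"
      by (simp add: s_def)
    have e: "- (inverse (s ^ m) * (real m * ((- (2 * t)) * s ^ (m - 1))) * inverse (s ^ m)) =
        real m * (2 * t) * inverse (s ^ (m + 1))"
      using s by (cases m) (auto simp: field_simps)
    show ?thesis by (rule DERIV_cong[OF d e])
  qed
  have d2: "((\<lambda>t::real. exp (- 1 / (1 - t\<^sup>2))) has_real_derivative exp (- 1 / s) * (- (2 * t) / s\<^sup>2)) (at t)"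
  proof -
    have "((\<lambda>t::real. - inverse (1 - t\<^sup>2)) has_real_derivative - (2 * t) / s\<^sup>2) (at t)"
      using DERIV_minus[OF DERIV_inverse'[OF ds]] s by (simp add: s_def field_simps power2_eq_square)
    from DERIV_fun_exp[OF this] show ?thesis by (simp add: s_def divide_inverse)
  qed
  have "((\<lambda>t. poly p t * inverse ((1 - t\<^sup>2) ^ m) * exp (- 1 / (1 - t\<^sup>2))) has_real_derivative
     (poly (pderiv p) t * inverse (s ^ m) + poly p t * (real m * (2 * t) * inverse (s ^ (m + 1)))) * exp (- 1 / s)
     + poly p t * inverse (s ^ m) * (exp (- 1 / s) * (- (2 * t) / s\<^sup>2))) (at t)"
    using DERIV_mult[OF DERIV_mult[OF poly_DERIV d1] d2, of p]
    by (simp add: s_def algebra_simps)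
  moreover have "(poly (pderiv p) t * inverse (s ^ m) + poly p t * (real m * (2 * t) * inverse (s ^ (m + 1)))) * exp (- 1 / s)
     + poly p t * inverse (s ^ m) * (exp (- 1 / s) * (- (2 * t) / s\<^sup>2)) =
     (poly (pderiv p) t * s\<^sup>2 + 2 * real m * (t * s * poly p t) - 2 * (t * poly p t)) / s ^ (m + 2) * exp (- 1 / s)"
    using s by (simp add: field_simps power2_eq_square power_add)
  moreover have "poly (pderiv p) t * s\<^sup>2 + 2 * real m * (t * s * poly p t) - 2 * (t * poly p t) =
     poly (pderiv p * [:1, 0, -1:]\<^sup>2 + smult (2 * real m) ([:0, 1, 0, -1:] * p) - smult 2 ([:0, 1:] * p)) t"
    by (simp add: s_def algebra_simps power2_eq_square)
  ultimately have d: "((\<lambda>t. poly p t * inverse ((1 - t\<^sup>2) ^ m) * exp (- 1 / (1 - t\<^sup>2))) has_real_derivative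
    bump (pderiv p * [:1, 0, -1:]\<^sup>2 + smult (2 * real m) ([:0, 1, 0, -1:] * p) - smult 2 ([:0, 1:] * p)) (m + 2) t) (at t)"
    using assms by (simp only: bump_def s_def if_True)
  have "\<forall>\<^sub>F u in nhds t. u \<in> {-1<..<1}"
    using assms by (intro eventually_nhds_in_open) auto
  then have ev: "\<forall>\<^sub>F u in nhds t. bump p m u = poly p u * inverse ((1 - u\<^sup>2) ^ m) * exp (- 1 / (1 - u\<^sup>2))"
    by eventually_elim (auto simp: bump_def divide_inverse)
  show ?thesis
    using d DERIV_cong_ev[OF refl ev refl] by blast
qed

text \<open>The bump vanishes to second order at the end points: bounding the exponential by the
  power \<open>m + 2\<close> absorbs the pole of order \<open>m\<close> and leaves a square.\<close>

lemma bump_deriv_outside: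
  assumes "\<bar>t\<bar> \<ge> 1"
  shows "(bump p m has_real_derivative 0) (at t)"
proof -
  have "bounded (poly p ` {-1..1})"
    by (intro compact_imp_bounded compact_continuous_image continuous_intros) auto
  then obtain P where P: "\<And>u. \<bar>u\<bar> \<le> 1 \<Longrightarrow> \<bar>poly p u\<bar> \<le> P"
    by (force simp: bounded_iff)
  \<comment> \<open>The 4 is the square of the factor in
    \<open>1 - u\<^sup>2 \<le> 2 * \<bar>u - t\<bar>\<close>, valid for
    \<open>\<bar>u\<bar> < 1 \<le> \<bar>t\<bar>\<close>.\<close>
  define C where "C = \<bar>P\<bar> * fact (m + 2) * 4"
  have bound: "\<bar>bump p m u\<bar> \<le> C * \<bar>u - t\<bar>\<^sup>2" for u
  proof (cases "\<bar>u\<bar> < 1")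
    case True
    define s where "s = 1 - u\<^sup>2"
    have s: "s > 0" using True by (simp add: s_def abs_square_less_1)
    have "s = (1 - \<bar>u\<bar>) * (1 + \<bar>u\<bar>)" by (simp add: s_def algebra_simps power2_eq_square)
    also have "\<dots> \<le> \<bar>u - t\<bar> * 2" using True assms by (intro mult_mono) auto
    finally have "s\<^sup>2 \<le> (\<bar>u - t\<bar> * 2)\<^sup>2" using s by (intro power_mono) auto
    then have s2: "s\<^sup>2 \<le> 4 * \<bar>u - t\<bar>\<^sup>2" by (simp add: power_mult_distrib)
    have "\<bar>bump p m u\<bar> = \<bar>poly p u\<bar> / s ^ m * exp (- 1 / s)"
      using True s by (simp add: bump_def s_def[symmetric] abs_mult)
    also have "\<dots> \<le> \<bar>P\<bar> / s ^ m * (fact (m + 2) * s ^ (m + 2))"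
      using P[of u] True s by (intro mult_mono divide_right_mono exp_minus_inverse_le) auto
    also have "\<dots> = \<bar>P\<bar> * fact (m + 2) * s\<^sup>2" using s by (simp add: power_add power2_eq_square)
    also have "\<dots> \<le> \<bar>P\<bar> * fact (m + 2) * (4 * \<bar>u - t\<bar>\<^sup>2)" using s2 by (intro mult_left_mono) auto
    finally show ?thesis by (simp only: C_def mult.assoc)
  qed (simp add: bump_def C_def)
  have t0: "bump p m t = 0" using assms by (simp add: bump_def)
  have "((\<lambda>u. C * \<bar>u - t\<bar>) \<longlongrightarrow> C * \<bar>t - t\<bar>) (at t)" by (intro tendsto_intros)
  then have lim: "((\<lambda>u. C * \<bar>u - t\<bar>) \<longlongrightarrow> 0) (at t)" by simp
  have "((\<lambda>u. (bump p m u - bump p m t) / (u - t)) \<longlongrightarrow> 0) (at t)"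
  proof (rule Lim_null_comparison[OF _ lim])
    show "\<forall>\<^sub>F u in at t. norm ((bump p m u - bump p m t) / (u - t)) \<le> C * \<bar>u - t\<bar>"
    proof (rule eventually_mono[OF eventually_True])
      fix u
      show "norm ((bump p m u - bump p m t) / (u - t)) \<le> C * \<bar>u - t\<bar>"
      proof (cases "u = t")
        case False
        then show ?thesis
          using bound[of u] t0 by (simp add: abs_mult field_simps power2_eq_square)
      qed simp
    qed
  qed
  then show ?thesis by (simp add: has_field_derivative_iff)
qed

lemma smooth_bump: "smooth_real (bump p m)"
proof (rule smooth_realI[of _ "{bump p m |p m. True}"])
  fix g assume "g \<in> {bump p m |p m. True}"
  then obtain p m where g: "g = bump p m" by auto
  define q where "q = pderiv p * [:1, 0, -1:]\<^sup>2 + smult (2 * real m) ([:0, 1, 0, -1:] * p) - smult 2 ([:0, 1:] * p)"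
  have "(g has_real_derivative bump q (m + 2) t) (at t)" for t
  proof (cases "\<bar>t\<bar> < 1")
    case True
    then show ?thesis unfolding g q_def by (rule bump_deriv_inside)
  next
    case False
    then have "bump q (m + 2) t = 0" by (simp add: bump_def)
    then show ?thesis using False bump_deriv_outside[of t p m] by (simp add: g)
  qed
  then show "\<exists>g'\<in>{bump p m |p m. True}. \<forall>t. (g has_real_derivative g' t) (at t)" by blast
qed auto

text \<open>A partial derivative of a product of functions of one coordinate each only replaces one
  factor, so derivatives are explicit and stay in the class. It serves both the mollifier and the
  monomials.\<close>

definition tensor :: "('n \<Rightarrow> real \<Rightarrow> real) \<Rightarrow> real^'n::finite \<Rightarrow> real" where
  "tensor \<beta> x = (\<Prod>i\<in>UNIV. \<beta> i (x $ i))"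

lemma tensor_has_derivative:
  fixes \<beta> \<beta>' :: "'n::finite \<Rightarrow> real \<Rightarrow> real"
  assumes "\<And>i t. (\<beta> i has_real_derivative \<beta>' i t) (at t)"
  shows "(tensor \<beta> has_derivative (\<lambda>h. \<Sum>i\<in>UNIV. tensor (\<beta>(i := \<beta>' i)) x * h $ i)) (at x)"
proof -
  have "((\<lambda>x. \<beta> i (x $ i)) has_derivative (\<lambda>h. \<beta>' i (x $ i) * h $ i)) (at x)" for i
  proof -
    have "(\<beta> i has_derivative (\<lambda>h. \<beta>' i (x $ i) * h)) (at (x $ i))"
      using assms by (simp add: has_field_derivative_def)
    moreover have "((\<lambda>x. x $ i) has_derivative (\<lambda>h. h $ i)) (at x)"
      by (rule bounded_linear_imp_has_derivative) (rule bounded_linear_vec_nth)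
    ultimately show ?thesis by (rule has_derivative_compose[rotated])
  qed
  then have "(tensor \<beta> has_derivative
      (\<lambda>h. \<Sum>i\<in>UNIV. \<beta>' i (x $ i) * h $ i * (\<Prod>j\<in>UNIV - {i}. \<beta> j (x $ j)))) (at x)"
    unfolding tensor_def by (intro has_derivative_prod) auto
  moreover have "\<beta>' i (x $ i) * h $ i * (\<Prod>j\<in>UNIV - {i}. \<beta> j (x $ j)) = tensor (\<beta>(i := \<beta>' i)) x * h $ i" for i h
    unfolding tensor_def by (subst prod.remove[of UNIV i]) (auto simp: mult_ac intro!: prod.cong)
  ultimately show ?thesis by simp
qed

lemma partial_eqI:
  fixes f :: "real^'n::finite \<Rightarrow> real"
  assumes "(f has_derivative (\<lambda>h. \<Sum>i\<in>UNIV. G i * h $ i)) (at x)"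
  shows "partial j f x = G j"
proof -
  have "frechet_derivative f (at x) = (\<lambda>h. \<Sum>i\<in>UNIV. G i * h $ i)"
    using assms by (rule frechet_derivative_at[symmetric])
  then show ?thesis
    by (simp add: partial_def axis_def if_distrib[of "\<lambda>x. _ * x"] cong: if_cong)
qed

text \<open>\<open>smooth\<close> iterates \<open>partial\<close> over arbitrary lists of indices;
  the products of smooth factors are closed under each \<open>partial i\<close>.\<close>

lemma smooth_tensor:
  fixes \<beta> :: "'n::finite \<Rightarrow> real \<Rightarrow> real"
  assumes "\<And>i. smooth_real (\<beta> i)"
  shows "smooth (\<lambda>x. c * tensor \<beta> x)"
proof -
  define X where "X = {\<lambda>x. c * tensor \<beta> x | \<beta> :: 'n \<Rightarrow> real \<Rightarrow> real. \<forall>i. smooth_real (\<beta> i)}"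
  have deriv: "\<exists>\<beta>'. (\<forall>i. smooth_real (\<beta>' i)) \<and> (\<forall>x. ((\<lambda>x. c * tensor \<beta> x) has_derivative
      (\<lambda>h. \<Sum>i\<in>UNIV. (c * tensor (\<beta>(i := \<beta>' i)) x) * h $ i)) (at x))"
    if "\<forall>i. smooth_real (\<beta> i)" for \<beta> :: "'n \<Rightarrow> real \<Rightarrow> real"
  proof -
    have "\<forall>i. \<exists>f'. smooth_real f' \<and> (\<forall>t. (\<beta> i has_real_derivative f' t) (at t))"
      using that by (metis smooth_real_deriv)
    from choice[OF this] obtain \<beta>' where \<beta>': "\<And>i. smooth_real (\<beta>' i)"
      "\<And>i t. (\<beta> i has_real_derivative \<beta>' i t) (at t)" by blast
    have "((\<lambda>x. c * tensor \<beta> x) has_derivative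
      (\<lambda>h. c * (\<Sum>i\<in>UNIV. tensor (\<beta>(i := \<beta>' i)) x * h $ i))) (at x)" for x
      by (intro has_derivative_mult_right tensor_has_derivative \<beta>')
    then show ?thesis using \<beta>'(1) by (auto simp: sum_distrib_left mult.assoc)
  qed
  have step: "partial i f \<in> X \<and> f differentiable_on UNIV" if "f \<in> X" for f i
  proof -
    obtain \<beta> where \<beta>: "f = (\<lambda>x. c * tensor \<beta> x)" "\<forall>i. smooth_real (\<beta> i)"
      using \<open>f \<in> X\<close> by (auto simp: X_def)
    obtain \<beta>' where \<beta>': "\<forall>i. smooth_real (\<beta>' i)" "\<forall>x. (f has_derivative
      (\<lambda>h. \<Sum>i\<in>UNIV. (c * tensor (\<beta>(i := \<beta>' i)) x) * h $ i)) (at x)"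
      using deriv[OF \<beta>(2)] \<beta>(1) by blast
    have "partial i f = (\<lambda>x. c * tensor (\<beta>(i := \<beta>' i)) x)"
      by (intro ext partial_eqI[where G = "\<lambda>i. c * tensor (\<beta>(i := \<beta>' i)) x" for x] \<beta>'(2)[rule_format])
    moreover have "\<forall>j. smooth_real ((\<beta>(i := \<beta>' i)) j)" using \<beta>(2) \<beta>'(1) by simp
    ultimately have "partial i f \<in> X" unfolding X_def by blast
    moreover have "f differentiable_on UNIV"
      using \<beta>'(2) by (auto simp: differentiable_on_def differentiable_def intro: has_derivative_at_withinI)
    ultimately show ?thesis by blast
  qed
  have "foldr partial is (\<lambda>x. c * tensor \<beta> x) \<in> X" for "is"
    by (induction "is") (use assms step in \<open>auto simp: X_def\<close>)
  then show ?thesis unfolding smooth_def using step by blast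
qed

text \<open>The gradient \<open>G\<close> is part of the result, with its continuity and support,
  because mollified functions are differentiated on the kernel.\<close>

lemma mollifier_exists:
  fixes \<delta> :: real
  assumes \<delta>: "\<delta> > 0"
  shows "\<exists>(\<rho> :: real^'n::finite \<Rightarrow> real) G.
    (\<forall>z. \<rho> z \<ge> 0) \<and> (\<forall>z. \<rho> z \<noteq> 0 \<longrightarrow> norm z < \<delta>) \<and> integrable lborel \<rho> \<and> (LINT z|lborel. \<rho> z) = 1 \<and>
    (\<forall>y. smooth (\<lambda>x. \<rho> (y - x))) \<and>
    (\<forall>i. continuous_on UNIV (G i) \<and> (\<forall>z. G i z \<noteq> 0 \<longrightarrow> norm z \<le> \<delta>)) \<and>
    (\<forall>z. (\<rho> has_derivative (\<lambda>h. \<Sum>i\<in>UNIV. G i z * h $ i)) (at z))"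
proof -
  define b where "b = bump 1 0"
  have b: "smooth_real b" "b t \<ge> 0" "b t \<noteq> 0 \<longleftrightarrow> \<bar>t\<bar> < 1" for t
    by (auto simp: b_def smooth_bump bump_def split: if_splits)
  \<comment> \<open>Scaling by \<open>a\<close> confines each coordinate to \<delta> divided by the
    dimension, so that the sum of the absolute coordinates, and with it the norm, stays below
    \<delta>.\<close>
  define a where "a = real CARD('n) / \<delta>"
  have a: "a > 0" using \<delta> by (simp add: a_def)
  obtain f' where f': "smooth_real f'" "\<And>t. ((\<lambda>t. b (a * t + 0)) has_real_derivative f' t) (at t)"
    using smooth_real_deriv[OF smooth_real_affine[OF b(1), of a 0]] by blast
  define \<beta> where "\<beta> = (\<lambda>(i::'n) t. b (a * t + 0))"
  define r where "r = tensor \<beta>"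
  have \<beta>s: "smooth_real (\<beta> i)" for i unfolding \<beta>_def by (rule smooth_real_affine[OF b(1)])
  have conttensor: "continuous_on UNIV (tensor \<gamma>)" if "\<And>i. smooth_real (\<gamma> i)" for \<gamma> :: "'n \<Rightarrow> real \<Rightarrow> real"
    unfolding tensor_def
    by (intro continuous_on_prod continuous_on_compose2[OF smooth_real_continuous[OF that]] continuous_intros) auto
  have r0: "r z \<ge> 0" for z unfolding r_def tensor_def \<beta>_def by (intro prod_nonneg) (use b in auto)
  have rsupp: "norm z < \<delta>" if "r z \<noteq> 0" for z
  proof -
    have "\<bar>z $ i\<bar> < 1 / a" for i
      using that a unfolding r_def tensor_def \<beta>_def by (auto simp: b(3) abs_mult field_simps)
    then have "(\<Sum>i\<in>UNIV. \<bar>z $ i\<bar>) < (\<Sum>i\<in>(UNIV::'n set). 1 / a)" by (intro sum_strict_mono) auto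
    also have "\<dots> = \<delta>" by (simp add: a_def)
    finally show ?thesis using norm_le_l1_cart[of z] by linarith
  qed
  have contr: "continuous_on UNIV r" unfolding r_def using \<beta>s by (rule conttensor)
  have intr: "integrable lborel r"
  proof -
    have "integrable lborel (\<lambda>x. indicator (cball 0 \<delta>) x *\<^sub>R r x)"
      by (intro borel_integrable_compact continuous_on_subset[OF contr]) auto
    moreover have "(\<lambda>x. indicator (cball 0 \<delta>) x *\<^sub>R r x) = r"
      using rsupp by (force simp: indicator_def)
    ultimately show ?thesis by simp
  qed
  define Z where "Z = (LINT z|lborel. r z)"
  have "Z > 0"
  proof -
    have r00: "r 0 \<noteq> 0" by (simp add: r_def tensor_def \<beta>_def b(3))
    have "Z \<noteq> 0"
    proof
      assume "Z = 0"
      then have "AE z in lborel. r z = 0"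
        using integral_nonneg_eq_0_iff_AE[OF intr] r0 by (simp add: Z_def)
      moreover have "{z. r z \<noteq> 0} \<in> sets lborel"
        using contr by (auto intro!: borel_open open_Collect_neq continuous_intros)
      ultimately have "{z. r z \<noteq> 0} \<in> null_sets lborel"
        by (auto simp: AE_iff_null_sets)
      then have "negligible {z. r z \<noteq> 0}"
        by (auto simp: negligible_iff_null_sets intro: null_sets_completionI)
      moreover have "open {z. r z \<noteq> 0}" using contr by (intro open_Collect_neq continuous_intros) auto
      ultimately show False using r00 open_not_negligible by blast
    qed
    moreover have "Z \<ge> 0" unfolding Z_def using r0 by simp
    ultimately show ?thesis by simp
  qed
  define \<rho> where "\<rho> z = (1 / Z) * r z" for z
  define G where "G i z = (1 / Z) * tensor (\<beta>(i := f')) z" for i z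
  have der: "(\<rho> has_derivative (\<lambda>h. \<Sum>i\<in>UNIV. G i z * h $ i)) (at z)" for z
  proof -
    have "((\<lambda>x. (1 / Z) * tensor \<beta> x) has_derivative
      (\<lambda>h. (1 / Z) * (\<Sum>i\<in>UNIV. tensor (\<beta>(i := f')) z * h $ i))) (at z)"
      by (intro has_derivative_mult_right tensor_has_derivative) (use f' in \<open>simp add: \<beta>_def\<close>)
    then show ?thesis by (simp add: \<rho>_def[abs_def] r_def G_def sum_distrib_left mult.assoc)
  qed
  \<comment> \<open>Where the norm exceeds \<delta> the kernel vanishes in a neighbourhood, hence so
    does its derivative; the argument says nothing on the sphere, whence the bound that is not
    strict.\<close>
  have Gsupp: "norm z \<le> \<delta>" if "G i z \<noteq> 0" for i z
  proof (rule ccontr)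
    assume z: "\<not> norm z \<le> \<delta>"
    have "open {z. norm z > \<delta>}" by (intro open_Collect_less continuous_intros)
    moreover have "0 = \<rho> w" if "w \<in> {z. norm z > \<delta>}" for w
      using that rsupp[of w] by (cases "r w = 0") (auto simp: \<rho>_def)
    ultimately have "(\<rho> has_derivative (\<lambda>h. 0)) (at z)"
      using z by (intro has_derivative_transform_within_open[OF has_derivative_const]) auto
    then have "(\<lambda>h. \<Sum>i\<in>UNIV. G i z * h $ i) = (\<lambda>h. 0)"
      using der has_derivative_unique by blast
    then have "(\<Sum>j\<in>UNIV. G j z * axis i 1 $ j) = 0" by meson
    then show False
      using that by (simp add: axis_def if_distrib[of "\<lambda>x. _ * x"] cong: if_cong)
  qed
  have sm: "smooth (\<lambda>x. \<rho> (y - x))" for y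
  proof -
    have "(\<lambda>x. \<rho> (y - x)) = (\<lambda>x. (1 / Z) * tensor (\<lambda>i t. b ((- a) * t + a * y $ i)) x)"
      by (auto simp: \<rho>_def r_def tensor_def \<beta>_def algebra_simps)
    moreover have "smooth (\<lambda>x. (1 / Z) * tensor (\<lambda>i t. b ((- a) * t + a * y $ i)) x)"
      by (intro smooth_tensor smooth_real_affine b(1))
    ultimately show ?thesis by (simp only:)
  qed
  have Gcont: "continuous_on UNIV (G i)" for i
    unfolding G_def by (intro continuous_intros conttensor) (use \<beta>s f' in auto)
  show ?thesis
  proof (intro exI[of _ \<rho>] exI[of _ G] conjI allI impI)
    show "(LINT z|lborel. \<rho> z) = 1" using \<open>Z > 0\<close> by (simp add: \<rho>_def Z_def)
    show "integrable lborel \<rho>" unfolding \<rho>_def using intr by simp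
  qed (use r0 rsupp \<open>Z > 0\<close> sm Gcont Gsupp der in \<open>auto simp: \<rho>_def\<close>)
qed

section \<open>Continuous representatives of Lipschitz functions in the weak sense\<close>

lemma Linf_AE_bound:
  assumes "Linf S f"
  obtains C where "C \<ge> 0" "AE x in lebesgue_on S. \<bar>f x\<bar> \<le> C"
proof -
  define E where "E = esssup (lebesgue_on S) (\<lambda>x. ereal \<bar>f x\<bar>)"
  have ae: "AE x in lebesgue_on S. ereal \<bar>f x\<bar> \<le> E" unfolding E_def by (rule esssup_AE)
  have "E < \<infinity>" using assms by (simp add: Linf_def E_def)
  show ?thesis
  \<comment> \<open>The absolute value also covers \<open>E = -\<infinity>\<close>, which occurs
    when \<open>S\<close> is a null set and the bound is vacuous.\<close>
  proof (rule that[of "\<bar>real_of_ereal E\<bar>"])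
    show "AE x in lebesgue_on S. \<bar>f x\<bar> \<le> \<bar>real_of_ereal E\<bar>"
      using ae by eventually_elim (use \<open>E < \<infinity>\<close> in \<open>cases E; simp\<close>)
  qed (rule abs_ge_zero)
qed

lemma lborel_distr_reflect: "distr lborel borel (\<lambda>x. y - x) = (lborel :: 'a::euclidean_space measure)"
proof -
  have "lborel = density (distr lborel borel (\<lambda>x. y + (- 1) *\<^sub>R x)) (\<lambda>_. ennreal (\<bar>- 1 :: real\<bar> ^ DIM('a)))"
    by (rule lborel_affine) simp
  then show ?thesis by (simp add: density_1)
qed

section \<open>Convolution with a mollifier and convergence in L1\<close>

definition mollify :: "('a::euclidean_space \<Rightarrow> real) \<Rightarrow> ('a \<Rightarrow> real) \<Rightarrow> 'a \<Rightarrow> real" where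
  "mollify \<rho> g y = (LINT z|lborel. g z * \<rho> (y - z))"

locale mollifier =
  fixes \<rho> :: "'a::euclidean_space \<Rightarrow> real" and \<delta> :: real
  assumes nonneg: "\<rho> z \<ge> 0" and supp: "\<rho> z \<noteq> 0 \<Longrightarrow> norm z < \<delta>"
    and integrable: "integrable lborel \<rho>" and integral: "(LINT z|lborel. \<rho> z) = 1"
begin

abbreviation "conv \<equiv> mollify \<rho>"

lemma measurable_kernel [measurable]: "\<rho> \<in> borel_measurable borel"
  using borel_measurable_integrable[OF integrable] by simp

lemma integrable_reflect: "integrable lborel (\<lambda>z. \<rho> (y - z))"
proof -
  have "integrable (distr lborel borel (\<lambda>x. y - x)) \<rho>"
    unfolding lborel_distr_reflect by (rule integrable)
  then show ?thesis by (subst (asm) integrable_distr_eq) auto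
qed

lemma integral_reflect: "(LINT z|lborel. \<rho> (y - z)) = 1"
proof -
  have "(LINT z|lborel. \<rho> z) = (LINT z|distr lborel borel (\<lambda>x. y - x). \<rho> z)"
    by (simp only: lborel_distr_reflect)
  also have "\<dots> = (LINT z|lborel. \<rho> (y - z))" by (rule integral_distr) auto
  finally show ?thesis by (simp add: integral)
qed

lemma integrable_conv:
  assumes [measurable]: "g \<in> borel_measurable borel" and B: "\<And>x. \<bar>g x\<bar> \<le> B"
  shows "integrable lborel (\<lambda>z. g z * \<rho> (y - z))"
proof (rule Bochner_Integration.integrable_bound)
  show "integrable lborel (\<lambda>z. B * \<rho> (y - z))" using integrable_reflect by simp
  show "AE x in lborel. norm (g x * \<rho> (y - x)) \<le> norm (B * \<rho> (y - x))"
  proof (rule AE_I2)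
    fix x show "norm (g x * \<rho> (y - x)) \<le> norm (B * \<rho> (y - x))"
      using B[of x] nonneg[of "y - x"] by (auto simp: abs_mult intro: mult_right_mono)
  qed
qed measurable

lemma measurable_conv [measurable]:
  assumes [measurable]: "g \<in> borel_measurable borel"
  shows "conv g \<in> borel_measurable borel"
  unfolding mollify_def by (rule lborel.borel_measurable_lebesgue_integral) measurable

lemma conv_diff:
  assumes "g \<in> borel_measurable borel" "\<And>x. \<bar>g x\<bar> \<le> B" "h \<in> borel_measurable borel" "\<And>x. \<bar>h x\<bar> \<le> B'"
  shows "conv (\<lambda>x. g x - h x) y = conv g y - conv h y"
  unfolding mollify_def left_diff_distrib
  by (intro Bochner_Integration.integral_diff integrable_conv[OF assms(1,2)] integrable_conv[OF assms(3,4)])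

text \<open>Convolution is an average of total mass one over points closer than \<delta>. With
  \<open>c = 0\<close> this gives boundedness, with \<open>c = g y\<close> it exploits uniform
  continuity.\<close>

lemma conv_near:
  assumes "g \<in> borel_measurable borel" "\<And>x. \<bar>g x\<bar> \<le> B"
    and e: "\<And>z. norm (y - z) < \<delta> \<Longrightarrow> \<bar>g z - c\<bar> \<le> e"
  shows "\<bar>conv g y - c\<bar> \<le> e"
proof -
  have i1: "integrable lborel (\<lambda>z. g z * \<rho> (y - z))" by (rule integrable_conv[OF assms(1,2)])
  have i2: "integrable lborel (\<lambda>z. c' * \<rho> (y - z))" for c' using integrable_reflect by simp
  have "conv g y - c = (LINT z|lborel. g z * \<rho> (y - z)) - (LINT z|lborel. c * \<rho> (y - z))"
    by (simp add: mollify_def integral_reflect)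
  also have "\<dots> = (LINT z|lborel. g z * \<rho> (y - z) - c * \<rho> (y - z))"
    using i1 i2 by (rule Bochner_Integration.integral_diff[symmetric])
  finally have "\<bar>conv g y - c\<bar> \<le> (LINT z|lborel. \<bar>g z * \<rho> (y - z) - c * \<rho> (y - z)\<bar>)"
    by simp
  also have "\<dots> \<le> (LINT z|lborel. e * \<rho> (y - z))"
  proof (rule integral_mono)
    show "integrable lborel (\<lambda>z. \<bar>g z * \<rho> (y - z) - c * \<rho> (y - z)\<bar>)"
      by (intro Bochner_Integration.integrable_abs Bochner_Integration.integrable_diff i1 i2)
    show "\<bar>g z * \<rho> (y - z) - c * \<rho> (y - z)\<bar> \<le> e * \<rho> (y - z)" for z
      using supp[of "y - z"] e[of z] nonneg[of "y - z"]
      by (cases "\<rho> (y - z) = 0") (auto simp: abs_mult left_diff_distrib[symmetric] intro: mult_right_mono)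
  qed (rule i2)
  finally show ?thesis by (simp add: integral_reflect)
qed

text \<open>Young's inequality for the exponent 1, by Fubini and the unit mass of the kernel. Where
  the integrand is not integrable its Bochner integral is 0, so the pointwise bound holds for every
  \<open>y\<close>.\<close>

lemma conv_L1_le:
  assumes [measurable]: "g \<in> borel_measurable borel" and g: "integrable lborel g"
  shows "(\<integral>\<^sup>+y. ennreal \<bar>conv g y\<bar> \<partial>lborel) \<le> ennreal (LINT z|lborel. \<bar>g z\<bar>)"
proof -
  have "(\<integral>\<^sup>+y. ennreal \<bar>conv g y\<bar> \<partial>lborel) \<le> (\<integral>\<^sup>+y. (\<integral>\<^sup>+z. ennreal \<bar>g z * \<rho> (y - z)\<bar> \<partial>lborel) \<partial>lborel)"
    unfolding mollify_def
  proof (rule nn_integral_mono)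
    fix y
    show "ennreal \<bar>LINT z|lborel. g z * \<rho> (y - z)\<bar> \<le> (\<integral>\<^sup>+z. ennreal \<bar>g z * \<rho> (y - z)\<bar> \<partial>lborel)"
      using integral_norm_bound_ennreal[of lborel "\<lambda>z. g z * \<rho> (y - z)"]
      by (cases "integrable lborel (\<lambda>z. g z * \<rho> (y - z))") (simp_all add: not_integrable_integral_eq)
  qed
  also have "\<dots> = (\<integral>\<^sup>+z. (\<integral>\<^sup>+y. ennreal \<bar>g z * \<rho> (y - z)\<bar> \<partial>lborel) \<partial>lborel)"
    by (rule lborel_pair.Fubini') measurable
  also have "\<dots> = (\<integral>\<^sup>+z. ennreal \<bar>g z\<bar> * (\<integral>\<^sup>+y. ennreal (\<rho> (y + (- z))) \<partial>lborel) \<partial>lborel)"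
    using nonneg by (intro nn_integral_cong)
      (subst nn_integral_cmult[symmetric], auto simp: abs_mult ennreal_mult)
  also have "\<dots> = (\<integral>\<^sup>+z. ennreal \<bar>g z\<bar> \<partial>lborel)"
  proof (intro nn_integral_cong)
    fix z
    have "(\<integral>\<^sup>+y. ennreal (\<rho> (y + (- z))) \<partial>lborel) = (\<integral>\<^sup>+y. ennreal (\<rho> y) \<partial>lborel)"
      by (rule nn_integral_lborel_translate) measurable
    also have "\<dots> = 1" using integrable nonneg integral by (subst nn_integral_eq_integral) auto
    finally show "ennreal \<bar>g z\<bar> * (\<integral>\<^sup>+y. ennreal (\<rho> (y + (- z))) \<partial>lborel) = ennreal \<bar>g z\<bar>" by simp
  qed
  also have "\<dots> = ennreal (LINT z|lborel. \<bar>g z\<bar>)"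
    using g by (intro nn_integral_eq_integral) auto
  finally show ?thesis .
qed

lemma conv_support:
  assumes "\<And>x. g x \<noteq> 0 \<Longrightarrow> norm x \<le> R" "norm y > R + \<delta>"
  shows "conv g y = 0"
proof -
  have "(\<lambda>z. g z * \<rho> (y - z)) = (\<lambda>z. 0)"
  proof
    fix z
    have "norm z > R" if "\<rho> (y - z) \<noteq> 0"
      using supp[OF that] norm_triangle_sub[of y z] assms(2) by linarith
    then show "g z * \<rho> (y - z) = 0" using assms(1)[of z] by fastforce
  qed
  then show ?thesis by (simp add: mollify_def)
qed

end

text \<open>A measurable function is an almost everywhere limit of continuous ones. Clipping them at
  \<open>C\<close> and multiplying by the cutoff \<zeta> provides a dominating function and does not
  change the limit, as \<open>f\<close> obeys the same bounds.\<close>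

lemma continuous_L1_approximation:
  fixes f :: "'a::euclidean_space \<Rightarrow> real"
  assumes [measurable]: "f \<in> borel_measurable borel" and C: "\<And>x. \<bar>f x\<bar> \<le> C"
    and R: "\<And>x. f x \<noteq> 0 \<Longrightarrow> norm x \<le> R" and e: "e > 0"
  obtains g where "continuous_on UNIV g" "\<And>x. \<bar>g x\<bar> \<le> C" "\<And>x. g x \<noteq> 0 \<Longrightarrow> norm x \<le> R + 1"
    "(LINT x|lborel. \<bar>f x - g x\<bar>) < e"
proof -
  have C0: "C \<ge> 0" using C[of 0] by linarith
  have "f measurable_on UNIV"
    by (rule lebesgue_measurable_imp_measurable_on) (auto intro: measurable_completion)
  then obtain N h where N: "negligible N" and h: "\<And>n. continuous_on UNIV (h n)"
    "\<And>x. x \<notin> N \<Longrightarrow> (\<lambda>n. h n x) \<longlonglongrightarrow> f x"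
    by (auto simp: measurable_on_def)
  define \<zeta> where "\<zeta> x = max 0 (min 1 (R + 1 - norm x))" for x :: 'a
  define g where "g n x = \<zeta> x * max (- C) (min C (h n x))" for n x
  have cont: "continuous_on UNIV (g n)" for n
    unfolding g_def \<zeta>_def by (intro continuous_intros h)
  have \<zeta>: "0 \<le> \<zeta> x" "\<zeta> x \<le> 1" for x by (auto simp: \<zeta>_def)
  have bound: "\<bar>g n x\<bar> \<le> C" for n x
  proof -
    have "\<bar>max (- C) (min C (h n x))\<bar> \<le> C" using C0 by auto
    then have "\<bar>\<zeta> x\<bar> * \<bar>max (- C) (min C (h n x))\<bar> \<le> 1 * C"
      using \<zeta>[of x] C0 by (intro mult_mono) auto
    then show ?thesis by (simp add: g_def abs_mult)
  qed
  have suppg: "norm x \<le> R + 1" if "g n x \<noteq> 0" for n x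
    using that by (auto simp: g_def \<zeta>_def max_def min_def split: if_splits)
  have [measurable]: "g n \<in> borel_measurable borel" for n
    using cont by (rule borel_measurable_continuous_onI)
  have lim: "(\<lambda>n. g n x) \<longlonglongrightarrow> f x" if "x \<notin> N" for x
  proof -
    have "(\<lambda>n. g n x) \<longlonglongrightarrow> \<zeta> x * max (- C) (min C (f x))"
      unfolding g_def by (intro tendsto_intros h that)
    moreover have "\<zeta> x * max (- C) (min C (f x)) = f x"
      using C[of x] R[of x] by (cases "f x = 0") (auto simp: \<zeta>_def max_def min_def)
    ultimately show ?thesis by simp
  qed
  have "(\<lambda>n. LINT x|lborel. \<bar>f x - g n x\<bar>) \<longlonglongrightarrow> integral\<^sup>L lborel (\<lambda>x::'a. 0::real)"
  proof (rule integral_dominated_convergence)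
    show "integrable lborel (\<lambda>x::'a. 2 * C * indicator (cball 0 (R + 1)) x)"
      using emeasure_lborel_cball_finite[of "0::'a" "R + 1"] by simp
    show "AE x in lborel. (\<lambda>n. \<bar>f x - g n x\<bar>) \<longlonglongrightarrow> 0"
      using AE_lborel_negligible[OF N]
    proof eventually_elim
      case (elim x)
      have "(\<lambda>n. \<bar>f x - g n x\<bar>) \<longlonglongrightarrow> \<bar>f x - f x\<bar>" by (intro tendsto_intros lim elim)
      then show ?case by simp
    qed
    show "AE x in lborel. norm \<bar>f x - g n x\<bar> \<le> 2 * C * indicator (cball 0 (R + 1)) x" for n
    proof (rule AE_I2)
      fix x
      show "norm \<bar>f x - g n x\<bar> \<le> 2 * C * indicator (cball 0 (R + 1)) x"
        using C[of x] bound[of n x] suppg[of n x] R[of x]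
        by (cases "norm x \<le> R + 1") (force simp: indicator_def)+
    qed
  qed measurable
  then have "\<forall>\<^sub>F n in sequentially. (LINT x|lborel. \<bar>f x - g n x\<bar>) < e"
    using e by (intro order_tendstoD) auto
  then obtain n where "(LINT x|lborel. \<bar>f x - g n x\<bar>) < e"
    by (auto simp: eventually_sequentially)
  then show ?thesis using that[of "g n"] cont bound suppg by blast
qed

text \<open>Split over a continuous \<open>g\<close> close to \<open>f\<close>: two parts are small
  because mollification does not increase the L1 norm, the middle one because \<open>g\<close> is
  uniformly continuous on a compact set.\<close>

lemma mollify_L1_tendsto:
  fixes f :: "'a::euclidean_space \<Rightarrow> real" and \<rho> :: "nat \<Rightarrow> 'a \<Rightarrow> real"
  assumes mol: "\<And>j. mollifier (\<rho> j) (\<delta> j)" and \<delta>: "\<delta> \<longlonglongrightarrow> 0" "\<And>j. \<delta> j \<le> 1"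
    and [measurable]: "f \<in> borel_measurable borel" and C: "\<And>x. \<bar>f x\<bar> \<le> C"
    and R: "\<And>x. f x \<noteq> 0 \<Longrightarrow> norm x \<le> R"
  shows "integrable lborel (\<lambda>y. mollify (\<rho> j) f y - f y)"
    and "(\<lambda>j. LINT y|lborel. \<bar>mollify (\<rho> j) f y - f y\<bar>) \<longlonglongrightarrow> 0"
proof -
  have nice: "integrable lborel g" if "g \<in> borel_measurable borel" "\<And>x. \<bar>g x\<bar> \<le> B" "\<And>x. g x \<noteq> 0 \<Longrightarrow> norm x \<le> r"
    for g :: "'a \<Rightarrow> real" and B r
    by (rule integrable_bounded_support[where A = "cball 0 r" and B = B]) (use that in force)+
  have conv_bound: "\<bar>mollify (\<rho> j) g y\<bar> \<le> B" if "g \<in> borel_measurable borel" "\<And>x. \<bar>g x\<bar> \<le> B" for g B j y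
    using mollifier.conv_near[OF mol[of j] that, where y = y and c = 0 and e = B] that(2) by simp
  have conv_supp: "norm y \<le> r + 1" if "mollify (\<rho> j) g y \<noteq> 0" "\<And>x. g x \<noteq> 0 \<Longrightarrow> norm x \<le> r" for g r j y
    using mollifier.conv_support[OF mol[of j] that(2), where y = y] that(1) \<delta>(2)[of j] by force
  have meas: "mollify (\<rho> j) g \<in> borel_measurable borel" if "g \<in> borel_measurable borel" for g j
    by (rule mollifier.measurable_conv[OF mol[of j] that])
  have intconv: "integrable lborel (mollify (\<rho> j) g)"
    if g: "g \<in> borel_measurable borel" "\<And>x. \<bar>g x\<bar> \<le> B" "\<And>x. g x \<noteq> 0 \<Longrightarrow> norm x \<le> r" for g B r j
    by (rule nice[OF meas[OF g(1)] conv_bound[OF g(1,2)] conv_supp[OF _ g(3)]])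
  have intf: "integrable lborel f" by (rule nice[OF _ C R]) auto
  show "integrable lborel (\<lambda>y. mollify (\<rho> j) f y - f y)" for j
    by (intro Bochner_Integration.integrable_diff intf intconv[OF _ C R]) auto
  show "(\<lambda>j. LINT y|lborel. \<bar>mollify (\<rho> j) f y - f y\<bar>) \<longlonglongrightarrow> 0"
  proof (rule LIMSEQ_I)
    fix e :: real assume e: "e > 0"
    obtain g where g: "continuous_on UNIV g" "\<And>x. \<bar>g x\<bar> \<le> C" "\<And>x. g x \<noteq> 0 \<Longrightarrow> norm x \<le> R + 1"
      "(LINT x|lborel. \<bar>f x - g x\<bar>) < e / 4"
      using continuous_L1_approximation[of f C R "e / 4"] C R e by auto
    have [measurable]: "g \<in> borel_measurable borel" using g(1) by (rule borel_measurable_continuous_onI)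
    \<comment> \<open>Radii: \<open>g\<close> lives in \<open>R + 1\<close>, its mollification in
      \<open>R + 2\<close> as \<open>\<delta> j \<le> 1\<close>, and the values averaged there are
      taken in \<open>R + 3\<close>. With \<open>e'\<close> the uniform error integrates to at most
      \<open>e / 4\<close>.\<close>
    define V where "V = measure lborel (cball (0::'a) (R + 2))"
    define e' where "e' = e / (4 * (V + 1))"
    have V: "V \<ge> 0" by (simp add: V_def)
    then have e': "e' > 0" using e by (simp add: e'_def)
    have "uniformly_continuous_on (cball 0 (R + 3)) g"
      by (intro compact_uniformly_continuous continuous_on_subset[OF g(1)]) auto
    then obtain d where d: "d > 0" "\<And>x x'. x \<in> cball 0 (R + 3) \<Longrightarrow> x' \<in> cball 0 (R + 3) \<Longrightarrow> dist x' x < d \<Longrightarrow> dist (g x') (g x) < e'"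
      unfolding uniformly_continuous_on_def using e' by metis
    obtain j0 where j0: "\<And>j. j \<ge> j0 \<Longrightarrow> \<delta> j < d"
      using order_tendstoD(2)[OF \<delta>(1) d(1)] by (auto simp: eventually_sequentially)
    show "\<exists>j0. \<forall>j\<ge>j0. norm ((LINT y|lborel. \<bar>mollify (\<rho> j) f y - f y\<bar>) - 0) < e"
    proof (intro exI[of _ j0] allI impI)
      fix j assume j: "j \<ge> j0"
      interpret mollifier "\<rho> j" "\<delta> j" by (rule mol)
      have intg: "integrable lborel g" by (rule nice[OF _ g(2,3)]) auto
      have intcf: "integrable lborel (conv f)" by (rule intconv[OF _ C R]) auto
      have intcg: "integrable lborel (conv g)" by (rule intconv[OF _ g(2,3)]) auto
      have near: "\<bar>conv g y - g y\<bar> \<le> e' * indicator (cball 0 (R + 2)) y" for y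
      proof (cases "norm y \<le> R + 2")
        case True
        have "\<bar>conv g y - g y\<bar> \<le> e'"
        proof (rule conv_near[OF _ g(2)])
          fix z assume z: "norm (y - z) < \<delta> j"
          then have "norm z \<le> R + 3" using True norm_triangle_sub[of z y] \<delta>(2)[of j] by (simp add: norm_minus_commute)
          then have "dist (g z) (g y) < e'"
            using z j0[OF j] True by (intro d(2)) (auto simp: dist_norm norm_minus_commute)
          then show "\<bar>g z - g y\<bar> \<le> e'" by (simp add: dist_real_def)
        qed measurable
        then show ?thesis using True by simp
      next
        case False
        then have "g y = 0" "conv g y = 0" using g(3)[of y] conv_supp[of j g y "R + 1"] g(3) by force+
        then show ?thesis using e' by simp
      qed
      have a: "(LINT y|lborel. \<bar>conv f y - conv g y\<bar>) \<le> e / 4"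
      proof -
        have i: "integrable lborel (\<lambda>y. f y - g y)" using intf intg by simp
        have "(\<integral>\<^sup>+y. ennreal \<bar>conv (\<lambda>x. f x - g x) y\<bar> \<partial>lborel) \<le> ennreal (LINT z|lborel. \<bar>f z - g z\<bar>)"
          by (rule conv_L1_le) (use i in auto)
        then have "(\<integral>\<^sup>+y. ennreal \<bar>conv f y - conv g y\<bar> \<partial>lborel) \<le> ennreal (LINT z|lborel. \<bar>f z - g z\<bar>)"
          using conv_diff[OF _ C _ g(2)] by simp
        moreover have "(\<integral>\<^sup>+y. ennreal \<bar>conv f y - conv g y\<bar> \<partial>lborel) = ennreal (LINT y|lborel. \<bar>conv f y - conv g y\<bar>)"
          using intcf intcg by (intro nn_integral_eq_integral) auto
        ultimately have "(LINT y|lborel. \<bar>conv f y - conv g y\<bar>) \<le> (LINT z|lborel. \<bar>f z - g z\<bar>)"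
          by (simp add: ennreal_le_iff)
        then show ?thesis using g(4) by linarith
      qed
      have b: "(LINT y|lborel. \<bar>conv g y - g y\<bar>) \<le> e / 4"
      proof -
        have fin: "emeasure lborel (cball (0::'a) (R + 2)) < \<infinity>" by (rule emeasure_lborel_cball_finite)
        have "(LINT y|lborel. \<bar>conv g y - g y\<bar>) \<le> (LINT y|lborel. e' * indicator (cball (0::'a) (R + 2)) y)"
          by (intro integral_mono near) (use intcg intg fin in auto)
        also have "\<dots> = e' * V" by (simp add: V_def)
        also have "\<dots> \<le> e / 4" using V e by (simp add: e'_def field_simps)
        finally show ?thesis .
      qed
      have "(LINT y|lborel. \<bar>conv f y - f y\<bar>) \<le>
          (LINT y|lborel. \<bar>conv f y - conv g y\<bar> + \<bar>conv g y - g y\<bar> + \<bar>f y - g y\<bar>)"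
        by (intro integral_mono) (use intcf intcg intg intf in auto)
      also have "\<dots> = (LINT y|lborel. \<bar>conv f y - conv g y\<bar>) + (LINT y|lborel. \<bar>conv g y - g y\<bar>) + (LINT y|lborel. \<bar>f y - g y\<bar>)"
        using intcf intcg intg intf by simp
      also have "\<dots> < e" using a b g(4) e by linarith
      finally show "norm ((LINT y|lborel. \<bar>conv f y - f y\<bar>) - 0) < e" by simp
    qed
  qed
qed

text \<open>The difference quotients of \<open>k\<close> are bounded by \<open>B\<close> through the
  mean value inequality, so \<open>\<bar>f\<bar> * B\<close> dominates.\<close>

lemma deriv_under_integral:
  fixes f :: "'a \<Rightarrow> real" and k k' :: "real \<Rightarrow> 'a \<Rightarrow> real"
  assumes f: "integrable M f"
    and k: "\<And>t z. ((\<lambda>t. k t z) has_real_derivative k' t z) (at t)" and B: "\<And>t z. \<bar>k' t z\<bar> \<le> B"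
    and int: "\<And>t. integrable M (\<lambda>z. f z * k t z)" and meas: "\<And>t. k' t \<in> borel_measurable M"
  shows "((\<lambda>t. LINT z|M. f z * k t z) has_real_derivative (LINT z|M. f z * k' t z)) (at t)"
  unfolding has_field_derivative_iff tendsto_at_iff_sequentially
proof (intro allI impI)
  fix X :: "nat \<Rightarrow> real" assume X: "\<forall>i. X i \<in> UNIV - {t}" "X \<longlonglongrightarrow> t"
  have [measurable]: "f \<in> borel_measurable M" using f by auto
  define q where "q i z = f z * ((k (X i) z - k t z) / (X i - t))" for i z
  have q: "q i = (\<lambda>z. (f z * k (X i) z - f z * k t z) / (X i - t))" for i
    by (auto simp: q_def right_diff_distrib)
  have intq: "integrable M (q i)" for i
    unfolding q using int by auto
  have "(\<lambda>i. LINT z|M. q i z) \<longlonglongrightarrow> (LINT z|M. f z * k' t z)"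
  proof (rule integral_dominated_convergence[where w = "\<lambda>z. \<bar>f z\<bar> * B"])
    show "(\<lambda>z. f z * k' t z) \<in> borel_measurable M" using meas by measurable
    show "q i \<in> borel_measurable M" for i using intq by auto
    show "integrable M (\<lambda>z. \<bar>f z\<bar> * B)" using f by auto
    show "AE z in M. (\<lambda>i. q i z) \<longlonglongrightarrow> f z * k' t z"
    proof (rule AE_I2)
      fix z
      have "((\<lambda>s. (k s z - k t z) / (s - t)) \<longlongrightarrow> k' t z) (at t)"
        using k by (simp add: has_field_derivative_iff)
      then have "(\<lambda>i. (k (X i) z - k t z) / (X i - t)) \<longlonglongrightarrow> k' t z"
        using X unfolding tendsto_at_iff_sequentially by (auto simp: comp_def)
      then show "(\<lambda>i. q i z) \<longlonglongrightarrow> f z * k' t z" unfolding q_def by (intro tendsto_intros)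
    qed
    show "AE z in M. norm (q i z) \<le> \<bar>f z\<bar> * B" for i
    proof (rule AE_I2)
      fix z
      have "norm (k (X i) z - k t z) \<le> B * norm (X i - t)"
        by (rule field_differentiable_bound[of UNIV "\<lambda>t. k t z" "\<lambda>t. k' t z"])
          (use k B in \<open>auto intro: has_field_derivative_at_within\<close>)
      moreover have "\<bar>X i - t\<bar> > 0" using X by simp
      ultimately have "\<bar>(k (X i) z - k t z) / (X i - t)\<bar> \<le> B"
        by (simp add: abs_divide pos_divide_le_eq)
      then have "\<bar>f z\<bar> * \<bar>(k (X i) z - k t z) / (X i - t)\<bar> \<le> \<bar>f z\<bar> * B"
        by (rule mult_left_mono) simp
      then show "norm (q i z) \<le> \<bar>f z\<bar> * B"
        by (simp add: q_def abs_mult)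
    qed
  qed
  moreover have "(LINT z|M. q i z) = ((LINT z|M. f z * k (X i) z) - (LINT z|M. f z * k t z)) / (X i - t)" for i
    unfolding q using int by simp
  ultimately show "((\<lambda>s. ((LINT z|M. f z * k s z) - (LINT z|M. f z * k t z)) / (s - t)) \<circ> X)
      \<longlonglongrightarrow> (LINT z|M. f z * k' t z)"
    by (simp add: comp_def)
qed

lemma integral_lebesgue_on_borel:
  fixes h :: "'a::euclidean_space \<Rightarrow> real"
  assumes [measurable]: "S \<in> sets borel" "h \<in> borel_measurable borel"
  shows "(LINT x|lebesgue_on S. h x) = (LINT x|lborel. indicator S x * h x)"
proof -
  have "(LINT x|lebesgue_on S. h x) = (LINT x|lebesgue. indicator S x * h x)"
    by (subst integral_restrict_space) auto
  also have "\<dots> = (LINT x|lborel. indicator S x * h x)"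
    by (rule integral_completion) measurable
  finally show ?thesis .
qed

text \<open>The derivative along the segment falls on the kernel, so \<open>f\<close> needs no
  regularity. Only the smoothed derivatives at points of the segment have to be bounded, which keeps
  the estimate local.\<close>

lemma mollified_lipschitz_segment:
  fixes f :: "real^'n::finite \<Rightarrow> real"
  assumes f: "integrable lborel f" and fB: "\<And>x. \<bar>f x\<bar> \<le> B"
    and \<rho>: "mollifier \<rho> \<delta>"
    and G: "\<And>i. continuous_on UNIV (G i)" "\<And>i z. \<bar>G i z\<bar> \<le> D"
    and der: "\<And>z. (\<rho> has_derivative (\<lambda>h. \<Sum>i\<in>UNIV. G i z * h $ i)) (at z)"
    and C: "\<And>i z. z \<in> closed_segment x y \<Longrightarrow> \<bar>LINT w|lborel. f w * G i (z - w)\<bar> \<le> C i"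
  shows "\<bar>mollify \<rho> f x - mollify \<rho> f y\<bar> \<le> (\<Sum>i\<in>UNIV. C i) * dist x y"
proof -
  have [measurable]: "f \<in> borel_measurable borel" using borel_measurable_integrable[OF f] by simp
  have [measurable]: "G i \<in> borel_measurable borel" for i using G(1) by (rule borel_measurable_continuous_onI)
  interpret mollifier \<rho> \<delta> by (rule \<rho>)
  define p where "p t = x + t *\<^sub>R (y - x)" for t
  define k where "k t z = \<rho> (p t - z)" for t z
  define k' where "k' t z = (\<Sum>i\<in>UNIV. G i (p t - z) * (y - x) $ i)" for t z
  define A where "A t = (\<Sum>i\<in>UNIV. (y - x) $ i * (LINT w|lborel. f w * G i (p t - w)))" for t
  have int: "integrable lborel (\<lambda>w. f w * G i (p t - w))" for i t
  proof (rule Bochner_Integration.integrable_bound)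
    show "integrable lborel (\<lambda>w. D * f w)" using f by simp
    show "AE w in lborel. norm (f w * G i (p t - w)) \<le> norm (D * f w)"
    proof (rule AE_I2)
      fix w
      have "\<bar>G i (p t - w)\<bar> \<le> \<bar>D\<bar>" using G(2)[of i "p t - w"] by linarith
      then have "\<bar>f w\<bar> * \<bar>G i (p t - w)\<bar> \<le> \<bar>f w\<bar> * \<bar>D\<bar>"
        by (rule mult_left_mono) simp
      then show "norm (f w * G i (p t - w)) \<le> norm (D * f w)"
        by (simp add: abs_mult mult.commute)
    qed
  qed measurable
  have dk: "((\<lambda>t. k t z) has_real_derivative k' t z) (at t)" for t z
  proof -
    have "((\<lambda>t. p t - z) has_derivative (\<lambda>h. h *\<^sub>R (y - x))) (at t)"
      unfolding p_def by (auto intro!: derivative_eq_intros)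
    from has_derivative_compose[OF this der]
    have "((\<lambda>t. k t z) has_derivative (\<lambda>h. \<Sum>i\<in>UNIV. G i (p t - z) * (h *\<^sub>R (y - x)) $ i)) (at t)"
      by (simp add: k_def)
    moreover have "(\<lambda>h. \<Sum>i\<in>UNIV. G i (p t - z) * (h *\<^sub>R (y - x)) $ i) = (*) (k' t z)"
      by (auto simp: k'_def sum_distrib_left sum_distrib_right mult_ac intro!: sum.cong)
    ultimately show ?thesis by (simp add: has_field_derivative_def)
  qed
  have dF: "((\<lambda>t. LINT z|lborel. f z * k t z) has_real_derivative (LINT z|lborel. f z * k' t z)) (at t)" for t
  proof (rule deriv_under_integral[OF f dk])
    show "\<bar>k' t z\<bar> \<le> (\<Sum>i\<in>UNIV. D * \<bar>(y - x) $ i\<bar>)" for t z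
      unfolding k'_def using G(2)
      by (intro order_trans[OF sum_abs] sum_mono) (auto simp: abs_mult intro: mult_right_mono)
    show "integrable lborel (\<lambda>z. f z * k t z)" for t
      unfolding k_def by (rule integrable_conv[OF _ fB]) measurable
    show "k' t \<in> borel_measurable lborel" for t unfolding k'_def by measurable
  qed
  have eqA: "(LINT z|lborel. f z * k' t z) = A t" for t
  proof -
    have "(LINT z|lborel. f z * k' t z) = (LINT z|lborel. (\<Sum>i\<in>UNIV. (y - x) $ i * (f z * G i (p t - z))))"
      by (simp add: k'_def sum_distrib_left mult_ac)
    also have "\<dots> = A t"
      unfolding A_def using int by (subst Bochner_Integration.integral_sum) auto
    finally show ?thesis .
  qed
  have bA: "\<bar>A t\<bar> \<le> (\<Sum>i\<in>UNIV. C i) * dist x y" if t: "t \<in> {0..1}" for t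
  proof -
    have "p t \<in> closed_segment x y"
      using t by (auto simp: p_def in_segment algebra_simps intro!: exI[of _ t])
    then have "\<bar>(y - x) $ i * (LINT w|lborel. f w * G i (p t - w))\<bar> \<le> dist x y * C i" for i
      using C[of "p t" i] component_le_norm_cart[of "y - x" i]
      by (auto simp: abs_mult dist_norm norm_minus_commute intro!: mult_mono)
    then have "\<bar>A t\<bar> \<le> (\<Sum>i\<in>UNIV. dist x y * C i)"
      unfolding A_def by (intro order_trans[OF sum_abs] sum_mono) auto
    then show ?thesis unfolding sum_distrib_right by (simp add: mult.commute)
  qed
  have "norm ((LINT z|lborel. f z * k 0 z) - (LINT z|lborel. f z * k 1 z)) \<le> ((\<Sum>i\<in>UNIV. C i) * dist x y) * norm (0 - 1 :: real)"
    by (rule field_differentiable_bound[where S = "{0..1}" and f' = A])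
      (use dF bA in \<open>auto simp: eqA intro: has_field_derivative_at_within\<close>)
  moreover have "(LINT z|lborel. f z * k 0 z) = mollify \<rho> f x" "(LINT z|lborel. f z * k 1 z) = mollify \<rho> f y"
    by (auto simp: mollify_def k_def p_def)
  ultimately show ?thesis by simp
qed

text \<open>
  Testing the weak derivative \<open>g\<close> with a translate of the mollifier bounds the corresponding
  derivative of the mollified function.
\<close>

lemma weak_derivative_mollified:
  fixes f g :: "real^'n::finite \<Rightarrow> real"
  assumes S: "open S" and y: "cball y \<delta> \<subseteq> S" and \<rho>: "mollifier \<rho> \<delta>"
    and smooth: "smooth (\<lambda>z. \<rho> (y - z))"
    and G: "\<And>i. continuous_on UNIV (G i)"
    and der: "\<And>z. (\<rho> has_derivative (\<lambda>h. \<Sum>i\<in>UNIV. G i z * h $ i)) (at z)"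
    and f0 [measurable]: "f0 \<in> borel_measurable borel" and f0S: "\<And>x. x \<notin> S \<Longrightarrow> f0 x = 0"
    and f: "f \<in> borel_measurable (lebesgue_on S)" and ae: "AE x in lebesgue_on S. f0 x = f x"
    and weak: "\<And>\<psi>. test_function S \<psi> \<Longrightarrow>
      (LINT x|lebesgue_on S. f x * partial i \<psi> x) = - (LINT x|lebesgue_on S. g x * \<psi> x)"
    and g: "g \<in> borel_measurable (lebesgue_on S)" "AE x in lebesgue_on S. \<bar>g x\<bar> \<le> C" "C \<ge> 0"
  shows "\<bar>LINT w|lborel. f0 w * G i (y - w)\<bar> \<le> C"
proof -
  interpret mollifier \<rho> \<delta> by (rule \<rho>)
  have [measurable]: "S \<in> sets borel" "G i \<in> borel_measurable borel"
    using S G by (auto intro: borel_measurable_continuous_onI)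
  have [measurable]: "S \<in> sets lebesgue" using S by auto
  define \<psi> where "\<psi> z = \<rho> (y - z)" for z
  have [measurable]: "\<psi> \<in> borel_measurable borel" unfolding \<psi>_def by measurable
  have "{z. \<psi> z \<noteq> 0} \<subseteq> cball y \<delta>"
    using supp by (force simp: \<psi>_def dist_norm)
  then have cl: "closure {z. \<psi> z \<noteq> 0} \<subseteq> cball y \<delta>" by (intro closure_minimal) auto
  have "compact (closure {z. \<psi> z \<noteq> 0})"
    unfolding compact_eq_bounded_closed using bounded_subset[OF bounded_cball cl] by simp
  then have test: "test_function S \<psi>"
    using cl y smooth unfolding test_function_def \<psi>_def by auto
  \<comment> \<open>The reflection \<open>z \<mapsto> y - z\<close> contributes the sign that
    cancels the one in the definition of the weak derivative.\<close>
  have part: "partial i \<psi> z = - G i (y - z)" for z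
  proof (rule partial_eqI)
    have "((\<lambda>z. y - z) has_derivative (\<lambda>h. - h)) (at z)"
      by (auto intro!: derivative_eq_intros)
    from has_derivative_compose[OF this der]
    show "(\<psi> has_derivative (\<lambda>h. \<Sum>i\<in>UNIV. - G i (y - z) * h $ i)) (at z)"
      by (simp add: \<psi>_def[abs_def])
  qed
  have inter: "integrable (lebesgue_on S) \<psi>" and int\<psi>: "(LINT w|lebesgue_on S. \<psi> w) \<le> 1"
  proof -
    have i: "integrable lborel \<psi>" unfolding \<psi>_def by (rule integrable_reflect)
    then have "integrable lebesgue \<psi>" by (simp add: integrable_completion)
    then have "integrable lebesgue (\<lambda>x. indicator S x *\<^sub>R \<psi> x)"
      by (rule integrable_mult_indicator[rotated]) measurable
    then show "integrable (lebesgue_on S) \<psi>"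
      by (subst integrable_restrict_space) auto
    have "(LINT w|lebesgue_on S. \<psi> w) = (LINT w|lborel. indicator S w * \<psi> w)"
      by (rule integral_lebesgue_on_borel) measurable
    also have "\<dots> \<le> (LINT w|lborel. \<psi> w)"
    proof (rule integral_mono[OF _ i])
      show "integrable lborel (\<lambda>w. indicator S w * \<psi> w)"
        using integrable_mult_indicator[OF _ i, of S] by simp
    qed (auto simp: indicator_def \<psi>_def nonneg)
    also have "\<dots> = 1" unfolding \<psi>_def by (rule integral_reflect)
    finally show "(LINT w|lebesgue_on S. \<psi> w) \<le> 1" .
  qed
  have b2l: "h \<in> borel_measurable (lebesgue_on S)" if "h \<in> borel_measurable borel" for h :: "real^'n \<Rightarrow> real"
    using that by (intro measurable_restrict_space1 measurable_completion) simp
  have "(LINT w|lborel. f0 w * G i (y - w)) = (LINT w|lborel. indicator S w * (f0 w * G i (y - w)))"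
    using f0S by (intro Bochner_Integration.integral_cong) (auto simp: indicator_def)
  also have "\<dots> = (LINT w|lebesgue_on S. f0 w * G i (y - w))"
    by (rule integral_lebesgue_on_borel[symmetric]) measurable
  also have "\<dots> = (LINT w|lebesgue_on S. - (f w * partial i \<psi> w))"
  proof (rule integral_cong_AE)
    show "(\<lambda>w. f0 w * G i (y - w)) \<in> borel_measurable (lebesgue_on S)" by (rule b2l) measurable
    have "(\<lambda>w. G i (y - w)) \<in> borel_measurable (lebesgue_on S)" by (rule b2l) measurable
    then show "(\<lambda>w. - (f w * partial i \<psi> w)) \<in> borel_measurable (lebesgue_on S)"
      unfolding part using f by measurable
    show "AE w in lebesgue_on S. f0 w * G i (y - w) = - (f w * partial i \<psi> w)"
      using ae by eventually_elim (simp add: part)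
  qed
  also have "\<dots> = (LINT w|lebesgue_on S. g w * \<psi> w)"
    using weak[OF test] by simp
  finally have "\<bar>LINT w|lborel. f0 w * G i (y - w)\<bar> \<le> (LINT w|lebesgue_on S. \<bar>g w * \<psi> w\<bar>)"
    by simp
  also have "\<dots> \<le> (LINT w|lebesgue_on S. C * \<psi> w)"
  proof (rule integral_mono_AE)
    show "AE w in lebesgue_on S. \<bar>g w * \<psi> w\<bar> \<le> C * \<psi> w"
      using g(2) by eventually_elim (auto simp: abs_mult \<psi>_def nonneg intro: mult_right_mono)
    then have "AE w in lebesgue_on S. norm (g w * \<psi> w) \<le> norm (C * \<psi> w)"
      by eventually_elim simp
    then have "integrable (lebesgue_on S) (\<lambda>w. g w * \<psi> w)"
      using inter g(1) b2l[of \<psi>]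
      by (intro Bochner_Integration.integrable_bound[of _ "\<lambda>w. C * \<psi> w" "\<lambda>w. g w * \<psi> w"]) auto
    then show "integrable (lebesgue_on S) (\<lambda>w. \<bar>g w * \<psi> w\<bar>)" by simp
  qed (use inter in simp)
  also have "\<dots> = C * (LINT w|lebesgue_on S. \<psi> w)" by simp
  also have "\<dots> \<le> C" using int\<psi> g(3) by (simp add: mult_left_le)
  finally show ?thesis .
qed


text \<open>Mollifications of the zero extension are Lipschitz with one common constant on segments
  that keep distance \<open>\<delta> j\<close> from the complement of \<open>S\<close>. A
  subsequence converges almost everywhere, and the common constant upgrades this to convergence at
  every point of \<open>S\<close>. The bound is stated along segments inside \<open>S\<close>
  because \<open>S\<close> need not be convex.\<close>

lemma W1inf_lipschitz_representative:
  fixes f :: "real^'n::finite \<Rightarrow> real"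
  assumes S: "open S" "bounded S" and W: "W1inf S f"
  obtains g C where "C \<ge> 0" "AE x in lebesgue_on S. g x = f x"
    "\<And>x y. closed_segment x y \<subseteq> S \<Longrightarrow> \<bar>g x - g y\<bar> \<le> C * dist x y"
proof -
  have [measurable]: "S \<in> sets borel" using S by auto
  have S_leb: "S \<in> sets lebesgue" using S by auto
  have Lf: "Linf S f" using W by (simp add: W1inf_def)
  then have fm: "f \<in> borel_measurable (lebesgue_on S)" by (simp add: Linf_def)
  obtain B where B: "B \<ge> 0" "AE x in lebesgue_on S. \<bar>f x\<bar> \<le> B" using Linf_AE_bound[OF Lf] .
  obtain R where R: "\<And>x. x \<in> S \<Longrightarrow> norm x \<le> R" using S(2) by (auto simp: bounded_iff)
  define P where "P i g \<longleftrightarrow> Linf S g \<and> (\<forall>\<psi>. test_function S \<psi> \<longrightarrow>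
           (LINT x|lebesgue_on S. f x * partial i \<psi> x) = - (LINT x|lebesgue_on S. g x * \<psi> x))" for i g
  have "\<forall>i. \<exists>g. P i g" using W by (simp add: W1inf_def P_def)
  then obtain dg where dg: "\<And>i. P i (dg i)" by metis
  have "\<forall>i. \<exists>C. C \<ge> 0 \<and> (AE x in lebesgue_on S. \<bar>dg i x\<bar> \<le> C)"
    using dg Linf_AE_bound unfolding P_def by metis
  then obtain c where c: "\<And>i. c i \<ge> 0" "\<And>i. AE x in lebesgue_on S. \<bar>dg i x\<bar> \<le> c i" by metis
  define C where "C = (\<Sum>i\<in>UNIV. c i)"
  have C0: "C \<ge> 0" unfolding C_def using c by (intro sum_nonneg) auto
  have "(\<lambda>x. if x \<in> S then f x else 0) \<in> borel_measurable lebesgue"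
    using fm S_leb by (subst borel_measurable_if) auto
  then obtain f2 where f2: "f2 \<in> borel_measurable lborel" "AE x in lborel. (if x \<in> S then f x else 0) = f2 x"
    using completion_ex_borel_measurable_real by blast
  \<comment> \<open>A Borel version of the zero extension; clipping at \<open>B\<close> makes the
    almost everywhere bound hold everywhere.\<close>
  define f0 where "f0 x = indicator S x * max (- B) (min B (f2 x))" for x
  have [measurable]: "f2 \<in> borel_measurable borel" using f2(1) by simp
  have f0m [measurable]: "f0 \<in> borel_measurable borel" unfolding f0_def by measurable
  have f0B: "\<bar>f0 x\<bar> \<le> B" for x using B(1) by (auto simp: f0_def indicator_def)
  have f0S: "f0 x = 0" if "x \<notin> S" for x using that by (simp add: f0_def)
  have f0R: "norm x \<le> R" if "f0 x \<noteq> 0" for x using that f0S R by blast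
  have ae0: "AE x in lebesgue_on S. f0 x = f x"
  proof -
    have "AE x in lebesgue. (if x \<in> S then f x else 0) = f2 x"
      using f2(2) by (rule AE_completion)
    then have "AE x in lebesgue_on S. f x = f2 x"
      by (subst AE_restrict_space_iff) (use S_leb in auto)
    moreover have "AE x in lebesgue_on S. x \<in> S"
      by (rule AE_I2) simp
    ultimately show ?thesis
      using B(2) by eventually_elim (auto simp: f0_def)
  qed
  have intf0: "integrable lborel f0"
    by (rule integrable_bounded_support[where A = "cball 0 R" and B = B]) (use f0B f0R in force)+
  define \<delta> where "\<delta> j = 1 / real (Suc j)" for j
  have \<delta>: "\<delta> \<longlonglongrightarrow> 0" "\<delta> j \<le> 1" "\<delta> j > 0" for j
    unfolding \<delta>_def using LIMSEQ_inverse_real_of_nat by (simp_all add: divide_simps)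
  define Q where "Q j \<rho> G \<longleftrightarrow> (\<forall>z. \<rho> z \<ge> 0) \<and> (\<forall>z. \<rho> z \<noteq> 0 \<longrightarrow> norm z < \<delta> j) \<and> integrable lborel \<rho> \<and> (LINT z|lborel. \<rho> z) = 1 \<and>
    (\<forall>y. smooth (\<lambda>x. \<rho> (y - x))) \<and>
    (\<forall>i. continuous_on UNIV (G i) \<and> (\<forall>z. G i z \<noteq> 0 \<longrightarrow> norm z \<le> \<delta> j)) \<and>
    (\<forall>z. (\<rho> has_derivative (\<lambda>h. \<Sum>i\<in>UNIV. G i z * h $ i)) (at z))" for j and \<rho> :: "real^'n \<Rightarrow> real" and G
  have "\<forall>j. \<exists>\<rho> G. Q j \<rho> G" unfolding Q_def using mollifier_exists[OF \<delta>(3)] by blast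
  then obtain \<rho> G where "\<And>j. Q j (\<rho> j) (G j)" by metis
  note Q = this[unfolded Q_def]
  have mol: "mollifier (\<rho> j) (\<delta> j)" for j
    using Q[of j] by unfold_locales blast+
  have Gc: "continuous_on UNIV (G j i)" for j i using Q[of j] by blast
  have Gd: "(\<rho> j has_derivative (\<lambda>h. \<Sum>i\<in>UNIV. G j i z * h $ i)) (at z)" for j z using Q[of j] by blast
  have Gs: "smooth (\<lambda>x. \<rho> j (y - x))" for j y using Q[of j] by blast
  have "\<exists>D. \<forall>i z. \<bar>G j i z\<bar> \<le> D" for j
  proof -
    have "\<exists>D. \<forall>z. \<bar>G j i z\<bar> \<le> D" for i
    proof -
      have "bounded (G j i ` cball 0 (\<delta> j))"
        by (intro compact_imp_bounded compact_continuous_image continuous_on_subset[OF Gc]) auto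
      then obtain D where D: "\<And>z. norm z \<le> \<delta> j \<Longrightarrow> \<bar>G j i z\<bar> \<le> D"
        by (force simp: bounded_iff)
      have "\<bar>G j i z\<bar> \<le> \<bar>D\<bar>" for z
      proof (cases "norm z \<le> \<delta> j")
        case True
        then show ?thesis using D[of z] by linarith
      next
        case False
        then have "G j i z = 0" using Q[of j] by blast
        then show ?thesis by simp
      qed
      then show ?thesis by blast
    qed
    then obtain D where D: "\<And>i z. \<bar>G j i z\<bar> \<le> D i" by metis
    have "\<bar>G j i z\<bar> \<le> (\<Sum>i\<in>UNIV. \<bar>D i\<bar>)" for i z
      using D[of i z] member_le_sum[of i UNIV "\<lambda>i. \<bar>D i\<bar>"] by simp
    then show ?thesis by blast
  qed
  then obtain D where D: "\<And>j i z. \<bar>G j i z\<bar> \<le> D j" by metis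
  define F where "F j = mollify (\<rho> j) f0" for j
  have lip: "\<bar>F j x - F j y\<bar> \<le> C * dist x y"
    if seg: "\<And>z. z \<in> closed_segment x y \<Longrightarrow> cball z (\<delta> j) \<subseteq> S" for j x y
    unfolding F_def C_def
  proof (rule mollified_lipschitz_segment[OF intf0 f0B mol Gc D Gd])
    fix i z assume "z \<in> closed_segment x y"
    then have "cball z (\<delta> j) \<subseteq> S" by (rule seg)
    then show "\<bar>LINT w|lborel. f0 w * G j i (z - w)\<bar> \<le> c i"
      using dg[of i] c[of i] unfolding P_def Linf_def
      by (intro weak_derivative_mollified[OF S(1) _ mol Gs Gc Gd f0m f0S fm ae0, where g = "dg i"]) auto
  qed
  note L1 = mollify_L1_tendsto[OF mol \<delta>(1,2) f0m f0B f0R, folded F_def]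
  obtain r where r: "strict_mono r" "AE x in lborel. (\<lambda>j. F (r j) x - f0 x) \<longlonglongrightarrow> 0"
    using tendsto_L1_AE_subseq[of lborel "\<lambda>j x. F j x - f0 x"] L1 by auto
  have rj: "\<forall>\<^sub>F j in sequentially. \<delta> (r j) < d" if "d > 0" for d
    using order_tendstoD(2)[OF LIMSEQ_subseq_LIMSEQ[OF \<delta>(1) r(1)] that] by (simp add: comp_def)
  have Cauchy: "Cauchy (\<lambda>j. F (r j) x)" if x: "x \<in> S" for x
  proof (rule metric_CauchyI)
    fix e :: real assume e: "e > 0"
    obtain d where d: "d > 0" "cball x d \<subseteq> S" using S(1) x by (meson open_contains_cball)
    \<comment> \<open>\<open>d / 2\<close> leaves room inside \<open>cball x d\<close> for the
      radius of the kernel; the other bound makes the Lipschitz error between \<open>x\<close> and a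
      nearby point of convergence at most \<open>e / 4\<close>.\<close>
    define s where "s = min (d / 2) (e / (4 * (C + 1)))"
    have s: "s > 0" "s \<le> d / 2" "C * s \<le> e / 4"
    proof -
      show "s > 0" using d e C0 by (auto simp: s_def)
      show "s \<le> d / 2" unfolding s_def by (rule min.cobounded1)
      have "s \<le> e / (4 * (C + 1))" unfolding s_def by (rule min.cobounded2)
      then have "C * s \<le> C * (e / (4 * (C + 1)))" using C0 by (rule mult_left_mono)
      also have "\<dots> \<le> e / 4" using C0 e by (simp add: field_simps)
      finally show "C * s \<le> e / 4" .
    qed
    have "\<exists>y\<in>ball x s. (\<lambda>j. F (r j) y - f0 y) \<longlonglongrightarrow> 0"
    proof (rule ccontr)
      assume "\<not> ?thesis"
      then have "AE y in lborel. y \<notin> ball x s" using r(2) by (auto elim: eventually_mono)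
      then have "ball x s \<in> null_sets lborel" by (subst AE_iff_null_sets) auto
      then have "negligible (ball x s)" by (auto simp: negligible_iff_null_sets intro: null_sets_completionI)
      then show False using open_not_negligible[of "ball x s"] s(1) by auto
    qed
    then obtain y where y: "y \<in> ball x s" "(\<lambda>j. F (r j) y - f0 y) \<longlonglongrightarrow> 0" by blast
    have "(\<lambda>j. F (r j) y) \<longlonglongrightarrow> f0 y" using y(2) by (simp add: LIM_zero_iff)
    then have "Cauchy (\<lambda>j. F (r j) y)" by (rule LIMSEQ_imp_Cauchy)
    then obtain j1 where j1: "\<And>m n. m \<ge> j1 \<Longrightarrow> n \<ge> j1 \<Longrightarrow> dist (F (r m) y) (F (r n) y) < e / 2"
      using e by (meson half_gt_zero metric_CauchyD)
    obtain j2 where j2: "\<And>j. j \<ge> j2 \<Longrightarrow> \<delta> (r j) < d / 2"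
      using rj[of "d / 2"] d by (auto simp: eventually_sequentially)
    have near: "\<bar>F (r j) x - F (r j) y\<bar> \<le> e / 4" if "j \<ge> j2" for j
    proof -
      have "\<bar>F (r j) x - F (r j) y\<bar> \<le> C * dist x y"
      proof (rule lip)
        fix z assume z: "z \<in> closed_segment x y"
        have "closed_segment x y \<subseteq> ball x s" using y(1) s(1) by (intro closed_segment_subset) auto
        then have "cball z (\<delta> (r j)) \<subseteq> cball x d"
          using z s(2) j2[OF that] by (intro cball_subset_cball_iff[THEN iffD2]) (auto simp: dist_commute)
        then show "cball z (\<delta> (r j)) \<subseteq> S" using d(2) by blast
      qed
      also have "\<dots> \<le> C * s" using y(1) C0 by (intro mult_left_mono) auto
      finally show ?thesis using s(3) by linarith
    qed
    show "\<exists>M. \<forall>m\<ge>M. \<forall>n\<ge>M. dist (F (r m) x) (F (r n) x) < e"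
    proof (intro exI[of _ "max j1 j2"] allI impI)
      fix m n assume mn: "m \<ge> max j1 j2" "n \<ge> max j1 j2"
      have "\<bar>F (r m) x - F (r m) y\<bar> \<le> e / 4" "\<bar>F (r n) x - F (r n) y\<bar> \<le> e / 4"
        "\<bar>F (r m) y - F (r n) y\<bar> < e / 2"
        using near[of m] near[of n] j1[of m n] mn by (auto simp: dist_real_def)
      then show "dist (F (r m) x) (F (r n) x) < e" unfolding dist_real_def by linarith
    qed
  qed
  define g where "g x = lim (\<lambda>j. F (r j) x)" for x
  have glim: "(\<lambda>j. F (r j) x) \<longlonglongrightarrow> g x" if "x \<in> S" for x
    unfolding g_def by (rule convergent_LIMSEQ_iff[THEN iffD1, OF Cauchy_convergent[OF Cauchy[OF that]]])
  have "AE x in lebesgue. (\<lambda>j. F (r j) x - f0 x) \<longlonglongrightarrow> 0" using r(2) by (rule AE_completion)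
  then have "AE x in lebesgue_on S. (\<lambda>j. F (r j) x - f0 x) \<longlonglongrightarrow> 0"
    by (subst AE_restrict_space_iff) (use S_leb in auto)
  moreover have "AE x in lebesgue_on S. x \<in> S" by (rule AE_I2) simp
  ultimately have aeg: "AE x in lebesgue_on S. g x = f x"
    using ae0
  proof eventually_elim
    case (elim x)
    then have "(\<lambda>j. F (r j) x) \<longlonglongrightarrow> f0 x" by (simp add: LIM_zero_iff)
    then show ?case using glim[of x] elim LIMSEQ_unique by metis
  qed
  have gl: "\<bar>g x - g y\<bar> \<le> C * dist x y" if seg: "closed_segment x y \<subseteq> S" for x y
  proof -
    \<comment> \<open>A compact segment keeps a positive distance from the complement of the open
      set, which the kernels eventually respect.\<close>
    obtain d where d: "d > 0" "(\<Union>z\<in>closed_segment x y. ball z d) \<subseteq> S"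
      using compact_subset_open_imp_ball_epsilon_subset[OF _ S(1) seg] by auto
    have "(\<lambda>j. \<bar>F (r j) x - F (r j) y\<bar>) \<longlonglongrightarrow> \<bar>g x - g y\<bar>"
      using seg by (intro tendsto_intros glim) auto
    moreover have "\<forall>\<^sub>F j in sequentially. \<bar>F (r j) x - F (r j) y\<bar> \<le> C * dist x y"
      using rj[OF d(1)]
    proof eventually_elim
      case (elim j)
      show ?case
      proof (rule lip)
        fix z assume "z \<in> closed_segment x y"
        moreover have "cball z (\<delta> (r j)) \<subseteq> ball z d" using elim by auto
        ultimately show "cball z (\<delta> (r j)) \<subseteq> S" using d(2) by blast
      qed
    qed
    ultimately show ?thesis by (rule tendsto_upperbound) simp
  qed
  show ?thesis by (rule that[OF C0 aeg gl])
qed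

text \<open>
  Near a boundary point two points of a hypograph are joined by a path of three segments that first
  descends in the direction \<open>- e\<close>, so that the Lipschitz bound along segments extends to the boundary.
\<close>

lemma lipschitz_near_boundary:
  fixes g :: "'a::euclidean_space \<Rightarrow> real"
  assumes S: "lipschitz_boundary_in UNIV S" and p: "p \<in> frontier S" and C: "C \<ge> 0"
    and g: "\<And>x y. closed_segment x y \<subseteq> S \<Longrightarrow> \<bar>g x - g y\<bar> \<le> C * dist x y"
  obtains r L where "r > 0" "L \<ge> 0" "\<And>x y. x \<in> S \<inter> ball p r \<Longrightarrow> y \<in> S \<inter> ball p r \<Longrightarrow> \<bar>g x - g y\<bar> \<le> L * dist x y"
proof -
  have pf: "p \<in> top_of_set UNIV frontier_of S" using p by simp
  obtain U e l \<gamma> where U: "open U" "p \<in> U" and e: "norm e = 1" and \<gamma>: "l-lipschitz_on UNIV \<gamma>"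
    and graph: "S \<inter> U = {y \<in> UNIV \<inter> U. y \<bullet> e < \<gamma> (y - (y \<bullet> e) *\<^sub>R e)}"
    using S[unfolded lipschitz_boundary_in_def, rule_format, OF pf] by blast
  have ee: "e \<bullet> e = 1" using e by (simp add: norm_eq_1)
  define q where "q y = y - (y \<bullet> e) *\<^sub>R e" for y
  have mem: "y \<in> S \<longleftrightarrow> y \<bullet> e < \<gamma> (q y)" if "y \<in> U" for y
    using graph that by (auto simp: q_def)
  have l0: "l \<ge> 0" using \<gamma> by (rule lipschitz_on_nonneg)
  \<comment> \<open>Between \<open>x\<close> and a point of the segment to \<open>y\<close> the
    component along \<open>e\<close> changes by at most \<open>h\<close> and \<gamma> by at most
    \<open>2 * l * h\<close>; a descent by \<open>M * h\<close> therefore keeps the lowered segment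
    below the graph.\<close>
  define M where "M = 2 * l + 2"
  obtain r0 where r0: "r0 > 0" "ball p r0 \<subseteq> U" using U by (meson open_contains_ball)
  \<comment> \<open>Two points of the small ball are less than \<open>2 * r\<close> apart, so a
    descent by \<open>M * h\<close> stays within \<open>r + 2 * M * r = r0\<close>.\<close>
  define r where "r = r0 / (2 * M + 1)"
  have M: "M \<ge> 2" using l0 by (simp add: M_def)
  have r: "r > 0" "r * (2 * M + 1) = r0" using r0 M by (auto simp: r_def)
  have bound: "\<bar>g x - g y\<bar> \<le> (C * (2 * M + 1)) * dist x y" if xy: "x \<in> S \<inter> ball p r" "y \<in> S \<inter> ball p r" for x y
  proof -
    define h where "h = dist x y"
    have h: "0 \<le> h" "h < 2 * r"
      using xy dist_triangle[of x y p] by (auto simp: h_def dist_commute)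
    have inU: "w - t *\<^sub>R e \<in> U" if "dist p w < r" "0 \<le> t" "t \<le> M * h" for w t
    proof -
      have "dist p (w - t *\<^sub>R e) \<le> dist p w + t"
        using dist_triangle[of p "w - t *\<^sub>R e" w] e that(2) by (simp add: dist_norm)
      also have "\<dots> < r + M * (2 * r)"
        using that h M by (intro add_less_le_mono order_trans[OF that(3)] mult_left_mono) auto
      also have "\<dots> = r0" using r(2) by (simp add: algebra_simps)
      finally show ?thesis using r0(2) by auto
    qed
    have qinv: "q (w - t *\<^sub>R e) = q w" for w t
      by (simp add: q_def inner_diff_left ee algebra_simps)
    have down: "w - t *\<^sub>R e \<in> S" if w: "w \<in> S \<inter> ball p r" and t: "0 \<le> t" "t \<le> M * h" for w t
    proof -
      have "w \<in> U" using inU[of w 0] w h M by auto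
      then have "w \<bullet> e < \<gamma> (q w)" using mem w by auto
      then have "(w - t *\<^sub>R e) \<bullet> e < \<gamma> (q (w - t *\<^sub>R e))"
        unfolding qinv using t by (simp add: inner_diff_left ee)
      then show ?thesis using mem inU[of w t] w t by auto
    qed
    have vert: "closed_segment w (w - (M * h) *\<^sub>R e) \<subseteq> S" if w: "w \<in> S \<inter> ball p r" for w
    proof
      fix v assume "v \<in> closed_segment w (w - (M * h) *\<^sub>R e)"
      then obtain u where u: "0 \<le> u" "u \<le> 1" "v = (1 - u) *\<^sub>R w + u *\<^sub>R (w - (M * h) *\<^sub>R e)"
        by (auto simp: in_segment)
      then have "v = w - (u * (M * h)) *\<^sub>R e" by (simp add: algebra_simps)
      moreover have "0 \<le> u * (M * h)" "u * (M * h) \<le> M * h"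
        using u h M by (auto intro: mult_left_le_one_le)
      ultimately show "v \<in> S" using down[OF w] by simp
    qed
    have horiz: "closed_segment (x - (M * h) *\<^sub>R e) (y - (M * h) *\<^sub>R e) \<subseteq> S"
    proof
      fix v assume "v \<in> closed_segment (x - (M * h) *\<^sub>R e) (y - (M * h) *\<^sub>R e)"
      then obtain u where u: "0 \<le> u" "u \<le> 1" "v = (1 - u) *\<^sub>R (x - (M * h) *\<^sub>R e) + u *\<^sub>R (y - (M * h) *\<^sub>R e)"
        by (auto simp: in_segment)
      define w where "w = (1 - u) *\<^sub>R x + u *\<^sub>R y"
      have v: "v = w - (M * h) *\<^sub>R e" unfolding u(3) w_def by (simp add: algebra_simps)
      have "w \<in> closed_segment x y" using u by (auto simp: w_def in_segment)
      moreover have "closed_segment x y \<subseteq> ball p r" using xy by (intro closed_segment_subset) auto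
      ultimately have wp: "dist p w < r" by auto
      have wx: "w - x = u *\<^sub>R (y - x)" by (simp add: w_def algebra_simps)
      have nwx: "norm (w - x) \<le> h"
        unfolding wx h_def using u by (simp add: dist_norm norm_minus_commute mult_left_le_one_le)
      have "q w - q x = (w - x) - ((w - x) \<bullet> e) *\<^sub>R e" by (simp add: q_def inner_diff_left algebra_simps)
      moreover have ine: "\<bar>(w - x) \<bullet> e\<bar> \<le> h" using Cauchy_Schwarz_ineq2[of "w - x" e] e nwx by simp
      ultimately have "norm (q w - q x) \<le> 2 * h"
        using norm_triangle_ineq4[of "w - x" "((w - x) \<bullet> e) *\<^sub>R e"] nwx e by simp
      then have "\<bar>\<gamma> (q w) - \<gamma> (q x)\<bar> \<le> l * (2 * h)"
        using lipschitz_onD[OF \<gamma>, of "q w" "q x"] l0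
        by (auto simp: dist_norm intro: order_trans mult_left_mono)
      moreover have "x \<bullet> e < \<gamma> (q x)"
        using mem[of x] inU[of x 0] xy h M by auto
      moreover have "w \<bullet> e \<le> x \<bullet> e + h" using ine by (simp add: inner_diff_left)
      ultimately have "w \<bullet> e - M * h < \<gamma> (q w)"
        using h by (simp add: M_def algebra_simps)
      then have "v \<bullet> e < \<gamma> (q v)" unfolding v qinv by (simp add: inner_diff_left ee)
      then show "v \<in> S" using mem inU[OF wp, of "M * h"] h M unfolding v by auto
    qed
    have v1: "\<bar>g w - g (w - (M * h) *\<^sub>R e)\<bar> \<le> C * (M * h)" if "w \<in> S \<inter> ball p r" for w
      using g[OF vert[OF that]] e h M by (simp add: dist_norm)
    have "\<bar>g (x - (M * h) *\<^sub>R e) - g (y - (M * h) *\<^sub>R e)\<bar> \<le> C * h"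
      using g[OF horiz] by (simp add: h_def dist_norm)
    then have "\<bar>g x - g y\<bar> \<le> C * (M * h) + C * h + C * (M * h)"
      using v1[OF xy(1)] v1[OF xy(2)] by linarith
    also have "\<dots> = (C * (2 * M + 1)) * dist x y" by (simp add: h_def algebra_simps)
    finally show ?thesis .
  qed
  show ?thesis by (rule that[OF r(1) _ bound]) (use C M in auto)
qed

text \<open>Local Lipschitz bounds hold in the interior because balls are convex and at the boundary
  by the path of three segments. Below a Lebesgue number of the compact closure they become uniform,
  and a uniformly continuous function extends to the closure.\<close>

lemma continuous_extension_to_closure:
  fixes g :: "'a::euclidean_space \<Rightarrow> real"
  assumes S: "open S" "bounded S" "lipschitz_boundary_in UNIV S" and C: "C \<ge> 0"
    and g: "\<And>x y. closed_segment x y \<subseteq> S \<Longrightarrow> \<bar>g x - g y\<bar> \<le> C * dist x y"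
  obtains h where "continuous_on (closure S) h" "\<And>x. x \<in> S \<Longrightarrow> h x = g x"
proof -
  define P where "P p r L \<longleftrightarrow> r > 0 \<and> L \<ge> 0 \<and>
    (\<forall>x y. x \<in> S \<inter> ball p r \<longrightarrow> y \<in> S \<inter> ball p r \<longrightarrow> \<bar>g x - g y\<bar> \<le> L * dist x y)" for p r L
  have "\<exists>r L. P p r L" if p: "p \<in> closure S" for p
  proof (cases "p \<in> S")
    case True
    then obtain r where r: "r > 0" "ball p r \<subseteq> S" using S(1) by (meson open_contains_ball)
    have "\<bar>g x - g y\<bar> \<le> C * dist x y" if "x \<in> S \<inter> ball p r" "y \<in> S \<inter> ball p r" for x y
      by (rule g, rule order_trans[OF closed_segment_subset r(2)]) (use that in auto)
    then show ?thesis using r C unfolding P_def by blast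
  next
    case False
    then have "p \<in> frontier S" using p S(1) by (simp add: frontier_def interior_open)
    from lipschitz_near_boundary[OF S(3) this C g] show ?thesis unfolding P_def by metis
  qed
  then obtain r L where rL: "\<And>p. p \<in> closure S \<Longrightarrow> P p (r p) (L p)" by metis
  have comp: "compact (closure S)" using S(2) by (simp add: compact_eq_bounded_closed bounded_closure)
  have cover: "closure S \<subseteq> (\<Union>p\<in>closure S. ball p (r p))"
    using rL by (force simp: P_def)
  obtain T where T: "T \<subseteq> closure S" "finite T" "closure S \<subseteq> (\<Union>p\<in>T. ball p (r p))"
    by (rule compactE_image[OF comp _ cover]) auto
  obtain \<epsilon> where \<epsilon>: "\<epsilon> > 0" "\<And>x. x \<in> closure S \<Longrightarrow> \<exists>G\<in>(\<lambda>p. ball p (r p)) ` T. ball x \<epsilon> \<subseteq> G"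
    using Heine_Borel_lemma[OF comp, of "(\<lambda>p. ball p (r p)) ` T"] T(3) by auto
  \<comment> \<open>Dominates all local constants and is positive, so that it may be divided
    by.\<close>
  define A where "A = (\<Sum>p\<in>T. L p) + 1"
  have L0: "L p \<ge> 0" if "p \<in> T" for p using rL T(1) that by (auto simp: P_def)
  have A: "A > 0" "\<And>p. p \<in> T \<Longrightarrow> L p \<le> A"
    unfolding A_def using L0 T(2) sum_nonneg[of T L] member_le_sum[of _ T L] by fastforce+
  have loc: "\<bar>g x - g y\<bar> \<le> A * dist x y" if xy: "x \<in> S" "y \<in> S" "dist x y < \<epsilon>" for x y
  proof -
    have "x \<in> closure S" using xy closure_subset by blast
    then obtain p where p: "p \<in> T" "ball x \<epsilon> \<subseteq> ball p (r p)" using \<epsilon>(2) by blast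
    moreover have "x \<in> ball x \<epsilon>" "y \<in> ball x \<epsilon>" using xy \<epsilon>(1) by auto
    ultimately have "x \<in> ball p (r p)" "y \<in> ball p (r p)" by blast+
    then have "\<bar>g x - g y\<bar> \<le> L p * dist x y" using rL[of p] T(1) p xy by (auto simp: P_def)
    also have "\<dots> \<le> A * dist x y" using A(2)[OF p(1)] by (intro mult_right_mono) auto
    finally show ?thesis .
  qed
  have "uniformly_continuous_on S g"
    unfolding uniformly_continuous_on_def
  proof (intro allI impI)
    fix e :: real assume e: "e > 0"
    show "\<exists>d>0. \<forall>x\<in>S. \<forall>x'\<in>S. dist x' x < d \<longrightarrow> dist (g x') (g x) < e"
    proof (intro exI[of _ "min \<epsilon> (e / A)"] conjI ballI impI)
      show "min \<epsilon> (e / A) > 0" using \<epsilon>(1) e A(1) by simp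
      fix x x' assume x: "x \<in> S" "x' \<in> S" "dist x' x < min \<epsilon> (e / A)"
      then have "\<bar>g x' - g x\<bar> \<le> A * dist x' x" by (intro loc) auto
      also have "\<dots> < e" using x(3) A(1) by (simp add: field_simps)
      finally show "dist (g x') (g x) < e" by (simp add: dist_real_def)
    qed
  qed
  then obtain h where "uniformly_continuous_on (closure S) h" "\<And>x. x \<in> S \<Longrightarrow> g x = h x"
    by (rule uniformly_continuous_on_extension_on_closure) blast
  then show ?thesis using that[of h] uniformly_continuous_imp_continuous by metis
qed

text \<open>The existence statement that allows the choice in \<open>continuous_trace\<close> to be
  used.\<close>

theorem W1inf_continuous_representative:
  fixes f :: "real^'n::finite \<Rightarrow> real"
  assumes S: "open S" "bounded S" "lipschitz_boundary_in UNIV S" and W: "W1inf S f"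
  shows "\<exists>h. continuous_on (closure S) h \<and> (AE x in lebesgue_on S. h x = f x)"
proof -
  obtain g C where g: "C \<ge> 0" "AE x in lebesgue_on S. g x = f x"
    "\<And>x y. closed_segment x y \<subseteq> S \<Longrightarrow> \<bar>g x - g y\<bar> \<le> C * dist x y"
    by (rule W1inf_lipschitz_representative[OF S(1,2) W]) blast
  obtain h where h: "continuous_on (closure S) h" "\<And>x. x \<in> S \<Longrightarrow> h x = g x"
    by (rule continuous_extension_to_closure[OF S g(1,3)]) blast+
  have "AE x in lebesgue_on S. x \<in> S" by (rule AE_I2) simp
  with g(2) have "AE x in lebesgue_on S. h x = f x"
    by eventually_elim (use h in auto)
  then show ?thesis using h(1) by blast
qed

lemma continuous_trace_W1inf:
  fixes f :: "real^'n::finite \<Rightarrow> real"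
  assumes "open S" "bounded S" "lipschitz_boundary_in UNIV S" "W1inf S f"
  shows "continuous_on (closure S) (continuous_trace S f)"
    "AE x in lebesgue_on S. continuous_trace S f x = f x"
  using someI_ex[OF W1inf_continuous_representative[OF assms]]
  unfolding continuous_trace_def by (rule conjunct1, rule conjunct2)

text \<open>\<open>continuous_trace\<close> chooses for the matrix as a whole and not entry by
  entry, so a continuous matrix has to be assembled before the choice is invoked; the finitely many
  null sets of the entries are united.\<close>

lemma continuous_trace_matrix_W1inf:
  fixes A :: "real^'n::finite \<Rightarrow> real^'n^'n"
  assumes S: "open S" "bounded S" "lipschitz_boundary_in UNIV S"
    and W: "\<And>i j. W1inf S (\<lambda>x. A x $ i $ j)"
  shows "continuous_on (closure S) (continuous_trace S A)"
    "AE x in lebesgue_on S. continuous_trace S A x = A x"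
proof -
  have "\<forall>i j. \<exists>h. continuous_on (closure S) h \<and> (AE x in lebesgue_on S. h x = A x $ i $ j)"
    using W1inf_continuous_representative[OF S W] by blast
  then obtain h where h: "\<And>i j. continuous_on (closure S) (h i j)"
    "\<And>i j. AE x in lebesgue_on S. h i j x = A x $ i $ j" by metis
  define g where "g x = (\<chi> i j. h i j x)" for x
  have "continuous_on (closure S) g"
    unfolding g_def by (intro continuous_on_vec_lambda h)
  moreover have "AE x in lebesgue_on S. \<forall>i j. h i j x = A x $ i $ j"
    using h(2) by (intro AE_all_countable[THEN iffD2] allI)
  then have "AE x in lebesgue_on S. g x = A x"
    by eventually_elim (simp add: g_def vec_eq_iff)
  ultimately have "\<exists>g. continuous_on (closure S) g \<and> (AE x in lebesgue_on S. g x = A x)" by blast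
  from someI_ex[OF this] show "continuous_on (closure S) (continuous_trace S A)"
    "AE x in lebesgue_on S. continuous_trace S A x = A x"
    by (auto simp: continuous_trace_def)
qed

section \<open>Finite-dimensional inner product spaces of functions\<close>

text \<open>The axioms are relative to the subspace \<open>V\<close>: for functions outside it the
  integrals need not exist and the form need not be definite.\<close>

locale inner_product_on = vector_space scale
  for scale :: "real \<Rightarrow> 'b::ab_group_add \<Rightarrow> 'b" +
  fixes V :: "'b set" and s :: "'b \<Rightarrow> 'b \<Rightarrow> real"
  assumes V: "subspace V"
    and s_add: "\<And>u v w. u \<in> V \<Longrightarrow> v \<in> V \<Longrightarrow> w \<in> V \<Longrightarrow> s (u + v) w = s u w + s v w"
    and s_scale: "\<And>c u w. u \<in> V \<Longrightarrow> w \<in> V \<Longrightarrow> s (scale c u) w = c * s u w"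
    and s_commute: "\<And>u w. u \<in> V \<Longrightarrow> w \<in> V \<Longrightarrow> s u w = s w u"
    and s_nonneg: "\<And>u. u \<in> V \<Longrightarrow> s u u \<ge> 0"
    and s_definite: "\<And>u. u \<in> V \<Longrightarrow> s u u = 0 \<Longrightarrow> u = 0"
begin

definition orthonormal :: "'b set \<Rightarrow> bool" where
  "orthonormal B \<longleftrightarrow> finite B \<and> B \<subseteq> V \<and> (\<forall>a\<in>B. \<forall>b\<in>B. s a b = (if a = b then 1 else 0))"

lemma s_zero: "w \<in> V \<Longrightarrow> s 0 w = 0"
  using s_scale[of 0 w 0] V by (simp add: subspace_0)

lemma s_sum:
  assumes "B \<subseteq> V" "w \<in> V" "finite B"
  shows "s (\<Sum>b\<in>B. scale (f b) b) w = (\<Sum>b\<in>B. f b * s b w)"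
  using assms(3,1)
proof (induction B rule: finite_induct)
  case (insert x B)
  have "(\<Sum>b\<in>B. scale (f b) b) \<in> V" "scale (f x) x \<in> V"
    using insert V by (auto intro!: subspace_sum subspace_scale)
  then show ?case using insert assms(2) by (simp add: s_add s_scale)
qed (simp add: s_zero assms)

text \<open>Stated as an expansion of every element of the span, the form in which an orthonormal
  basis is used later. A generator that equals its own projection leaves \<open>A\<close>
  unchanged.\<close>

lemma gram_schmidt:
  assumes "finite B" "B \<subseteq> V"
  shows "\<exists>A. orthonormal A \<and> (\<forall>v\<in>span B. v = (\<Sum>b\<in>A. scale (s v b) b))"
  using assms
proof (induction B rule: finite_induct)
  case empty
  show ?case by (rule exI[of _ "{}"]) (simp add: orthonormal_def)
next
  case (insert x B)
  then obtain A where A: "orthonormal A" and rep: "\<And>v. v \<in> span B \<Longrightarrow> v = (\<Sum>b\<in>A. scale (s v b) b)"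
    by auto
  have A': "finite A" "A \<subseteq> V" "\<And>a b. a \<in> A \<Longrightarrow> b \<in> A \<Longrightarrow> s a b = (if a = b then 1 else 0)"
    using A by (auto simp: orthonormal_def)
  have x: "x \<in> V" and B: "B \<subseteq> V" using insert by auto
  have spanB: "span B \<subseteq> V" using B V by (rule span_minimal)
  define P where "P v = (\<Sum>b\<in>A. scale (s v b) b)" for v
  have PV: "P v \<in> V" for v
    unfolding P_def using A'(2) V by (intro subspace_sum subspace_scale) auto
  define r where "r = x - P x"
  have r: "r \<in> V" unfolding r_def using x PV V by (intro subspace_diff)
  have sPb: "s (P v) b = s v b" if "b \<in> A" "v \<in> V" for b v
  proof -
    have "s (P v) b = (\<Sum>a\<in>A. s v a * s a b)"
      unfolding P_def using A' that by (intro s_sum) auto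
    also have "\<dots> = (\<Sum>a\<in>A. if a = b then s v a else 0)"
      using A'(3) that by (intro sum.cong) auto
    also have "\<dots> = s v b" using A'(1) that by simp
    finally show ?thesis .
  qed
  have x_eq: "x = r + P x" by (simp add: r_def)
  have srb: "s r b = 0" if "b \<in> A" for b
  proof -
    have "s x b = s r b + s (P x) b"
      using s_add[OF r PV, of b x] A'(2) that x_eq by auto
    then show ?thesis using sPb[OF that x] by simp
  qed
  have break: "\<exists>k u. v = scale k x + u \<and> u \<in> span B" if v: "v \<in> span (insert x B)" for v
  proof -
    obtain k where "v - scale k x \<in> span B" using v unfolding span_breakdown_eq by blast
    then show ?thesis by (intro exI[of _ k] exI[of _ "v - scale k x"]) simp
  qed
  \<comment> \<open>The expansion property is linear in \<open>v\<close>, so it is enough to check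
    it for the new generator and on the old span.\<close>
  have lin: "(\<Sum>b\<in>C. scale (s v b) b) = v"
    if C: "C \<subseteq> V" "finite C" and v: "v \<in> span (insert x B)"
      and hx: "(\<Sum>b\<in>C. scale (s x b) b) = x" and hB: "\<And>u. u \<in> span B \<Longrightarrow> (\<Sum>b\<in>C. scale (s u b) b) = u"
    for C v
  proof -
    obtain k u where ku: "v = scale k x + u" "u \<in> span B" using break[OF v] by blast
    have uV: "u \<in> V" using ku spanB by auto
    have kx: "scale k x \<in> V" using x V by (simp add: subspace_scale)
    have "(\<Sum>b\<in>C. scale (s v b) b) = (\<Sum>b\<in>C. scale k (scale (s x b) b) + scale (s u b) b)"
      using C ku uV kx x by (intro sum.cong) (auto simp: s_add s_scale scale_left_distrib subset_iff)
    also have "\<dots> = scale k (\<Sum>b\<in>C. scale (s x b) b) + (\<Sum>b\<in>C. scale (s u b) b)"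
      by (simp add: sum.distrib scale_sum_right)
    also have "\<dots> = v" using hx hB[OF ku(2)] ku by simp
    finally show ?thesis .
  qed
  show ?case
  proof (cases "r = 0")
    case True
    then have Px: "P x = x" using x_eq by simp
    have "(\<Sum>b\<in>A. scale (s v b) b) = v" if "v \<in> span (insert x B)" for v
      by (rule lin[OF A'(2,1) that Px[unfolded P_def] rep[symmetric]])
    then show ?thesis using A by (intro exI[of _ A]) simp
  next
    case False
    then have "s r r \<noteq> 0" using s_definite[OF r] by blast
    then have srr: "s r r > 0" using s_nonneg[OF r] by simp
    define c where "c = 1 / sqrt (s r r)"
    define w where "w = scale c r"
    have w: "w \<in> V" unfolding w_def using r V by (simp add: subspace_scale)
    have cc: "c * (c * s r r) = 1" using srr by (simp add: c_def)
    have swb: "s w b = 0" if "b \<in> A" for b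
      using srb[OF that] s_scale[OF r, of b c] A'(2) that by (auto simp: w_def)
    have sbw: "s b w = 0" if "b \<in> A" for b
      using swb[OF that] s_commute[OF w, of b] A'(2) that by auto
    have wr: "s w r = c * s r r" unfolding w_def by (rule s_scale[OF r r])
    have sww: "s w w = 1"
    proof -
      have "s w w = c * s r w" using s_scale[OF r w, of c] by (simp add: w_def)
      also have "s r w = s w r" by (rule s_commute[OF r w])
      finally show ?thesis using wr cc by simp
    qed
    have wA: "w \<notin> A" using swb[of w] sww by auto
    have on: "orthonormal (insert w A)"
      unfolding orthonormal_def using A' w sww swb sbw wA by auto
    have "(\<Sum>b\<in>insert w A. scale (s v b) b) = v" if v: "v \<in> span (insert x B)" for v
    proof (rule lin[OF _ _ v])
      show "insert w A \<subseteq> V" "finite (insert w A)" using A' w by auto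
      have "s (P x) w = 0"
        unfolding P_def using A' w sbw by (subst s_sum) auto
      then have "s x w = s r w" using s_add[OF r PV w, of x] x_eq by simp
      also have "\<dots> = c * s r r" using s_commute[OF r w] wr by simp
      finally have "scale (s x w) w = r"
        using cc by (simp add: w_def mult.commute mult.left_commute)
      then show "(\<Sum>b\<in>insert w A. scale (s x b) b) = x"
        using A'(1) wA x_eq by (simp add: P_def)
      fix u assume u: "u \<in> span B"
      have "s u w = s (\<Sum>b\<in>A. scale (s u b) b) w"
        using arg_cong[OF rep[OF u], of "\<lambda>v. s v w"] .
      also have "\<dots> = (\<Sum>b\<in>A. s u b * s b w)" by (rule s_sum[OF A'(2) w A'(1)])
      also have "\<dots> = 0" using sbw by simp
      finally show "(\<Sum>b\<in>insert w A. scale (s u b) b) = u"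
        using rep[OF u, symmetric] A'(1) wA by simp
    qed
    then show ?thesis using on by (intro exI[of _ "insert w A"]) simp
  qed
qed

text \<open>Bessel's inequality: the square of a coefficient is one summand of Parseval's
  sum.\<close>

lemma norm_expansion_le:
  assumes A: "orthonormal A" and v: "v \<in> V" and rep: "v = (\<Sum>b\<in>A. scale (s v b) b)" and b: "b \<in> A"
  shows "\<bar>s v b\<bar> \<le> sqrt (s v v)"
proof -
  have A': "finite A" "A \<subseteq> V" using A by (auto simp: orthonormal_def)
  have "s v v = (\<Sum>b\<in>A. s v b * s b v)"
    using s_sum[OF A'(2) v A'(1), of "\<lambda>b. s v b"] rep by simp
  also have "\<dots> = (\<Sum>b\<in>A. (s v b)\<^sup>2)"
    using A' s_commute[OF v] by (intro sum.cong) (auto simp: power2_eq_square)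
  finally have "(s v b)\<^sup>2 \<le> s v v"
    using member_le_sum[of b A "\<lambda>b. (s v b)\<^sup>2"] A' b by simp
  then show ?thesis by (metis real_sqrt_abs real_sqrt_le_mono)
qed

text \<open>The representative has the values of \<open>F\<close> on an orthonormal basis as
  coefficients. The projectors and the components of the discrete gradient are definite descriptions
  of this kind.\<close>

lemma riesz:
  assumes B: "finite B" "V = span B"
    and F: "\<And>u v. u \<in> V \<Longrightarrow> v \<in> V \<Longrightarrow> F (u + v) = F u + F v" "\<And>c u. u \<in> V \<Longrightarrow> F (scale c u) = c * F u"
  shows "\<exists>!p. p \<in> V \<and> (\<forall>r\<in>V. s p r = F r)"
proof (rule ex_ex1I)
  have "B \<subseteq> V" using B span_superset by auto
  then obtain A where A: "orthonormal A" and rep: "\<And>v. v \<in> V \<Longrightarrow> v = (\<Sum>b\<in>A. scale (s v b) b)"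
    using gram_schmidt[OF B(1)] B(2) by blast
  have A': "finite A" "A \<subseteq> V" using A by (auto simp: orthonormal_def)
  have F0: "F 0 = 0" using F(2)[of 0 0] V by (simp add: subspace_0)
  have Fsum: "F (\<Sum>b\<in>C. scale (f b) b) = (\<Sum>b\<in>C. f b * F b)" if "finite C" "C \<subseteq> V" for C f
    using that
  proof (induction C rule: finite_induct)
    case (insert x C)
    have "(\<Sum>b\<in>C. scale (f b) b) \<in> V" "scale (f x) x \<in> V"
      using insert V by (auto intro!: subspace_sum subspace_scale)
    then show ?case using insert by (simp add: F)
  qed (simp add: F0)
  define p where "p = (\<Sum>b\<in>A. scale (F b) b)"
  have "p \<in> V" unfolding p_def using A' V by (intro subspace_sum subspace_scale) auto
  moreover have "s p r = F r" if r: "r \<in> V" for r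
  proof -
    have "s p r = (\<Sum>b\<in>A. F b * s b r)" unfolding p_def using A' r by (intro s_sum) auto
    also have "\<dots> = (\<Sum>b\<in>A. s r b * F b)"
      using A' s_commute[OF r] by (intro sum.cong) auto
    also have "\<dots> = F r" using Fsum[OF A', of "\<lambda>b. s r b"] rep[OF r] by simp
    finally show ?thesis .
  qed
  ultimately show "\<exists>p. p \<in> V \<and> (\<forall>r\<in>V. s p r = F r)" by blast
  fix p q assume p: "p \<in> V \<and> (\<forall>r\<in>V. s p r = F r)" and q: "q \<in> V \<and> (\<forall>r\<in>V. s q r = F r)"
  have d: "p - q \<in> V" using p q V by (simp add: subspace_diff)
  have "s p (p - q) = s (p - q) (p - q) + s q (p - q)"
    using s_add[OF d _ d, of q] q by simp
  then have "s (p - q) (p - q) = 0" using p q d by simp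
  then have "p - q = 0" using s_definite d by blast
  then show "p = q" by simp
qed

end

definition fun_scale :: "real \<Rightarrow> ('x \<Rightarrow> real) \<Rightarrow> 'x \<Rightarrow> real" where
  "fun_scale c f = (\<lambda>x. c * f x)"

lemma sum_fun_apply: "(\<Sum>i\<in>I. f i) x = (\<Sum>i\<in>I. f i x :: real)"
  by (induction I rule: infinite_finite_induct) auto

interpretation fun_space: vector_space fun_scale
  by unfold_locales (auto simp: fun_scale_def fun_eq_iff algebra_simps)

lemma L2_inner_product_on:
  assumes P: "fun_space.subspace P"
    and int: "\<And>p r. p \<in> P \<Longrightarrow> r \<in> P \<Longrightarrow> integrable \<mu> (\<lambda>x. p x * r x)"
    and def: "\<And>p. p \<in> P \<Longrightarrow> (LINT x|\<mu>. p x * p x) = 0 \<Longrightarrow> p = 0"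
  shows "inner_product_on fun_scale P (\<lambda>p r. LINT x|\<mu>. p x * r x)"
proof
  show "fun_space.subspace P" by (rule P)
  show "(LINT x|\<mu>. (u + v) x * w x) = (LINT x|\<mu>. u x * w x) + (LINT x|\<mu>. v x * w x)"
    if "u \<in> P" "v \<in> P" "w \<in> P" for u v w
    using int that by (simp add: distrib_right)
  show "(LINT x|\<mu>. fun_scale c u x * w x) = c * (LINT x|\<mu>. u x * w x)" for c u w
    by (simp add: fun_scale_def mult.assoc)
qed (use def in \<open>auto simp: mult.commute\<close>)

lemma L2_proj_ex1:
  assumes ip: "inner_product_on fun_scale P (\<lambda>p r. LINT x|\<mu>. p x * r x)"
    and B: "finite B" "P = fun_space.span B"
    and f: "\<And>r. r \<in> P \<Longrightarrow> integrable \<mu> (\<lambda>x. f x * r x)"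
  shows "\<exists>!p. p \<in> P \<and> (\<forall>r\<in>P. (LINT x|\<mu>. p x * r x) = (LINT x|\<mu>. f x * r x))"
  using f by (intro inner_product_on.riesz[OF ip B]) (auto simp: fun_scale_def distrib_left mult.left_commute)

section \<open>Polynomial functions\<close>

definition monomial :: "('n \<Rightarrow> nat) \<Rightarrow> real^'n::finite \<Rightarrow> real" where
  "monomial \<alpha> x = (\<Prod>i\<in>UNIV. x $ i ^ \<alpha> i)"

lemma finite_exponents: "finite {\<alpha> :: 'n::finite \<Rightarrow> nat. (\<Sum>i\<in>UNIV. \<alpha> i) \<le> q}"
proof (rule finite_subset)
  show "finite (PiE (UNIV :: 'n set) (\<lambda>_. {..q}))" by (intro finite_PiE) auto
  show "{\<alpha>. (\<Sum>i\<in>UNIV. \<alpha> i) \<le> q} \<subseteq> PiE (UNIV :: 'n set) (\<lambda>_. {..q})"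
  proof
    fix \<alpha> :: "'n \<Rightarrow> nat" assume "\<alpha> \<in> {\<alpha>. (\<Sum>i\<in>UNIV. \<alpha> i) \<le> q}"
    then have "\<alpha> i \<le> q" for i using member_le_sum[of i UNIV \<alpha>] by simp
    then show "\<alpha> \<in> PiE UNIV (\<lambda>_. {..q})" by auto
  qed
qed

lemma polys_eq: "polys q = {\<lambda>x. \<Sum>\<alpha> | (\<Sum>i\<in>UNIV. \<alpha> i) \<le> q. c \<alpha> * monomial \<alpha> x |c. True}"
  by (auto simp: polys_def monomial_def)

lemma subspace_polys: "fun_space.subspace (polys q)"
  unfolding fun_space.subspace_def
proof (intro conjI ballI allI)
  show "0 \<in> polys q"
    unfolding polys_eq by (auto intro!: exI[of _ "\<lambda>_. 0"] simp: zero_fun_def)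
  show "p + r \<in> polys q" if "p \<in> polys q" "r \<in> polys q" for p r :: "real^'n \<Rightarrow> real"
  proof -
    obtain c d where "p = (\<lambda>x. \<Sum>\<alpha> | (\<Sum>i\<in>UNIV. \<alpha> i) \<le> q. c \<alpha> * monomial \<alpha> x)"
      "r = (\<lambda>x. \<Sum>\<alpha> | (\<Sum>i\<in>UNIV. \<alpha> i) \<le> q. d \<alpha> * monomial \<alpha> x)" using \<open>p \<in> polys q\<close> \<open>r \<in> polys q\<close> by (auto simp: polys_eq)
    then have "p + r = (\<lambda>x. \<Sum>\<alpha> | (\<Sum>i\<in>UNIV. \<alpha> i) \<le> q. (c \<alpha> + d \<alpha>) * monomial \<alpha> x)"
      by (auto simp: fun_eq_iff sum.distrib distrib_right)
    then show ?thesis unfolding polys_eq by (intro CollectI exI[of _ "\<lambda>\<alpha>. c \<alpha> + d \<alpha>"]) simp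
  qed
  show "fun_scale a p \<in> polys q" if "p \<in> polys q" for a and p :: "real^'n \<Rightarrow> real"
  proof -
    obtain c where "p = (\<lambda>x. \<Sum>\<alpha> | (\<Sum>i\<in>UNIV. \<alpha> i) \<le> q. c \<alpha> * monomial \<alpha> x)" using \<open>p \<in> polys q\<close> by (auto simp: polys_eq)
    then have "fun_scale a p = (\<lambda>x. \<Sum>\<alpha> | (\<Sum>i\<in>UNIV. \<alpha> i) \<le> q. (a * c \<alpha>) * monomial \<alpha> x)"
      by (auto simp: fun_eq_iff fun_scale_def sum_distrib_left mult.assoc)
    then show ?thesis unfolding polys_eq by (intro CollectI exI[of _ "\<lambda>\<alpha>. a * c \<alpha>"]) simp
  qed
qed

lemma monomial_in_polys: "(\<Sum>i\<in>UNIV. \<alpha> i) \<le> q \<Longrightarrow> monomial \<alpha> \<in> polys q"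
proof -
  assume \<alpha>: "(\<Sum>i\<in>UNIV. \<alpha> i) \<le> q"
  have "(\<Sum>\<beta> | (\<Sum>i\<in>UNIV. \<beta> i) \<le> q. (if \<beta> = \<alpha> then 1 else 0) * monomial \<beta> x) = monomial \<alpha> x" for x
  proof -
    have "(\<Sum>\<beta> | (\<Sum>i\<in>UNIV. \<beta> i) \<le> q. (if \<beta> = \<alpha> then 1 else 0) * monomial \<beta> x)
        = (\<Sum>\<beta> | (\<Sum>i\<in>UNIV. \<beta> i) \<le> q. if \<beta> = \<alpha> then monomial \<beta> x else 0)"
      by (intro sum.cong) auto
    also have "\<dots> = monomial \<alpha> x" using \<alpha> by (simp add: sum.delta[OF finite_exponents])
    finally show ?thesis .
  qed
  then show ?thesis
    unfolding polys_eq by (intro CollectI exI[of _ "\<lambda>\<beta>. if \<beta> = \<alpha> then 1 else 0"]) auto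
qed

lemma polys_span: "polys q = fun_space.span (monomial ` {\<alpha>. (\<Sum>i\<in>UNIV. \<alpha> i) \<le> q})"
proof
  show "fun_space.span (monomial ` {\<alpha>. (\<Sum>i\<in>UNIV. \<alpha> i) \<le> q}) \<subseteq> polys q"
    by (intro fun_space.span_minimal subspace_polys) (auto intro: monomial_in_polys)
  show "polys q \<subseteq> fun_space.span (monomial ` {\<alpha>. (\<Sum>i\<in>UNIV. \<alpha> i) \<le> q})"
  proof
    fix p :: "real^'n \<Rightarrow> real" assume "p \<in> polys q"
    then obtain c where "p = (\<lambda>x. \<Sum>\<alpha> | (\<Sum>i\<in>UNIV. \<alpha> i) \<le> q. c \<alpha> * monomial \<alpha> x)" by (auto simp: polys_eq)
    then have "p = (\<Sum>\<alpha> | (\<Sum>i\<in>UNIV. \<alpha> i) \<le> q. fun_scale (c \<alpha>) (monomial \<alpha>))"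
      by (auto simp: fun_eq_iff fun_scale_def sum_fun_apply)
    moreover have "(\<Sum>\<alpha> | (\<Sum>i\<in>UNIV. \<alpha> i) \<le> q. fun_scale (c \<alpha>) (monomial \<alpha>))
        \<in> fun_space.span (monomial ` {\<alpha>. (\<Sum>i\<in>UNIV. \<alpha> i) \<le> q})"
      by (intro fun_space.span_sum fun_space.span_scale fun_space.span_base imageI)
    ultimately show "p \<in> fun_space.span (monomial ` {\<alpha>. (\<Sum>i\<in>UNIV. \<alpha> i) \<le> q})" by simp
  qed
qed

lemma polys_mono: "q \<le> q' \<Longrightarrow> polys q \<subseteq> polys q'"
  unfolding polys_span by (intro fun_space.span_mono) auto

lemma polys_add: "p \<in> polys q \<Longrightarrow> r \<in> polys q \<Longrightarrow> (\<lambda>x. p x + r x) \<in> polys q"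
  using fun_space.subspace_add[OF subspace_polys, of p q r] by (simp add: plus_fun_def)

lemma polys_cmult: "p \<in> polys q \<Longrightarrow> (\<lambda>x. c * p x) \<in> polys q"
  using fun_space.subspace_scale[OF subspace_polys, of p q c] by (simp add: fun_scale_def)

lemma polys_sum: "(\<And>i. i \<in> I \<Longrightarrow> p i \<in> polys q) \<Longrightarrow> (\<Sum>i\<in>I. p i) \<in> polys q"
  by (rule fun_space.subspace_sum[OF subspace_polys])

lemma polys_const: "(\<lambda>x. c) \<in> polys q"
  using polys_cmult[OF monomial_in_polys[of "\<lambda>_. 0" q], of c] by (simp add: monomial_def)

lemma monomial_tensor: "monomial \<alpha> = tensor (\<lambda>i t. t ^ \<alpha> i)"
  by (auto simp: monomial_def tensor_def)

lemma monomial_has_derivative: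
  fixes \<alpha> :: "'n::finite \<Rightarrow> nat"
  shows "(monomial \<alpha> has_derivative
    (\<lambda>h. \<Sum>i\<in>UNIV. (real (\<alpha> i) * monomial (\<alpha>(i := \<alpha> i - 1)) x) * h $ i)) (at x)"
proof -
  have "(tensor (\<lambda>i t. t ^ \<alpha> i) has_derivative
    (\<lambda>h. \<Sum>i\<in>UNIV. tensor ((\<lambda>i t. t ^ \<alpha> i)(i := (\<lambda>t. real (\<alpha> i) * t ^ (\<alpha> i - 1)))) x * h $ i)) (at x)"
    by (rule tensor_has_derivative[where \<beta>' = "\<lambda>i t. real (\<alpha> i) * t ^ (\<alpha> i - 1)"])
      (auto intro!: derivative_eq_intros)
  moreover have "tensor ((\<lambda>i t. t ^ \<alpha> i)(i := (\<lambda>t. real (\<alpha> i) * t ^ (\<alpha> i - 1)))) x =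
    real (\<alpha> i) * monomial (\<alpha>(i := \<alpha> i - 1)) x" for i
    unfolding monomial_def tensor_def
    by (subst (1 2) prod.remove[of UNIV i]) (auto simp: mult.assoc intro!: prod.cong)
  ultimately show ?thesis by (simp add: monomial_tensor)
qed

lemma polys_has_derivative:
  fixes p :: "real^'n::finite \<Rightarrow> real"
  assumes p: "p \<in> polys (Suc q)"
  shows "(p has_derivative (\<lambda>h. \<Sum>i\<in>UNIV. partial i p x * h $ i)) (at x)" and "partial i p \<in> polys q"
proof -
  obtain c where c: "p = (\<lambda>x. \<Sum>\<alpha> | (\<Sum>i\<in>UNIV. \<alpha> i) \<le> Suc q. c \<alpha> * monomial \<alpha> x)"
    using p by (auto simp: polys_eq)
  \<comment> \<open>The truncated exponent \<open>\<alpha> i - 1\<close> is harmless for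
    \<open>\<alpha> i = 0\<close>, since the coefficient then vanishes.\<close>
  define G where "G i x = (\<Sum>\<alpha> | (\<Sum>i\<in>UNIV. \<alpha> i) \<le> Suc q. c \<alpha> * (real (\<alpha> i) * monomial (\<alpha>(i := \<alpha> i - 1)) x))" for i x
  have der: "(p has_derivative (\<lambda>h. \<Sum>i\<in>UNIV. G i x * h $ i)) (at x)" for x
  proof -
    have "(p has_derivative (\<lambda>h. \<Sum>\<alpha> | (\<Sum>i\<in>UNIV. \<alpha> i) \<le> Suc q. c \<alpha> *
        (\<Sum>i\<in>UNIV. (real (\<alpha> i) * monomial (\<alpha>(i := \<alpha> i - 1)) x) * h $ i))) (at x)"
      unfolding c by (intro has_derivative_sum has_derivative_mult_right monomial_has_derivative)
    moreover have "(\<Sum>\<alpha> | (\<Sum>i\<in>UNIV. \<alpha> i) \<le> Suc q. c \<alpha> *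
        (\<Sum>i\<in>UNIV. (real (\<alpha> i) * monomial (\<alpha>(i := \<alpha> i - 1)) x) * h $ i)) = (\<Sum>i\<in>UNIV. G i x * h $ i)" for h
      unfolding G_def sum_distrib_left sum_distrib_right
      by (subst sum.swap) (simp add: mult.assoc)
    ultimately show ?thesis by simp
  qed
  have pG: "partial i p = G i" for i using der by (intro ext partial_eqI)
  show "(p has_derivative (\<lambda>h. \<Sum>i\<in>UNIV. partial i p x * h $ i)) (at x)" using der by (simp add: pG)
  have "(\<lambda>x. c \<alpha> * (real (\<alpha> i) * monomial (\<alpha>(i := \<alpha> i - 1)) x)) \<in> polys q"
    if \<alpha>: "(\<Sum>i\<in>UNIV. \<alpha> i) \<le> Suc q" for \<alpha>
  proof (cases "\<alpha> i = 0")
    case True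
    then show ?thesis using polys_const[of 0 q] by simp
  next
    case False
    have "(\<Sum>j\<in>UNIV. (\<alpha>(i := \<alpha> i - 1)) j) = (\<alpha> i - 1) + (\<Sum>j\<in>UNIV-{i}. \<alpha> j)"
      by (subst sum.remove[of _ i]) auto
    moreover have "(\<Sum>j\<in>UNIV. \<alpha> j) = \<alpha> i + (\<Sum>j\<in>UNIV-{i}. \<alpha> j)"
      by (subst sum.remove[of _ i]) auto
    ultimately have "(\<Sum>j\<in>UNIV. (\<alpha>(i := \<alpha> i - 1)) j) \<le> q" using \<alpha> False by linarith
    then show ?thesis by (intro polys_cmult monomial_in_polys)
  qed
  then have "(\<Sum>\<alpha> | (\<Sum>i\<in>UNIV. \<alpha> i) \<le> Suc q. (\<lambda>x. c \<alpha> * (real (\<alpha> i) * monomial (\<alpha>(i := \<alpha> i - 1)) x))) \<in> polys q"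
    by (intro polys_sum) auto
  moreover have "(\<Sum>\<alpha> | (\<Sum>i\<in>UNIV. \<alpha> i) \<le> Suc q. (\<lambda>x. c \<alpha> * (real (\<alpha> i) * monomial (\<alpha>(i := \<alpha> i - 1)) x))) = G i"
    by (auto simp: fun_eq_iff G_def sum_fun_apply)
  ultimately show "partial i p \<in> polys q" by (simp add: pG)
qed

lemma polys_continuous: "p \<in> polys q \<Longrightarrow> continuous_on S p"
  by (auto simp: polys_def intro!: continuous_intros)

lemma polys_bounded_on:
  assumes "p \<in> polys q" "bounded S"
  obtains B where "\<And>x. x \<in> S \<Longrightarrow> \<bar>p x\<bar> \<le> B"
proof -
  have "bounded (p ` closure S)"
    using assms by (intro compact_imp_bounded compact_continuous_image polys_continuous)
      (auto simp: compact_eq_bounded_closed bounded_closure)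
  then show ?thesis using that closure_subset[of S] by (force simp: bounded_iff)
qed

lemma polys_line:
  assumes "p \<in> polys q"
  shows "\<exists>P. \<forall>t. p (x + t *\<^sub>R v) = poly P t"
proof -
  obtain c where c: "p = (\<lambda>x. \<Sum>\<alpha> | (\<Sum>i\<in>UNIV. \<alpha> i) \<le> q. c \<alpha> * (\<Prod>i\<in>UNIV. x $ i ^ \<alpha> i))"
    using assms by (auto simp: polys_def)
  have "p (x + t *\<^sub>R v) = poly (\<Sum>\<alpha> | (\<Sum>i\<in>UNIV. \<alpha> i) \<le> q. smult (c \<alpha>) (\<Prod>i\<in>UNIV. [:x $ i, v $ i:] ^ \<alpha> i)) t" for t
    by (simp add: c poly_sum poly_prod)
  then show ?thesis by blast
qed

text \<open>On the line joining a point of \<open>S\<close> to \<open>y\<close> the polynomial is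
  univariate with infinitely many zeros.\<close>

lemma polys_zero_on_open:
  fixes p :: "real^'n::finite \<Rightarrow> real"
  assumes p: "p \<in> polys q" and S: "open S" "S \<noteq> {}" and zero: "\<And>x. x \<in> S \<Longrightarrow> p x = 0"
  shows "p = 0"
proof
  fix y
  obtain x where x: "x \<in> S" using S by auto
  obtain P where P: "\<And>t. p (x + t *\<^sub>R (y - x)) = poly P t" using polys_line[OF p] by blast
  have "open ((\<lambda>t. x + t *\<^sub>R (y - x)) -` S)"
    using S(1) by (intro open_vimage continuous_intros)
  moreover have "0 \<in> (\<lambda>t. x + t *\<^sub>R (y - x)) -` S" using x by simp
  ultimately have "infinite ((\<lambda>t. x + t *\<^sub>R (y - x)) -` S)"
    by (metis empty_iff finite_imp_not_open)
  moreover have "(\<lambda>t. x + t *\<^sub>R (y - x)) -` S \<subseteq> {t. poly P t = 0}"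
    using zero P by (metis (mono_tags, lifting) mem_Collect_eq subsetI vimageE)
  ultimately have "P = 0" using poly_roots_finite finite_subset by blast
  then show "p y = 0 y" using P[of 1] by simp
qed

lemma polys_gradient_zero:
  fixes p :: "real^'n::finite \<Rightarrow> real"
  assumes p: "p \<in> polys (Suc q)" and zero: "\<And>i. partial i p = 0"
  obtains c where "p = (\<lambda>x. c)"
proof -
  have "(p has_derivative (\<lambda>h. 0)) (at x)" for x
    using polys_has_derivative(1)[OF p, of x] by (simp add: zero)
  then have "\<exists>c. \<forall>x\<in>UNIV. p x = c"
    by (intro has_derivative_zero_constant) auto
  then show ?thesis using that by blast
qed

section \<open>Discrete operators\<close>

lemma integrable_lebesgue_on_bounded:
  fixes f :: "'a::euclidean_space \<Rightarrow> real"
  assumes S: "S \<in> sets lebesgue" "bounded S" and f: "f \<in> borel_measurable (lebesgue_on S)"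
    and B: "AE x in lebesgue_on S. \<bar>f x\<bar> \<le> B"
  shows "integrable (lebesgue_on S) f"
proof -
  have "emeasure (lebesgue_on S) (space (lebesgue_on S)) = emeasure lebesgue S"
    using S by (simp add: emeasure_restrict_space)
  also have "\<dots> < \<infinity>"
    using bounded_set_imp_lmeasurable[OF S(2,1)] by (auto simp: fmeasurable_def)
  finally have "finite_measure (lebesgue_on S)" by (intro finite_measureI) auto
  then show ?thesis
    by (rule finite_measure.integrable_const_bound[where B = B]) (use f B in auto)
qed

lemma measurable_lebesgue_on_continuous:
  fixes f :: "'a::euclidean_space \<Rightarrow> 'b::topological_space"
  assumes "continuous_on UNIV f"
  shows "f \<in> borel_measurable (lebesgue_on S)"
proof -
  have "f \<in> borel_measurable lborel"
    using borel_measurable_continuous_onI[OF assms] by simp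
  then show ?thesis by (intro measurable_restrict_space1 measurable_completion)
qed

lemma integrable_lebesgue_on_continuous:
  fixes f :: "'a::euclidean_space \<Rightarrow> real"
  assumes S: "S \<in> sets lebesgue" "bounded S" and f: "continuous_on UNIV f"
  shows "integrable (lebesgue_on S) f"
proof -
  have "bounded (f ` closure S)"
    using S by (intro compact_imp_bounded compact_continuous_image continuous_on_subset[OF f])
      (auto simp: compact_eq_bounded_closed bounded_closure)
  then obtain B where B: "\<And>x. x \<in> S \<Longrightarrow> \<bar>f x\<bar> \<le> B"
    using closure_subset[of S] by (force simp: bounded_iff)
  show ?thesis
    by (rule integrable_lebesgue_on_bounded[OF S measurable_lebesgue_on_continuous[OF f], of B])
      (rule AE_I2, use B in simp)
qed

lemma AE_lebesgue_on_open_zero: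
  fixes f :: "'a::euclidean_space \<Rightarrow> real"
  assumes S: "open S" and f: "continuous_on UNIV f" and ae: "AE x in lebesgue_on S. f x = 0" and x: "x \<in> S"
  shows "f x = 0"
proof (rule ccontr)
  assume "f x \<noteq> 0"
  have "open (S \<inter> {x. f x \<noteq> 0})"
    using S f by (intro open_Int open_Collect_neq continuous_intros) auto
  moreover have "AE x in lebesgue. x \<notin> S \<inter> {x. f x \<noteq> 0}"
    using ae S by (subst (asm) AE_restrict_space_iff) (auto elim: eventually_mono)
  then have "negligible (S \<inter> {x. f x \<noteq> 0})"
    using \<open>open (S \<inter> {x. f x \<noteq> 0})\<close> by (subst (asm) AE_iff_null_sets[symmetric]) (auto simp: negligible_iff_null_sets)
  ultimately show False using x \<open>f x \<noteq> 0\<close> open_not_negligible by blast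
qed

section \<open>Polynomials and bounded functions on faces\<close>

definition smul_indicator :: "'a set \<Rightarrow> ('a \<Rightarrow> real) \<Rightarrow> 'a \<Rightarrow> real" where
  "smul_indicator \<sigma> p = (\<lambda>x. indicat_real \<sigma> x * p x)"

lemma face_polys_image: "face_polys q \<sigma> = smul_indicator \<sigma> ` polys q"
  by (auto simp: face_polys_def smul_indicator_def)

lemma face_polys_span:
  "face_polys q \<sigma> = fun_space.span (smul_indicator \<sigma> ` monomial ` {\<alpha>. (\<Sum>i\<in>UNIV. \<alpha> i) \<le> q})"
proof -
  have "Modules.module_hom fun_scale fun_scale (smul_indicator \<sigma>)"
    by unfold_locales (auto simp: smul_indicator_def fun_scale_def fun_eq_iff algebra_simps)
  from module_hom.span_image[OF this] show ?thesis
    by (simp add: face_polys_image polys_span)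
qed

lemma subspace_face_polys: "fun_space.subspace (face_polys q \<sigma>)"
  unfolding face_polys_span by (rule fun_space.subspace_span)

lemma face_polysE:
  assumes "f \<in> face_polys q \<sigma>"
  obtains p where "p \<in> polys q" "f = (\<lambda>x. indicat_real \<sigma> x * p x)"
  using assms by (auto simp: face_polys_def)

context flat_face
begin

lemma face_polys_nice:
  fixes f :: "'a \<Rightarrow> real"
  assumes "\<And>x. x \<in> \<sigma> \<Longrightarrow> f x = p x" "continuous_on UNIV p"
  shows "f \<in> borel_measurable (face_measure \<sigma>)" "\<exists>B. \<forall>x\<in>\<sigma>. \<bar>f x\<bar> \<le> B"
proof -
  have "p \<in> borel_measurable (face_measure \<sigma>)"
    using assms(2) by (intro measurable_face_measure_continuous) (rule continuous_on_subset, auto)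
  then show "f \<in> borel_measurable (face_measure \<sigma>)"
    by (subst measurable_cong[of _ _ p]) (use assms(1) in auto)
  have "bounded (p ` closure \<sigma>)"
    using bounded_face by (intro compact_imp_bounded compact_continuous_image continuous_on_subset[OF assms(2)])
      (auto simp: compact_eq_bounded_closed bounded_closure)
  then show "\<exists>B. \<forall>x\<in>\<sigma>. \<bar>f x\<bar> \<le> B"
    using closure_subset[of \<sigma>] assms(1) by (force simp: bounded_iff)
qed

end

text \<open>A class closed under sums and products whose members are integrable for the finite face
  measure. Values off \<sigma> are left free.\<close>

definition face_fun :: "'a::euclidean_space set \<Rightarrow> ('a \<Rightarrow> real) \<Rightarrow> bool" where
  "face_fun \<sigma> f \<longleftrightarrow> f \<in> borel_measurable (face_measure \<sigma>) \<and> (\<exists>B. \<forall>x\<in>\<sigma>. \<bar>f x\<bar> \<le> B)"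

lemma face_fun_add: "face_fun \<sigma> f \<Longrightarrow> face_fun \<sigma> g \<Longrightarrow> face_fun \<sigma> (\<lambda>x. f x + g x)"
  unfolding face_fun_def by (auto intro: order_trans[OF abs_triangle_ineq add_mono])

lemma face_fun_mult:
  assumes "face_fun \<sigma> f" "face_fun \<sigma> g"
  shows "face_fun \<sigma> (\<lambda>x. f x * g x)"
proof -
  obtain B C where "\<And>x. x \<in> \<sigma> \<Longrightarrow> \<bar>f x\<bar> \<le> B" "\<And>x. x \<in> \<sigma> \<Longrightarrow> \<bar>g x\<bar> \<le> C"
    using assms by (auto simp: face_fun_def)
  then have "\<forall>x\<in>\<sigma>. \<bar>f x * g x\<bar> \<le> \<bar>B\<bar> * \<bar>C\<bar>"
    by (auto simp: abs_mult intro!: mult_mono intro: order_trans[OF _ abs_ge_self])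
  then show ?thesis using assms by (auto simp: face_fun_def)
qed

lemma face_fun_const: "face_fun \<sigma> (\<lambda>x. c)"
  unfolding face_fun_def by auto

lemma face_fun_cmult: "face_fun \<sigma> f \<Longrightarrow> face_fun \<sigma> (\<lambda>x. c * f x)"
  by (rule face_fun_mult[OF face_fun_const])

context discretisation
begin

lemma face_fun_integrable:
  assumes "\<sigma> \<in> \<E>" "face_fun \<sigma> f"
  shows "integrable (face_measure \<sigma>) f"
proof -
  obtain n c where "flat_face \<sigma> n c" using face_flat[OF assms(1)] .
  then show ?thesis using assms(2) flat_face.integrable_face_measure by (force simp: face_fun_def)
qed

lemma face_fun_continuous:
  assumes "\<sigma> \<in> \<E>" "continuous_on (closure \<sigma>) f"
  shows "face_fun \<sigma> f"
proof -
  obtain n c where "flat_face \<sigma> n c" using face_flat[OF assms(1)] .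
  then interpret flat_face \<sigma> n c .
  have "bounded (f ` closure \<sigma>)"
    using bounded_face by (intro compact_imp_bounded compact_continuous_image assms(2))
      (auto simp: compact_eq_bounded_closed bounded_closure)
  then have "\<exists>B. \<forall>x\<in>\<sigma>. \<bar>f x\<bar> \<le> B" using closure_subset[of \<sigma>] by (force simp: bounded_iff)
  moreover have "f \<in> borel_measurable (face_measure \<sigma>)"
    using assms(2) closure_subset by (intro measurable_face_measure_continuous) (rule continuous_on_subset)
  ultimately show ?thesis by (simp add: face_fun_def)
qed

end

lemma ex1_implies_eq: "\<exists>!x. P x \<Longrightarrow> P a \<Longrightarrow> P b \<Longrightarrow> a = b"
  by auto

section \<open>Projectors and discrete gradients\<close>

locale hybrid_discretisation = discretisation \<Omega> \<M> \<E> \<F>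
  for \<Omega> :: "(real^'n::finite) set" and \<M> \<E> :: "(real^'n) set set"
    and \<F> :: "(real^'n) set \<Rightarrow> (real^'n) set set" +
  fixes k :: nat
begin

lemma cell_lebesgue: "K \<in> \<M> \<Longrightarrow> K \<in> sets lebesgue"
  using cell(1) by (simp add: borel_open)

lemma cell_integrable:
  "K \<in> \<M> \<Longrightarrow> continuous_on UNIV f \<Longrightarrow> integrable (lebesgue_on K) (f :: real^'n \<Rightarrow> real)"
  using integrable_lebesgue_on_continuous[OF cell_lebesgue cell(3)] .

lemma cell_inner:
  assumes "K \<in> \<M>"
  shows "inner_product_on fun_scale (polys q) (\<lambda>p r. LINT x|lebesgue_on K. p x * r x)"
proof (rule L2_inner_product_on[OF subspace_polys])
  show int: "integrable (lebesgue_on K) (\<lambda>x. p x * r x)" if "p \<in> polys q" "r \<in> polys q" for p r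
    using that by (intro cell_integrable[OF assms] continuous_intros polys_continuous)
  fix p :: "real^'n \<Rightarrow> real" assume p: "p \<in> polys q" "(LINT x|lebesgue_on K. p x * p x) = 0"
  have "AE x in lebesgue_on K. p x * p x = 0"
    using p(2) integral_nonneg_eq_0_iff_AE[OF int[OF p(1) p(1)]] by simp
  then have "AE x in lebesgue_on K. p x = 0" by simp
  then have "p x = 0" if "x \<in> K" for x
    by (rule AE_lebesgue_on_open_zero[OF cell(1)[OF assms] polys_continuous[OF p(1)] _ that])
  then show "p = 0" by (rule polys_zero_on_open[OF p(1) cell(1,4)[OF assms]])
qed

lemma cell_proj_in_polys:
  assumes K: "K \<in> \<M>" and f: "f \<in> borel_measurable (lebesgue_on K)" "AE x in lebesgue_on K. \<bar>f x\<bar> \<le> B"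
  shows "cell_proj q K f \<in> polys q"
proof -
  have "\<exists>!p. p \<in> polys q \<and> (\<forall>r\<in>polys q. (LINT x|lebesgue_on K. p x * r x) = (LINT x|lebesgue_on K. f x * r x))"
  proof (rule L2_proj_ex1[OF cell_inner[OF K] _ polys_span])
    show "finite (monomial ` {\<alpha> :: 'n \<Rightarrow> nat. (\<Sum>i\<in>UNIV. \<alpha> i) \<le> q})" by (intro finite_imageI finite_exponents)
    fix r :: "real^'n \<Rightarrow> real" assume r: "r \<in> polys q"
    obtain C where C: "\<And>x. x \<in> K \<Longrightarrow> \<bar>r x\<bar> \<le> C" by (rule polys_bounded_on[OF r cell(3)[OF K]]) blast
    have rm: "r \<in> borel_measurable (lebesgue_on K)"
      by (rule measurable_lebesgue_on_continuous[OF polys_continuous[OF r]])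
    show "integrable (lebesgue_on K) (\<lambda>x. f x * r x)"
    proof (rule integrable_lebesgue_on_bounded[OF cell_lebesgue[OF K] cell(3)[OF K]])
      show "(\<lambda>x. f x * r x) \<in> borel_measurable (lebesgue_on K)" using f(1) rm by measurable
      have "AE x in lebesgue_on K. x \<in> K" by (rule AE_I2) simp
      with f(2) show "AE x in lebesgue_on K. \<bar>f x * r x\<bar> \<le> \<bar>B\<bar> * \<bar>C\<bar>"
        by eventually_elim (auto simp: abs_mult intro!: mult_mono intro: order_trans[OF _ abs_ge_self] C)
    qed
  qed
  from theI'[OF this] show ?thesis unfolding cell_proj_def L2_proj_def by blast
qed

lemma face_fun_face_polys:
  assumes "\<sigma> \<in> \<E>" "f \<in> face_polys q \<sigma>"
  shows "face_fun \<sigma> f"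
proof -
  obtain n c where "flat_face \<sigma> n c" using face_flat[OF assms(1)] .
  then interpret flat_face \<sigma> n c .
  obtain p where p: "p \<in> polys q" "f = (\<lambda>x. indicat_real \<sigma> x * p x)" using face_polysE[OF assms(2)] .
  show ?thesis
    unfolding face_fun_def using face_polys_nice[of f p] p polys_continuous[OF p(1)] by auto
qed

text \<open>Definiteness rests on storing face polynomials as restrictions extended by zero: a
  nonzero polynomial may vanish on \<sigma>, but the function stored for it is then zero.\<close>

lemma face_inner:
  assumes \<sigma>: "\<sigma> \<in> \<E>"
  shows "inner_product_on fun_scale (face_polys q \<sigma>) (\<lambda>p r. LINT x|face_measure \<sigma>. p x * r x)"
proof (rule L2_inner_product_on[OF subspace_face_polys])
  show int: "integrable (face_measure \<sigma>) (\<lambda>x. p x * r x)" if "p \<in> face_polys q \<sigma>" "r \<in> face_polys q \<sigma>" for p r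
    using that by (intro face_fun_integrable[OF \<sigma>] face_fun_mult face_fun_face_polys[OF \<sigma>])
  obtain n c where "flat_face \<sigma> n c" using face_flat[OF \<sigma>] .
  then interpret flat_face \<sigma> n c .
  fix f assume f: "f \<in> face_polys q \<sigma>" "(LINT x|face_measure \<sigma>. f x * f x) = 0"
  obtain p where p: "p \<in> polys q" "f = (\<lambda>x. indicat_real \<sigma> x * p x)" using face_polysE[OF f(1)] .
  have "AE x in face_measure \<sigma>. f x * f x = 0"
    using f(2) integral_nonneg_eq_0_iff_AE[OF int[OF f(1) f(1)]] by simp
  moreover have "AE x in face_measure \<sigma>. x \<in> \<sigma>" by (rule AE_I2) simp
  ultimately have "AE x in face_measure \<sigma>. p x = 0" by eventually_elim (simp add: p)
  then have "p x = 0" if "x \<in> \<sigma>" for x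
    using AE_face_measure_continuous[OF polys_continuous[OF p(1)] _ that] by blast
  then show "f = 0" by (auto simp: p fun_eq_iff indicator_def)
qed

lemma face_proj_ex1:
  assumes \<sigma>: "\<sigma> \<in> \<E>" and f: "face_fun \<sigma> f"
  shows "\<exists>!p. p \<in> face_polys q \<sigma> \<and> (\<forall>r\<in>face_polys q \<sigma>. (LINT x|face_measure \<sigma>. p x * r x) = (LINT x|face_measure \<sigma>. f x * r x))"
proof (rule L2_proj_ex1[OF face_inner[OF \<sigma>] _ face_polys_span])
  show "finite (smul_indicator \<sigma> ` monomial ` {\<alpha> :: 'n \<Rightarrow> nat. (\<Sum>i\<in>UNIV. \<alpha> i) \<le> q})"
    by (intro finite_imageI finite_exponents)
  show "integrable (face_measure \<sigma>) (\<lambda>x. f x * r x)" if "r \<in> face_polys q \<sigma>" for r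
    by (rule face_fun_integrable[OF \<sigma> face_fun_mult[OF f face_fun_face_polys[OF \<sigma> that]]])
qed

lemma face_proj:
  assumes \<sigma>: "\<sigma> \<in> \<E>" and f: "face_fun \<sigma> f"
  shows "face_proj q \<sigma> f \<in> face_polys q \<sigma>"
    "\<And>r. r \<in> face_polys q \<sigma> \<Longrightarrow> (LINT x|face_measure \<sigma>. face_proj q \<sigma> f x * r x) = (LINT x|face_measure \<sigma>. f x * r x)"
  using theI'[OF face_proj_ex1[OF assms, of q]] unfolding face_proj_def L2_proj_def by blast+

lemma face_proj_eqI:
  assumes \<sigma>: "\<sigma> \<in> \<E>" and f: "face_fun \<sigma> f" and p: "p \<in> face_polys q \<sigma>"
    and eq: "\<And>r. r \<in> face_polys q \<sigma> \<Longrightarrow> (LINT x|face_measure \<sigma>. p x * r x) = (LINT x|face_measure \<sigma>. f x * r x)"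
  shows "face_proj q \<sigma> f = p"
  unfolding face_proj_def L2_proj_def
  by (rule the1_equality[OF face_proj_ex1[OF \<sigma> f, of q]]) (use p eq in blast)

lemma face_proj_add:
  assumes \<sigma>: "\<sigma> \<in> \<E>" and f: "face_fun \<sigma> f" and g: "face_fun \<sigma> g"
  shows "face_proj q \<sigma> (\<lambda>x. f x + g x) = face_proj q \<sigma> f + face_proj q \<sigma> g"
proof (rule face_proj_eqI[OF \<sigma> face_fun_add[OF f g]])
  show "face_proj q \<sigma> f + face_proj q \<sigma> g \<in> face_polys q \<sigma>"
    by (intro fun_space.subspace_add[OF subspace_face_polys] face_proj \<sigma> f g)
  fix r assume r: "r \<in> face_polys q \<sigma>"
  note i = face_fun_integrable[OF \<sigma> face_fun_mult[OF _ face_fun_face_polys[OF \<sigma> r]]]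
  show "(LINT x|face_measure \<sigma>. (face_proj q \<sigma> f + face_proj q \<sigma> g) x * r x) = (LINT x|face_measure \<sigma>. (f x + g x) * r x)"
    using i[OF f] i[OF g] i[OF face_fun_face_polys[OF \<sigma> face_proj(1)[OF \<sigma> f, of q]]]
      i[OF face_fun_face_polys[OF \<sigma> face_proj(1)[OF \<sigma> g, of q]]]
    by (simp add: distrib_right face_proj(2)[OF \<sigma> f r] face_proj(2)[OF \<sigma> g r])
qed

lemma face_proj_cmult:
  assumes \<sigma>: "\<sigma> \<in> \<E>" and f: "face_fun \<sigma> f"
  shows "face_proj q \<sigma> (\<lambda>x. c * f x) = fun_scale c (face_proj q \<sigma> f)"
proof (rule face_proj_eqI[OF \<sigma> face_fun_cmult[OF f]])
  show "fun_scale c (face_proj q \<sigma> f) \<in> face_polys q \<sigma>"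
    by (intro fun_space.subspace_scale[OF subspace_face_polys] face_proj \<sigma> f)
  show "(LINT x|face_measure \<sigma>. fun_scale c (face_proj q \<sigma> f) x * r x) = (LINT x|face_measure \<sigma>. c * f x * r x)"
    if "r \<in> face_polys q \<sigma>" for r
    using face_proj(2)[OF \<sigma> f that] by (simp add: fun_scale_def mult.assoc)
qed

lemma face_proj_const:
  assumes \<sigma>: "\<sigma> \<in> \<E>"
  shows "face_proj q \<sigma> (\<lambda>x. c) = (\<lambda>x. c * indicat_real \<sigma> x)"
proof (rule face_proj_eqI[OF \<sigma> face_fun_const])
  show "(\<lambda>x. c * indicat_real \<sigma> x) \<in> face_polys q \<sigma>"
    unfolding face_polys_def using polys_const[of c q] by (auto simp: mult.commute)
  obtain n b where "flat_face \<sigma> n b" using face_flat[OF \<sigma>] .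
  then interpret flat_face \<sigma> n b .
  show "(LINT x|face_measure \<sigma>. c * indicat_real \<sigma> x * r x) = (LINT x|face_measure \<sigma>. c * r x)" for r
    by (rule Bochner_Integration.integral_cong) auto
qed

abbreviation "V \<equiv> hybrid_space \<M> \<E> k"

lemma hybrid_spaceD:
  assumes "v \<in> V"
  shows "K \<in> \<M> \<Longrightarrow> fst v K \<in> polys (Suc k)" "\<sigma> \<in> \<E> \<Longrightarrow> snd v \<sigma> \<in> face_polys k \<sigma>"
    "K \<notin> \<M> \<Longrightarrow> fst v K = 0" "\<sigma> \<notin> \<E> \<Longrightarrow> snd v \<sigma> = 0"
  using assms by (auto simp: hybrid_space_def)

lemma polys_face_fun: "\<sigma> \<in> \<E> \<Longrightarrow> p \<in> polys q \<Longrightarrow> face_fun \<sigma> p"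
  by (intro face_fun_continuous polys_continuous)

lemma face_in_faces: "K \<in> \<M> \<Longrightarrow> \<sigma> \<in> \<F> K \<Longrightarrow> \<sigma> \<in> \<E>"
  using cell(6) by blast

text \<open>The right-hand side in the definition of the discrete gradient for the field with
  \<open>p\<close> in component \<open>i\<close> and 0 elsewhere.\<close>

definition grad_rhs :: "(real^'n) set \<Rightarrow> 'n hybrid \<Rightarrow> 'n \<Rightarrow> (real^'n \<Rightarrow> real) \<Rightarrow> real" where
  "grad_rhs K v i p = - (LINT x|lebesgue_on K. fst v K x * partial i p x) +
     (\<Sum>\<sigma>\<in>\<F> K. LINT x|face_measure \<sigma>. snd v \<sigma> x * (p x * outward_normal K \<sigma> $ i))"

lemma polys_partial: "p \<in> polys q \<Longrightarrow> partial i p \<in> polys q"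
  using polys_has_derivative(2)[of p q i] polys_mono[of q "Suc q"] by auto

lemma polys_deriv: "p \<in> polys q \<Longrightarrow> (p has_derivative (\<lambda>h. \<Sum>i\<in>UNIV. partial i p x * h $ i)) (at x)"
  using polys_has_derivative(1)[of p q x] polys_mono[of q "Suc q"] by auto

lemma partial_add:
  assumes "p \<in> polys q" "r \<in> polys q"
  shows "partial i (\<lambda>x. p x + r x) x = partial i p x + partial i r x"
  by (rule partial_eqI) (use has_derivative_add[OF polys_deriv[OF assms(1)] polys_deriv[OF assms(2)]]
    in \<open>simp add: sum.distrib distrib_right\<close>)

lemma partial_cmult:
  assumes "p \<in> polys q"
  shows "partial i (\<lambda>x. c * p x) x = c * partial i p x"
  by (rule partial_eqI) (use has_derivative_mult_right[OF polys_deriv[OF assms], of c]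
    in \<open>simp add: sum_distrib_left mult.assoc\<close>)

lemma grad_integrable:
  assumes K: "K \<in> \<M>" and v: "v \<in> V" and p: "p \<in> polys q"
  shows "integrable (lebesgue_on K) (\<lambda>x. fst v K x * partial i p x)"
    "\<sigma> \<in> \<F> K \<Longrightarrow> integrable (face_measure \<sigma>) (\<lambda>x. snd v \<sigma> x * (p x * c))"
proof -
  show "integrable (lebesgue_on K) (\<lambda>x. fst v K x * partial i p x)"
    using hybrid_spaceD(1)[OF v K] polys_partial[OF p]
    by (intro cell_integrable[OF K] continuous_intros polys_continuous)
  assume \<sigma>: "\<sigma> \<in> \<F> K"
  have \<sigma>E: "\<sigma> \<in> \<E>" using face_in_faces[OF K \<sigma>] .
  show "integrable (face_measure \<sigma>) (\<lambda>x. snd v \<sigma> x * (p x * c))"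
    using hybrid_spaceD(2)[OF v \<sigma>E] p
    by (intro face_fun_integrable[OF \<sigma>E] face_fun_mult face_fun_const face_fun_face_polys[OF \<sigma>E] polys_face_fun[OF \<sigma>E])
qed

lemma grad_rhs_vector:
  assumes K: "K \<in> \<M>" and v: "v \<in> V" and \<tau>: "\<tau> \<in> vpolys k"
  shows "- (LINT x|lebesgue_on K. fst v K x * divergence \<tau> x) +
      (\<Sum>\<sigma>\<in>\<F> K. LINT x|face_measure \<sigma>. snd v \<sigma> x * (\<tau> x \<bullet> outward_normal K \<sigma>))
    = (\<Sum>i\<in>UNIV. grad_rhs K v i (\<lambda>x. \<tau> x $ i))"
proof -
  have \<tau>i: "(\<lambda>x. \<tau> x $ i) \<in> polys k" for i using \<tau> by (simp add: vpolys_def)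
  have 1: "(LINT x|lebesgue_on K. fst v K x * divergence \<tau> x) =
    (\<Sum>i\<in>UNIV. LINT x|lebesgue_on K. fst v K x * partial i (\<lambda>x. \<tau> x $ i) x)"
    unfolding divergence_def sum_distrib_left
    by (rule Bochner_Integration.integral_sum) (rule grad_integrable(1)[OF K v \<tau>i])
  have 2: "(LINT x|face_measure \<sigma>. snd v \<sigma> x * (\<tau> x \<bullet> outward_normal K \<sigma>)) =
    (\<Sum>i\<in>UNIV. LINT x|face_measure \<sigma>. snd v \<sigma> x * (\<tau> x $ i * outward_normal K \<sigma> $ i))" if "\<sigma> \<in> \<F> K" for \<sigma>
    unfolding inner_vec_def inner_real_def sum_distrib_left
    by (rule Bochner_Integration.integral_sum) (rule grad_integrable(2)[OF K v \<tau>i that])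
  have "(\<Sum>\<sigma>\<in>\<F> K. LINT x|face_measure \<sigma>. snd v \<sigma> x * (\<tau> x \<bullet> outward_normal K \<sigma>))
    = (\<Sum>\<sigma>\<in>\<F> K. \<Sum>i\<in>UNIV. LINT x|face_measure \<sigma>. snd v \<sigma> x * (\<tau> x $ i * outward_normal K \<sigma> $ i))"
    using 2 by (intro sum.cong) auto
  also have "\<dots> = (\<Sum>i\<in>UNIV. \<Sum>\<sigma>\<in>\<F> K. LINT x|face_measure \<sigma>. snd v \<sigma> x * (\<tau> x $ i * outward_normal K \<sigma> $ i))"
    by (rule sum.swap)
  finally show ?thesis
    unfolding grad_rhs_def 1 by (simp only: sum.distrib sum_negf)
qed

text \<open>Fields with a single nonzero component decouple the vector problem into scalar Riesz
  problems. The second and fourth claims are this componentwise form, in which gradients are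
  computed later.\<close>

lemma discrete_grad_ex1:
  assumes K: "K \<in> \<M>" and v: "v \<in> V"
  shows "\<exists>!G. G \<in> vpolys k \<and> (\<forall>\<tau>\<in>vpolys k. (LINT x|lebesgue_on K. G x \<bullet> \<tau> x) =
      - (LINT x|lebesgue_on K. fst v K x * divergence \<tau> x) +
      (\<Sum>\<sigma>\<in>\<F> K. LINT x|face_measure \<sigma>. snd v \<sigma> x * (\<tau> x \<bullet> outward_normal K \<sigma>)))"
    and "\<And>G. G \<in> vpolys k \<Longrightarrow> (\<And>i p. p \<in> polys k \<Longrightarrow> (LINT x|lebesgue_on K. G x $ i * p x) = grad_rhs K v i p) \<Longrightarrow>
      discrete_grad \<F> k K v = G"
    and "discrete_grad \<F> k K v \<in> vpolys k"
    and "\<And>i p. p \<in> polys k \<Longrightarrow> (LINT x|lebesgue_on K. discrete_grad \<F> k K v x $ i * p x) = grad_rhs K v i p"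
proof -
  let ?P = "\<lambda>G. G \<in> vpolys k \<and> (\<forall>\<tau>\<in>vpolys k. (LINT x|lebesgue_on K. G x \<bullet> \<tau> x) =
      - (LINT x|lebesgue_on K. fst v K x * divergence \<tau> x) +
      (\<Sum>\<sigma>\<in>\<F> K. LINT x|face_measure \<sigma>. snd v \<sigma> x * (\<tau> x \<bullet> outward_normal K \<sigma>)))"
  interpret ip: inner_product_on fun_scale "polys k" "\<lambda>p r. LINT x|lebesgue_on K. p x * r x"
    by (rule cell_inner[OF K])
  have ex: "\<exists>!g. g \<in> polys k \<and> (\<forall>p\<in>polys k. (LINT x|lebesgue_on K. g x * p x) = grad_rhs K v i p)" for i
  proof (rule ip.riesz[OF _ polys_span])
    show "finite (monomial ` {\<alpha> :: 'n \<Rightarrow> nat. (\<Sum>i\<in>UNIV. \<alpha> i) \<le> k})"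
      by (intro finite_imageI finite_exponents)
    show "grad_rhs K v i (p + r) = grad_rhs K v i p + grad_rhs K v i r" if "p \<in> polys k" "r \<in> polys k" for p r
      using grad_integrable[OF K v that(1)] grad_integrable[OF K v that(2)] partial_add[OF that, of i]
      by (simp add: grad_rhs_def plus_fun_def distrib_left distrib_right sum.distrib)
    show "grad_rhs K v i (fun_scale c p) = c * grad_rhs K v i p" if "p \<in> polys k" for c p
      using partial_cmult[OF that, of i c]
      by (simp add: grad_rhs_def fun_scale_def distrib_left right_diff_distrib sum_distrib_left mult.left_commute mult.assoc)
  qed
  have equiv: "?P G \<longleftrightarrow> G \<in> vpolys k \<and> (\<forall>i. \<forall>p\<in>polys k. (LINT x|lebesgue_on K. G x $ i * p x) = grad_rhs K v i p)" for G
  proof (intro iffI conjI allI ballI; (elim conjE)?)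
    assume G: "G \<in> vpolys k" and all: "\<forall>\<tau>\<in>vpolys k. (LINT x|lebesgue_on K. G x \<bullet> \<tau> x) =
      - (LINT x|lebesgue_on K. fst v K x * divergence \<tau> x) +
      (\<Sum>\<sigma>\<in>\<F> K. LINT x|face_measure \<sigma>. snd v \<sigma> x * (\<tau> x \<bullet> outward_normal K \<sigma>))"
    fix i :: 'n and p :: "real^'n \<Rightarrow> real" assume p: "p \<in> polys k"
    define \<tau> :: "real^'n \<Rightarrow> real^'n" where "\<tau> x = axis i (p x)" for x
    have comp: "(\<lambda>x. \<tau> x $ j) = (if j = i then p else (\<lambda>x. 0))" for j by (auto simp: \<tau>_def axis_def)
    have \<tau>: "\<tau> \<in> vpolys k" unfolding vpolys_def using p by (simp add: comp polys_const)
    have p0: "grad_rhs K v j (\<lambda>x. 0) = 0" for j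
    proof -
      have "partial j (\<lambda>x. 0) x = 0" for x :: "real^'n"
        by (rule partial_eqI) simp
      then show ?thesis by (simp add: grad_rhs_def)
    qed
    have "(LINT x|lebesgue_on K. G x $ i * p x) = (LINT x|lebesgue_on K. G x \<bullet> \<tau> x)"
      by (simp add: \<tau>_def inner_axis)
    also have "\<dots> = (\<Sum>j\<in>UNIV. grad_rhs K v j (\<lambda>x. \<tau> x $ j))"
      using all \<tau> grad_rhs_vector[OF K v \<tau>] by simp
    also have "\<dots> = (\<Sum>j\<in>UNIV. if j = i then grad_rhs K v i p else 0)"
      by (intro sum.cong) (auto simp: comp p0)
    finally show "(LINT x|lebesgue_on K. G x $ i * p x) = grad_rhs K v i p" by simp
  next
    assume G: "G \<in> vpolys k" and all: "\<forall>i. \<forall>p\<in>polys k. (LINT x|lebesgue_on K. G x $ i * p x) = grad_rhs K v i p"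
    fix \<tau> :: "real^'n \<Rightarrow> real^'n" assume \<tau>: "\<tau> \<in> vpolys k"
    have i: "integrable (lebesgue_on K) (\<lambda>x. G x $ i * \<tau> x $ i)" for i
      using G \<tau> by (intro cell_integrable[OF K] continuous_on_mult polys_continuous) (auto simp: vpolys_def)
    have "(LINT x|lebesgue_on K. G x \<bullet> \<tau> x) = (\<Sum>i\<in>UNIV. LINT x|lebesgue_on K. G x $ i * \<tau> x $ i)"
      unfolding inner_vec_def inner_real_def by (rule Bochner_Integration.integral_sum) (rule i)
    also have "\<dots> = (\<Sum>i\<in>UNIV. grad_rhs K v i (\<lambda>x. \<tau> x $ i))"
      using all \<tau> by (intro sum.cong) (auto simp: vpolys_def)
    finally show "(LINT x|lebesgue_on K. G x \<bullet> \<tau> x) =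
      - (LINT x|lebesgue_on K. fst v K x * divergence \<tau> x) +
      (\<Sum>\<sigma>\<in>\<F> K. LINT x|face_measure \<sigma>. snd v \<sigma> x * (\<tau> x \<bullet> outward_normal K \<sigma>))"
      by (simp only: grad_rhs_vector[OF K v \<tau>])
  qed
  obtain g where g: "\<And>i. g i \<in> polys k" "\<And>i p. p \<in> polys k \<Longrightarrow> (LINT x|lebesgue_on K. g i x * p x) = grad_rhs K v i p"
    using ex by metis
  show ex1: "\<exists>!G. ?P G"
    unfolding equiv
  proof (rule ex1I[of _ "\<lambda>x. \<chi> i. g i x"])
    show "(\<lambda>x. \<chi> i. g i x) \<in> vpolys k \<and>
      (\<forall>i. \<forall>p\<in>polys k. (LINT x|lebesgue_on K. (\<chi> i. g i x) $ i * p x) = grad_rhs K v i p)"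
      using g by (auto simp: vpolys_def)
    fix G assume G: "G \<in> vpolys k \<and> (\<forall>i. \<forall>p\<in>polys k. (LINT x|lebesgue_on K. G x $ i * p x) = grad_rhs K v i p)"
    have "(\<lambda>x. G x $ i) = g i" for i
    proof -
      have "(\<lambda>x. G x $ i) \<in> polys k \<and> (\<forall>p\<in>polys k. (LINT x|lebesgue_on K. G x $ i * p x) = grad_rhs K v i p)"
        using G by (simp add: vpolys_def)
      moreover have "g i \<in> polys k \<and> (\<forall>p\<in>polys k. (LINT x|lebesgue_on K. g i x * p x) = grad_rhs K v i p)"
        using g by blast
      ultimately show ?thesis using ex1_implies_eq[OF ex[of i]] by blast
    qed
    then show "G = (\<lambda>x. \<chi> i. g i x)" by (auto simp: fun_eq_iff vec_eq_iff)
  qed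
  have "?P (discrete_grad \<F> k K v)" unfolding discrete_grad_def by (rule theI'[OF ex1])
  then have P: "discrete_grad \<F> k K v \<in> vpolys k \<and>
     (\<forall>i. \<forall>p\<in>polys k. (LINT x|lebesgue_on K. discrete_grad \<F> k K v x $ i * p x) = grad_rhs K v i p)"
    unfolding equiv .
  then show "discrete_grad \<F> k K v \<in> vpolys k"
    and "\<And>i p. p \<in> polys k \<Longrightarrow> (LINT x|lebesgue_on K. discrete_grad \<F> k K v x $ i * p x) = grad_rhs K v i p"
    by blast+
  show "discrete_grad \<F> k K v = G" if "G \<in> vpolys k" "\<And>i p. p \<in> polys k \<Longrightarrow> (LINT x|lebesgue_on K. G x $ i * p x) = grad_rhs K v i p" for G
    using ex1[unfolded equiv] P that by blast
qed

end

interpretation hybrid: vector_space "hybrid_scale :: real \<Rightarrow> 'n::finite hybrid \<Rightarrow> _"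
  by unfold_locales (auto simp: hybrid_scale_def fun_eq_iff algebra_simps prod_eq_iff)

lemma polys_line_deriv:
  fixes p :: "real^'n::finite \<Rightarrow> real"
  assumes "p \<in> polys q"
  shows "((\<lambda>t. p (x + t *\<^sub>R axis i 1)) has_real_derivative partial i p (x + t *\<^sub>R axis i 1)) (at t)"
proof -
  have "((\<lambda>t. x + t *\<^sub>R axis i 1) has_derivative (\<lambda>h. h *\<^sub>R axis i 1)) (at t)"
    by (auto intro!: derivative_eq_intros)
  moreover have "(p has_derivative (\<lambda>h. \<Sum>j\<in>UNIV. partial j p y * h $ j)) (at y)" for y
    using polys_has_derivative(1)[of p q y] polys_mono[of q "Suc q"] assms by auto
  ultimately have "((\<lambda>t. p (x + t *\<^sub>R axis i 1)) has_derivative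
      (\<lambda>h. \<Sum>j\<in>UNIV. partial j p (x + t *\<^sub>R axis i 1) * (h *\<^sub>R axis i 1) $ j)) (at t)"
    by (rule has_derivative_compose)
  moreover have "(\<Sum>j\<in>UNIV. partial j p (x + t *\<^sub>R axis i 1) * (h *\<^sub>R axis i 1) $ j) =
      partial i p (x + t *\<^sub>R axis i 1) * h" for h :: real
  proof -
    have "(\<Sum>j\<in>UNIV. partial j p (x + t *\<^sub>R axis i 1) * (h *\<^sub>R axis i 1) $ j) =
      (\<Sum>j\<in>UNIV. if j = i then partial i p (x + t *\<^sub>R axis i 1) * h else 0)"
      by (intro sum.cong) (auto simp: axis_def)
    then show ?thesis by simp
  qed
  ultimately show ?thesis by (simp add: has_field_derivative_def)
qed

context hybrid_discretisation
begin

section \<open>Linearity of the discrete operators\<close>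

lemma subspace_V: "hybrid.subspace V"
  unfolding hybrid.subspace_def
proof (intro conjI ballI allI)
  show "0 \<in> V"
    using fun_space.subspace_0[OF subspace_polys] fun_space.subspace_0[OF subspace_face_polys]
    by (auto simp: hybrid_space_def)
  show "v + w \<in> V" if "v \<in> V" "w \<in> V" for v w
    using that unfolding hybrid_space_def
    by (auto intro: fun_space.subspace_add[OF subspace_polys] fun_space.subspace_add[OF subspace_face_polys])
  have scale: "(\<lambda>x. c * f x) \<in> face_polys q \<sigma>" if "f \<in> face_polys q \<sigma>" for c f q and \<sigma> :: "(real^'n) set"
    using fun_space.subspace_scale[OF subspace_face_polys that, of c] by (simp add: fun_scale_def)
  show "hybrid_scale c v \<in> V" if "v \<in> V" for c v
    using that unfolding hybrid_space_def by (auto simp: hybrid_scale_def zero_fun_def intro: polys_cmult scale)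
qed

lemmas V_add = hybrid.subspace_add[OF subspace_V]
  and V_diff = hybrid.subspace_diff[OF subspace_V]
  and V_scale = hybrid.subspace_scale[OF subspace_V]

lemma grad_rhs_add:
  assumes K: "K \<in> \<M>" and v: "v \<in> V" and w: "w \<in> V" and p: "p \<in> polys k"
  shows "grad_rhs K (v + w) i p = grad_rhs K v i p + grad_rhs K w i p"
proof -
  have "(LINT x|lebesgue_on K. fst (v + w) K x * partial i p x) =
      (LINT x|lebesgue_on K. fst v K x * partial i p x) + (LINT x|lebesgue_on K. fst w K x * partial i p x)"
    using grad_integrable(1)[OF K v p, of i] grad_integrable(1)[OF K w p, of i] by (simp add: distrib_right)
  moreover have "(LINT x|face_measure \<sigma>. snd (v + w) \<sigma> x * (p x * c)) =
      (LINT x|face_measure \<sigma>. snd v \<sigma> x * (p x * c)) + (LINT x|face_measure \<sigma>. snd w \<sigma> x * (p x * c))"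
    if "\<sigma> \<in> \<F> K" for \<sigma> c
    using Bochner_Integration.integral_add[OF grad_integrable(2)[OF K v p that, of c] grad_integrable(2)[OF K w p that, of c]]
    by (simp add: distrib_right)
  ultimately show ?thesis
    unfolding grad_rhs_def by (simp add: sum.distrib)
qed

lemma grad_rhs_scale: "grad_rhs K (hybrid_scale c v) i p = c * grad_rhs K v i p"
  by (simp add: grad_rhs_def hybrid_scale_def mult.assoc right_diff_distrib sum_distrib_left)

lemma grad_component_continuous:
  assumes "K \<in> \<M>" "v \<in> V"
  shows "continuous_on UNIV (\<lambda>x. discrete_grad \<F> k K v x $ i)"
proof -
  have "(\<lambda>x. discrete_grad \<F> k K v x $ i) \<in> polys k"
    using discrete_grad_ex1(3)[OF assms] by (simp add: vpolys_def)
  then show ?thesis by (rule polys_continuous)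
qed

lemma grad_continuous:
  assumes "K \<in> \<M>" "v \<in> V"
  shows "continuous_on UNIV (discrete_grad \<F> k K v)"
  using continuous_on_vec_lambda[of UNIV "\<lambda>i x. discrete_grad \<F> k K v x $ i"] grad_component_continuous[OF assms]
  by simp

lemma grad_add:
  assumes K: "K \<in> \<M>" and v: "v \<in> V" and w: "w \<in> V"
  shows "discrete_grad \<F> k K (v + w) = (\<lambda>x. discrete_grad \<F> k K v x + discrete_grad \<F> k K w x)"
proof (rule discrete_grad_ex1(2)[OF K V_add[OF v w]])
  note G = discrete_grad_ex1(3)[OF K v] discrete_grad_ex1(3)[OF K w]
  show "(\<lambda>x. discrete_grad \<F> k K v x + discrete_grad \<F> k K w x) \<in> vpolys k"
    using G by (auto simp: vpolys_def intro: polys_add)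
  fix i and p :: "real^'n \<Rightarrow> real" assume p: "p \<in> polys k"
  have int: "integrable (lebesgue_on K) (\<lambda>x. discrete_grad \<F> k K u x $ i * p x)" if "u \<in> V" for u
    by (intro cell_integrable[OF K] continuous_on_mult grad_component_continuous[OF K that] polys_continuous[OF p])
  show "(LINT x|lebesgue_on K. (discrete_grad \<F> k K v x + discrete_grad \<F> k K w x) $ i * p x) = grad_rhs K (v + w) i p"
    using int[OF v] int[OF w] discrete_grad_ex1(4)[OF K v p] discrete_grad_ex1(4)[OF K w p]
    by (simp add: distrib_right grad_rhs_add[OF K v w p])
qed

lemma grad_scale:
  assumes K: "K \<in> \<M>" and v: "v \<in> V"
  shows "discrete_grad \<F> k K (hybrid_scale c v) = (\<lambda>x. c *\<^sub>R discrete_grad \<F> k K v x)"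
proof (rule discrete_grad_ex1(2)[OF K V_scale[OF v]])
  show "(\<lambda>x. c *\<^sub>R discrete_grad \<F> k K v x) \<in> vpolys k"
    using discrete_grad_ex1(3)[OF K v] by (auto simp: vpolys_def intro: polys_cmult)
  show "(LINT x|lebesgue_on K. (c *\<^sub>R discrete_grad \<F> k K v x) $ i * p x) = grad_rhs K (hybrid_scale c v) i p"
    if "p \<in> polys k" for i p
    using discrete_grad_ex1(4)[OF K v that] by (simp add: grad_rhs_scale mult.assoc)
qed

lemma jump_eq: "jump k K \<sigma> v = face_proj k \<sigma> (fst v K) - snd v \<sigma>"
  by (auto simp: jump_def fun_eq_iff)

lemma jump_face_polys:
  assumes K: "K \<in> \<M>" and \<sigma>: "\<sigma> \<in> \<F> K" and v: "v \<in> V"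
  shows "jump k K \<sigma> v \<in> face_polys k \<sigma>"
proof -
  have \<sigma>E: "\<sigma> \<in> \<E>" using face_in_faces[OF K \<sigma>] .
  show ?thesis
    unfolding jump_eq
    by (intro fun_space.subspace_diff[OF subspace_face_polys] face_proj(1)[OF \<sigma>E]
        polys_face_fun[OF \<sigma>E hybrid_spaceD(1)[OF v K]] hybrid_spaceD(2)[OF v \<sigma>E])
qed

lemma jump_add:
  assumes K: "K \<in> \<M>" and \<sigma>: "\<sigma> \<in> \<F> K" and v: "v \<in> V" and w: "w \<in> V"
  shows "jump k K \<sigma> (v + w) = jump k K \<sigma> v + jump k K \<sigma> w"
proof -
  have \<sigma>E: "\<sigma> \<in> \<E>" using face_in_faces[OF K \<sigma>] .
  have "face_proj k \<sigma> (fst (v + w) K) = face_proj k \<sigma> (fst v K) + face_proj k \<sigma> (fst w K)"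
    using face_proj_add[OF \<sigma>E polys_face_fun[OF \<sigma>E hybrid_spaceD(1)[OF v K]] polys_face_fun[OF \<sigma>E hybrid_spaceD(1)[OF w K]]]
    by (simp add: plus_fun_def)
  then show ?thesis by (simp add: jump_eq)
qed

lemma jump_scale:
  assumes K: "K \<in> \<M>" and \<sigma>: "\<sigma> \<in> \<F> K" and v: "v \<in> V"
  shows "jump k K \<sigma> (hybrid_scale c v) = fun_scale c (jump k K \<sigma> v)"
proof -
  have \<sigma>E: "\<sigma> \<in> \<E>" using face_in_faces[OF K \<sigma>] .
  have "face_proj k \<sigma> (fst (hybrid_scale c v) K) = fun_scale c (face_proj k \<sigma> (fst v K))"
    using face_proj_cmult[OF \<sigma>E polys_face_fun[OF \<sigma>E hybrid_spaceD(1)[OF v K]]]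
    by (simp add: hybrid_scale_def)
  then show ?thesis by (auto simp: jump_eq hybrid_scale_def fun_scale_def fun_eq_iff right_diff_distrib)
qed

text \<open>
  Without jumps the face unknowns are the projected traces of the cell unknown, and the definition
  of the discrete gradient becomes the divergence theorem.
\<close>

lemma grad_without_jumps:
  assumes K: "K \<in> \<M>" and v: "v \<in> V" and J: "\<And>\<sigma>. \<sigma> \<in> \<F> K \<Longrightarrow> jump k K \<sigma> v = 0"
  shows "discrete_grad \<F> k K v = (\<lambda>x. \<chi> i. partial i (fst v K) x)"
proof (rule discrete_grad_ex1(2)[OF K v])
  define w where "w = fst v K"
  have w: "w \<in> polys (Suc k)" unfolding w_def by (rule hybrid_spaceD(1)[OF v K])
  show "(\<lambda>x. \<chi> i. partial i (fst v K) x) \<in> vpolys k"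
    using polys_has_derivative(2)[OF w] by (simp add: vpolys_def w_def)
  fix i and p :: "real^'n \<Rightarrow> real" assume p: "p \<in> polys k"
  have face: "(LINT x|face_measure \<sigma>. snd v \<sigma> x * (p x * outward_normal K \<sigma> $ i)) =
      (outward_normal K \<sigma> \<bullet> axis i 1) * (LINT x|face_measure \<sigma>. w x * p x)" if \<sigma>: "\<sigma> \<in> \<F> K" for \<sigma>
  proof -
    have \<sigma>E: "\<sigma> \<in> \<E>" using face_in_faces[OF K \<sigma>] .
    obtain n b where "flat_face \<sigma> n b" using face_flat[OF \<sigma>E] .
    then interpret flat_face \<sigma> n b .
    \<comment> \<open>The projection of the trace disappears because \<open>p\<close> has degree at
      most \<open>k\<close>, so that its restriction is an admissible test function for the
      projector.\<close>
    have r: "(\<lambda>x. indicat_real \<sigma> x * p x) \<in> face_polys k \<sigma>" using p by (auto simp: face_polys_def)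
    have ind: "(LINT x|face_measure \<sigma>. g x * (indicat_real \<sigma> x * p x)) = (LINT x|face_measure \<sigma>. g x * p x)" for g
      by (rule Bochner_Integration.integral_cong) auto
    have "snd v \<sigma> = face_proj k \<sigma> w" using J[OF \<sigma>] by (simp add: jump_eq w_def)
    then have "(LINT x|face_measure \<sigma>. snd v \<sigma> x * p x) = (LINT x|face_measure \<sigma>. w x * p x)"
      using face_proj(2)[OF \<sigma>E polys_face_fun[OF \<sigma>E w] r] by (simp add: ind)
    moreover have "(LINT x|face_measure \<sigma>. snd v \<sigma> x * (p x * outward_normal K \<sigma> $ i)) =
        outward_normal K \<sigma> $ i * (LINT x|face_measure \<sigma>. snd v \<sigma> x * p x)"
    proof -
      have "(\<lambda>x. snd v \<sigma> x * (p x * outward_normal K \<sigma> $ i)) = (\<lambda>x. outward_normal K \<sigma> $ i * (snd v \<sigma> x * p x))"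
        by (simp add: fun_eq_iff)
      then show ?thesis by (simp only: integral_mult_right_zero)
    qed
    ultimately show ?thesis by (simp add: inner_axis)
  qed
  have int: "integrable (lebesgue_on K) (\<lambda>x. partial i w x * p x)" "integrable (lebesgue_on K) (\<lambda>x. w x * partial i p x)"
    by (intro cell_integrable[OF K] continuous_on_mult polys_continuous[OF p] polys_continuous[OF w]
        polys_continuous[OF polys_partial[OF p]] polys_continuous[OF polys_partial[OF w]])+
  have "(LINT x|lebesgue_on K. partial i w x * p x + w x * partial i p x) =
    (\<Sum>\<sigma>\<in>\<F> K. (outward_normal K \<sigma> \<bullet> axis i 1) * (LINT x|face_measure \<sigma>. w x * p x))"
  proof (rule divergence_theorem_cell[OF K])
    show "((\<lambda>t. w (x + t *\<^sub>R axis i 1) * p (x + t *\<^sub>R axis i 1)) has_real_derivative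
      partial i w (x + t *\<^sub>R axis i 1) * p (x + t *\<^sub>R axis i 1) + w (x + t *\<^sub>R axis i 1) * partial i p (x + t *\<^sub>R axis i 1)) (at t)" for x t
      using DERIV_mult[OF polys_line_deriv[OF w] polys_line_deriv[OF p]] by (simp add: algebra_simps)
    show "continuous_on UNIV (\<lambda>x. w x * p x)"
      by (intro continuous_on_mult polys_continuous[OF p] polys_continuous[OF w])
    show "continuous_on UNIV (\<lambda>x. partial i w x * p x + w x * partial i p x)"
      by (intro continuous_on_add continuous_on_mult polys_continuous[OF p] polys_continuous[OF w]
        polys_continuous[OF polys_partial[OF p]] polys_continuous[OF polys_partial[OF w]])
  qed (simp add: norm_axis_1)
  then show "(LINT x|lebesgue_on K. (\<chi> i. partial i (fst v K) x) $ i * p x) = grad_rhs K v i p"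
    using int face by (simp add: grad_rhs_def w_def[symmetric])
qed

lemma constant_on_cell:
  assumes K: "K \<in> \<M>" and v: "v \<in> V" and J: "\<And>\<sigma>. \<sigma> \<in> \<F> K \<Longrightarrow> jump k K \<sigma> v = 0"
    and G: "discrete_grad \<F> k K v = (\<lambda>x. 0)"
  shows "\<exists>c. fst v K = (\<lambda>x. c) \<and> (\<forall>\<sigma>\<in>\<F> K. snd v \<sigma> = (\<lambda>x. c * indicat_real \<sigma> x))"
proof -
  have "partial i (fst v K) = 0" for i
  proof
    fix x
    have "(\<lambda>x. \<chi> i. partial i (fst v K) x) = (\<lambda>x. 0)" using grad_without_jumps[OF K v J] G by simp
    then have "(\<chi> i. partial i (fst v K) x) $ i = 0 $ i" by metis
    then show "partial i (fst v K) x = 0 x" by simp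
  qed
  then obtain c where c: "fst v K = (\<lambda>x. c)"
    using polys_gradient_zero[OF hybrid_spaceD(1)[OF v K]] by blast
  moreover have "snd v \<sigma> = (\<lambda>x. c * indicat_real \<sigma> x)" if "\<sigma> \<in> \<F> K" for \<sigma>
    using J[OF that] face_proj_const[OF face_in_faces[OF K that], of k c] by (simp add: jump_eq c)
  ultimately show ?thesis by blast
qed

lemma hybrid_one_V: "hybrid_one \<M> \<E> \<in> V"
proof -
  have "indicat_real \<sigma> \<in> face_polys k \<sigma>" for \<sigma> :: "(real^'n) set"
    unfolding face_polys_def using polys_const[of 1 k] by (force simp: fun_eq_iff)
  then show ?thesis by (auto simp: hybrid_space_def hybrid_one_def polys_const)
qed

lemma jump_one: "K \<in> \<M> \<Longrightarrow> \<sigma> \<in> \<F> K \<Longrightarrow> jump k K \<sigma> (hybrid_one \<M> \<E>) = 0"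
  using face_proj_const[OF face_in_faces, of K \<sigma> k 1]
  by (simp add: jump_eq hybrid_one_def face_in_faces fun_eq_iff)

lemma grad_one: "K \<in> \<M> \<Longrightarrow> discrete_grad \<F> k K (hybrid_one \<M> \<E>) = (\<lambda>x. 0)"
proof -
  assume K: "K \<in> \<M>"
  have "partial i (\<lambda>x. 1) x = 0" for i and x :: "real^'n"
    by (rule partial_eqI) simp
  then show ?thesis
    using grad_without_jumps[OF K hybrid_one_V jump_one[OF K]] K by (simp add: hybrid_one_def vec_eq_iff fun_eq_iff)
qed

section \<open>The seminorm of gradients and jumps, and its kernel\<close>

definition total :: "'n hybrid \<Rightarrow> real" where
  "total v = (\<Sum>K\<in>\<M>. LINT x|lebesgue_on K. fst v K x)"

definition seminorm_form :: "'n hybrid \<Rightarrow> 'n hybrid \<Rightarrow> real" where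
  "seminorm_form z w = (\<Sum>K\<in>\<M>. (LINT x|lebesgue_on K. discrete_grad \<F> k K z x \<bullet> discrete_grad \<F> k K w x) +
     (\<Sum>\<sigma>\<in>\<F> K. LINT x|face_measure \<sigma>. jump k K \<sigma> z x * jump k K \<sigma> w x))"

text \<open>The rank-one term detects the constants, which form the kernel of the first term; on
  elements of zero total it adds nothing.\<close>

definition form_s :: "'n hybrid \<Rightarrow> 'n hybrid \<Rightarrow> real" where
  "form_s z w = seminorm_form z w + total z * total w"

lemma grad_inner_integrable:
  assumes "K \<in> \<M>" "z \<in> V" "w \<in> V"
  shows "integrable (lebesgue_on K) (\<lambda>x. discrete_grad \<F> k K z x \<bullet> discrete_grad \<F> k K w x)"
  using assms by (intro cell_integrable continuous_on_inner grad_continuous)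

lemma jump_integrable:
  assumes "K \<in> \<M>" "\<sigma> \<in> \<F> K" "z \<in> V" "w \<in> V"
  shows "integrable (face_measure \<sigma>) (\<lambda>x. jump k K \<sigma> z x * jump k K \<sigma> w x)"
proof -
  have \<sigma>: "\<sigma> \<in> \<E>" using face_in_faces assms by blast
  show ?thesis
    by (rule face_fun_integrable[OF \<sigma> face_fun_mult[OF
          face_fun_face_polys[OF \<sigma> jump_face_polys[OF assms(1,2,3)]]
          face_fun_face_polys[OF \<sigma> jump_face_polys[OF assms(1,2,4)]]]])
qed

lemma cell_value_integrable: "K \<in> \<M> \<Longrightarrow> v \<in> V \<Longrightarrow> integrable (lebesgue_on K) (fst v K)"
  by (intro cell_integrable polys_continuous[OF hybrid_spaceD(1)])

lemma total_add: "v \<in> V \<Longrightarrow> w \<in> V \<Longrightarrow> total (v + w) = total v + total w"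
  by (simp add: total_def sum.distrib cell_value_integrable)

lemma total_scale: "total (hybrid_scale c v) = c * total v"
  by (simp add: total_def hybrid_scale_def sum_distrib_left)

lemma seminorm_form_add:
  assumes "u \<in> V" "v \<in> V" "w \<in> V"
  shows "seminorm_form (u + v) w = seminorm_form u w + seminorm_form v w"
proof -
  have "(LINT x|lebesgue_on K. discrete_grad \<F> k K (u + v) x \<bullet> discrete_grad \<F> k K w x) +
     (\<Sum>\<sigma>\<in>\<F> K. LINT x|face_measure \<sigma>. jump k K \<sigma> (u + v) x * jump k K \<sigma> w x) =
    ((LINT x|lebesgue_on K. discrete_grad \<F> k K u x \<bullet> discrete_grad \<F> k K w x) +
     (\<Sum>\<sigma>\<in>\<F> K. LINT x|face_measure \<sigma>. jump k K \<sigma> u x * jump k K \<sigma> w x)) +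
    ((LINT x|lebesgue_on K. discrete_grad \<F> k K v x \<bullet> discrete_grad \<F> k K w x) +
     (\<Sum>\<sigma>\<in>\<F> K. LINT x|face_measure \<sigma>. jump k K \<sigma> v x * jump k K \<sigma> w x))" if K: "K \<in> \<M>" for K
  proof -
    have "(\<Sum>\<sigma>\<in>\<F> K. LINT x|face_measure \<sigma>. jump k K \<sigma> (u + v) x * jump k K \<sigma> w x) =
      (\<Sum>\<sigma>\<in>\<F> K. (LINT x|face_measure \<sigma>. jump k K \<sigma> u x * jump k K \<sigma> w x) + (LINT x|face_measure \<sigma>. jump k K \<sigma> v x * jump k K \<sigma> w x))"
      using assms jump_integrable[OF K] by (intro sum.cong) (auto simp: jump_add[OF K] distrib_right)
    then show ?thesis
      using assms grad_inner_integrable[OF K] by (simp add: grad_add[OF K] inner_add_left sum.distrib)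
  qed
  then show ?thesis by (simp add: seminorm_form_def sum.distrib)
qed

lemma seminorm_form_scale:
  assumes "u \<in> V" "w \<in> V"
  shows "seminorm_form (hybrid_scale c u) w = c * seminorm_form u w"
  using assms unfolding seminorm_form_def sum_distrib_left distrib_left
  by (intro sum.cong refl arg_cong2[where f = "(+)"]) (auto simp: grad_scale jump_scale fun_scale_def mult.assoc)

lemma seminorm_form_one: "v \<in> V \<Longrightarrow> seminorm_form (hybrid_one \<M> \<E>) v = 0"
  by (simp add: seminorm_form_def grad_one jump_one)

lemma seminorm_form_commute: "seminorm_form z w = seminorm_form w z"
  unfolding seminorm_form_def by (simp add: inner_commute mult.commute)

lemma seminorm_form_nonneg: "seminorm_form v v \<ge> 0"
  unfolding seminorm_form_def by (intro sum_nonneg add_nonneg_nonneg) auto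

text \<open>Each cell carries a constant that its faces share. A face common to two cells holds one
  unknown only, so the constants cannot differ across it.\<close>

lemma seminorm_form_zero:
  assumes v: "v \<in> V" and zero: "seminorm_form v v = 0"
  obtains c where "v = hybrid_scale c (hybrid_one \<M> \<E>)"
proof -
  have nn: "(LINT x|lebesgue_on K. discrete_grad \<F> k K v x \<bullet> discrete_grad \<F> k K v x) \<ge> 0"
    "(LINT x|face_measure \<sigma>. jump k K \<sigma> v x * jump k K \<sigma> v x) \<ge> 0" for K \<sigma> by auto
  have cell0: "(LINT x|lebesgue_on K. discrete_grad \<F> k K v x \<bullet> discrete_grad \<F> k K v x) +
     (\<Sum>\<sigma>\<in>\<F> K. LINT x|face_measure \<sigma>. jump k K \<sigma> v x * jump k K \<sigma> v x) = 0" if "K \<in> \<M>" for K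
    using zero that finite_cells unfolding seminorm_form_def
    by (subst (asm) sum_nonneg_eq_0_iff) (auto intro!: add_nonneg_nonneg sum_nonneg)
  have const: "\<exists>c. fst v K = (\<lambda>x. c) \<and> (\<forall>\<sigma>\<in>\<F> K. snd v \<sigma> = (\<lambda>x. c * indicat_real \<sigma> x))" if K: "K \<in> \<M>" for K
  proof (rule constant_on_cell[OF K v])
    have sums: "(\<Sum>\<sigma>\<in>\<F> K. LINT x|face_measure \<sigma>. jump k K \<sigma> v x * jump k K \<sigma> v x) = 0"
      "(LINT x|lebesgue_on K. discrete_grad \<F> k K v x \<bullet> discrete_grad \<F> k K v x) = 0"
      using cell0[OF K] nn(1)[of K] sum_nonneg[of "\<F> K" "\<lambda>\<sigma>. LINT x|face_measure \<sigma>. jump k K \<sigma> v x * jump k K \<sigma> v x"] nn(2)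
      by (auto simp: add_nonneg_eq_0_iff)
    show "jump k K \<sigma> v = 0" if \<sigma>: "\<sigma> \<in> \<F> K" for \<sigma>
    proof -
      have "(LINT x|face_measure \<sigma>. jump k K \<sigma> v x * jump k K \<sigma> v x) = 0"
        using sums(1) \<sigma> nn(2) cell(8)[OF K] by (subst (asm) sum_nonneg_eq_0_iff) auto
      then show ?thesis
        using inner_product_on.s_definite[OF face_inner[OF face_in_faces[OF K \<sigma>]] jump_face_polys[OF K \<sigma> v]] by simp
    qed
    have "AE x in lebesgue_on K. discrete_grad \<F> k K v x \<bullet> discrete_grad \<F> k K v x = 0"
      using sums(2) integral_nonneg_eq_0_iff_AE[OF grad_inner_integrable[OF K v v]] by simp
    then have "discrete_grad \<F> k K v x \<bullet> discrete_grad \<F> k K v x = 0" if "x \<in> K" for x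
      using that by (intro AE_lebesgue_on_open_zero[OF cell(1)[OF K], of "\<lambda>x. discrete_grad \<F> k K v x \<bullet> discrete_grad \<F> k K v x"])
        (auto intro!: continuous_on_inner grad_continuous K v)
    then have "discrete_grad \<F> k K v x $ i = 0" if "x \<in> K" for x i
      using that by simp
    moreover have "(\<lambda>x. discrete_grad \<F> k K v x $ i) \<in> polys k" for i
      using discrete_grad_ex1(3)[OF K v] by (simp add: vpolys_def)
    ultimately have "(\<lambda>x. discrete_grad \<F> k K v x $ i) = 0" for i
      by (intro polys_zero_on_open[OF _ cell(1,4)[OF K]])
    then have "discrete_grad \<F> k K v x $ i = 0" for x i by (metis zero_fun_def)
    then show "discrete_grad \<F> k K v = (\<lambda>x. 0)" by (auto simp: fun_eq_iff vec_eq_iff)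
  qed
  then obtain c where c: "\<And>K. K \<in> \<M> \<Longrightarrow> fst v K = (\<lambda>x. c K)"
    "\<And>K \<sigma>. K \<in> \<M> \<Longrightarrow> \<sigma> \<in> \<F> K \<Longrightarrow> snd v \<sigma> = (\<lambda>x. c K * indicat_real \<sigma> x)" by metis
  have "\<exists>c0. \<forall>K\<in>\<M>. c K = c0"
  proof (cases "\<M> = {}")
    case False
    then obtain K0 where K0: "K0 \<in> \<M>" by auto
    \<comment> \<open>Were this a proper subset of the cells, a cell inside and a cell outside would
      share a face.\<close>
    define S where "S = {K\<in>\<M>. c K = c K0}"
    have "S = \<M>"
    proof (rule ccontr)
      assume "S \<noteq> \<M>"
      have S: "S \<subseteq> \<M>" "S \<noteq> {}" using K0 by (auto simp: S_def)
      obtain K K' \<sigma> where *: "K \<in> S" "K' \<in> \<M> - S" "\<sigma> \<in> \<F> K" "\<sigma> \<in> \<F> K'"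
        by (rule cells_connected_through_faces[OF S \<open>S \<noteq> \<M>\<close>])
      then have KM: "K \<in> \<M>" "K' \<in> \<M>" by (auto simp: S_def)
      obtain x where x: "x \<in> \<sigma>" using face(4)[OF face_in_faces[OF KM(1) *(3)]] by auto
      have "(\<lambda>x. c K * indicat_real \<sigma> x) = (\<lambda>x. c K' * indicat_real \<sigma> x)"
        using c(2)[OF KM(1) *(3)] c(2)[OF KM(2) *(4)] by simp
      from fun_cong[OF this, of x] have "c K = c K'" using x by simp
      then show False using * by (auto simp: S_def)
    qed
    then show ?thesis by (auto simp: S_def)
  qed auto
  then obtain c0 where c0: "\<And>K. K \<in> \<M> \<Longrightarrow> c K = c0" by blast
  have "fst v K = fst (hybrid_scale c0 (hybrid_one \<M> \<E>)) K" for K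
    using c(1)[of K] c0[of K] hybrid_spaceD(3)[OF v, of K]
    by (cases "K \<in> \<M>") (auto simp: hybrid_scale_def hybrid_one_def fun_eq_iff)
  \<comment> \<open>Every face unknown is determined because every face belongs to a cell.\<close>
  moreover have "snd v \<sigma> = snd (hybrid_scale c0 (hybrid_one \<M> \<E>)) \<sigma>" for \<sigma>
  proof (cases "\<sigma> \<in> \<E>")
    case True
    then obtain K where K: "K \<in> \<M>" "\<sigma> \<in> \<F> K" using face_has_cell by blast
    then show ?thesis using c(2)[OF K] c0[OF K(1)] True by (auto simp: hybrid_scale_def hybrid_one_def fun_eq_iff)
  next
    case False
    then show ?thesis using hybrid_spaceD(4)[OF v False] by (auto simp: hybrid_scale_def hybrid_one_def fun_eq_iff)
  qed
  ultimately have "v = hybrid_scale c0 (hybrid_one \<M> \<E>)" by (auto simp: prod_eq_iff fun_eq_iff)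
  then show ?thesis by (rule that)
qed

lemma total_one: "total (hybrid_one \<M> \<E>) = measure lebesgue (\<Union>\<M>)"
proof -
  have lm: "K \<in> lmeasurable" if "K \<in> \<M>" for K
    using that by (intro bounded_set_imp_lmeasurable cell(3) cell_lebesgue)
  have "total (hybrid_one \<M> \<E>) = (\<Sum>K\<in>\<M>. measure lebesgue K)"
    unfolding total_def by (intro sum.cong) (auto simp: hybrid_one_def cell_lebesgue measure_restrict_space)
  also have "\<dots> = measure lebesgue (\<Union>\<M>)"
    using disjoint_cells finite_cells lm
    by (intro measure_Union'[symmetric]) auto
  finally show ?thesis .
qed

lemma total_one_pos: "\<M> \<noteq> {} \<Longrightarrow> total (hybrid_one \<M> \<E>) > 0"
proof -
  assume "\<M> \<noteq> {}"
  then obtain K where K: "K \<in> \<M>" by auto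
  have "open (\<Union>\<M>)" "\<Union>\<M> \<noteq> {}" using cell(1,4) K by blast+
  moreover have "\<Union>\<M> \<in> lmeasurable"
    using cell(2) bounded_subset[OF bounded_domain, of "\<Union>\<M>"] \<open>open (\<Union>\<M>)\<close>
    by (intro bounded_set_imp_lmeasurable) auto
  ultimately show ?thesis
    unfolding total_one by (metis measure_nonneg negligible_iff_measure0 open_not_negligible order_less_le)
qed

text \<open>For definiteness: the seminorm leaves only constants, and a constant of zero total
  vanishes since the cells have positive volume. Without cells there are no faces either.\<close>

lemma hybrid_inner: "inner_product_on hybrid_scale V form_s"
proof
  show "hybrid.subspace V" by (rule subspace_V)
  show "form_s (u + v) w = form_s u w + form_s v w" if "u \<in> V" "v \<in> V" "w \<in> V" for u v w
    using that by (simp add: form_s_def seminorm_form_add total_add distrib_right)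
  show "form_s (hybrid_scale c u) w = c * form_s u w" if "u \<in> V" "w \<in> V" for c u w
    using that by (simp add: form_s_def seminorm_form_scale total_scale distrib_left)
  show "form_s u w = form_s w u" for u w
    by (simp add: form_s_def seminorm_form_commute[of u w] mult.commute)
  show "form_s u u \<ge> 0" for u
    using seminorm_form_nonneg[of u] by (simp add: form_s_def)
  fix u assume u: "u \<in> V" "form_s u u = 0"
  then have z: "seminorm_form u u = 0" "total u = 0"
    using seminorm_form_nonneg[of u] zero_le_square[of "total u"] by (auto simp: form_s_def add_nonneg_eq_0_iff)
  obtain c where c: "u = hybrid_scale c (hybrid_one \<M> \<E>)" by (rule seminorm_form_zero[OF u(1) z(1)])
  show "u = 0"
  proof (cases "\<M> = {}")
    case True
    then have "\<E> = {}" using face_has_cell by blast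
    then show ?thesis using True c by (auto simp: hybrid_one_def hybrid_scale_def prod_eq_iff fun_eq_iff)
  next
    case False
    then have "c = 0" using z(2) c total_one_pos by (simp add: total_scale)
    then show ?thesis using c by simp
  qed
qed

section \<open>Finite dimension and orthonormal expansions\<close>

definition cell_embed :: "(real^'n) set \<Rightarrow> (real^'n \<Rightarrow> real) \<Rightarrow> 'n hybrid" where
  "cell_embed K p = (\<lambda>K'. if K' = K then p else 0, 0)"

definition face_embed :: "(real^'n) set \<Rightarrow> (real^'n \<Rightarrow> real) \<Rightarrow> 'n hybrid" where
  "face_embed \<sigma> p = (0, \<lambda>\<sigma>'. if \<sigma>' = \<sigma> then p else 0)"

lemma finite_dimensional: "\<exists>B. finite B \<and> V = hybrid.span B"
proof -
  define X where "X q = monomial ` {\<alpha> :: 'n \<Rightarrow> nat. (\<Sum>i\<in>UNIV. \<alpha> i) \<le> q}" for q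
  define B where "B = (\<Union>K\<in>\<M>. cell_embed K ` X (Suc k)) \<union> (\<Union>\<sigma>\<in>\<E>. face_embed \<sigma> ` smul_indicator \<sigma> ` X k)"
  have "finite (X q)" for q unfolding X_def by (intro finite_imageI finite_exponents)
  then have fin: "finite B" unfolding B_def using finite_cells finite_faces by auto
  have homc: "Modules.module_hom fun_scale hybrid_scale (cell_embed K)" for K
    by unfold_locales (auto simp: cell_embed_def fun_scale_def hybrid_scale_def fun_eq_iff prod_eq_iff algebra_simps)
  have homf: "Modules.module_hom fun_scale hybrid_scale (face_embed \<sigma>)" for \<sigma>
    by unfold_locales (auto simp: face_embed_def fun_scale_def hybrid_scale_def fun_eq_iff prod_eq_iff algebra_simps)
  have spanc: "cell_embed K ` polys (Suc k) = hybrid.span (cell_embed K ` X (Suc k))" for K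
    using module_hom.span_image[OF homc] by (simp add: polys_span X_def)
  have spanf: "face_embed \<sigma> ` face_polys k \<sigma> = hybrid.span (face_embed \<sigma> ` smul_indicator \<sigma> ` X k)" for \<sigma>
    using module_hom.span_image[OF homf] by (simp add: face_polys_span X_def)
  have "B \<subseteq> V"
  proof -
    have z: "0 \<in> polys q" "0 \<in> face_polys q \<sigma>" for q and \<sigma> :: "(real^'n) set"
      using fun_space.subspace_0[OF subspace_polys] fun_space.subspace_0[OF subspace_face_polys] by auto
    have "cell_embed K p \<in> V" if "K \<in> \<M>" "p \<in> X (Suc k)" for K p
      using that z unfolding hybrid_space_def cell_embed_def X_def
      by (auto intro!: monomial_in_polys)
    moreover have "face_embed \<sigma> (smul_indicator \<sigma> p) \<in> V" if "\<sigma> \<in> \<E>" "p \<in> X k" for \<sigma> p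
      using that z unfolding hybrid_space_def face_embed_def X_def
      by (auto simp: face_polys_image intro!: imageI monomial_in_polys)
    ultimately show ?thesis by (auto simp: B_def)
  qed
  then have "hybrid.span B \<subseteq> V" using subspace_V by (rule hybrid.span_minimal)
  moreover have "V \<subseteq> hybrid.span B"
  proof
    fix v assume v: "v \<in> V"
    have "v = (\<Sum>K\<in>\<M>. cell_embed K (fst v K)) + (\<Sum>\<sigma>\<in>\<E>. face_embed \<sigma> (snd v \<sigma>))"
    proof -
      have s: "(\<Sum>K\<in>A. (\<lambda>K'. if K' = K then g K else 0)) K' = (if K' \<in> A then g K' else 0)"
        if "finite A" for A :: "(real^'n) set set" and g :: "(real^'n) set \<Rightarrow> real^'n \<Rightarrow> real" and K'
        using that by (induction A rule: finite_induct) auto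
      have "fst (\<Sum>K\<in>\<M>. cell_embed K (fst v K)) K' = fst v K'" for K'
        using hybrid_spaceD(3)[OF v, of K'] by (simp add: fst_sum cell_embed_def s[OF finite_cells])
      moreover have "snd (\<Sum>\<sigma>\<in>\<E>. face_embed \<sigma> (snd v \<sigma>)) \<sigma>' = snd v \<sigma>'" for \<sigma>'
        using hybrid_spaceD(4)[OF v, of \<sigma>'] by (simp add: snd_sum face_embed_def s[OF finite_faces])
      moreover have "snd (\<Sum>K\<in>\<M>. cell_embed K (fst v K)) = 0" "fst (\<Sum>\<sigma>\<in>\<E>. face_embed \<sigma> (snd v \<sigma>)) = 0"
        by (simp_all add: fst_sum snd_sum cell_embed_def face_embed_def)
      ultimately show ?thesis by (simp add: prod_eq_iff fun_eq_iff)
    qed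
    moreover have "cell_embed K (fst v K) \<in> hybrid.span B" if "K \<in> \<M>" for K
    proof -
      have "cell_embed K (fst v K) \<in> hybrid.span (cell_embed K ` X (Suc k))"
        using hybrid_spaceD(1)[OF v that] spanc by blast
      also have "\<dots> \<subseteq> hybrid.span B" using that by (intro hybrid.span_mono) (auto simp: B_def)
      finally show ?thesis .
    qed
    moreover have "face_embed \<sigma> (snd v \<sigma>) \<in> hybrid.span B" if "\<sigma> \<in> \<E>" for \<sigma>
    proof -
      have "face_embed \<sigma> (snd v \<sigma>) \<in> hybrid.span (face_embed \<sigma> ` smul_indicator \<sigma> ` X k)"
        using hybrid_spaceD(2)[OF v that] spanf by blast
      also have "\<dots> \<subseteq> hybrid.span B" using that by (intro hybrid.span_mono) (auto simp: B_def)
      finally show ?thesis .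
    qed
    ultimately show "v \<in> hybrid.span B"
      by (metis (no_types, lifting) hybrid.span_add hybrid.span_sum)
  qed
  ultimately show ?thesis using fin by blast
qed

text \<open>Takes the place of the equivalence of norms: any norm and any point value of an element
  of \<open>V\<close> is controlled by finitely many coefficients, each bounded by the square root
  of \<open>form_s\<close>.\<close>

lemma hybrid_expansion:
  obtains A where "finite A" "A \<subseteq> V" "\<And>v. v \<in> V \<Longrightarrow> v = (\<Sum>b\<in>A. hybrid_scale (form_s v b) b)"
    "\<And>v b. v \<in> V \<Longrightarrow> b \<in> A \<Longrightarrow> \<bar>form_s v b\<bar> \<le> sqrt (form_s v v)"
proof -
  interpret ip: inner_product_on hybrid_scale V form_s by (rule hybrid_inner)
  obtain B where B: "finite B" "V = hybrid.span B" using finite_dimensional by blast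
  have "B \<subseteq> V" unfolding B(2) by (rule hybrid.span_superset)
  then obtain A where A: "ip.orthonormal A" and rep: "\<forall>v\<in>V. v = (\<Sum>b\<in>A. hybrid_scale (form_s v b) b)"
    using ip.gram_schmidt[OF B(1)] B(2) by blast
  show ?thesis
  proof (rule that)
    show "finite A" "A \<subseteq> V" using A by (auto simp: ip.orthonormal_def)
    show "v = (\<Sum>b\<in>A. hybrid_scale (form_s v b) b)" if "v \<in> V" for v using rep that by blast
    show "\<bar>form_s v b\<bar> \<le> sqrt (form_s v v)" if "v \<in> V" "b \<in> A" for v b
      using ip.norm_expansion_le[OF A that(1) _ that(2)] rep that(1) by blast
  qed
qed

end

section \<open>Coercivity\<close>

lemma AE_lebesgue_on_subset:
  assumes "S \<in> sets lebesgue" "T \<in> sets lebesgue" "S \<subseteq> T" "AE x in lebesgue_on T. P x"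
  shows "AE x in lebesgue_on S. P x"
proof -
  have "AE x in lebesgue. x \<in> T \<longrightarrow> P x"
    using assms(2,4) by (subst (asm) AE_restrict_space_iff) auto
  then have "AE x in lebesgue. x \<in> S \<longrightarrow> P x"
    by eventually_elim (use assms(3) in auto)
  then show ?thesis using assms(1) by (subst AE_restrict_space_iff) auto
qed

lemma measurable_lebesgue_on_subset:
  fixes f :: "'a::euclidean_space \<Rightarrow> real"
  assumes "S \<in> sets lebesgue" "T \<in> sets lebesgue" "S \<subseteq> T" "f \<in> borel_measurable (lebesgue_on T)"
  shows "f \<in> borel_measurable (lebesgue_on S)"
  using measurable_restrict_mono[OF assms(4,3)] by simp

lemma AE_lebesgue_on_open_ge:
  fixes h :: "'a::euclidean_space \<Rightarrow> real"
  assumes S: "open S" and h: "continuous_on S h" and ae: "AE x in lebesgue_on S. h x \<ge> c" and x: "x \<in> S"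
  shows "h x \<ge> c"
proof (rule ccontr)
  assume "\<not> h x \<ge> c"
  have op: "open (S \<inter> h -` {..<c})" using h S by (intro continuous_open_preimage) auto
  have "AE x in lebesgue. x \<in> S \<longrightarrow> h x \<ge> c"
    using ae S by (subst (asm) AE_restrict_space_iff) auto
  then have "AE x in lebesgue. x \<notin> S \<inter> h -` {..<c}"
    by eventually_elim auto
  moreover have "S \<inter> h -` {..<c} \<in> sets lebesgue" using op by simp
  ultimately have "negligible (S \<inter> h -` {..<c})"
    by (simp add: AE_iff_null_sets negligible_iff_null_sets)
  then show False using x \<open>\<not> h x \<ge> c\<close> op open_not_negligible by fastforce
qed

context hybrid_discretisation
begin

lemma sets_domain: "\<Omega> \<in> sets lebesgue"
  using open_domain by simp

lemma diameter_cell_pos: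
  assumes "K \<in> \<M>"
  shows "diameter K > 0"
proof -
  obtain x where "x \<in> K" using cell(4)[OF assms] by auto
  then obtain r where r: "r > 0" "ball x r \<subseteq> K" using cell(1)[OF assms] by (meson open_contains_ball)
  then have "diameter (ball x r) \<le> diameter K" using cell(3)[OF assms] by (intro diameter_subset)
  then show ?thesis using r(1) by (simp add: diameter_ball)
qed

text \<open>In dimension one a face is a point of diameter 0. From dimension two on there is a
  vector tangential to the face, and a short step along it stays inside.\<close>

lemma diameter_face_pos:
  assumes \<sigma>: "\<sigma> \<in> \<E>" and dim: "CARD('n) \<ge> 2"
  shows "diameter \<sigma> > 0"
proof -
  obtain n c where "flat_face \<sigma> n c" using face_flat[OF \<sigma>] .
  then interpret flat_face \<sigma> n c .
  obtain x where x: "x \<in> \<sigma>" using nonempty_face by auto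
  obtain T where T: "open T" "\<sigma> = {x. n \<bullet> x = c} \<inter> T"
    using openin_face by (auto simp: openin_open)
  then obtain r where r: "r > 0" "ball x r \<subseteq> T" using x by (meson IntD2 open_contains_ball)
  obtain v where v: "v \<noteq> 0" "n \<bullet> v = 0"
    using orthogonal_to_vector_exists[of n] dim by (auto simp: orthogonal_def inner_commute)
  define y where "y = x + (r / (2 * norm v)) *\<^sub>R v"
  have "y \<in> \<sigma>"
    using T r v face_plane[OF x] by (auto simp: y_def inner_add_right dist_norm subset_iff)
  then have "dist x y \<le> diameter \<sigma>" using x bounded_face by (intro diameter_bounded_bound)
  moreover have "dist x y > 0" using r v by (simp add: y_def dist_norm)
  ultimately show ?thesis by linarith
qed

lemma integrable_cell_Linf:
  assumes K: "K \<in> \<M>" and f: "Linf \<Omega> f" and g: "continuous_on UNIV g"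
  shows "integrable (lebesgue_on K) (\<lambda>x. f x * g x)"
proof -
  obtain C where C: "C \<ge> 0" "AE x in lebesgue_on \<Omega>. \<bar>f x\<bar> \<le> C" using Linf_AE_bound[OF f] .
  have fm: "f \<in> borel_measurable (lebesgue_on K)"
    using f by (intro measurable_lebesgue_on_subset[OF cell_lebesgue[OF K] sets_domain cell(2)[OF K]]) (simp add: Linf_def)
  have ae: "AE x in lebesgue_on K. \<bar>f x\<bar> \<le> C"
    by (rule AE_lebesgue_on_subset[OF cell_lebesgue[OF K] sets_domain cell(2)[OF K] C(2)])
  have int: "integrable (lebesgue_on K) (\<lambda>x. C * \<bar>g x\<bar>)"
    using g by (intro cell_integrable[OF K] continuous_intros)
  show ?thesis
  proof (rule Bochner_Integration.integrable_bound[OF int])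
    show "(\<lambda>x. f x * g x) \<in> borel_measurable (lebesgue_on K)"
      using fm measurable_lebesgue_on_continuous[OF g] by measurable
    show "AE x in lebesgue_on K. norm (f x * g x) \<le> norm (C * \<bar>g x\<bar>)"
      using ae by eventually_elim (use C(1) in \<open>auto simp: abs_mult intro: mult_right_mono\<close>)
  qed
qed

text \<open>Ellipticity holds only almost everywhere in the cell. The continuous representative
  carries it to all of \<open>closure K\<close>, in particular to the face, which is a null set for
  the volume but not for its own measure.\<close>

lemma face_diffusion_ge:
  assumes K: "K \<in> \<M>" and \<sigma>: "\<sigma> \<in> \<F> K" and lam: "lam > 0"
    and elliptic: "AE x in lebesgue_on \<Omega>. \<forall>\<xi>. (\<Lambda> x *v \<xi>) \<bullet> \<xi> \<ge> lam * (norm \<xi>)\<^sup>2"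
    and W: "\<And>i j. W1inf K (\<lambda>x. \<Lambda> x $ i $ j)"
  shows "face_diffusion \<Lambda> K \<sigma> \<ge> lam"
proof -
  define N where "N = outward_normal K \<sigma>"
  obtain c where "flat_face \<sigma> N c" using face_normal[OF K \<sigma>] by (auto simp: N_def)
  then interpret flat_face \<sigma> N c .
  define g where "g = continuous_trace K \<Lambda>"
  have g: "continuous_on (closure K) g" "AE x in lebesgue_on K. g x = \<Lambda> x"
    unfolding g_def by (rule continuous_trace_matrix_W1inf[OF cell(1,3,5)[OF K] W])+
  define h where "h x = (g x *v N) \<bullet> N" for x
  have conth: "continuous_on (closure K) h"
    unfolding h_def matrix_vector_mult_def inner_vec_def using g(1)
    by (auto intro!: continuous_intros)
  have ae: "AE x in lebesgue_on K. \<forall>\<xi>. (\<Lambda> x *v \<xi>) \<bullet> \<xi> \<ge> lam * (norm \<xi>)\<^sup>2"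
    by (rule AE_lebesgue_on_subset[OF cell_lebesgue[OF K] sets_domain cell(2)[OF K] elliptic])
  have "AE x in lebesgue_on K. h x \<ge> lam"
    using ae g(2)
  proof eventually_elim
    case (elim x)
    then have "(\<Lambda> x *v N) \<bullet> N \<ge> lam * (norm N)\<^sup>2" by blast
    then show ?case using elim(2) normal by (simp add: h_def)
  qed
  then have "h x \<ge> lam" if "x \<in> K" for x
    using AE_lebesgue_on_open_ge[OF cell(1)[OF K] continuous_on_subset[OF conth closure_subset] _ that] by blast
  then have hcl: "h x \<ge> lam" if "x \<in> closure K" for x
    using continuous_ge_on_closure[OF conth that] by blast
  have \<sigma>cl: "\<sigma> \<subseteq> closure K" using face_subset_frontier[OF K \<sigma>] by (auto simp: frontier_def)
  have "bounded (h ` closure K)"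
    using cell(3)[OF K] by (intro compact_imp_bounded compact_continuous_image conth)
      (auto simp: compact_eq_bounded_closed bounded_closure)
  then obtain B where B: "\<And>x. x \<in> closure K \<Longrightarrow> \<bar>h x\<bar> \<le> B" by (force simp: bounded_iff)
  have hm: "h \<in> borel_measurable (face_measure \<sigma>)"
    by (intro measurable_face_measure_continuous continuous_on_subset[OF conth \<sigma>cl])
  define E where "E = esssup (face_measure \<sigma>) (\<lambda>x. ereal \<bar>h x\<bar>)"
  \<comment> \<open>Finiteness matters: \<open>real_of_ereal\<close> would send an infinite
    essential supremum to 0.\<close>
  have "E \<le> ereal B"
    unfolding E_def using hm B \<sigma>cl by (intro esssup_I) (auto intro!: AE_I2)
  moreover have "E \<ge> ereal lam"
  proof (rule ccontr)
    assume less: "\<not> E \<ge> ereal lam"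
    have "AE x in face_measure \<sigma>. ereal \<bar>h x\<bar> \<le> E" unfolding E_def by (rule esssup_AE)
    moreover have "AE x in face_measure \<sigma>. x \<in> \<sigma>" by (rule AE_I2) simp
    ultimately have "AE x in face_measure \<sigma>. False"
    proof eventually_elim
      case (elim x)
      have "ereal lam \<le> ereal \<bar>h x\<bar>" using hcl[of x] \<sigma>cl elim(2) by auto
      then show ?case using elim(1) less by (meson order_trans)
    qed
    then have "AE x in face_measure \<sigma>. x \<notin> space (face_measure \<sigma>)" by eventually_elim simp
    then have "emeasure (face_measure \<sigma>) (space (face_measure \<sigma>)) = 0"
      using AE_iff_null_sets[OF sets.top, of "face_measure \<sigma>"] by (blast intro: null_setsD1)
    moreover obtain x where x: "x \<in> \<sigma>" using nonempty_face by auto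
    have "emeasure (face_measure \<sigma>) (\<sigma> \<inter> ball x 1) \<le> emeasure (face_measure \<sigma>) (space (face_measure \<sigma>))"
      by (rule emeasure_space)
    ultimately show False using emeasure_face_measure_ball[OF x, of 1] by simp
  qed
  moreover have "face_diffusion \<Lambda> K \<sigma> = real_of_ereal E"
    by (simp add: face_diffusion_def E_def h_def g_def N_def)
  ultimately show ?thesis by (cases E) auto
qed

lemma grad_diffusion_integrable:
  assumes K: "K \<in> \<M>" and Lam: "\<And>i j. Linf \<Omega> (\<lambda>x. \<Lambda> x $ i $ j)" and w: "w \<in> V"
  shows "integrable (lebesgue_on K) (\<lambda>x. (\<Lambda> x *v discrete_grad \<F> k K w x) \<bullet> discrete_grad \<F> k K w x)"
proof -
  have eq: "(\<Lambda> x *v G) \<bullet> G = (\<Sum>i\<in>UNIV. \<Sum>j\<in>UNIV. \<Lambda> x $ i $ j * (G $ j * G $ i))" for x G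
    by (simp add: matrix_vector_mult_def inner_vec_def sum_distrib_right mult.assoc)
  show ?thesis
    unfolding eq
    by (intro Bochner_Integration.integrable_sum integrable_cell_Linf[OF K Lam] continuous_on_mult
        grad_component_continuous[OF K w])
qed

text \<open>The weighted terms are nonnegative and are discarded. The stabilisation does not involve
  \<open>l\<close>, and this is why \<kappa> can be chosen uniformly in it.\<close>

lemma form_T_coercive:
  assumes dim: "CARD('n) \<ge> 2" and lam: "lam > 0" and \<epsilon>: "\<epsilon> > 0"
    and Lam: "\<And>i j. Linf \<Omega> (\<lambda>x. \<Lambda> x $ i $ j)"
    and elliptic: "AE x in lebesgue_on \<Omega>. \<forall>\<xi>. (\<Lambda> x *v \<xi>) \<bullet> \<xi> \<ge> lam * (norm \<xi>)\<^sup>2"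
    and W: "\<And>K i j. K \<in> \<M> \<Longrightarrow> W1inf K (\<lambda>x. \<Lambda> x $ i $ j)"
  obtains \<kappa> where "\<kappa> > 0" "\<And>l w. w \<in> V \<Longrightarrow> form_T \<M> \<F> k \<Lambda> \<epsilon> l w w \<ge> \<kappa> * seminorm_form w w"
proof -
  \<comment> \<open>Including \<open>lam\<close> lets one constant serve the gradient and the jumps,
    and keeps the set nonempty.\<close>
  define \<kappa>1 where "\<kappa>1 = Min (insert lam ((\<lambda>\<sigma>. lam / diameter \<sigma>) ` \<E>))"
  have \<kappa>1: "\<kappa>1 > 0" "\<kappa>1 \<le> lam" "\<And>\<sigma>. \<sigma> \<in> \<E> \<Longrightarrow> \<kappa>1 \<le> lam / diameter \<sigma>"
    unfolding \<kappa>1_def using finite_faces lam diameter_face_pos[OF _ dim]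
    by (auto simp: Min_gr_iff intro!: Min_le)
  \<comment> \<open>The 1 keeps the set nonempty when there are no cells.\<close>
  define \<kappa>2 where "\<kappa>2 = Min (insert 1 ((\<lambda>K. \<epsilon> * diameter K ^ (k + 2)) ` \<M>))"
  have \<kappa>2: "\<kappa>2 > 0" "\<And>K. K \<in> \<M> \<Longrightarrow> \<kappa>2 \<le> \<epsilon> * diameter K ^ (k + 2)"
  proof -
    have "\<epsilon> * diameter K ^ (k + 2) > 0" if "K \<in> \<M>" for K
      using \<epsilon> diameter_cell_pos[OF that] by simp
    then show "\<kappa>2 > 0" unfolding \<kappa>2_def using finite_cells by (subst Min_gr_iff) auto
    show "\<kappa>2 \<le> \<epsilon> * diameter K ^ (k + 2)" if "K \<in> \<M>" for K
      unfolding \<kappa>2_def using finite_cells that by (intro Min_le) auto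
  qed
  have ell: "AE x in lebesgue_on K. \<forall>\<xi>. (\<Lambda> x *v \<xi>) \<bullet> \<xi> \<ge> lam * (norm \<xi>)\<^sup>2" if "K \<in> \<M>" for K
    by (rule AE_lebesgue_on_subset[OF cell_lebesgue[OF that] sets_domain cell(2)[OF that] elliptic])
  have fd: "face_diffusion \<Lambda> K \<sigma> / diameter \<sigma> \<ge> \<kappa>1" "face_diffusion \<Lambda> K \<sigma> / diameter \<sigma> \<ge> 0"
    if "K \<in> \<M>" "\<sigma> \<in> \<F> K" for K \<sigma>
  proof -
    have d: "diameter \<sigma> > 0" using diameter_face_pos[OF face_in_faces[OF that] dim] .
    have "\<kappa>1 \<le> lam / diameter \<sigma>" using \<kappa>1(3)[OF face_in_faces[OF that]] .
    also have "\<dots> \<le> face_diffusion \<Lambda> K \<sigma> / diameter \<sigma>"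
      using face_diffusion_ge[OF that lam elliptic W[OF that(1)]] d by (intro divide_right_mono) auto
    finally show "face_diffusion \<Lambda> K \<sigma> / diameter \<sigma> \<ge> \<kappa>1" .
    then show "face_diffusion \<Lambda> K \<sigma> / diameter \<sigma> \<ge> 0" using \<kappa>1(1) by linarith
  qed
  define q where "q K w = (LINT x|lebesgue_on K. discrete_grad \<F> k K w x \<bullet> discrete_grad \<F> k K w x) +
     (\<Sum>\<sigma>\<in>\<F> K. LINT x|face_measure \<sigma>. jump k K \<sigma> w x * jump k K \<sigma> w x)" for K w
  have q0: "q K w \<ge> 0" for K w
    unfolding q_def by (intro add_nonneg_nonneg sum_nonneg) auto
  have fa: "form_a \<F> k \<Lambda> K w w \<ge> \<kappa>1 * q K w" if K: "K \<in> \<M>" and w: "w \<in> V" for K w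
  proof -
    have "\<kappa>1 * (LINT x|lebesgue_on K. discrete_grad \<F> k K w x \<bullet> discrete_grad \<F> k K w x)
        = (LINT x|lebesgue_on K. \<kappa>1 * (discrete_grad \<F> k K w x \<bullet> discrete_grad \<F> k K w x))" by simp
    also have "\<dots> \<le> (LINT x|lebesgue_on K. (\<Lambda> x *v discrete_grad \<F> k K w x) \<bullet> discrete_grad \<F> k K w x)"
    proof (rule integral_mono_AE)
      show "integrable (lebesgue_on K) (\<lambda>x. \<kappa>1 * (discrete_grad \<F> k K w x \<bullet> discrete_grad \<F> k K w x))"
        using grad_inner_integrable[OF K w w] by simp
      show "integrable (lebesgue_on K) (\<lambda>x. (\<Lambda> x *v discrete_grad \<F> k K w x) \<bullet> discrete_grad \<F> k K w x)"
        by (rule grad_diffusion_integrable[OF K Lam w])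
      show "AE x in lebesgue_on K. \<kappa>1 * (discrete_grad \<F> k K w x \<bullet> discrete_grad \<F> k K w x)
          \<le> (\<Lambda> x *v discrete_grad \<F> k K w x) \<bullet> discrete_grad \<F> k K w x"
        using ell[OF K]
      proof eventually_elim
        case (elim x)
        let ?G = "discrete_grad \<F> k K w x"
        have "\<kappa>1 * (?G \<bullet> ?G) \<le> lam * (?G \<bullet> ?G)" using \<kappa>1(2) by (intro mult_right_mono) auto
        also have "\<dots> \<le> (\<Lambda> x *v ?G) \<bullet> ?G" using elim by (simp add: power2_norm_eq_inner)
        finally show ?case .
      qed
    qed
    finally have 1: "\<kappa>1 * (LINT x|lebesgue_on K. discrete_grad \<F> k K w x \<bullet> discrete_grad \<F> k K w x)
      \<le> (LINT x|lebesgue_on K. (\<Lambda> x *v discrete_grad \<F> k K w x) \<bullet> discrete_grad \<F> k K w x)" .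
    have 2: "\<kappa>1 * (\<Sum>\<sigma>\<in>\<F> K. LINT x|face_measure \<sigma>. jump k K \<sigma> w x * jump k K \<sigma> w x) \<le>
       (\<Sum>\<sigma>\<in>\<F> K. face_diffusion \<Lambda> K \<sigma> / diameter \<sigma> * (LINT x|face_measure \<sigma>. jump k K \<sigma> w x * jump k K \<sigma> w x))"
      unfolding sum_distrib_left using fd(1)[OF K] by (intro sum_mono mult_right_mono) auto
    show ?thesis using 1 2 unfolding form_a_def q_def by (simp add: distrib_left)
  qed
  have T: "form_T \<M> \<F> k \<Lambda> \<epsilon> l w w \<ge> (\<kappa>1 * \<kappa>2) * seminorm_form w w" if w: "w \<in> V" for l w
  proof -
    have "(\<kappa>1 * \<kappa>2) * seminorm_form w w = (\<Sum>K\<in>\<M>. \<kappa>2 * (\<kappa>1 * q K w))"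
      by (simp add: seminorm_form_def q_def sum_distrib_left mult_ac)
    also have "\<dots> \<le> (\<Sum>K\<in>\<M>.
        (LINT x|lebesgue_on K. exp (fst l K x) *
           ((\<Lambda> x *v discrete_grad \<F> k K w x) \<bullet> discrete_grad \<F> k K w x)) +
        (\<Sum>\<sigma>\<in>\<F> K. face_diffusion \<Lambda> K \<sigma> / diameter \<sigma> *
           (LINT x|face_measure \<sigma>.
              (exp (face_proj k \<sigma> (fst l K) x) + exp (snd l \<sigma> x)) / 2 *
              jump k K \<sigma> w x * jump k K \<sigma> w x)) +
        \<epsilon> * diameter K ^ (k + 2) * form_a \<F> k \<Lambda> K w w)"
    proof (rule sum_mono)
      fix K assume K: "K \<in> \<M>"
      have "AE x in lebesgue_on K. exp (fst l K x) * ((\<Lambda> x *v discrete_grad \<F> k K w x) \<bullet> discrete_grad \<F> k K w x) \<ge> 0"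
        using ell[OF K]
      proof eventually_elim
        case (elim x)
        have "0 \<le> lam * (norm (discrete_grad \<F> k K w x))\<^sup>2" using lam by simp
        also have "\<dots> \<le> (\<Lambda> x *v discrete_grad \<F> k K w x) \<bullet> discrete_grad \<F> k K w x" using elim by blast
        finally show ?case by simp
      qed
      then have a: "(LINT x|lebesgue_on K. exp (fst l K x) *
           ((\<Lambda> x *v discrete_grad \<F> k K w x) \<bullet> discrete_grad \<F> k K w x)) \<ge> 0"
        by (rule integral_nonneg_AE)
      have b: "(\<Sum>\<sigma>\<in>\<F> K. face_diffusion \<Lambda> K \<sigma> / diameter \<sigma> *
           (LINT x|face_measure \<sigma>.
              (exp (face_proj k \<sigma> (fst l K) x) + exp (snd l \<sigma> x)) / 2 *
              jump k K \<sigma> w x * jump k K \<sigma> w x)) \<ge> 0"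
      proof (rule sum_nonneg, rule mult_nonneg_nonneg)
        fix \<sigma> assume \<sigma>: "\<sigma> \<in> \<F> K"
        show "0 \<le> face_diffusion \<Lambda> K \<sigma> / diameter \<sigma>" by (rule fd(2)[OF K \<sigma>])
        show "0 \<le> (LINT x|face_measure \<sigma>.
              (exp (face_proj k \<sigma> (fst l K) x) + exp (snd l \<sigma> x)) / 2 *
              jump k K \<sigma> w x * jump k K \<sigma> w x)"
        proof (rule integral_nonneg_AE, rule AE_I2)
          fix x
          have "0 \<le> (exp (face_proj k \<sigma> (fst l K) x) + exp (snd l \<sigma> x)) / 2 * (jump k K \<sigma> w x * jump k K \<sigma> w x)"
            by (rule mult_nonneg_nonneg[OF _ zero_le_square]) (simp add: add_nonneg_nonneg)
          then show "0 \<le> (exp (face_proj k \<sigma> (fst l K) x) + exp (snd l \<sigma> x)) / 2 * jump k K \<sigma> w x * jump k K \<sigma> w x"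
            by (simp only: mult.assoc)
        qed
      qed
      have "\<kappa>2 * (\<kappa>1 * q K w) \<le> (\<epsilon> * diameter K ^ (k + 2)) * form_a \<F> k \<Lambda> K w w"
        using \<kappa>2 K fa[OF K w] \<kappa>1(1) q0[of K w] less_imp_le[OF \<kappa>2(1)] by (intro mult_mono) (auto intro: order_trans[of 0 \<kappa>2])
      then show "\<kappa>2 * (\<kappa>1 * q K w) \<le> (LINT x|lebesgue_on K. exp (fst l K x) *
           ((\<Lambda> x *v discrete_grad \<F> k K w x) \<bullet> discrete_grad \<F> k K w x)) +
        (\<Sum>\<sigma>\<in>\<F> K. face_diffusion \<Lambda> K \<sigma> / diameter \<sigma> *
           (LINT x|face_measure \<sigma>.
              (exp (face_proj k \<sigma> (fst l K) x) + exp (snd l \<sigma> x)) / 2 *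
              jump k K \<sigma> w x * jump k K \<sigma> w x)) +
        \<epsilon> * diameter K ^ (k + 2) * form_a \<F> k \<Lambda> K w w"
        using a b by linarith
    qed
    finally show ?thesis unfolding form_T_def .
  qed
  show ?thesis by (rule that[OF _ T]) (use \<kappa>1 \<kappa>2 in auto)
qed

section \<open>Constants, the discrete potential and reconstructions\<close>

lemma form_T_one: "form_T \<M> \<F> k \<Lambda> \<epsilon> l w (hybrid_one \<M> \<E>) = 0"
  unfolding form_T_def form_a_def
  by (intro sum.neutral ballI) (simp add: grad_one jump_one)

lemma hybrid_potential_V:
  assumes "W1inf \<Omega> \<phi>"
  shows "hybrid_potential \<Omega> \<M> \<E> k \<phi> \<in> V"
proof -
  have L: "Linf \<Omega> \<phi>" using assms by (simp add: W1inf_def)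
  obtain C where C: "C \<ge> 0" "AE x in lebesgue_on \<Omega>. \<bar>\<phi> x\<bar> \<le> C" using Linf_AE_bound[OF L] .
  have "cell_proj (k + 1) K \<phi> \<in> polys (k + 1)" if K: "K \<in> \<M>" for K
  proof (rule cell_proj_in_polys[OF K])
    show "\<phi> \<in> borel_measurable (lebesgue_on K)"
      using L by (intro measurable_lebesgue_on_subset[OF cell_lebesgue[OF K] sets_domain cell(2)[OF K]]) (simp add: Linf_def)
    show "AE x in lebesgue_on K. \<bar>\<phi> x\<bar> \<le> C"
      by (rule AE_lebesgue_on_subset[OF cell_lebesgue[OF K] sets_domain cell(2)[OF K] C(2)])
  qed
  moreover have "face_proj k \<sigma> (continuous_trace \<Omega> \<phi>) \<in> face_polys k \<sigma>" if \<sigma>: "\<sigma> \<in> \<E>" for \<sigma>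
  proof (rule face_proj(1)[OF \<sigma> face_fun_continuous[OF \<sigma>]])
    have "closure \<sigma> \<subseteq> closure \<Omega>" using face(2)[OF \<sigma>] by (intro closure_minimal) auto
    then show "continuous_on (closure \<sigma>) (continuous_trace \<Omega> \<phi>)"
      by (rule continuous_on_subset[OF continuous_trace_W1inf(1)[OF open_domain bounded_domain lipschitz_domain assms]])
  qed
  ultimately show ?thesis by (auto simp: hybrid_space_def hybrid_potential_def)
qed

text \<open>The cells are disjoint and exhaust the domain up to the skeleton, a null set.\<close>

lemma sum_cells_integral:
  fixes f :: "real^'n \<Rightarrow> real"
  assumes f: "integrable (lebesgue_on \<Omega>) f"
  shows "(\<Sum>K\<in>\<M>. LINT x|lebesgue_on K. f x) = (LINT x|lebesgue_on \<Omega>. f x)"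
    and "\<And>K. K \<in> \<M> \<Longrightarrow> integrable (lebesgue_on K) f"
proof -
  define F where "F x = indicator \<Omega> x *\<^sub>R f x" for x
  have F: "integrable lebesgue F"
    using f sets_domain unfolding F_def by (subst (asm) integrable_restrict_space) auto
  have KF: "indicator K x *\<^sub>R f x = indicator K x *\<^sub>R F x" if "K \<in> \<M>" for K x
    using cell(2)[OF that] by (auto simp: F_def indicator_def)
  have intK: "integrable lebesgue (\<lambda>x. indicator K x *\<^sub>R f x)" if "K \<in> \<M>" for K
    unfolding KF[OF that] by (rule integrable_mult_indicator[OF cell_lebesgue[OF that] F])
  then show "integrable (lebesgue_on K) f" if "K \<in> \<M>" for K
    using that cell_lebesgue by (subst integrable_restrict_space) auto
  have "(\<Sum>K\<in>\<M>. LINT x|lebesgue_on K. f x) = (\<Sum>K\<in>\<M>. LINT x|lebesgue. indicator K x *\<^sub>R f x)"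
    using cell_lebesgue by (intro sum.cong refl integral_restrict_space) auto
  also have "\<dots> = (LINT x|lebesgue. (\<Sum>K\<in>\<M>. indicator K x *\<^sub>R f x))"
    using intK by (intro Bochner_Integration.integral_sum[symmetric])
  also have "\<dots> = (LINT x|lebesgue. F x)"
  proof (rule integral_cong_AE)
    show "(\<lambda>x. \<Sum>K\<in>\<M>. indicator K x *\<^sub>R f x) \<in> borel_measurable lebesgue"
      using intK by (intro borel_measurable_sum) auto
    show "F \<in> borel_measurable lebesgue" using F by auto
    have "AE x in lebesgue. x \<notin> \<Omega> - \<Union>\<M>"
      using negligible_skeleton by (intro AE_not_in) (simp add: negligible_iff_null_sets)
    then show "AE x in lebesgue. (\<Sum>K\<in>\<M>. indicator K x *\<^sub>R f x) = F x"
    proof eventually_elim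
      case (elim x)
      show ?case
      proof (cases "x \<in> \<Omega>")
        case True
        then obtain K where K: "K \<in> \<M>" "x \<in> K" using elim by auto
        have "x \<notin> K'" if "K' \<in> \<M> - {K}" for K'
          using disjoint_cells K that by (auto simp: pairwise_def disjnt_def)
        then have "(\<Sum>K\<in>\<M>. indicator K x *\<^sub>R f x) = indicator K x *\<^sub>R f x"
          using finite_cells K(1) by (subst sum.remove[of _ K]) auto
        then show ?thesis using K True by (simp add: F_def)
      next
        case False
        then have "x \<notin> K" if "K \<in> \<M>" for K using cell(2)[OF that] by auto
        then show ?thesis using False by (simp add: F_def)
      qed
    qed
  qed
  also have "\<dots> = (LINT x|lebesgue_on \<Omega>. f x)"
    unfolding F_def using sets_domain by (subst integral_restrict_space) auto
  finally show "(\<Sum>K\<in>\<M>. LINT x|lebesgue_on K. f x) = (LINT x|lebesgue_on \<Omega>. f x)" .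
qed

lemma reconstruct_cell:
  assumes K: "K \<in> \<M>" and x: "x \<in> K"
  shows "reconstruct \<M> v x = fst v K x"
proof -
  have "x \<notin> K'" if "K' \<in> \<M> - {K}" for K'
    using disjoint_cells K x that by (auto simp: pairwise_def disjnt_def)
  then show ?thesis
    unfolding reconstruct_def using finite_cells K x by (subst sum.remove[of _ K]) auto
qed

lemma reconstruct_measurable_bounded:
  assumes v: "v \<in> V"
  shows "reconstruct \<M> v \<in> borel_measurable (lebesgue_on \<Omega>)" "\<exists>B. \<forall>x. \<bar>reconstruct \<M> v x\<bar> \<le> B"
proof -
  have "reconstruct \<M> v \<in> borel_measurable borel"
    unfolding reconstruct_def
    by (intro borel_measurable_sum borel_measurable_times borel_measurable_indicator)
      (use cell(1) polys_continuous[OF hybrid_spaceD(1)[OF v]] in \<open>auto intro: borel_measurable_continuous_onI\<close>)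
  then have "reconstruct \<M> v \<in> borel_measurable lborel" by simp
  then show "reconstruct \<M> v \<in> borel_measurable (lebesgue_on \<Omega>)"
    by (intro measurable_restrict_space1 measurable_completion)
  have "\<exists>B. \<forall>x\<in>K. \<bar>fst v K x\<bar> \<le> B" if "K \<in> \<M>" for K
    using polys_bounded_on[OF hybrid_spaceD(1)[OF v that] cell(3)[OF that]] by metis
  then obtain B where B: "\<And>K x. K \<in> \<M> \<Longrightarrow> x \<in> K \<Longrightarrow> \<bar>fst v K x\<bar> \<le> B K" by metis
  have "\<bar>reconstruct \<M> v x\<bar> \<le> (\<Sum>K\<in>\<M>. \<bar>B K\<bar>)" for x
    unfolding reconstruct_def
    by (intro order_trans[OF sum_abs] sum_mono) (use B in \<open>force simp: indicator_def\<close>)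
  then show "\<exists>B. \<forall>x. \<bar>reconstruct \<M> v x\<bar> \<le> B" by blast
qed

end

section \<open>Entropy decay and convergence\<close>

text \<open>Convexity of \<open>s log s - s\<close> between \<open>s = exp b\<close> and
  \<open>s = exp a\<close>, reduced to the tangent inequality of the exponential; the terms with
  \<open>p\<close> agree on both sides.\<close>

lemma exp_entropy_convex:
  fixes a b p :: real
  shows "exp a * (a - 1 + p) - exp b * (b - 1 + p) \<le> (exp a - exp b) * (a + p)"
proof -
  have "exp b * (1 + (a - b)) \<le> exp b * exp (a - b)"
    by (intro mult_left_mono exp_ge_add_one_self) auto
  also have "\<dots> = exp a" by (simp add: exp_add[symmetric])
  finally show ?thesis by (simp add: algebra_simps)
qed

text \<open>For fixed \<open>p\<close>, the expression \<open>s (log s - 1 + p)\<close> is minimal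
  at \<open>s = exp (- p)\<close>.\<close>

lemma exp_entropy_ge:
  fixes a p :: real
  shows "exp a * (a - 1 + p) \<ge> - exp (- p)"
proof -
  have "exp (a + p) * (1 + (- (a + p))) \<le> exp (a + p) * exp (- (a + p))"
    by (intro mult_left_mono exp_ge_add_one_self) auto
  then have "exp (a + p) * (a - 1 + p) \<ge> - 1"
    by (simp add: exp_add[symmetric] algebra_simps)
  then have "exp (- p) * (exp (a + p) * (a - 1 + p)) \<ge> exp (- p) * (- 1)"
    by (intro mult_left_mono) auto
  then show ?thesis by (simp add: exp_add[symmetric] mult.assoc[symmetric])
qed

text \<open>A decreasing sequence bounded below converges, so its steps tend to zero and dominate
  \<open>q\<close>.\<close>

lemma antimono_bounded_steps_vanish:
  fixes E q :: "nat \<Rightarrow> real"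
  assumes step: "\<And>n. c * q (Suc n) \<le> E n - E (Suc n)" and c: "c > 0" and q: "\<And>n. q n \<ge> 0"
    and low: "\<And>n. L \<le> E n"
  shows "q \<longlonglongrightarrow> 0"
proof -
  have "decseq E"
    unfolding decseq_Suc_iff
  proof
    fix n
    have "0 \<le> c * q (Suc n)" using c q by simp
    then show "E (Suc n) \<le> E n" using step[of n] by linarith
  qed
  then obtain l where l: "E \<longlonglongrightarrow> l" using decseq_convergent low by metis
  then have "(\<lambda>n. (E n - E (Suc n)) / c) \<longlonglongrightarrow> (l - l) / c"
    by (intro tendsto_intros LIMSEQ_Suc) (use c in auto)
  then have lim: "(\<lambda>n. (E n - E (Suc n)) / c) \<longlonglongrightarrow> 0" by simp
  have "q (Suc n) \<le> (E n - E (Suc n)) / c" for n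
    using step[of n] c by (simp add: pos_le_divide_eq mult.commute)
  then have "(\<lambda>n. q (Suc n)) \<longlonglongrightarrow> 0"
    by (intro tendsto_sandwich[OF _ _ tendsto_const lim]) (auto simp: q)
  then show ?thesis by (rule LIMSEQ_imp_Suc)
qed

text \<open>Apart from the vanishing of the form on constants, \<Lambda> and \<epsilon> enter the
  analysis in time only through \<open>coercive\<close>, whose constant \<kappa> is therefore a
  parameter.\<close>

locale nonlinear_scheme = hybrid_discretisation \<Omega> \<M> \<E> \<F> k
  for \<Omega> :: "(real^'n::finite) set" and \<M> \<E> :: "(real^'n) set set"
    and \<F> :: "(real^'n) set \<Rightarrow> (real^'n) set set" and k :: nat +
  fixes \<Lambda> :: "real^'n \<Rightarrow> real^'n^'n" and \<phi> u0 :: "real^'n \<Rightarrow> real"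
    and dt \<epsilon> \<kappa> :: real and l :: "nat \<Rightarrow> 'n hybrid"
  assumes phi: "W1inf \<Omega> \<phi>"
    and u0_L1: "integrable (lebesgue_on \<Omega>) u0"
    and u0_mass: "(LINT x|lebesgue_on \<Omega>. u0 x) > 0"
    and dt_pos: "dt > 0"
    and solution: "nonlinear_scheme_solution \<Omega> \<M> \<E> \<F> k \<Lambda> \<phi> u0 dt \<epsilon> l"
    and \<kappa>_pos: "\<kappa> > 0"
    and coercive: "\<And>l w. w \<in> V \<Longrightarrow> form_T \<M> \<F> k \<Lambda> \<epsilon> l w w \<ge> \<kappa> * seminorm_form w w"
begin

abbreviation "\<Phi> \<equiv> hybrid_potential \<Omega> \<M> \<E> k \<phi>"
abbreviation "mass \<equiv> LINT x|lebesgue_on \<Omega>. u0 x"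

definition w :: "nat \<Rightarrow> 'n hybrid" where "w n = l n + \<Phi>"

lemma \<Phi>_V: "\<Phi> \<in> V" by (rule hybrid_potential_V[OF phi])

lemma l_V: "n \<ge> 1 \<Longrightarrow> l n \<in> V"
  using solution by (auto simp: nonlinear_scheme_solution_def)

lemma w_V: "n \<ge> 1 \<Longrightarrow> w n \<in> V"
  unfolding w_def by (intro V_add l_V \<Phi>_V)

lemma scheme:
  "v \<in> V \<Longrightarrow> (\<Sum>K\<in>\<M>. LINT x|lebesgue_on K. (density_at u0 l (n + 1) K x - density_at u0 l n K x) / dt * fst v K x) +
    form_T \<M> \<F> k \<Lambda> \<epsilon> (l (n + 1)) (w (n + 1)) v = 0"
  using solution unfolding nonlinear_scheme_solution_def w_def by blast

lemma cell_continuous: "v \<in> V \<Longrightarrow> K \<in> \<M> \<Longrightarrow> continuous_on UNIV (fst v K)"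
  by (rule polys_continuous[OF hybrid_spaceD(1)])

lemma density_integrable:
  assumes "K \<in> \<M>"
  shows "integrable (lebesgue_on K) (density_at u0 l n K)"
proof (cases "n = 0")
  case True
  then have "density_at u0 l n K = u0" by (auto simp: density_at_def)
  then show ?thesis using sum_cells_integral(2)[OF u0_L1 assms] by simp
next
  case False
  then have "density_at u0 l n K = (\<lambda>x. exp (fst (l n) K x))" by (auto simp: density_at_def)
  then show ?thesis using False l_V[of n] assms
    by (auto intro!: cell_integrable continuous_intros cell_continuous)
qed

lemma mass_conservation:
  assumes "n \<ge> 1"
  shows "(\<Sum>K\<in>\<M>. LINT x|lebesgue_on K. exp (fst (l n) K x)) = mass"
proof -
  \<comment> \<open>Stated through \<open>density_at\<close> for all \<open>n\<close>, so that the
    induction starts from the initial datum.\<close>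
  have const: "(\<Sum>K\<in>\<M>. LINT x|lebesgue_on K. density_at u0 l n K x) = mass" for n
  proof (induction n)
    case 0
    then show ?case using sum_cells_integral(1)[OF u0_L1] by (simp add: density_at_def)
  next
    case (Suc n)
    have "(\<Sum>K\<in>\<M>. LINT x|lebesgue_on K. (density_at u0 l (n + 1) K x - density_at u0 l n K x) / dt * fst (hybrid_one \<M> \<E>) K x) = 0"
      using scheme[OF hybrid_one_V, of n] by (simp add: form_T_one)
    moreover have "(LINT x|lebesgue_on K. (density_at u0 l (n + 1) K x - density_at u0 l n K x) / dt * fst (hybrid_one \<M> \<E>) K x)
        = ((LINT x|lebesgue_on K. density_at u0 l (n + 1) K x) - (LINT x|lebesgue_on K. density_at u0 l n K x)) / dt" if "K \<in> \<M>" for K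
      using that density_integrable[OF that] by (simp add: hybrid_one_def)
    ultimately have "(\<Sum>K\<in>\<M>. LINT x|lebesgue_on K. density_at u0 l (n + 1) K x) - (\<Sum>K\<in>\<M>. LINT x|lebesgue_on K. density_at u0 l n K x) = 0"
      using dt_pos by (simp add: sum_divide_distrib[symmetric] sum_subtractf)
    then show ?case using Suc by simp
  qed
  then show ?thesis using const[of n] assms by (simp add: density_at_def)
qed

definition entropy :: "nat \<Rightarrow> real" where
  "entropy n = (\<Sum>K\<in>\<M>. LINT x|lebesgue_on K. exp (fst (l n) K x) * (fst (l n) K x - 1 + fst \<Phi> K x))"

lemma entropy_integrable:
  assumes "n \<ge> 1" "K \<in> \<M>"
  shows "integrable (lebesgue_on K) (\<lambda>x. exp (fst (l n) K x) * (fst (l n) K x - 1 + fst \<Phi> K x))"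
  using assms by (intro cell_integrable continuous_intros cell_continuous l_V \<Phi>_V)

lemma entropy_step:
  assumes n: "n \<ge> 1"
  shows "dt * \<kappa> * seminorm_form (w (Suc n)) (w (Suc n)) \<le> entropy n - entropy (Suc n)"
proof -
  have n1: "Suc n \<ge> 1" by simp
  \<comment> \<open>The term of the scheme with the time difference, tested with
    \<open>w (Suc n)\<close> and freed of the factor \<open>1 / dt\<close>.\<close>
  define I where "I K = (LINT x|lebesgue_on K. (exp (fst (l (Suc n)) K x) - exp (fst (l n) K x)) * fst (w (Suc n)) K x)" for K
  have cells: "(LINT x|lebesgue_on K. exp (fst (l (Suc n)) K x) * (fst (l (Suc n)) K x - 1 + fst \<Phi> K x)) -
      (LINT x|lebesgue_on K. exp (fst (l n) K x) * (fst (l n) K x - 1 + fst \<Phi> K x)) \<le> I K" if K: "K \<in> \<M>" for K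
  proof -
    have "(LINT x|lebesgue_on K. exp (fst (l (Suc n)) K x) * (fst (l (Suc n)) K x - 1 + fst \<Phi> K x)) -
      (LINT x|lebesgue_on K. exp (fst (l n) K x) * (fst (l n) K x - 1 + fst \<Phi> K x)) =
      (LINT x|lebesgue_on K. exp (fst (l (Suc n)) K x) * (fst (l (Suc n)) K x - 1 + fst \<Phi> K x) -
        exp (fst (l n) K x) * (fst (l n) K x - 1 + fst \<Phi> K x))"
      by (rule Bochner_Integration.integral_diff[symmetric]) (intro entropy_integrable n n1 K)+
    also have "\<dots> \<le> I K"
      unfolding I_def
    proof (rule integral_mono)
      show "integrable (lebesgue_on K) (\<lambda>x. exp (fst (l (Suc n)) K x) * (fst (l (Suc n)) K x - 1 + fst \<Phi> K x) -
        exp (fst (l n) K x) * (fst (l n) K x - 1 + fst \<Phi> K x))"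
        by (intro Bochner_Integration.integrable_diff entropy_integrable n n1 K)
      show "integrable (lebesgue_on K) (\<lambda>x. (exp (fst (l (Suc n)) K x) - exp (fst (l n) K x)) * fst (w (Suc n)) K x)"
        by (intro cell_integrable K continuous_intros cell_continuous l_V w_V n n1)
      show "exp (fst (l (Suc n)) K x) * (fst (l (Suc n)) K x - 1 + fst \<Phi> K x) -
        exp (fst (l n) K x) * (fst (l n) K x - 1 + fst \<Phi> K x) \<le>
        (exp (fst (l (Suc n)) K x) - exp (fst (l n) K x)) * fst (w (Suc n)) K x" for x
        using exp_entropy_convex[of "fst (l (Suc n)) K x" "fst \<Phi> K x" "fst (l n) K x"] by (simp add: w_def)
    qed
    finally show ?thesis .
  qed
  have "(\<Sum>K\<in>\<M>. I K) / dt + form_T \<M> \<F> k \<Lambda> \<epsilon> (l (Suc n)) (w (Suc n)) (w (Suc n)) = 0"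
    using scheme[OF w_V[OF n1], of n] n by (simp add: density_at_def I_def sum_divide_distrib)
  then have "(\<Sum>K\<in>\<M>. I K) = - dt * form_T \<M> \<F> k \<Lambda> \<epsilon> (l (Suc n)) (w (Suc n)) (w (Suc n))"
    using dt_pos by (simp add: field_simps)
  moreover have "dt * (\<kappa> * seminorm_form (w (Suc n)) (w (Suc n))) \<le> dt * form_T \<M> \<F> k \<Lambda> \<epsilon> (l (Suc n)) (w (Suc n)) (w (Suc n))"
    using coercive[OF w_V[OF n1]] dt_pos by (intro mult_left_mono) auto
  moreover have "entropy (Suc n) - entropy n \<le> (\<Sum>K\<in>\<M>. I K)"
    unfolding entropy_def sum_subtractf[symmetric] by (intro sum_mono cells)
  ultimately show ?thesis by (simp add: mult.assoc)
qed

lemma entropy_ge: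
  assumes n: "n \<ge> 1"
  shows "- (\<Sum>K\<in>\<M>. LINT x|lebesgue_on K. exp (- fst \<Phi> K x)) \<le> entropy n"
  unfolding entropy_def sum_negf[symmetric]
proof (rule sum_mono)
  fix K assume K: "K \<in> \<M>"
  have i: "integrable (lebesgue_on K) (\<lambda>x. exp (- fst \<Phi> K x))"
    by (intro cell_integrable K continuous_intros cell_continuous \<Phi>_V)
  have "- (LINT x|lebesgue_on K. exp (- fst \<Phi> K x)) = (LINT x|lebesgue_on K. - exp (- fst \<Phi> K x))" by simp
  also have "\<dots> \<le> (LINT x|lebesgue_on K. exp (fst (l n) K x) * (fst (l n) K x - 1 + fst \<Phi> K x))"
    by (rule integral_mono) (use i entropy_integrable[OF n K] exp_entropy_ge in auto)
  finally show "- (LINT x|lebesgue_on K. exp (- fst \<Phi> K x)) \<le>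
    (LINT x|lebesgue_on K. exp (fst (l n) K x) * (fst (l n) K x - 1 + fst \<Phi> K x))" .
qed

lemma seminorm_vanishes: "(\<lambda>n. seminorm_form (w n) (w n)) \<longlonglongrightarrow> 0"
proof -
  have "(\<lambda>n. seminorm_form (w (Suc n)) (w (Suc n))) \<longlonglongrightarrow> 0"
  \<comment> \<open>Shifted by one because the entropy is expressed by the unknowns
    \<open>l n\<close>, which represent the density only from \<open>n = 1\<close> on.\<close>
  proof (rule antimono_bounded_steps_vanish[where E = "\<lambda>n. entropy (Suc n)" and c = "dt * \<kappa>"])
    show "dt * \<kappa> * seminorm_form (w (Suc (Suc n))) (w (Suc (Suc n))) \<le> entropy (Suc n) - entropy (Suc (Suc n))" for n
      using entropy_step[of "Suc n"] by simp
    show "- (\<Sum>K\<in>\<M>. LINT x|lebesgue_on K. exp (- fst \<Phi> K x)) \<le> entropy (Suc n)" for n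
      using entropy_ge[of "Suc n"] by simp
  qed (use dt_pos \<kappa>_pos seminorm_form_nonneg in auto)
  then show ?thesis by (rule LIMSEQ_imp_Suc)
qed

section \<open>Splitting off the mean and identifying its limit\<close>

lemma domain_nonempty: "\<Omega> \<noteq> {}"
proof
  assume "\<Omega> = {}"
  then have "mass = (LINT x|lebesgue_on {}. u0 x)" by simp
  also have "\<dots> = 0" by (subst integral_restrict_space) auto
  finally show False using u0_mass by simp
qed

lemma cells_nonempty: "\<M> \<noteq> {}"
  using closure_domain domain_nonempty closure_subset[of \<Omega>] by auto

definition mean :: "nat \<Rightarrow> real" where "mean n = total (w n) / total (hybrid_one \<M> \<E>)"

definition z :: "nat \<Rightarrow> 'n hybrid" where "z n = w n - hybrid_scale (mean n) (hybrid_one \<M> \<E>)"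

lemma z_V: "n \<ge> 1 \<Longrightarrow> z n \<in> V"
  unfolding z_def by (intro V_diff w_V V_scale hybrid_one_V)

text \<open>\<open>z n\<close> has zero total by the choice of the mean, and constants are
  annihilated by the seminorm form in either argument.\<close>

lemma form_s_z:
  assumes "n \<ge> 1"
  shows "form_s (z n) (z n) = seminorm_form (w n) (w n)"
proof -
  have w: "w n \<in> V" using w_V[OF assms] .
  define o1 where "o1 = hybrid_scale (- mean n) (hybrid_one \<M> \<E>)"
  have o1: "o1 \<in> V" unfolding o1_def by (intro V_scale hybrid_one_V)
  have z: "z n = w n + o1" by (simp add: z_def o1_def)
  have s0: "seminorm_form o1 v = 0" if "v \<in> V" for v
    unfolding o1_def seminorm_form_scale[OF hybrid_one_V that] seminorm_form_one[OF that] by simp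
  have "total (z n) = total (w n) + total o1" unfolding z by (rule total_add[OF w o1])
  also have "\<dots> = 0"
    using total_one_pos[OF cells_nonempty] unfolding o1_def total_scale by (simp add: mean_def)
  finally have "total (z n) = 0" .
  moreover have "seminorm_form (z n) (z n) = seminorm_form (w n) (w n)"
  proof -
    have "seminorm_form (z n) (z n) = seminorm_form (w n) (z n)"
      using seminorm_form_add[OF w o1, of "z n"] z_V[OF assms] s0 by (simp add: z)
    also have "\<dots> = seminorm_form (z n) (w n)" by (rule seminorm_form_commute)
    also have "\<dots> = seminorm_form (w n) (w n)"
      using seminorm_form_add[OF w o1 w] s0[OF w] by (simp add: z)
    finally show ?thesis .
  qed
  ultimately show ?thesis by (simp add: form_s_def)
qed

text \<open>The normalising integral of the Gibbs density of the discrete potential, computed cell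
  by cell.\<close>

definition partition_sum :: real where
  "partition_sum = (\<Sum>K\<in>\<M>. LINT x|lebesgue_on K. exp (- fst \<Phi> K x))"

lemma partition_sum_pos: "partition_sum > 0"
proof -
  have i: "integrable (lebesgue_on K) (\<lambda>x. exp (- fst \<Phi> K x))" if "K \<in> \<M>" for K
    by (intro cell_integrable that continuous_intros cell_continuous \<Phi>_V)
  have pos: "(LINT x|lebesgue_on K. exp (- fst \<Phi> K x)) > 0" if K: "K \<in> \<M>" for K
  proof (rule ccontr)
    assume "\<not> ?thesis"
    moreover have "(LINT x|lebesgue_on K. exp (- fst \<Phi> K x)) \<ge> 0" by simp
    ultimately have "(LINT x|lebesgue_on K. exp (- fst \<Phi> K x)) = 0" by linarith
    then have "AE x in lebesgue_on K. exp (- fst \<Phi> K x) = 0"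
      using integral_nonneg_eq_0_iff_AE[OF i[OF K]] by simp
    then have "AE x in lebesgue_on K. (1::real) = 0" by simp
    then have "(1::real) = 0" if "x \<in> K" for x
      using AE_lebesgue_on_open_zero[OF cell(1)[OF K], of "\<lambda>_. 1" x] that by simp
    then show False using cell(4)[OF K] by auto
  qed
  show ?thesis
    unfolding partition_sum_def using finite_cells cells_nonempty pos by (intro sum_pos)
qed

lemma partition_sum_eq: "partition_sum = (LINT x|lebesgue_on \<Omega>. exp (- reconstruct \<M> \<Phi> x))"
proof -
  have "integrable (lebesgue_on \<Omega>) (\<lambda>x. exp (- reconstruct \<M> \<Phi> x))"
  proof -
    obtain B where B: "\<And>x. \<bar>reconstruct \<M> \<Phi> x\<bar> \<le> B" using reconstruct_measurable_bounded(2)[OF \<Phi>_V] by blast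
    have "\<bar>exp (- reconstruct \<M> \<Phi> x)\<bar> \<le> exp B" for x using B[of x] by auto
    then show ?thesis
      using reconstruct_measurable_bounded(1)[OF \<Phi>_V]
      by (intro integrable_lebesgue_on_bounded[OF sets_domain bounded_domain, of _ "exp B"]) auto
  qed
  from sum_cells_integral(1)[OF this, symmetric]
  show ?thesis
    unfolding partition_sum_def
    by (auto intro!: sum.cong Bochner_Integration.integral_cong simp: reconstruct_cell)
qed

abbreviation "limit_constant \<equiv> ln (mass / partition_sum)"

text \<open>Conservation of mass squeezes the mean: the mass lies between
  \<open>exp (mean n - d)\<close> and \<open>exp (mean n + d)\<close> times the partition sum, and
  taking logarithms gives the claim. The bound on \<open>z n\<close> thus passes directly to the
  mean, and no subsequences have to be extracted.\<close>

lemma mean_near_limit: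
  assumes n: "n \<ge> 1" and d: "\<And>K x. K \<in> \<M> \<Longrightarrow> x \<in> K \<Longrightarrow> \<bar>fst (z n) K x\<bar> \<le> d"
  shows "\<bar>mean n - limit_constant\<bar> \<le> d"
proof -
  have leq: "fst (l n) K x = fst (z n) K x + mean n - fst \<Phi> K x" if "K \<in> \<M>" for K x
    using that by (simp add: z_def w_def hybrid_scale_def hybrid_one_def)
  have i: "integrable (lebesgue_on K) (\<lambda>x. a * exp (- fst \<Phi> K x))" if "K \<in> \<M>" for K a
    by (intro cell_integrable that continuous_intros cell_continuous \<Phi>_V)
  have il: "integrable (lebesgue_on K) (\<lambda>x. exp (fst (l n) K x))" if "K \<in> \<M>" for K
    by (intro cell_integrable that continuous_intros cell_continuous l_V n)
  have "mass \<le> (\<Sum>K\<in>\<M>. LINT x|lebesgue_on K. exp (mean n + d) * exp (- fst \<Phi> K x))"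
    unfolding mass_conservation[OF n, symmetric]
  proof (intro sum_mono integral_mono il i)
    fix K x assume K: "K \<in> \<M>" "x \<in> space (lebesgue_on K)"
    have "fst (l n) K x \<le> mean n + d - fst \<Phi> K x" using d[of K x] leq[of K x] K by auto
    then show "exp (fst (l n) K x) \<le> exp (mean n + d) * exp (- fst \<Phi> K x)"
      by (simp add: exp_add[symmetric])
  qed
  then have up: "mass \<le> exp (mean n + d) * partition_sum"
    by (simp add: partition_sum_def sum_distrib_left)
  have "(\<Sum>K\<in>\<M>. LINT x|lebesgue_on K. exp (mean n - d) * exp (- fst \<Phi> K x)) \<le> mass"
    unfolding mass_conservation[OF n, symmetric]
  proof (intro sum_mono integral_mono il i)
    fix K x assume K: "K \<in> \<M>" "x \<in> space (lebesgue_on K)"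
    have "mean n - d - fst \<Phi> K x \<le> fst (l n) K x" using d[of K x] leq[of K x] K by auto
    then show "exp (mean n - d) * exp (- fst \<Phi> K x) \<le> exp (fst (l n) K x)"
      by (simp add: exp_add[symmetric])
  qed
  then have low: "exp (mean n - d) * partition_sum \<le> mass"
    by (simp add: partition_sum_def sum_distrib_left)
  have "mass / partition_sum \<le> exp (mean n + d)" "exp (mean n - d) \<le> mass / partition_sum"
    using up low partition_sum_pos by (simp_all add: field_simps)
  moreover have "mass / partition_sum > 0" using u0_mass partition_sum_pos by simp
  ultimately have "limit_constant \<le> mean n + d" "mean n - d \<le> limit_constant"
    by (metis exp_gt_zero ln_exp ln_le_cancel_iff)+
  then show ?thesis by linarith
qed

text \<open>Every error is bounded by a multiple of \<open>q n\<close>, the square root of the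
  seminorm form. The second claim records the uniform bound on cells, from which the densities are
  treated.\<close>

theorem convergence:
  shows "\<And>N. norm_on V N \<Longrightarrow>
      (\<lambda>n. N (l n - (hybrid_scale limit_constant (hybrid_one \<M> \<E>) - \<Phi>))) \<longlonglongrightarrow> 0"
    and "\<exists>r. r \<longlonglongrightarrow> 0 \<and> (\<forall>n\<ge>1. \<forall>K\<in>\<M>. \<forall>x\<in>K. \<bar>fst (l n) K x - (limit_constant - fst \<Phi> K x)\<bar> \<le> r n)"
proof -
  obtain A where A: "finite A" "A \<subseteq> V" "\<And>v. v \<in> V \<Longrightarrow> v = (\<Sum>b\<in>A. hybrid_scale (form_s v b) b)"
    "\<And>v b. v \<in> V \<Longrightarrow> b \<in> A \<Longrightarrow> \<bar>form_s v b\<bar> \<le> sqrt (form_s v v)"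
    by (rule hybrid_expansion) blast
  define q where "q n = sqrt (seminorm_form (w n) (w n))" for n
  have q: "q \<longlonglongrightarrow> 0"
    unfolding q_def using tendsto_real_sqrt[OF seminorm_vanishes] by simp
  have q0: "q n \<ge> 0" for n unfolding q_def using seminorm_form_nonneg by simp
  have coef: "\<bar>form_s (z n) b\<bar> \<le> q n" if "n \<ge> 1" "b \<in> A" for n b
    using A(4)[OF z_V[OF that(1)] that(2)] form_s_z[OF that(1)] by (simp add: q_def)
  have "\<exists>B. \<forall>x\<in>K. \<bar>fst b K x\<bar> \<le> B" if "b \<in> A" "K \<in> \<M>" for b K
    using polys_bounded_on[OF hybrid_spaceD(1)[of b K] cell(3)[OF that(2)]] A(2) that by (metis subsetD)
  then obtain B where B: "\<And>b K x. b \<in> A \<Longrightarrow> K \<in> \<M> \<Longrightarrow> x \<in> K \<Longrightarrow> \<bar>fst b K x\<bar> \<le> B b K" by metis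
  \<comment> \<open>Bounds the values on the cells of any combination of basis elements whose
    coefficients are at most 1 in absolute value.\<close>
  define C where "C = (\<Sum>b\<in>A. \<Sum>K\<in>\<M>. \<bar>B b K\<bar>)"
  have zb: "\<bar>fst (z n) K x\<bar> \<le> q n * C" if n: "n \<ge> 1" and K: "K \<in> \<M>" "x \<in> K" for n K x
  proof -
    have "fst (z n) K x = fst (\<Sum>b\<in>A. hybrid_scale (form_s (z n) b) b) K x"
      by (rule arg_cong[OF A(3)[OF z_V[OF n]], of "\<lambda>v. fst v K x"])
    also have "\<dots> = (\<Sum>b\<in>A. form_s (z n) b * fst b K x)"
      proof -
      have "(\<Sum>b\<in>A. f b) K x = (\<Sum>b\<in>A. f b K x)" for f :: "'n hybrid \<Rightarrow> (real^'n) set \<Rightarrow> real^'n \<Rightarrow> real"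
        using A(1) by (induction A rule: finite_induct) auto
      then show ?thesis by (simp add: fst_sum hybrid_scale_def)
    qed
    also have "\<bar>\<dots>\<bar> \<le> (\<Sum>b\<in>A. q n * (\<Sum>K\<in>\<M>. \<bar>B b K\<bar>))"
    proof (intro order_trans[OF sum_abs] sum_mono)
      fix b assume b: "b \<in> A"
      have "\<bar>B b K\<bar> \<le> (\<Sum>K\<in>\<M>. \<bar>B b K\<bar>)" using K(1) finite_cells by (intro member_le_sum) auto
      then have "\<bar>fst b K x\<bar> \<le> (\<Sum>K\<in>\<M>. \<bar>B b K\<bar>)" using B[OF b K] by linarith
      then show "\<bar>form_s (z n) b * fst b K x\<bar> \<le> q n * (\<Sum>K\<in>\<M>. \<bar>B b K\<bar>)"
        unfolding abs_mult using coef[OF n b] q0 by (intro mult_mono) auto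
    qed
    also have "\<dots> = q n * C" by (simp add: C_def sum_distrib_left)
    finally show ?thesis .
  qed
  have near: "\<bar>mean n - limit_constant\<bar> \<le> q n * C" if "n \<ge> 1" for n
    by (rule mean_near_limit[OF that]) (use zb[OF that] in blast)
  \<comment> \<open>The error splits into a part of zero total, controlled by the dissipation, and a
    constant, controlled by the mass.\<close>
  have leq: "l n - (hybrid_scale limit_constant (hybrid_one \<M> \<E>) - \<Phi>) =
      z n + hybrid_scale (mean n - limit_constant) (hybrid_one \<M> \<E>)" for n
    by (simp add: z_def w_def hybrid.scale_left_diff_distrib algebra_simps)
  show "\<exists>r. r \<longlonglongrightarrow> 0 \<and> (\<forall>n\<ge>1. \<forall>K\<in>\<M>. \<forall>x\<in>K. \<bar>fst (l n) K x - (limit_constant - fst \<Phi> K x)\<bar> \<le> r n)"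
  proof (intro exI[of _ "\<lambda>n. 2 * (q n * C)"] conjI allI impI ballI)
    have "(\<lambda>n. 2 * (q n * C)) \<longlonglongrightarrow> 2 * (0 * C)" by (intro tendsto_intros q)
    then show "(\<lambda>n. 2 * (q n * C)) \<longlonglongrightarrow> 0" by simp
    fix n :: nat and K x assume *: "1 \<le> n" "K \<in> \<M>" "x \<in> K"
    have "fst (l n) K x - (limit_constant - fst \<Phi> K x) = fst (z n) K x + (mean n - limit_constant)"
      using *(2) by (simp add: z_def w_def hybrid_scale_def hybrid_one_def)
    then show "\<bar>fst (l n) K x - (limit_constant - fst \<Phi> K x)\<bar> \<le> 2 * (q n * C)"
      using zb[OF *] near[OF *(1)] by linarith
  qed
  fix N assume N: "norm_on V N"
  have Nadd: "N (v + u) \<le> N v + N u" if "v \<in> V" "u \<in> V" for v u using N that by (auto simp: norm_on_def)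
  have Nscale: "N (hybrid_scale c v) = \<bar>c\<bar> * N v" if "v \<in> V" for c v using N that by (auto simp: norm_on_def)
  have Nnn: "N v \<ge> 0" if "v \<in> V" for v using N that by (auto simp: norm_on_def)
  have N0: "N 0 = 0" using Nscale[OF hybrid_one_V, of 0] by simp
  have Nsum: "N (\<Sum>b\<in>S. hybrid_scale (f b) b) \<le> (\<Sum>b\<in>S. \<bar>f b\<bar> * N b)" if "finite S" "S \<subseteq> V" for S f
    using that
  proof (induction S rule: finite_induct)
    case (insert b S)
    have bV: "b \<in> V" and SV: "(\<Sum>b\<in>S. hybrid_scale (f b) b) \<in> V"
      using insert by (auto intro!: hybrid.subspace_sum[OF subspace_V] V_scale)
    have "N (\<Sum>b\<in>insert b S. hybrid_scale (f b) b) = N (hybrid_scale (f b) b + (\<Sum>b\<in>S. hybrid_scale (f b) b))"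
      using insert by simp
    also have "\<dots> \<le> N (hybrid_scale (f b) b) + N (\<Sum>b\<in>S. hybrid_scale (f b) b)"
      by (rule Nadd[OF V_scale[OF bV] SV])
    also have "\<dots> \<le> \<bar>f b\<bar> * N b + (\<Sum>b\<in>S. \<bar>f b\<bar> * N b)"
      using Nscale[OF bV] insert by auto
    also have "\<dots> = (\<Sum>b\<in>insert b S. \<bar>f b\<bar> * N b)" using insert by simp
    finally show ?case .
  qed (simp add: N0)
  \<comment> \<open>Collects the norms of the basis elements, weighted by \<open>q n\<close> through
    their coefficients, and that of the constant, weighted by \<open>q n * C\<close>.\<close>
  define D where "D = (\<Sum>b\<in>A. N b) + C * N (hybrid_one \<M> \<E>)"
  have bound: "N (z n + hybrid_scale (mean n - limit_constant) (hybrid_one \<M> \<E>)) \<le> q n * D" if n: "n \<ge> 1" for n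
  proof -
    have "N (z n) = N (\<Sum>b\<in>A. hybrid_scale (form_s (z n) b) b)"
      by (rule arg_cong[OF A(3)[OF z_V[OF n]], of N])
    also have "\<dots> \<le> (\<Sum>b\<in>A. \<bar>form_s (z n) b\<bar> * N b)" by (rule Nsum[OF A(1,2)])
    also have "\<dots> \<le> (\<Sum>b\<in>A. q n * N b)"
      using A(2) by (intro sum_mono mult_right_mono coef[OF n] Nnn) auto
    finally have 1: "N (z n) \<le> q n * (\<Sum>b\<in>A. N b)" by (simp add: sum_distrib_left)
    have "N (hybrid_scale (mean n - limit_constant) (hybrid_one \<M> \<E>)) = \<bar>mean n - limit_constant\<bar> * N (hybrid_one \<M> \<E>)"
      by (rule Nscale[OF hybrid_one_V])
    also have "\<dots> \<le> (q n * C) * N (hybrid_one \<M> \<E>)"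
      by (intro mult_right_mono near[OF n] Nnn hybrid_one_V)
    finally have 2: "N (hybrid_scale (mean n - limit_constant) (hybrid_one \<M> \<E>)) \<le> (q n * C) * N (hybrid_one \<M> \<E>)" .
    show ?thesis
      using Nadd[OF z_V[OF n] V_scale[OF hybrid_one_V], of "mean n - limit_constant"] 1 2
      by (simp add: D_def algebra_simps)
  qed
  have lim: "(\<lambda>n. q n * D) \<longlonglongrightarrow> 0" using tendsto_mult_left_zero[OF q, of D] by simp
  show "(\<lambda>n. N (l n - (hybrid_scale limit_constant (hybrid_one \<M> \<E>) - \<Phi>))) \<longlonglongrightarrow> 0"
    unfolding leq
  proof (rule tendsto_sandwich[OF _ _ tendsto_const lim])
    show "\<forall>\<^sub>F n in sequentially. 0 \<le> N (z n + hybrid_scale (mean n - limit_constant) (hybrid_one \<M> \<E>))"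
      using eventually_ge_at_top[of 1]
      by eventually_elim (intro Nnn V_add z_V V_scale hybrid_one_V)
    show "\<forall>\<^sub>F n in sequentially. N (z n + hybrid_scale (mean n - limit_constant) (hybrid_one \<M> \<E>)) \<le> q n * D"
      using eventually_ge_at_top[of 1] by eventually_elim (rule bound)
  qed
qed

text \<open>The parameters cover the density with \<open>a = s = 1\<close> and the equilibrium with
  \<open>s = -1\<close>.\<close>

lemma Linf_exp_reconstruct:
  assumes "v \<in> V"
  shows "Linf \<Omega> (\<lambda>x. a * exp (s * reconstruct \<M> v x))"
proof -
  note m [measurable] = reconstruct_measurable_bounded(1)[OF assms]
  obtain B where B: "\<And>x. \<bar>reconstruct \<M> v x\<bar> \<le> B" using reconstruct_measurable_bounded(2)[OF assms] by blast
  have meas: "(\<lambda>x. a * exp (s * reconstruct \<M> v x)) \<in> borel_measurable (lebesgue_on \<Omega>)" by measurable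
  have "\<bar>a * exp (s * reconstruct \<M> v x)\<bar> \<le> \<bar>a\<bar> * exp (\<bar>s\<bar> * B)" for x
  proof -
    have "s * reconstruct \<M> v x \<le> \<bar>s\<bar> * \<bar>reconstruct \<M> v x\<bar>" by (metis abs_ge_self abs_mult)
    also have "\<dots> \<le> \<bar>s\<bar> * B" using B by (intro mult_left_mono) auto
    finally show ?thesis by (simp add: abs_mult mult_left_mono)
  qed
  then have "esssup (lebesgue_on \<Omega>) (\<lambda>x. ereal \<bar>a * exp (s * reconstruct \<M> v x)\<bar>) \<le> ereal (\<bar>a\<bar> * exp (\<bar>s\<bar> * B))"
    using meas by (intro esssup_I) (auto intro!: AE_I2)
  also have "\<dots> < \<infinity>" by simp
  finally show ?thesis using meas by (simp add: Linf_def)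
qed

theorem density_convergence:
  "tendsto_Linf \<Omega> (\<lambda>n x. exp (reconstruct \<M> (l n) x))
     (\<lambda>x. mass / partition_sum * exp (- reconstruct \<M> \<Phi> x))"
  unfolding tendsto_Linf_def
proof (intro conjI)
  show "\<forall>\<^sub>F n in sequentially. Linf \<Omega> (\<lambda>x. exp (reconstruct \<M> (l n) x))"
    using eventually_ge_at_top[of 1]
    by eventually_elim (use Linf_exp_reconstruct[OF l_V, of _ 1 1] in simp)
  show "Linf \<Omega> (\<lambda>x. mass / partition_sum * exp (- reconstruct \<M> \<Phi> x))"
    using Linf_exp_reconstruct[OF \<Phi>_V, of "mass / partition_sum" "-1"] by simp
  obtain r where r: "r \<longlonglongrightarrow> 0"
    "\<And>n K x. n \<ge> 1 \<Longrightarrow> K \<in> \<M> \<Longrightarrow> x \<in> K \<Longrightarrow> \<bar>fst (l n) K x - (limit_constant - fst \<Phi> K x)\<bar> \<le> r n"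
    using convergence(2) by blast
  obtain B where B: "\<And>x. \<bar>reconstruct \<M> \<Phi> x\<bar> \<le> B" using reconstruct_measurable_bounded(2)[OF \<Phi>_V] by blast
  define c where "c = mass / partition_sum"
  have c: "c > 0" using u0_mass partition_sum_pos by (simp add: c_def)
  define f where "f n x = ereal \<bar>exp (reconstruct \<M> (l n) x) - c * exp (- reconstruct \<M> \<Phi> x)\<bar>" for n x
  \<comment> \<open>The density is the equilibrium times \<open>exp d\<close> with
    \<open>\<bar>d\<bar> \<le> r n\<close>, and the equilibrium is at most
    \<open>c * exp B\<close>.\<close>
  define b where "b n = c * exp B * (exp (r n) - 1)" for n
  have lim: "(\<lambda>n. ereal (b n)) \<longlonglongrightarrow> 0"
  proof -
    have "b \<longlonglongrightarrow> c * exp B * (exp 0 - 1)" unfolding b_def by (intro tendsto_intros r(1))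
    then have "b \<longlonglongrightarrow> 0" by simp
    then show ?thesis by (simp add: zero_ereal_def)
  qed
  have meas: "f n \<in> borel_measurable (lebesgue_on \<Omega>)" if "n \<ge> 1" for n
    using reconstruct_measurable_bounded(1)[OF l_V[OF that]] reconstruct_measurable_bounded(1)[OF \<Phi>_V]
    unfolding f_def by measurable
  have upper: "esssup (lebesgue_on \<Omega>) (f n) \<le> ereal (b n)" if n: "n \<ge> 1" for n
  proof (rule esssup_I[OF meas[OF n]])
    have "AE x in lebesgue. x \<notin> \<Omega> - \<Union>\<M>"
      using negligible_skeleton by (intro AE_not_in) (simp add: negligible_iff_null_sets)
    then have "AE x in lebesgue_on \<Omega>. x \<in> \<Union>\<M>"
      using sets_domain by (subst AE_restrict_space_iff) (auto elim: eventually_mono)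
    then show "AE x in lebesgue_on \<Omega>. f n x \<le> ereal (b n)"
    proof eventually_elim
      case (elim x)
      then obtain K where K: "K \<in> \<M>" "x \<in> K" by auto
      define d where "d = fst (l n) K x - (limit_constant - fst \<Phi> K x)"
      have d: "\<bar>d\<bar> \<le> r n" using r(2)[OF n K] by (simp add: d_def)
      have "exp (fst (l n) K x) = c * exp (- fst \<Phi> K x) * exp d"
      proof -
        have "fst (l n) K x = ln c + (- fst \<Phi> K x) + d" by (simp add: d_def c_def)
        then show ?thesis using c by (simp only: exp_add exp_ln)
      qed
      then have "exp (reconstruct \<M> (l n) x) - c * exp (- reconstruct \<M> \<Phi> x) =
          c * exp (- fst \<Phi> K x) * (exp d - 1)"
        by (simp add: reconstruct_cell[OF K] right_diff_distrib)
      then have eq: "\<bar>exp (reconstruct \<M> (l n) x) - c * exp (- reconstruct \<M> \<Phi> x)\<bar> =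
          c * exp (- fst \<Phi> K x) * \<bar>exp d - 1\<bar>"
        using c by (simp add: abs_mult)
      have "- fst \<Phi> K x \<le> B" using B[of x] by (simp add: reconstruct_cell[OF K])
      moreover have "\<bar>exp d - 1\<bar> \<le> exp (r n) - 1"
      proof (cases "d \<ge> 0")
        case True
        then show ?thesis using d by auto
      next
        case False
        then have "exp d \<le> 1" by simp
        \<comment> \<open>For negative \<open>d\<close> the chain is
          \<open>1 - exp d \<le> - d \<le> exp (- d) - 1\<close>.\<close>
        moreover have "1 + d \<le> exp d" "1 + (- d) \<le> exp (- d)" by (rule exp_ge_add_one_self)+
        moreover have "exp (- d) \<le> exp (r n)" using d by simp
        ultimately show ?thesis using False unfolding abs_le_iff by linarith
      qed
      ultimately have "c * exp (- fst \<Phi> K x) * \<bar>exp d - 1\<bar> \<le> b n"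
        unfolding b_def using c by (intro mult_mono) auto
      then show ?case unfolding f_def eq by simp
    qed
  qed
  \<comment> \<open>On a null set the essential supremum would be \<open>-\<infinity>\<close>, so
    the positive measure of the domain enters.\<close>
  have lower: "0 \<le> esssup (lebesgue_on \<Omega>) (f n)" for n
  proof -
    have "emeasure (lebesgue_on \<Omega>) (space (lebesgue_on \<Omega>)) = emeasure lebesgue \<Omega>"
      using sets_domain by (simp add: emeasure_restrict_space)
    moreover have "emeasure lebesgue \<Omega> \<noteq> 0"
      using open_not_negligible[OF open_domain domain_nonempty] sets_domain
      by (auto simp: negligible_iff_null_sets null_sets_def)
    ultimately have "0 = esssup (lebesgue_on \<Omega>) (\<lambda>x. 0 :: ereal)"
      by (simp add: esssup_const)
    also have "\<dots> \<le> esssup (lebesgue_on \<Omega>) (f n)"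
      by (rule esssup_mono) (auto simp: f_def)
    finally show ?thesis .
  qed
  have "(\<lambda>n. esssup (lebesgue_on \<Omega>) (f n)) \<longlonglongrightarrow> 0"
  proof (rule tendsto_sandwich[OF _ _ tendsto_const lim])
    show "\<forall>\<^sub>F n in sequentially. 0 \<le> esssup (lebesgue_on \<Omega>) (f n)" using lower by simp
    show "\<forall>\<^sub>F n in sequentially. esssup (lebesgue_on \<Omega>) (f n) \<le> ereal (b n)"
      using eventually_ge_at_top[of 1] by eventually_elim (rule upper)
  qed
  then show "(\<lambda>n. esssup (lebesgue_on \<Omega>)
      (\<lambda>x. ereal \<bar>exp (reconstruct \<M> (l n) x) - mass / partition_sum * exp (- reconstruct \<M> \<Phi> x)\<bar>)) \<longlonglongrightarrow> 0"
    by (simp add: f_def[abs_def] c_def)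
qed

end

theorem proposition5:
  fixes \<Omega> :: "(real^'n::finite) set"
    and \<Lambda> :: "real^'n \<Rightarrow> real^'n^'n"
    and \<phi> u0 :: "real^'n \<Rightarrow> real"
    and lam dt \<epsilon> :: real
    and k :: nat
    and \<M> \<E> :: "(real^'n) set set"
    and \<F> :: "(real^'n) set \<Rightarrow> (real^'n) set set"
    and l :: "nat \<Rightarrow> 'n hybrid"
  assumes dim: "CARD('n) = 2 \<or> CARD('n) = 3"
    and domain: "polytopal_domain \<Omega>"
    and Lam_Linf: "\<And>i j. Linf \<Omega> (\<lambda>x. \<Lambda> x $ i $ j)"
    and lam_pos: "lam > 0"
    and elliptic: "AE x in lebesgue_on \<Omega>. \<forall>\<xi>. (\<Lambda> x *v \<xi>) \<bullet> \<xi> \<ge> lam * (norm \<xi>)\<^sup>2"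
    and phi_W1inf: "W1inf \<Omega> \<phi>"
    and u0_L1: "integrable (lebesgue_on \<Omega>) u0"
    and u0_nonneg: "AE x in lebesgue_on \<Omega>. u0 x \<ge> 0"
    and u0_entropy: "integrable (lebesgue_on \<Omega>) (\<lambda>x. u0 x * ln (u0 x))"
    and u0_mass: "(LINT x|lebesgue_on \<Omega>. u0 x) > 0"
    and dt_pos: "dt > 0"
    and mesh: "mesh \<Omega> \<M> \<E> \<F>"
    and Lam_W1inf: "\<And>K i j. K \<in> \<M> \<Longrightarrow> W1inf K (\<lambda>x. \<Lambda> x $ i $ j)"
    and eps_pos: "\<epsilon> > 0"
    and solution: "nonlinear_scheme_solution \<Omega> \<M> \<E> \<F> k \<Lambda> \<phi> u0 dt \<epsilon> l"
  shows "tendsto_hybrid (hybrid_space \<M> \<E> k) l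
           (equilibrium_log_potential \<Omega> \<M> \<E> k \<phi> (LINT x|lebesgue_on \<Omega>. u0 x)) \<and>
         tendsto_Linf \<Omega> (\<lambda>n x. exp (reconstruct \<M> (l n) x))
           (\<lambda>x. equilibrium_constant \<Omega> \<M> \<E> k \<phi> (LINT x|lebesgue_on \<Omega>. u0 x) *
                exp (- reconstruct \<M> (hybrid_potential \<Omega> \<M> \<E> k \<phi>) x))"
proof -
  interpret hybrid_discretisation \<Omega> \<M> \<E> \<F> k
    using domain mesh by unfold_locales
  \<comment> \<open>Dimension at least two makes the face diameters, by which the jump terms are
    divided, positive.\<close>
  have "CARD('n) \<ge> 2" using dim by auto
  then obtain \<kappa> where "\<kappa> > 0"
      "\<And>l w. w \<in> V \<Longrightarrow> form_T \<M> \<F> k \<Lambda> \<epsilon> l w w \<ge> \<kappa> * seminorm_form w w"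
    using form_T_coercive[OF _ lam_pos eps_pos Lam_Linf elliptic Lam_W1inf] by blast
  then interpret nonlinear_scheme \<Omega> \<M> \<E> \<F> k \<Lambda> \<phi> u0 dt \<epsilon> \<kappa> l
    using phi_W1inf u0_L1 u0_mass dt_pos solution by unfold_locales
  have const: "equilibrium_constant \<Omega> \<M> \<E> k \<phi> mass = mass / partition_sum"
    by (simp add: equilibrium_constant_def partition_sum_eq)
  have potential: "equilibrium_log_potential \<Omega> \<M> \<E> k \<phi> mass =
      hybrid_scale limit_constant (hybrid_one \<M> \<E>) - \<Phi>"
    by (simp add: equilibrium_log_potential_def const)
  have "tendsto_hybrid V l (hybrid_scale limit_constant (hybrid_one \<M> \<E>) - \<Phi>)"
    unfolding tendsto_hybrid_def
  proof (intro conjI allI impI)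
    show "\<forall>\<^sub>F n in sequentially. l n \<in> V"
      using eventually_ge_at_top[of 1] by eventually_elim (rule l_V)
    show "hybrid_scale limit_constant (hybrid_one \<M> \<E>) - \<Phi> \<in> V"
      by (intro V_diff V_scale hybrid_one_V \<Phi>_V)
  qed (rule convergence(1))
  then show ?thesis
    using density_convergence by (simp only: const potential)
qed

end
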